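(* Let $I\subset\Sigma$ be compact, $p>1$ and $x\in\mathcal V$. There exists $\lambda_0>0$ such that for $\lambda\in[0,\lambda_0)$: (1) $\displaystyle\sup_{E\in I}\sup_{\eta\in(0,1]}\int_\Omega|G_x(E+i\eta,H^{\lambda,\omega})|^p\,d\mathbb P(\omega)<\infty$; (2) $\displaystyle\liminf_{\eta\downarrow0}\int_I|G_x(E+i\eta,H^{\lambda,\omega})|^p\,dE<\infty$ for almost every $\omega\in\Omega$; (3) $\displaystyle\liminf_{\eta\downarrow0}\operatorname{Im}G_x(E+i\eta,H^{\lambda,\omega})>0$ for almost every $(\omega,E)\in\Omega\times I$; (4) $\displaystyle\lim_{\lambda\downarrow0}\sup_{\eta\in(0,1]}\int_\Omega|G_x(E+i\eta,H^{\lambda,\omega})-G_x(E+i\eta,T)|^p\,d\mathbb P(\omega)=0$ for all $E\in\Sigma$, and the convergence is uniform on $I$.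
   Context: $\mathbb H=\{z\in\mathbb C\mid\operatorname{Im}z>0\}$. Let $\mathcal A$ be a finite nonempty set (labels) and $M:\mathcal A\times\mathcal A\to\mathbb N_0$ (the substitution matrix). For $j\in\mathcal A$, $\mathcal T=\mathcal T(M,j)=(\mathcal V,\mathcal E)$ is the rooted tree with labeling $a:\mathcal V\to\mathcal A$ whose root $o$ has label $j$ and in which each vertex of label $k$ in the $n$-th sphere (distance $n$ from $o$) has exactly $M_{k,l}$ neighbors of label $l$ in the $(n+1)$-th sphere, for every $l\in\mathcal A$. $\mathcal T_x=(\mathcal V_x,\mathcal E_x)$ is the forward tree of $x$ (all $y$ whose path to $o$ passes $x$). Standing assumptions: (M0) if $\mathcal A$ has only one element, then $M>1$; (M1) $M_{k,k}\ge 1$ for all $k\in\mathcal A$; (M2) there is $n\in\mathbb N$ such that all entries of $M^n$ are positive. Let $\nu:\mathcal V\to(0,\infty)$ be label invariant ($\nu(x)=\nu(y)$ whenever $a(x)=a(y)$) and $\ell^2(\mathcal V,\nu)$ the space of $\nu$-square-summable functions. $T$ is a label invariant operator on $\ell^2(\mathcal V,\nu)$: $(T\varphi)(x)=\sum_{y\sim x}t(x,y)\varphi(y)+w(x)\varphi(x)$ with $t:\mathcal V\times\mathcal V\to\mathbb C$, $w:\mathcal V\to\mathbb R$ such that: (T0) $t(x,y)\ne0$ iff $x\sim y$; (T1) $t(x,y)\nu(x)=\overline{t(y,x)}\nu(y)$; (T2) there are a matrix $(m_{k,l})$ and a vector $(m_k)$ indexed by $\mathcal A$ with $m_{a(x),a(y)}=|t(x,y)|^2M_{a(x),a(y)}$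 for all $x\sim y$ and $m_{a(x)}=w(x)$ for all $x$. Let $(\Omega,\mathbb P)$ be a probability space and $v\in\mathcal W_{\mathrm{rand}}(\Omega,\mathcal T)$, i.e. $v:\Omega\times\mathcal V\to[-1,1]$, $(\omega,x)\mapsto v^\omega_x$, is measurable in $\omega$ with: (P1) for $x_1,\dots,x_n\in\mathcal V$ with pairwise disjoint $\mathcal V_{x_1},\dots,\mathcal V_{x_n}$ the random families $v|_{\mathcal V_{x_1}},\dots,v|_{\mathcal V_{x_n}}$ are independent; (P2) for all $x,y$ with $a(x)=a(y)$ and every graph isomorphism $\psi:\mathcal T_x\to\mathcal T_y$ the families $v|_{\mathcal V_x}$ and $v|_{\mathcal V_y}\circ\psi$ have the same distribution. $H^{\lambda,\omega}=T+\lambda v^\omega$ for $\lambda\ge0$. Let $\delta_x=\nu(x)^{-1/2}1_{\{x\}}$. $G_x(z,H)=\langle\delta_x,(H-z)^{-1}\delta_x\rangle$ and $\Gamma_x(z,T)=\langle\delta_x,(T_{\mathcal T_x}-z)^{-1}\delta_x\rangle$ for $z\in\mathbb H$, where $T_{\mathcal T_x}$ is the compression of $T$ to $\ell^2(\mathcal V_x,\nu|_{\mathcal V_x})$. $\Sigma\subset\mathbb R$ is the largest open set such that for all $x\in\mathcal V$ the maps $\mathbb H\to\mathbb H$, $z\mapsto\Gamma_x(z,T)$, have unique continuous extensions to $\mathbb H\cup\Sigma\to\mathbb H$. *)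

theory Defs
  imports "HOL-Probability.Probability"
begin

section \<open>Rooted trees of finite cone type\<close>

text \<open>
  A graph is a vertex set \<open>V\<close> with an adjacency relation \<open>adj\<close>. (The AFP entry on graph theory
  encodes an undirected edge as a pair of opposite arcs; its notion of a forest then excludes
  every edge, so trees are defined here.)
\<close>

definition simple_graph :: "'v set \<Rightarrow> ('v \<Rightarrow> 'v \<Rightarrow> bool) \<Rightarrow> bool" where
  "simple_graph V adj \<longleftrightarrow>
     (\<forall>x y. adj x y \<longrightarrow> x \<in> V \<and> y \<in> V) \<and> (\<forall>x y. adj x y \<longrightarrow> adj y x) \<and> (\<forall>x. \<not> adj x x)"

definition is_path :: "'v set \<Rightarrow> ('v \<Rightarrow> 'v \<Rightarrow> bool) \<Rightarrow> 'v \<Rightarrow> 'v list \<Rightarrow> 'v \<Rightarrow> bool" where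
  "is_path V adj x p y \<longleftrightarrow>
     p \<noteq> [] \<and> set p \<subseteq> V \<and> hd p = x \<and> last p = y \<and> successively adj p \<and> distinct p"

definition is_cycle :: "'v set \<Rightarrow> ('v \<Rightarrow> 'v \<Rightarrow> bool) \<Rightarrow> 'v list \<Rightarrow> bool" where
  "is_cycle V adj p \<longleftrightarrow>
     length p \<ge> 3 \<and> set p \<subseteq> V \<and> distinct p \<and> successively adj p \<and> adj (last p) (hd p)"

definition is_tree :: "'v set \<Rightarrow> ('v \<Rightarrow> 'v \<Rightarrow> bool) \<Rightarrow> bool" where
  "is_tree V adj \<longleftrightarrow> simple_graph V adj \<and> V \<noteq> {} \<and>
     (\<forall>x\<in>V. \<forall>y\<in>V. \<exists>p. is_path V adj x p y) \<and> (\<nexists>p. is_cycle V adj p)"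

definition graph_dist :: "'v set \<Rightarrow> ('v \<Rightarrow> 'v \<Rightarrow> bool) \<Rightarrow> 'v \<Rightarrow> 'v \<Rightarrow> nat" where
  "graph_dist V adj x y = (LEAST n. \<exists>p. is_path V adj x p y \<and> length p = Suc n)"

text \<open>
  \<open>(V, adj)\<close> with root \<open>rt\<close> and labeling \<open>a\<close> is the tree \<open>\<T>(M,j)\<close>. The conjunct on
  finiteness is needed because \<open>card\<close> of an infinite set is \<open>0\<close>.
\<close>

definition substitution_tree ::
  "nat ^'a ^'a \<Rightarrow> 'a \<Rightarrow> 'v set \<Rightarrow> ('v \<Rightarrow> 'v \<Rightarrow> bool) \<Rightarrow> 'v \<Rightarrow> ('v \<Rightarrow> 'a::finite) \<Rightarrow> bool" where
  "substitution_tree M j V adj rt a \<longleftrightarrow> is_tree V adj \<and> rt \<in> V \<and> a rt = j \<and>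
     (\<forall>n. \<forall>x\<in>V. graph_dist V adj rt x = n \<longrightarrow> (\<forall>l.
        finite {y. adj x y \<and> graph_dist V adj rt y = n + 1 \<and> a y = l} \<and>
        card {y. adj x y \<and> graph_dist V adj rt y = n + 1 \<and> a y = l} = M $ a x $ l))"

definition M0 :: "nat ^'a ^('a::finite) \<Rightarrow> bool" where
  "M0 M \<longleftrightarrow> (CARD('a) = 1 \<longrightarrow> (\<forall>k l. M $ k $ l > 1))"

definition M1 :: "nat ^'a ^('a::finite) \<Rightarrow> bool" where
  "M1 M \<longleftrightarrow> (\<forall>k. M $ k $ k \<ge> 1)"

definition M2 :: "nat ^'a ^('a::finite) \<Rightarrow> bool" where
  "M2 M \<longleftrightarrow> (\<exists>n\<ge>1. \<forall>k l. (((**) M ^^ n) (mat 1)) $ k $ l > 0)"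

definition forward_tree :: "'v set \<Rightarrow> ('v \<Rightarrow> 'v \<Rightarrow> bool) \<Rightarrow> 'v \<Rightarrow> 'v \<Rightarrow> 'v set" where
  "forward_tree V adj rt x = {y \<in> V. \<forall>p. is_path V adj y p rt \<longrightarrow> x \<in> set p}"


section \<open>Operators on weighted \<open>\<ell>\<^sup>2\<close>\<close>

text \<open>
  Elements of \<open>\<ell>\<^sup>2(B,\<nu>)\<close> are represented by functions on the whole vertex type that vanish off
  \<open>B\<close>, so \<open>\<ell>\<^sup>2(B,\<nu>)\<close> is literally a subspace of \<open>\<ell>\<^sup>2(V,\<nu>)\<close> for \<open>B \<subseteq> V\<close>.
\<close>

definition l2 :: "'v set \<Rightarrow> ('v \<Rightarrow> real) \<Rightarrow> ('v \<Rightarrow> complex) set" where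
  "l2 B \<nu> = {\<phi>. (\<forall>x. x \<notin> B \<longrightarrow> \<phi> x = 0) \<and> (\<lambda>x. (cmod (\<phi> x))\<^sup>2 * \<nu> x) summable_on B}"

definition l2_inner ::
  "'v set \<Rightarrow> ('v \<Rightarrow> real) \<Rightarrow> ('v \<Rightarrow> complex) \<Rightarrow> ('v \<Rightarrow> complex) \<Rightarrow> complex" where
  "l2_inner B \<nu> \<phi> \<psi> = (\<Sum>\<^sub>\<infinity>x\<in>B. cnj (\<phi> x) * \<psi> x * of_real (\<nu> x))"

definition delta :: "('v \<Rightarrow> real) \<Rightarrow> 'v \<Rightarrow> 'v \<Rightarrow> complex" where
  "delta \<nu> x = (\<lambda>y. of_real (\<nu> x powr (-1/2)) * indicator {x} y)"

definition tree_operator ::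
  "'v set \<Rightarrow> ('v \<Rightarrow> 'v \<Rightarrow> bool) \<Rightarrow> ('v \<Rightarrow> 'v \<Rightarrow> complex) \<Rightarrow> ('v \<Rightarrow> real) \<Rightarrow>
   ('v \<Rightarrow> complex) \<Rightarrow> 'v \<Rightarrow> complex" where
  "tree_operator V adj t w \<phi> x =
     (if x \<in> V then (\<Sum>y\<in>{y. adj x y}. t x y * \<phi> y) + of_real (w x) * \<phi> x else 0)"

definition add_potential ::
  "(('v \<Rightarrow> complex) \<Rightarrow> 'v \<Rightarrow> complex) \<Rightarrow> real \<Rightarrow> ('v \<Rightarrow> real) \<Rightarrow>
   ('v \<Rightarrow> complex) \<Rightarrow> 'v \<Rightarrow> complex" where
  "add_potential T lam v \<phi> x = T \<phi> x + of_real (lam * v x) * \<phi> x"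

definition compression ::
  "'v set \<Rightarrow> (('v \<Rightarrow> complex) \<Rightarrow> 'v \<Rightarrow> complex) \<Rightarrow> ('v \<Rightarrow> complex) \<Rightarrow> 'v \<Rightarrow> complex" where
  "compression B H \<phi> x = (if x \<in> B then H \<phi> x else 0)"

text \<open>
  \<open>(H - z)\<^sup>-\<^sup>1\<close>, as the inverse of the map \<open>H - z\<close> on \<open>\<ell>\<^sup>2(B,\<nu>)\<close>. It is only used for \<open>z\<close> in the
  upper half plane and bounded self-adjoint \<open>H\<close>, where this map is a bijection.
\<close>

definition resolvent ::
  "'v set \<Rightarrow> ('v \<Rightarrow> real) \<Rightarrow> (('v \<Rightarrow> complex) \<Rightarrow> 'v \<Rightarrow> complex) \<Rightarrow> complex \<Rightarrow>
   ('v \<Rightarrow> complex) \<Rightarrow> 'v \<Rightarrow> complex" where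
  "resolvent B \<nu> H z = inv_into (l2 B \<nu>) (\<lambda>\<phi> x. H \<phi> x - z * \<phi> x)"

definition green ::
  "'v set \<Rightarrow> ('v \<Rightarrow> real) \<Rightarrow> 'v \<Rightarrow> complex \<Rightarrow> (('v \<Rightarrow> complex) \<Rightarrow> 'v \<Rightarrow> complex) \<Rightarrow> complex" where
  "green B \<nu> x z H = l2_inner B \<nu> (delta \<nu> x) (resolvent B \<nu> H z (delta \<nu> x))"

definition green_forward ::
  "'v set \<Rightarrow> ('v \<Rightarrow> 'v \<Rightarrow> bool) \<Rightarrow> 'v \<Rightarrow> ('v \<Rightarrow> real) \<Rightarrow> 'v \<Rightarrow> complex \<Rightarrow>
   (('v \<Rightarrow> complex) \<Rightarrow> 'v \<Rightarrow> complex) \<Rightarrow> complex" where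
  "green_forward V adj rt \<nu> x z T =
     green (forward_tree V adj rt x) \<nu> x z (compression (forward_tree V adj rt x) T)"

definition T0 :: "'v set \<Rightarrow> ('v \<Rightarrow> 'v \<Rightarrow> bool) \<Rightarrow> ('v \<Rightarrow> 'v \<Rightarrow> complex) \<Rightarrow> bool" where
  "T0 V adj t \<longleftrightarrow> (\<forall>x\<in>V. \<forall>y\<in>V. t x y \<noteq> 0 \<longleftrightarrow> adj x y)"

definition T1 :: "'v set \<Rightarrow> ('v \<Rightarrow> real) \<Rightarrow> ('v \<Rightarrow> 'v \<Rightarrow> complex) \<Rightarrow> bool" where
  "T1 V \<nu> t \<longleftrightarrow> (\<forall>x\<in>V. \<forall>y\<in>V. t x y * of_real (\<nu> x) = cnj (t y x) * of_real (\<nu> y))"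

definition T2 ::
  "nat ^'a ^'a \<Rightarrow> 'v set \<Rightarrow> ('v \<Rightarrow> 'v \<Rightarrow> bool) \<Rightarrow> ('v \<Rightarrow> 'a::finite) \<Rightarrow>
   ('v \<Rightarrow> 'v \<Rightarrow> complex) \<Rightarrow> ('v \<Rightarrow> real) \<Rightarrow> bool" where
  "T2 M V adj a t w \<longleftrightarrow> (\<exists>(m :: real ^'a ^'a) (d :: real ^'a).
     (\<forall>x\<in>V. \<forall>y\<in>V. adj x y \<longrightarrow> m $ a x $ a y = (cmod (t x y))\<^sup>2 * real (M $ a x $ a y)) \<and>
     (\<forall>x\<in>V. d $ a x = w x))"


section \<open>The set \<open>\<Sigma>\<close>\<close>

definition upper_half_plane :: "complex set" (\<open>\<H>\<close>) where
  "\<H> = {z. Im z > 0}"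

definition has_unique_extension :: "(complex \<Rightarrow> complex) \<Rightarrow> real set \<Rightarrow> bool" where
  "has_unique_extension f S \<longleftrightarrow>
     (\<exists>!g. g \<in> (\<H> \<union> of_real ` S) \<rightarrow>\<^sub>E \<H> \<and> continuous_on (\<H> \<union> of_real ` S) g \<and> (\<forall>z\<in>\<H>. g z = f z))"

definition common_extension_set :: "'i set \<Rightarrow> ('i \<Rightarrow> complex \<Rightarrow> complex) \<Rightarrow> real set \<Rightarrow> bool" where
  "common_extension_set X f S \<longleftrightarrow> open S \<and> (\<forall>x\<in>X. has_unique_extension (f x) S)"

definition largest_extension_set :: "'i set \<Rightarrow> ('i \<Rightarrow> complex \<Rightarrow> complex) \<Rightarrow> real set" where
  "largest_extension_set X f = \<Union> {S. common_extension_set X f S}"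

text \<open>The union is itself such a set, and hence the largest one, as soon as there is any.\<close>

lemma has_unique_extension_agree:
  assumes S: "open S" "open S'" "s \<in> S" "s \<in> S'"
    and g: "continuous_on (\<H> \<union> of_real ` S) g" "\<forall>z\<in>\<H>. g z = f z"
    and h: "continuous_on (\<H> \<union> of_real ` S') h" "\<forall>z\<in>\<H>. h z = f z"
  shows "g (of_real s) = (h (of_real s) :: complex)"
proof -
  let ?s = "of_real s :: complex"
  have "?s islimpt \<H>"
  proof (unfold islimpt_approachable, intro allI impI)
    fix e :: real assume "0 < e"
    then have "Complex s (e/2) \<in> \<H> \<and> Complex s (e/2) \<noteq> ?s \<and> dist (Complex s (e/2)) ?s < e"
      by (auto simp: upper_half_plane_def dist_norm cmod_def complex_eq_iff)
    then show "\<exists>z'\<in>\<H>. z' \<noteq> ?s \<and> dist z' ?s < e"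
      by blast
  qed
  then have ntriv: "at ?s within \<H> \<noteq> bot"
    by (simp add: trivial_limit_within)
  have "(k \<longlongrightarrow> k ?s) (at ?s within \<H>)"
    if "continuous_on (\<H> \<union> of_real ` R) k" "s \<in> R" for R and k :: "complex \<Rightarrow> complex"
    using that by (auto simp: continuous_on_def intro: tendsto_within_subset)
  then have lim: "(g \<longlongrightarrow> g ?s) (at ?s within \<H>)" "(h \<longlongrightarrow> h ?s) (at ?s within \<H>)"
    using S g h by blast+
  have "(g \<longlongrightarrow> h ?s) (at ?s within \<H>)"
    by (rule Lim_transform_eventually[OF lim(2)])
      (use g(2) h(2) in \<open>auto simp: eventually_at_filter\<close>)
  then show ?thesis
    using tendsto_unique[OF ntriv lim(1)] by blast
qed

lemma common_extension_set_largest: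
  assumes "common_extension_set X f S0"
  shows "common_extension_set X f (largest_extension_set X f)"
    and "common_extension_set X f S \<Longrightarrow> S \<subseteq> largest_extension_set X f"
proof -
  show "S \<subseteq> largest_extension_set X f" if "common_extension_set X f S"
    using that by (auto simp: largest_extension_set_def)
  define U where "U = largest_extension_set X f"
  have opn: "open R" and ext: "x \<in> X \<Longrightarrow> has_unique_extension (f x) R"
    if "common_extension_set X f R" for R x
    using that by (auto simp: common_extension_set_def)
  have "open U"
    unfolding U_def largest_extension_set_def using opn by blast
  moreover have "has_unique_extension (f x) U" if x: "x \<in> X" for x
  proof -
    define F where "F = {R. common_extension_set X f R}"
    have "\<forall>R\<in>F. \<exists>g. g \<in> (\<H> \<union> of_real ` R) \<rightarrow>\<^sub>E \<H> \<and> continuous_on (\<H> \<union> of_real ` R) g \<and>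
        (\<forall>z\<in>\<H>. g z = f x z)"
    proof
      fix R assume "R \<in> F"
      then have "has_unique_extension (f x) R"
        using ext x by (simp add: F_def)
      from ex1_implies_ex[OF this[unfolded has_unique_extension_def]]
      show "\<exists>g. g \<in> (\<H> \<union> of_real ` R) \<rightarrow>\<^sub>E \<H> \<and> continuous_on (\<H> \<union> of_real ` R) g \<and>
        (\<forall>z\<in>\<H>. g z = f x z)" .
    qed
    then obtain g where g: "\<And>R. R \<in> F \<Longrightarrow> g R \<in> (\<H> \<union> of_real ` R) \<rightarrow>\<^sub>E \<H>"
      "\<And>R. R \<in> F \<Longrightarrow> continuous_on (\<H> \<union> of_real ` R) (g R)"
      "\<And>R z. R \<in> F \<Longrightarrow> z \<in> \<H> \<Longrightarrow> g R z = f x z"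
      by metis
    have opF: "open R" if "R \<in> F" for R
      using that opn by (simp add: F_def)
    have agree: "g R (of_real s) = g R' (of_real s)" if "R \<in> F" "R' \<in> F" "s \<in> R" "s \<in> R'" for R R' s
      using that g(2,3) opF
      by (intro has_unique_extension_agree[of R R' s "g R" "f x" "g R'"]) auto
    have real_H: "of_real s \<notin> \<H>" for s
      by (simp add: upper_half_plane_def)
    define h where "h = (\<lambda>z. if z \<in> \<H> then f x z else if z \<in> of_real ` U
      then g (SOME R. R \<in> F \<and> Re z \<in> R) z else undefined)"
    have h_eq: "h z = g R z" if Rz: "R \<in> F" "z \<in> \<H> \<union> of_real ` R" for R z
    proof (cases "z \<in> \<H>")
      case True
      then show ?thesis using that g(3) by (simp add: h_def)
    next
      case False
      then obtain s where s: "z = of_real s" "s \<in> R"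
        using Rz by auto
      have ex: "\<exists>R. R \<in> F \<and> Re z \<in> R" using s that by auto
      have "(SOME R. R \<in> F \<and> Re z \<in> R) \<in> F \<and> Re z \<in> (SOME R. R \<in> F \<and> Re z \<in> R)"
        by (rule someI_ex[OF ex])
      then have "g (SOME R. R \<in> F \<and> Re z \<in> R) z = g R z"
        using s that by (auto intro: agree)
      moreover have "s \<in> U"
        using s that by (auto simp: U_def largest_extension_set_def F_def)
      ultimately show ?thesis
        using False s by (simp add: h_def)
    qed
    have cover: "\<exists>R\<in>F. z \<in> \<H> \<union> of_real ` R" if "z \<in> \<H> \<union> of_real ` U" for z
      using that assms by (auto simp: U_def largest_extension_set_def F_def)
    have "h \<in> (\<H> \<union> of_real ` U) \<rightarrow>\<^sub>E \<H>"
    proof (rule PiE_I)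
      fix z assume "z \<in> \<H> \<union> of_real ` U"
      then obtain R where "R \<in> F" "z \<in> \<H> \<union> of_real ` R" using cover by blast
      then show "h z \<in> \<H>" using h_eq g(1) by (metis PiE_mem)
    next
      fix z assume "z \<notin> \<H> \<union> of_real ` U"
      then show "h z = undefined" by (simp add: h_def)
    qed
    moreover have "continuous_on (\<H> \<union> of_real ` U) h"
      unfolding continuous_on_def
    proof
      fix z assume z: "z \<in> \<H> \<union> of_real ` U"
      then obtain R where R: "R \<in> F" "z \<in> \<H> \<union> of_real ` R" using cover by blast
      define W where "W = \<H> \<union> {z. Re z \<in> R}"
      have "open W"
        unfolding W_def upper_half_plane_def using opF[OF R(1)]
        by (intro open_Un open_Collect_less continuous_intros)
          (simp add: open_vimage[of R Re, unfolded vimage_def] continuous_intros)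
      have "R \<subseteq> U" using R by (auto simp: U_def largest_extension_set_def F_def)
      then have "(\<H> \<union> of_real ` U) \<inter> W = \<H> \<union> of_real ` R"
        by (auto simp: W_def)
      moreover have "z \<in> W" using R by (auto simp: W_def)
      ultimately have at: "at z within (\<H> \<union> of_real ` U) = at z within (\<H> \<union> of_real ` R)"
        using \<open>open W\<close> by (intro at_within_nhd[of z W]) auto
      have "(g R \<longlongrightarrow> g R z) (at z within (\<H> \<union> of_real ` R))"
        using g(2)[OF R(1)] R(2) by (auto simp: continuous_on_def)
      then have "(h \<longlongrightarrow> g R z) (at z within (\<H> \<union> of_real ` R))"
        by (rule Lim_transform_eventually) (simp add: eventually_at_filter h_eq[OF R(1)])
      then show "(h \<longlongrightarrow> h z) (at z within (\<H> \<union> of_real ` U))"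
        using h_eq[OF R] at by simp
    qed
    moreover have "\<forall>z\<in>\<H>. h z = f x z"
      by (simp add: h_def)
    moreover have "k = h" if "k \<in> (\<H> \<union> of_real ` U) \<rightarrow>\<^sub>E \<H>" "continuous_on (\<H> \<union> of_real ` U) k"
      "\<forall>z\<in>\<H>. k z = f x z" for k
    proof (rule PiE_ext[OF that(1) \<open>h \<in> _\<close>])
      fix z assume "z \<in> \<H> \<union> of_real ` U"
      then show "k z = h z"
        using that(2,3) \<open>continuous_on _ h\<close> \<open>\<forall>z\<in>\<H>. h z = f x z\<close> \<open>open U\<close>
          has_unique_extension_agree[of U U _ k "f x" h] by auto
    qed
    ultimately show ?thesis
      unfolding has_unique_extension_def by (intro ex1I[of _ h]) blast+
  qed
  ultimately show "common_extension_set X f (largest_extension_set X f)"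
    by (simp add: common_extension_set_def U_def)
qed

definition Sigma_set ::
  "'v set \<Rightarrow> ('v \<Rightarrow> 'v \<Rightarrow> bool) \<Rightarrow> 'v \<Rightarrow> ('v \<Rightarrow> real) \<Rightarrow>
   (('v \<Rightarrow> complex) \<Rightarrow> 'v \<Rightarrow> complex) \<Rightarrow> real set" where
  "Sigma_set V adj rt \<nu> T =
     largest_extension_set V (\<lambda>x z. green_forward V adj rt \<nu> x z T)"


section \<open>Random potentials\<close>

definition graph_isomorphism ::
  "('v \<Rightarrow> 'v \<Rightarrow> bool) \<Rightarrow> 'v set \<Rightarrow> 'v set \<Rightarrow> ('v \<Rightarrow> 'v) \<Rightarrow> bool" where
  "graph_isomorphism adj B C \<psi> \<longleftrightarrow>
     bij_betw \<psi> B C \<and> (\<forall>u\<in>B. \<forall>u'\<in>B. adj u u' \<longleftrightarrow> adj (\<psi> u) (\<psi> u'))"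

definition P1 ::
  "'w measure \<Rightarrow> 'v set \<Rightarrow> ('v \<Rightarrow> 'v \<Rightarrow> bool) \<Rightarrow> 'v \<Rightarrow> ('w \<Rightarrow> 'v \<Rightarrow> real) \<Rightarrow> bool" where
  "P1 P V adj rt v \<longleftrightarrow>
     (\<forall>X. finite X \<and> X \<subseteq> V \<and> disjoint_family_on (forward_tree V adj rt) X \<longrightarrow>
        prob_space.indep_vars P (\<lambda>x. \<Pi>\<^sub>M u\<in>forward_tree V adj rt x. borel)
          (\<lambda>x \<omega>. \<lambda>u\<in>forward_tree V adj rt x. v \<omega> u) X)"

definition P2 ::
  "'w measure \<Rightarrow> 'v set \<Rightarrow> ('v \<Rightarrow> 'v \<Rightarrow> bool) \<Rightarrow> 'v \<Rightarrow> ('v \<Rightarrow> 'a) \<Rightarrow> ('w \<Rightarrow> 'v \<Rightarrow> real) \<Rightarrow> bool" where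
  "P2 P V adj rt a v \<longleftrightarrow>
     (\<forall>x\<in>V. \<forall>y\<in>V. \<forall>\<psi>. a x = a y \<and>
        graph_isomorphism adj (forward_tree V adj rt x) (forward_tree V adj rt y) \<psi> \<longrightarrow>
        distr P (\<Pi>\<^sub>M u\<in>forward_tree V adj rt x. borel) (\<lambda>\<omega>. \<lambda>u\<in>forward_tree V adj rt x. v \<omega> u) =
        distr P (\<Pi>\<^sub>M u\<in>forward_tree V adj rt x. borel) (\<lambda>\<omega>. \<lambda>u\<in>forward_tree V adj rt x. v \<omega> (\<psi> u)))"

definition random_potential ::
  "'w measure \<Rightarrow> 'v set \<Rightarrow> ('v \<Rightarrow> 'v \<Rightarrow> bool) \<Rightarrow> 'v \<Rightarrow> ('v \<Rightarrow> 'a) \<Rightarrow> ('w \<Rightarrow> 'v \<Rightarrow> real) \<Rightarrow> bool" where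
  "random_potential P V adj rt a v \<longleftrightarrow>
     (\<forall>x\<in>V. (\<lambda>\<omega>. v \<omega> x) \<in> borel_measurable P) \<and> (\<forall>\<omega>\<in>space P. \<forall>x\<in>V. v \<omega> x \<in> {-1..1}) \<and>
     P1 P V adj rt v \<and> P2 P V adj rt a v"

end

theory Submission
  imports Defs "HOL-Complex_Analysis.Complex_Analysis"
begin

text \<open>
  Fix \<open>z\<close> in the upper half plane. The forward Green functions \<open>g y\<close> of an operator with potential
  \<open>W\<close> satisfy \<open>- 1 / g y = z - W y + (\<Sum>u\<in>ch y. cc y u * g u)\<close>, where \<open>ch y\<close> is the set of children
  of \<open>y\<close> and \<open>cc y u = |t y u|\<^sup>2 * \<nu> y / \<nu> u\<close>. Let \<open>h\<close> be the solution for \<open>\<lambda> = 0\<close> and \<open>g\<close> the one for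
  \<open>\<lambda> > 0\<close>. Compactness of \<open>I\<close> and the extension of \<open>h\<close> to \<open>\<Sigma>\<close> keep all values of \<open>h\<close> over
  \<open>I \<times> (0,1]\<close> in a compact part of the upper half plane. What has to be shown is that \<open>g\<close> is close to
  \<open>h\<close> there in every \<open>L\<^sup>n\<close>, uniformly in \<open>Im z\<close>.

  The size of the displacement \<open>\<zeta> = (g - h) / Im h\<close> is measured by \<open>DD \<zeta> = |\<zeta>|\<^sup>2 / (1 + Im \<zeta>)\<close>, which is a
  function of the hyperbolic distance of \<open>g\<close> and \<open>h\<close> and convex in \<open>\<zeta>\<close>. The recursion takes the displacements
  at the children of \<open>x\<close> to their weighted mean, shifts it by \<open>O(\<lambda>)\<close>, and multiplies it by a number
  that is bounded away from 1; \<open>DD\<close> does not increase apart from the shift (\<open>star_step\<close>). So the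
  moment \<open>E (DD \<zeta>)^n\<close> at \<open>x\<close> is at most the mean of the moments at its children, minus the expected
  Jensen defect, plus \<open>O(\<lambda>)\<close>. Near the real axis there is no other contraction, and the gain must
  come from the defect.

  Choose a vertex \<open>x\<close> whose moment is maximal; there are only finitely many values, as moments depend
  on labels only. By (M1), \<open>x\<close> has a child \<open>x'\<close> with the same label, and it has a further child \<open>y\<close>.
  By maximality the expected defects at \<open>x\<close> and at \<open>x'\<close> are \<open>O(\<lambda>)\<close>. Now \<open>y\<close> may be exchanged with a
  child of \<open>x'\<close> of its label: the forward trees in question are disjoint, so by (P1) and (P2) the
  distribution stays the same and the defect at \<open>x'\<close> with \<open>y\<close> in place of that child is \<open>O(\<lambda>)\<close>
  as well. But if all three defects are small, then \<open>\<zeta> x'\<close> is close to \<open>\<zeta> y\<close>, \<open>\<zeta> y\<close> to the other children of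
  \<open>x'\<close>, and these to their weighted mean, whereas the recursion at \<open>x'\<close> moves this mean by a
  definite proportion. Hence \<open>\<zeta> y\<close> itself is small (\<open>two_step_bound\<close>), and the maximal moment is
  \<open>O(\<lambda>)\<close> (\<open>contraction\<close>).

  The full Green function is a rational function of finitely many forward Green functions, in which the
  imaginary part of each denominator is at least a multiple of some \<open>Im (g u)\<close>. Bounded moments of
  \<open>DD \<zeta>\<close> entail bounded moments of \<open>1 / Im (g u)\<close>. So moment bounds pass to the full Green function, to
  its inverse imaginary part, and to its difference from the Green function of \<open>T\<close> (\<open>Gr_families\<close>). This gives (1) and (4), and Fatou's lemma gives (2). For (3), a
  mean value inequality bounds \<open>1 / Im G\<close> at \<open>E + i(\<epsilon>+\<eta>)\<close> by its averages over
  \<open>[E-\<eta>,E+\<eta>] + i\<epsilon>\<close>, and Vitali's covering lemma turns this into a bound for the measure of those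
  \<open>E\<close> for which \<open>Im G\<close> is small at some height above \<open>\<epsilon>\<close>. The bound is uniform in \<open>\<epsilon>\<close> because the mean of
  \<open>1 / Im G\<close> is (\<open>Herglotz_weak_type\<close>, \<open>Im_Gr_liminf_pos\<close>).
\<close>

section \<open>Rooted trees and their forward trees\<close>

text \<open>
  Two different paths with the same ends contain a cycle: take the first edge where they part, follow
  one of them to its first vertex on the other, and return along the other.
\<close>

lemma is_path_unique:
  assumes g: "simple_graph V adj" and nocyc: "\<nexists>p. is_cycle V adj p"
    and "is_path V adj x p y" "is_path V adj x q y"
  shows "p = q"
  using assms(3,4)
proof (induction p arbitrary: x q)
  case Nil
  then show ?case by (simp add: is_path_def)
next
  case (Cons b p')
  have sym: "adj u v \<Longrightarrow> adj v u" for u v using g by (auto simp: simple_graph_def)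
  have b: "b = x" using Cons.prems(1) by (simp add: is_path_def)
  obtain q' where q: "q = x # q'" using Cons.prems(2) by (cases q) (auto simp: is_path_def)
  show ?case
  proof (cases "p' = [] \<or> q' = []")
    case True
    then have "y = x" using Cons.prems b q by (auto simp: is_path_def)
    then have "p' = []" "q' = []"
      using Cons.prems b q by (auto simp: is_path_def split: if_splits dest: last_in_set)
    then show ?thesis using b q by simp
  next
    case False
    then have ne: "p' \<noteq> []" "q' \<noteq> []" by auto
    have P: "is_path V adj (hd p') p' y" "adj x (hd p')" "x \<notin> set p'" "x \<in> V"
      using Cons.prems(1) ne b by (auto simp: is_path_def successively_Cons)
    have Q: "is_path V adj (hd q') q' y" "adj x (hd q')" "x \<notin> set q'"
      using Cons.prems(2) ne q by (auto simp: is_path_def successively_Cons)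
    have "hd p' = hd q'"
    proof (rule ccontr)
      assume hne: "hd p' \<noteq> hd q'"
      have "y \<in> set p'" using P(1) last_in_set[OF ne(1)] by (simp add: is_path_def)
      moreover have "y \<in> set q'" using Q(1) last_in_set[OF ne(2)] by (simp add: is_path_def)
      ultimately obtain p1 c p2 where p': "p' = p1 @ c # p2" "c \<in> set q'" "\<forall>u\<in>set p1. u \<notin> set q'"
        using split_list_first_prop[of p' "\<lambda>u. u \<in> set q'"] by blast
      from p'(2) obtain q1 q2 where q': "q' = q1 @ c # q2" by (meson split_list)
      define cyc where "cyc = x # p1 @ c # rev q1"
      have "p1 \<noteq> [] \<or> q1 \<noteq> []" using hne p' q' by auto
      then have "length cyc \<ge> 3"
        by (cases p1; cases q1) (auto simp: cyc_def)
      moreover have "set cyc \<subseteq> V" "distinct cyc"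
        using P Q p' q' by (auto simp: is_path_def cyc_def)
      moreover have "successively adj cyc"
      proof -
        have 1: "successively adj (p1 @ [c])" "successively adj (q1 @ [c])"
          using P(1) Q(1) p' q' by (auto simp: is_path_def successively_append_iff)
        have "successively adj (rev (q1 @ [c]))"
          using 1(2) sym unfolding successively_rev by (auto elim!: successively_mono)
        then have "successively adj (p1 @ c # rev q1)"
          using 1(1) by (cases p1 rule: rev_cases) (auto simp: successively_append_iff)
        then show ?thesis
          using P(2) p' by (auto simp: cyc_def successively_Cons hd_append)
      qed
      moreover have "adj (last cyc) (hd cyc)"
        using Q(2) q' sym by (cases q1) (auto simp: cyc_def)
      ultimately have "is_cycle V adj cyc" by (simp add: is_cycle_def)
      then show False using nocyc by blast
    qed
    then have "p' = q'" using Cons.IH[OF P(1)] Q(1) by simp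
    then show ?thesis using b q by simp
  qed
qed

locale rooted_tree =
  fixes V :: "'v set" and adj :: "'v \<Rightarrow> 'v \<Rightarrow> bool" and rt :: 'v
  assumes tree: "is_tree V adj" and rt_V: "rt \<in> V"
begin

text \<open>
  The path to the root consists of the root only, so \<open>par rt\<close> is the arbitrary value of \<open>last []\<close>.
\<close>

definition "pth y = (THE p. is_path V adj rt p y)"
definition "dd y = graph_dist V adj rt y"
definition "ch x = {y. adj x y \<and> dd y = dd x + 1}"
definition "par y = last (butlast (pth y))"
abbreviation "fwd x \<equiv> forward_tree V adj rt x"
definition "lev x n = {u \<in> fwd x. dd u = dd x + n}"

lemma adj_sym: "adj u v \<Longrightarrow> adj v u"
  and adj_V: "adj u v \<Longrightarrow> u \<in> V" "adj u v \<Longrightarrow> v \<in> V"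
  and adj_irrefl: "\<not> adj u u"
  using tree by (auto simp: is_tree_def simple_graph_def)

lemma pth: "y \<in> V \<Longrightarrow> is_path V adj rt (pth y) y"
  and pth_eqI: "is_path V adj rt p y \<Longrightarrow> pth y = p"
proof -
  have u: "p = q" if "is_path V adj rt p y" "is_path V adj rt q y" for p q y
    using tree that by (auto simp: is_tree_def intro: is_path_unique)
  show e: "pth y = p" if "is_path V adj rt p y" for p y
    unfolding pth_def using that u by blast
  show "is_path V adj rt (pth y) y" if y: "y \<in> V" for y
  proof -
    obtain p where "is_path V adj rt p y" using tree rt_V y unfolding is_tree_def by blast
    then show ?thesis using e by simp
  qed
qed

lemma pth_simps:
  assumes "y \<in> V" shows "pth y \<noteq> []" "set (pth y) \<subseteq> V" "hd (pth y) = rt" "last (pth y) = y"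
    "distinct (pth y)" "successively adj (pth y)" "y \<in> set (pth y)" "rt \<in> set (pth y)"
proof -
  show "pth y \<noteq> []" "set (pth y) \<subseteq> V" "hd (pth y) = rt" "last (pth y) = y"
    "distinct (pth y)" "successively adj (pth y)"
    using pth[OF assms] by (simp_all add: is_path_def)
  then show "y \<in> set (pth y)" "rt \<in> set (pth y)"
    using last_in_set hd_in_set by metis+
qed

lemma pth_rt: "pth rt = [rt]"
  by (rule pth_eqI) (simp add: is_path_def rt_V)

lemma dd_pth: "y \<in> V \<Longrightarrow> length (pth y) = Suc (dd y)"
proof -
  assume y: "y \<in> V"
  have "(\<exists>p. is_path V adj rt p y \<and> length p = Suc n) \<longleftrightarrow> length (pth y) = Suc n" for n
    using pth[OF y] pth_eqI by metis
  then have "dd y = (LEAST n. length (pth y) = Suc n)" by (simp add: dd_def graph_dist_def)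
  also have "\<dots> = length (pth y) - 1"
    using pth_simps(1)[OF y] by (intro Least_equality) (auto simp: Suc_diff_le)
  finally show ?thesis using pth_simps(1)[OF y] by (cases "pth y") auto
qed

lemma pth_snocI:
  assumes "adj x y" "y \<notin> set (pth x)"
  shows "pth y = pth x @ [y]"
  using assms pth_simps[OF adj_V(1)[OF assms(1)]] adj_V[OF assms(1)]
  by (intro pth_eqI) (auto simp: is_path_def successively_append_iff)

text \<open>
  Either \<open>y\<close> is not on the path to \<open>x\<close>, which can then be prolonged by \<open>y\<close>, or it is, and since the
  initial piece ending in \<open>y\<close> can be prolonged by \<open>x\<close>, nothing lies between \<open>y\<close> and \<open>x\<close>.
\<close>

lemma adj_cases:
  assumes xy: "adj x y"
  shows "pth y = pth x @ [y] \<or> pth x = pth y @ [x]"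
proof (cases "y \<in> set (pth x)")
  case False
  then show ?thesis using pth_snocI xy by blast
next
  case True
  note x = pth_simps[OF adj_V(1)[OF xy]]
  from True obtain q1 q2 where q: "pth x = q1 @ y # q2" by (meson split_list)
  have "pth y = q1 @ [y]"
    by (rule pth_eqI) (use x q in \<open>auto simp: is_path_def successively_append_iff hd_append split: if_splits\<close>)
  moreover have "q2 \<noteq> []" using x(4) q xy adj_irrefl by auto
  ultimately have "x \<notin> set (pth y)" using x(4,5) q by auto
  then show ?thesis using pth_snocI[OF adj_sym[OF xy]] by simp
qed

lemma ch_iff: "x \<in> V \<Longrightarrow> y \<in> ch x \<longleftrightarrow> y \<in> V \<and> pth y = pth x @ [y]"
proof
  assume x: "x \<in> V" and "y \<in> ch x"
  then have a: "adj x y" "dd y = dd x + 1" by (auto simp: ch_def)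
  then have y: "y \<in> V" using adj_V by blast
  have "length (pth y) = length (pth x) + 1" using dd_pth x y a(2) by simp
  then show "y \<in> V \<and> pth y = pth x @ [y]" using adj_cases[OF a(1)] y by (auto dest!: arg_cong[of _ _ length])
next
  assume x: "x \<in> V" and y: "y \<in> V \<and> pth y = pth x @ [y]"
  then have "dd y = dd x + 1" using dd_pth[of x] dd_pth[of y] by simp
  moreover have "adj x y"
    using pth_simps(6)[of y] pth_simps(1,4)[OF x] y by (auto simp: successively_append_iff)
  ultimately show "y \<in> ch x" by (simp add: ch_def)
qed

lemma ch_V: "y \<in> ch x \<Longrightarrow> x \<in> V" "y \<in> ch x \<Longrightarrow> y \<in> V"
  and ch_adj: "y \<in> ch x \<Longrightarrow> adj x y" "y \<in> ch x \<Longrightarrow> adj y x"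
  and ch_dd: "y \<in> ch x \<Longrightarrow> dd y = Suc (dd x)"
  using adj_V adj_sym by (auto simp: ch_def)

lemma ch_pth: "y \<in> ch x \<Longrightarrow> pth y = pth x @ [y]"
  using ch_iff ch_V by blast

lemma par_ch: "y \<in> ch x \<Longrightarrow> par y = x"
  using ch_pth[of y x] pth_simps[OF ch_V(1)[of y x]] by (simp add: par_def)

lemma rt_not_ch: "rt \<notin> ch x"
  using ch_pth[of rt x] pth_rt pth_simps(1)[OF ch_V(1)[of rt x]] by auto

lemma in_ch_par: assumes "y \<in> V" "y \<noteq> rt" shows "y \<in> ch (par y)" 
proof -
  note s = pth_simps[OF assms(1)]
  define q where "q = butlast (pth y)"
  have e: "pth y = q @ [y]" using s(1,4) append_butlast_last_id[of "pth y"] by (simp add: q_def)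
  then have q: "q \<noteq> []" using s(3) assms(2) by auto
  have p: "pth (last q) = q"
    by (rule pth_eqI) (use s q e in \<open>auto simp: is_path_def successively_append_iff\<close>)
  have "last q \<in> V" using s(2) e last_in_set[OF q] by auto
  moreover have "par y = last q" by (simp add: par_def q_def)
  ultimately show ?thesis using ch_iff[of "last q" y] p e assms(1) by simp
qed

lemma par_V: "y \<in> V \<Longrightarrow> y \<noteq> rt \<Longrightarrow> par y \<in> V"
  using in_ch_par ch_V by blast

lemma adj_iff: assumes "y \<in> V" shows "adj y u \<longleftrightarrow> u \<in> ch y \<or> y \<noteq> rt \<and> u = par y"
proof
  assume a: "adj y u"
  have u: "u \<in> V" using adj_V a by blast
  show "u \<in> ch y \<or> y \<noteq> rt \<and> u = par y"
    using adj_cases[OF a] ch_iff[OF assms] ch_iff[OF u] u assms par_ch rt_not_ch by blast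
next
  assume "u \<in> ch y \<or> y \<noteq> rt \<and> u = par y"
  then show "adj y u" using ch_adj in_ch_par assms by blast
qed

lemma ch_par_not_ch: "y \<in> V \<Longrightarrow> y \<noteq> rt \<Longrightarrow> par y \<notin> ch y"
  using ch_dd[of "par y" y] ch_dd[OF in_ch_par, of y] by auto

lemma neighbours: "y \<in> V \<Longrightarrow> {u. adj y u} = ch y \<union> (if y = rt then {} else {par y})"
  using adj_iff by auto

lemma fwd_iff: "y \<in> fwd x \<longleftrightarrow> y \<in> V \<and> x \<in> set (pth y)"
proof (cases "y \<in> V")
  case True
  have rev: "is_path V adj y p rt \<longleftrightarrow> is_path V adj rt (rev p) y" for p
    using adj_sym by (auto simp: is_path_def hd_rev last_rev successively_rev elim!: successively_mono)
  have "(\<forall>p. is_path V adj y p rt \<longrightarrow> x \<in> set p) \<longleftrightarrow> x \<in> set (pth y)"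
    unfolding rev using pth[OF True] pth_eqI by (metis rev_rev_ident set_rev)
  then show ?thesis using True by (simp add: forward_tree_def)
qed (simp add: forward_tree_def)

lemma fwd_V: "y \<in> fwd x \<Longrightarrow> y \<in> V" "fwd x \<subseteq> V"
  and fwd_self: "x \<in> V \<Longrightarrow> x \<in> fwd x"
  and fwd_rt: "fwd rt = V"
  using pth_simps(7,8) by (auto simp: fwd_iff)

lemma fwd_ch: "u \<in> fwd x \<Longrightarrow> y \<in> ch u \<Longrightarrow> y \<in> fwd x"
  using ch_pth ch_V by (auto simp: fwd_iff)

lemma fwd_par: assumes "u \<in> fwd x" "u \<noteq> x" shows "par u \<in> fwd x" "u \<noteq> rt" "u \<in> ch (par u)"
proof -
  have u: "u \<in> V" "x \<in> set (pth u)" using assms by (auto simp: fwd_iff)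
  show r: "u \<noteq> rt" using u(2) assms(2) pth_rt by auto
  show c: "u \<in> ch (par u)" by (rule in_ch_par[OF u(1) r])
  show "par u \<in> fwd x" using ch_pth[OF c] u assms ch_V[OF c] by (auto simp: fwd_iff)
qed

lemma fwd_induct [consumes 1, case_names root step]:
  assumes "u \<in> fwd x" "P x" "\<And>u y. u \<in> fwd x \<Longrightarrow> P u \<Longrightarrow> y \<in> ch u \<Longrightarrow> P y"
  shows "P u"
  using assms(1)
proof (induction "dd u" arbitrary: u rule: less_induct)
  case less
  show ?case
  proof (cases "u = x")
    case False
    note f = fwd_par[OF less.prems False]
    show ?thesis using less.hyps[of "par u"] f assms(3) ch_dd[OF f(3)] by auto
  qed (use assms in simp)
qed

lemma fwd_dd: "u \<in> fwd x \<Longrightarrow> dd x \<le> dd u \<and> (dd u = dd x \<longrightarrow> u = x)"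
proof (induction rule: fwd_induct)
  case (step u y)
  then show ?case using ch_dd by auto
qed simp

lemma fwd_trans: "y \<in> fwd x \<Longrightarrow> fwd y \<subseteq> fwd x"
proof
  fix u assume y: "y \<in> fwd x" and "u \<in> fwd y"
  from this(2) show "u \<in> fwd x"
    by (induction rule: fwd_induct) (use y fwd_ch in auto)
qed

lemma fwd_ch_sub: "y \<in> ch x \<Longrightarrow> fwd y \<subseteq> fwd x" "y \<in> ch x \<Longrightarrow> y \<in> fwd x" "y \<in> ch x \<Longrightarrow> x \<notin> fwd y"
proof -
  assume y: "y \<in> ch x"
  show "y \<in> fwd x" by (rule fwd_ch[OF fwd_self[OF ch_V(1)[OF y]] y])
  then show "fwd y \<subseteq> fwd x" by (rule fwd_trans)
  show "x \<notin> fwd y" using fwd_dd[of x y] ch_dd[OF y] by auto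
qed

lemma fwd_disjoint:
  assumes "dd y = dd y'" "y \<noteq> y'" shows "fwd y \<inter> fwd y' = {}"
proof -
  have "u \<in> fwd y \<Longrightarrow> u \<notin> fwd y'" for u
  proof (induction rule: fwd_induct)
    case root
    then show ?case using fwd_dd assms by metis
  next
    case (step u z)
    show ?case
    proof
      assume z: "z \<in> fwd y'"
      have "z \<noteq> y'" using fwd_dd[OF step.hyps(1)] ch_dd[OF step.hyps(2)] assms(1) by auto
      from fwd_par(1)[OF z this] show False using step par_ch by simp
    qed
  qed
  then show ?thesis by blast
qed

lemma fwd_disjoint_ch: "y \<in> ch x \<Longrightarrow> y' \<in> ch x \<Longrightarrow> y \<noteq> y' \<Longrightarrow> fwd y \<inter> fwd y' = {}"
  using fwd_disjoint ch_dd by simp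

lemma lev_0: "x \<in> V \<Longrightarrow> lev x 0 = {x}"
  using fwd_dd fwd_self by (auto simp: lev_def)

lemma lev_Suc: "lev x (Suc n) = (\<Union>u\<in>lev x n. ch u)"
proof
  show "lev x (Suc n) \<subseteq> (\<Union>u\<in>lev x n. ch u)"
  proof
    fix u assume u: "u \<in> lev x (Suc n)"
    then have "u \<in> fwd x" "u \<noteq> x" by (auto simp: lev_def)
    from fwd_par[OF this] u ch_dd[of u "par u"] show "u \<in> (\<Union>u\<in>lev x n. ch u)"
      by (auto simp: lev_def)
  qed
qed (auto simp: lev_def fwd_ch ch_dd)

lemma lev_ch_disjoint: "u \<noteq> u' \<Longrightarrow> ch u \<inter> ch u' = {}"
  using par_ch by blast

lemma fwd_lev: "fwd x = (\<Union>n. lev x n)"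
proof -
  have "u \<in> fwd x \<Longrightarrow> u \<in> lev x (dd u - dd x)" for u using fwd_dd[of u x] by (simp add: lev_def)
  then show ?thesis by (auto simp: lev_def)
qed

lemma lev_disjoint: "m \<noteq> n \<Longrightarrow> lev x m \<inter> lev x n = {}"
  by (auto simp: lev_def)

end

locale substitution =
  rooted_tree V adj rt for V :: "'v set" and adj rt +
  fixes M :: "nat ^'a ^('a::finite)" and a :: "'v \<Rightarrow> 'a"
  assumes subst: "\<And>x l. x \<in> V \<Longrightarrow> finite {y \<in> ch x. a y = l} \<and> card {y \<in> ch x. a y = l} = M $ a x $ l"
begin

lemma finite_ch: "finite (ch x)"
proof (cases "x \<in> V")
  case True
  have "finite (\<Union>l\<in>UNIV. {y \<in> ch x. a y = l})" using subst[OF True] by (intro finite_UN_I) auto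
  then show ?thesis by (rule finite_subset[rotated]) auto
next
  case False
  then have "ch x = {}" using ch_V by blast
  then show ?thesis by simp
qed

lemma finite_lev: "x \<in> V \<Longrightarrow> finite (lev x n)"
  by (induction n) (auto simp: lev_0 lev_Suc finite_ch)

lemma sum_lev_Suc:
  fixes f :: "'v \<Rightarrow> 'b::comm_monoid_add"
  assumes "x \<in> V"
  shows "(\<Sum>u\<in>lev x (Suc n). f u) = (\<Sum>y\<in>lev x n. \<Sum>u\<in>ch y. f u)"
  unfolding lev_Suc using finite_lev[OF assms] finite_ch lev_ch_disjoint
  by (intro sum.UNION_disjoint) auto

lemma sum_ch_label:
  fixes f :: "'a \<Rightarrow> 'b::semiring_1"
  assumes "x \<in> V"
  shows "(\<Sum>u\<in>ch x. f (a u)) = (\<Sum>l\<in>UNIV. of_nat (M $ a x $ l) * f l)"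
proof -
  have "(\<Sum>u\<in>ch x. f (a u)) = (\<Sum>l\<in>UNIV. \<Sum>u\<in>{y \<in> ch x. a y = l}. f (a u))"
    by (rule sum.group[symmetric]) (auto simp: finite_ch)
  also have "\<dots> = (\<Sum>l\<in>UNIV. of_nat (M $ a x $ l) * f l)"
    using subst[OF assms] by (intro sum.cong refl) simp
  finally show ?thesis .
qed

lemma ch_label_bij:
  assumes "x \<in> V" "y \<in> V" "a x = a y"
  shows "\<exists>\<beta>. bij_betw \<beta> (ch x) (ch y) \<and> (\<forall>u\<in>ch x. a (\<beta> u) = a u)"
proof -
  have "\<exists>b. bij_betw b {u \<in> ch x. a u = l} {u \<in> ch y. a u = l}" for l
    using subst assms by (intro finite_same_card_bij) auto
  then obtain b where b: "\<And>l. bij_betw (b l) {u \<in> ch x. a u = l} {u \<in> ch y. a u = l}" by metis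
  define \<beta> where "\<beta> u = b (a u) u" for u
  have im: "\<beta> u \<in> ch y \<and> a (\<beta> u) = a u" if "u \<in> ch x" for u
    using bij_betwE[OF b[of "a u"]] that by (simp add: \<beta>_def)
  have "inj_on \<beta> (ch x)"
  proof (rule inj_onI)
    fix u u' assume h: "u \<in> ch x" "u' \<in> ch x" "\<beta> u = \<beta> u'"
    then have "a u = a u'" using im by metis
    then show "u = u'" using h b[of "a u"] by (auto simp: \<beta>_def bij_betw_def inj_on_def)
  qed
  moreover have "ch y \<subseteq> \<beta> ` ch x"
  proof
    fix w assume "w \<in> ch y"
    then have "w \<in> b (a w) ` {u \<in> ch x. a u = a w}" using b[of "a w"] by (auto simp: bij_betw_def)
    then obtain u where "u \<in> ch x" "a u = a w" "w = b (a w) u" by blast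
    then show "w \<in> \<beta> ` ch x" by (auto simp: \<beta>_def image_iff intro!: bexI[of _ u])
  qed
  ultimately show ?thesis using im by (intro exI[of _ \<beta>]) (auto simp: bij_betw_def)
qed

text \<open>
  Between the children of two vertices of equal label there is a bijection that preserves labels, and
  these bijections are composed along the path from \<open>x\<close> to \<open>u\<close>. This makes (P2) applicable to
  every pair of vertices of equal label.
\<close>

lemma forward_tree_iso:
  assumes "x \<in> V" "y \<in> V" "a x = a y"
  shows "\<exists>\<psi>. graph_isomorphism adj (fwd x) (fwd y) \<psi> \<and> \<psi> x = y \<and>
     (\<forall>u\<in>fwd x. \<psi> u \<in> fwd y \<and> a (\<psi> u) = a u \<and> bij_betw \<psi> (ch u) (ch (\<psi> u)))"
proof -
  have "\<forall>u u'. \<exists>\<beta>. u \<in> V \<longrightarrow> u' \<in> V \<longrightarrow> a u = a u' \<longrightarrow> bij_betw \<beta> (ch u) (ch u') \<and> (\<forall>w\<in>ch u. a (\<beta> w) = a w)"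
    using ch_label_bij by metis
  then obtain \<beta> where \<beta>: "\<And>u u'. u \<in> V \<Longrightarrow> u' \<in> V \<Longrightarrow> a u = a u' \<Longrightarrow>
      bij_betw (\<beta> u u') (ch u) (ch u') \<and> (\<forall>w\<in>ch u. a (\<beta> u u' w) = a w)" by metis
  \<comment> \<open>Recursion on the depth below \<open>x\<close>: the image of the parent selects the bijection to be used.\<close>
  define E where "E n = rec_nat (\<lambda>u. y) (\<lambda>_ e u. \<beta> (par u) (e (par u)) u) n" for n
  define \<psi> where "\<psi> u = E (dd u - dd x) u" for u
  have psi_x: "\<psi> x = y" by (simp add: \<psi>_def E_def)
  have psi_ch: "\<psi> w = \<beta> u (\<psi> u) w" if "u \<in> fwd x" "w \<in> ch u" for u w
    using fwd_dd[OF that(1)] ch_dd[OF that(2)] par_ch[OF that(2)]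
    by (simp add: \<psi>_def E_def Suc_diff_le)
  have A: "\<psi> u \<in> fwd y \<and> a (\<psi> u) = a u \<and> dd u + dd y = dd (\<psi> u) + dd x" if "u \<in> fwd x" for u
    using that
  proof (induction rule: fwd_induct)
    case root
    show ?case using psi_x assms fwd_self by simp
  next
    case (step u w)
    have w: "\<psi> w \<in> ch (\<psi> u) \<and> a (\<psi> w) = a w"
      using \<beta>[of u "\<psi> u"] step fwd_V psi_ch[OF step.hyps(1,2)]
      by (metis bij_betwE)
    then show ?case using step ch_dd[OF step.hyps(2)] ch_dd[of "\<psi> w" "\<psi> u"] fwd_ch by auto
  qed
  have B: "bij_betw \<psi> (ch u) (ch (\<psi> u))" if u: "u \<in> fwd x" for u
  proof -
    have "bij_betw (\<beta> u (\<psi> u)) (ch u) (ch (\<psi> u))"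
      using \<beta>[of u "\<psi> u"] A[OF u] u fwd_V by metis
    then show ?thesis using psi_ch[OF u] by (simp cong: bij_betw_cong)
  qed
  have inj: "u = u'" if "u \<in> fwd x" "u' \<in> fwd x" "\<psi> u = \<psi> u'" for u u'
    using that
  proof (induction arbitrary: u' rule: fwd_induct)
    case root
    then have "dd u' = dd x" using A[of u'] A[of x] assms fwd_self by auto
    then show ?case using fwd_dd root by metis
  next
    case (step u w)
    have "dd w = dd u'" using A[of u'] A[of w] step fwd_ch by (metis add_right_cancel)
    then have "u' \<noteq> x" using ch_dd[OF step.hyps(2)] fwd_dd[OF step.hyps(1)] by auto
    note p = fwd_par[OF step.prems(1) this]
    have c: "\<psi> w \<in> ch (\<psi> u)" "\<psi> u' \<in> ch (\<psi> (par u'))"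
      using B[OF step.hyps(1)] B[OF p(1)] step.hyps(2) p(3) by (auto dest: bij_betwE)
    then have "\<psi> u = \<psi> (par u')" using par_ch step.prems(2) by metis
    then have "u = par u'" using step.IH p by simp
    then show ?case using B[OF step.hyps(1)] p step by (auto simp: bij_betw_def inj_on_def)
  qed
  have surj: "\<exists>u\<in>fwd x. \<psi> u = w" if "w \<in> fwd y" for w
    using that
  proof (induction rule: fwd_induct)
    case root
    show ?case using psi_x fwd_self assms by auto
  next
    case (step w z)
    then obtain u where "u \<in> fwd x" "\<psi> u = w" by auto
    then show ?case using B[of u] step fwd_ch by (metis bij_betw_imp_surj_on imageE)
  qed
  have cc: "w \<in> ch u \<longleftrightarrow> \<psi> w \<in> ch (\<psi> u)" if u: "u \<in> fwd x" and w: "w \<in> fwd x" for u w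
  proof
    assume "\<psi> w \<in> ch (\<psi> u)"
    then obtain w' where "w' \<in> ch u" "\<psi> w' = \<psi> w" using B[OF u]
      by (metis bij_betw_imp_surj_on imageE)
    then show "w \<in> ch u" using inj[of w' w] u w fwd_ch by auto
  qed (use B[OF u] in \<open>auto dest: bij_betwE\<close>)
  have adjc: "adj u w \<longleftrightarrow> w \<in> ch u \<or> u \<in> ch w" if "u \<in> V" "w \<in> V" for u w
    using adj_iff[OF that(1), of w] ch_adj(2)[of u w] in_ch_par[OF that(1)] by blast
  have "adj u w \<longleftrightarrow> adj (\<psi> u) (\<psi> w)" if "u \<in> fwd x" "w \<in> fwd x" for u w
  proof -
    have "u \<in> V" "w \<in> V" "\<psi> u \<in> V" "\<psi> w \<in> V"
      using that A[OF that(1)] A[OF that(2)] fwd_V(1) by blast+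
    then show ?thesis using adjc cc[OF that] cc[OF that(2,1)] by simp
  qed
  moreover have "bij_betw \<psi> (fwd x) (fwd y)"
    unfolding bij_betw_def
  proof
    show "inj_on \<psi> (fwd x)" by (rule inj_onI) (rule inj)
    show "\<psi> ` fwd x = fwd y" using A surj by blast
  qed
  ultimately have "graph_isomorphism adj (fwd x) (fwd y) \<psi>"
    by (simp add: graph_isomorphism_def)
  then show ?thesis using psi_x A B by blast
qed

end

section \<open>Displacements in the upper half plane\<close>

text \<open>
  This is \<open>2 (cosh d - 1)\<close> for the hyperbolic distance \<open>d\<close> of \<open>g\<close> and \<open>h\<close>. The
  function \<open>DD\<close> below expresses it by the displacement \<open>(g - h) / Im h\<close>; as a square divided by a
  positive affine function it is convex on the half plane \<open>1 + Im \<zeta> > 0\<close>.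
\<close>

definition hdist :: "complex \<Rightarrow> complex \<Rightarrow> real" where
  "hdist g h = (cmod (g - h))\<^sup>2 / (Im g * Im h)"

definition DD :: "complex \<Rightarrow> real" where
  "DD \<zeta> = (cmod \<zeta>)\<^sup>2 / (1 + Im \<zeta>)"

definition wmean :: "'i set \<Rightarrow> ('i \<Rightarrow> real) \<Rightarrow> ('i \<Rightarrow> complex) \<Rightarrow> complex" where
  "wmean A p \<zeta> = (\<Sum>i\<in>A. p i *\<^sub>R \<zeta> i)"

text \<open>
  The loss in Jensen's inequality for \<open>DD ^ n\<close>.
\<close>

definition defect :: "nat \<Rightarrow> 'i set \<Rightarrow> ('i \<Rightarrow> real) \<Rightarrow> ('i \<Rightarrow> complex) \<Rightarrow> real" where
  "defect n A p \<zeta> = (\<Sum>i\<in>A. p i * DD (\<zeta> i) ^ n) - DD (wmean A p \<zeta>) ^ n"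

lemma DD_nonneg: "1 + Im \<zeta> > 0 \<Longrightarrow> DD \<zeta> \<ge> 0"
  by (simp add: DD_def)

lemma hdist_nonneg: "Im g > 0 \<Longrightarrow> Im h > 0 \<Longrightarrow> hdist g h \<ge> 0"
  by (simp add: hdist_def)

lemma hdist_DD:
  assumes "Im h > 0" "Im g > 0"
  shows "hdist g h = DD ((g - h) / of_real (Im h))" "1 + Im ((g - h) / of_real (Im h)) > 0"
  using assms by (simp_all add: hdist_def DD_def norm_divide power_divide power2_eq_square field_simps)

lemma inverse_le_DD:
  assumes "1 + Im \<zeta> > 0" shows "1 / (1 + Im \<zeta>) \<le> DD \<zeta> + 2"
proof -
  have "(Im \<zeta>)\<^sup>2 \<le> (cmod \<zeta>)\<^sup>2" by (simp add: cmod_power2)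
  then have "DD \<zeta> \<ge> (Im \<zeta>)\<^sup>2 / (1 + Im \<zeta>)" using assms by (simp add: DD_def divide_right_mono)
  moreover have "(Im \<zeta>)\<^sup>2 / (1 + Im \<zeta>) = (1 + Im \<zeta>) - 2 + 1 / (1 + Im \<zeta>)"
    using assms by (simp add: field_simps power2_eq_square)
  ultimately show ?thesis using assms by linarith
qed

lemma le_hdist:
  assumes "Im g > 0" "Im h > 0" shows "Im h / Im g \<le> hdist g h + 2" "Im g / Im h \<le> hdist g h + 2"
proof -
  have "(Im g - Im h)\<^sup>2 \<le> (cmod (g - h))\<^sup>2" by (simp add: cmod_power2)
  then have "hdist g h \<ge> (Im g - Im h)\<^sup>2 / (Im g * Im h)" using assms by (simp add: hdist_def divide_right_mono)
  moreover have "(Im g - Im h)\<^sup>2 / (Im g * Im h) = Im h / Im g + Im g / Im h - 2"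
    using assms by (simp add: field_simps power2_eq_square)
  moreover have "Im h / Im g > 0" "Im g / Im h > 0" using assms by auto
  ultimately show "Im h / Im g \<le> hdist g h + 2" "Im g / Im h \<le> hdist g h + 2" by linarith+
qed

lemma wmean_Im:
  assumes "finite A" "sum p A = 1" shows "1 + Im (wmean A p \<zeta>) = (\<Sum>i\<in>A. p i * (1 + Im (\<zeta> i)))"
  using assms by (simp add: wmean_def distrib_left sum.distrib)

lemma wmean_Im_pos:
  assumes "finite A" "\<And>i. i \<in> A \<Longrightarrow> p i \<ge> 0" "sum p A = 1" "\<And>i. i \<in> A \<Longrightarrow> 1 + Im (\<zeta> i) > 0"
  shows "1 + Im (wmean A p \<zeta>) > 0"
proof -
  obtain i where i: "i \<in> A" "p i \<noteq> 0" using assms(3) by (metis sum.neutral zero_neq_one)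
  have "(\<Sum>i\<in>A. p i * (1 + Im (\<zeta> i))) > 0"
    by (rule sum_pos2[OF assms(1) i(1)]) (use i assms(2,4) in \<open>auto simp: less_le dest: order.strict_implies_order\<close>)
  then show ?thesis using wmean_Im[OF assms(1,3)] by simp
qed

text \<open>
  For \<open>n = 1\<close> the loss is exactly the variance of the directions \<open>\<zeta> i / (1 + Im (\<zeta> i))\<close> under weights
  that are tilted by \<open>1 + Im (\<zeta> i)\<close>.
\<close>

lemma DD_jensen_defect:
  fixes \<zeta> :: "'i \<Rightarrow> complex"
  assumes A: "finite A" "\<And>i. i \<in> A \<Longrightarrow> p i \<ge> 0" "sum p A = 1" "\<And>i. i \<in> A \<Longrightarrow> 1 + Im (\<zeta> i) > 0"
  defines "\<zeta>b \<equiv> wmean A p \<zeta>"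
  shows "(\<Sum>i\<in>A. p i * DD (\<zeta> i)) - DD \<zeta>b =
    (\<Sum>i\<in>A. p i * (1 + Im (\<zeta> i)) * (cmod (\<zeta> i / of_real (1 + Im (\<zeta> i)) - \<zeta>b / of_real (1 + Im \<zeta>b)))\<^sup>2)"
proof -
  define s where "s i = 1 + Im (\<zeta> i)" for i
  define sb where "sb = 1 + Im \<zeta>b"
  have sb: "sb > 0" using wmean_Im_pos[OF A] by (simp add: sb_def \<zeta>b_def)
  have sbe: "sb = (\<Sum>i\<in>A. p i * s i)" using wmean_Im[OF A(1,3)] by (simp add: sb_def s_def \<zeta>b_def)
  have t: "s i * (cmod (\<zeta> i / of_real (s i) - \<zeta>b / of_real sb))\<^sup>2
     = DD (\<zeta> i) - 2 / sb * (\<zeta> i \<bullet> \<zeta>b) + s i * ((cmod \<zeta>b)\<^sup>2 / sb\<^sup>2)" if "i \<in> A" for i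
  proof -
    have s: "s i > 0" using A(4) that by (simp add: s_def)
    have e: "\<zeta> i / of_real (s i) - \<zeta>b / of_real sb = (1 / s i) *\<^sub>R \<zeta> i - (1 / sb) *\<^sub>R \<zeta>b"
      by (simp add: scaleR_conv_of_real)
    have "(cmod ((1 / s i) *\<^sub>R \<zeta> i - (1 / sb) *\<^sub>R \<zeta>b))\<^sup>2 =
       (cmod (\<zeta> i))\<^sup>2 / (s i)\<^sup>2 - 2 / (s i * sb) * (\<zeta> i \<bullet> \<zeta>b) + (cmod \<zeta>b)\<^sup>2 / sb\<^sup>2"
      unfolding power2_norm_eq_inner using s sb
      by (simp add: inner_diff_left inner_diff_right inner_commute power2_eq_square field_simps)
    then show ?thesis unfolding e using s sb
      by (simp add: DD_def s_def[symmetric] field_simps power2_eq_square)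
  qed
  have "(\<Sum>i\<in>A. p i * s i * (cmod (\<zeta> i / of_real (s i) - \<zeta>b / of_real sb))\<^sup>2)
     = (\<Sum>i\<in>A. p i * DD (\<zeta> i) - 2 / sb * (p i * (\<zeta> i \<bullet> \<zeta>b)) + p i * s i * ((cmod \<zeta>b)\<^sup>2 / sb\<^sup>2))"
    using t by (intro sum.cong refl) (simp add: mult.assoc, simp add: algebra_simps)
  also have "\<dots> = (\<Sum>i\<in>A. p i * DD (\<zeta> i)) - 2 / sb * (\<Sum>i\<in>A. p i * (\<zeta> i \<bullet> \<zeta>b)) + sb * ((cmod \<zeta>b)\<^sup>2 / sb\<^sup>2)"
    by (simp only: sum.distrib sum_subtractf sum_distrib_left[symmetric] sum_distrib_right[symmetric] sbe)
  also have "(\<Sum>i\<in>A. p i * (\<zeta> i \<bullet> \<zeta>b)) = (cmod \<zeta>b)\<^sup>2"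
    unfolding power2_norm_eq_inner by (subst (3) \<zeta>b_def) (simp add: wmean_def inner_sum_right inner_commute)
  finally have "(\<Sum>i\<in>A. p i * s i * (cmod (\<zeta> i / of_real (s i) - \<zeta>b / of_real sb))\<^sup>2)
     = (\<Sum>i\<in>A. p i * DD (\<zeta> i)) - 2 / sb * (cmod \<zeta>b)\<^sup>2 + sb * ((cmod \<zeta>b)\<^sup>2 / sb\<^sup>2)" .
  moreover have "sb * ((cmod \<zeta>b)\<^sup>2 / sb\<^sup>2) = DD \<zeta>b" "2 / sb * (cmod \<zeta>b)\<^sup>2 = 2 * DD \<zeta>b"
    using sb by (simp_all add: DD_def sb_def[symmetric] power2_eq_square)
  ultimately show ?thesis unfolding s_def sb_def by linarith
qed

text \<open>
  The left side is the distance of the power from its tangent at \<open>m\<close>, which grows quadratically.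
\<close>

lemma power_tangent_defect:
  fixes D m :: real
  assumes "D \<ge> 0" "m \<ge> 0"
  shows "D ^ (k+2) - m ^ (k+2) - (real k + 2) * m ^ (k+1) * (D - m) \<ge> m ^ k * (D - m)\<^sup>2"
proof (induction k)
  case 0
  show ?case by (simp add: power2_eq_square algebra_simps)
next
  case (Suc k)
  define f where "f = D ^ (k+2) - m ^ (k+2) - (real k + 2) * m ^ (k+1) * (D - m)"
  have "0 \<le> m ^ k * (D - m)\<^sup>2" using assms by simp
  also have "\<dots> \<le> f" using Suc.IH unfolding f_def .
  finally have "f \<ge> 0" .
  then have "D * f \<ge> 0" using assms by simp
  moreover have "D ^ (Suc k+2) - m ^ (Suc k+2) - (real (Suc k) + 2) * m ^ (Suc k+1) * (D - m)
      = D * f + (real k + 2) * (m ^ (k+1) * (D - m)\<^sup>2)"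
    by (simp add: f_def power2_eq_square algebra_simps)
  moreover have "(real k + 2) * (m ^ (k+1) * (D - m)\<^sup>2) \<ge> 1 * (m ^ Suc k * (D - m)\<^sup>2)"
    using assms by (intro mult_mono) auto
  ultimately show ?case by linarith
qed

text \<open>
  The loss has two sources. The strict convexity of the power is felt when the values \<open>DD (\<zeta> i)\<close>
  differ, and the convexity of \<open>DD\<close> when the directions \<open>\<zeta> i / (1 + Im (\<zeta> i))\<close> differ.
\<close>

lemma defect_lower:
  fixes \<zeta> :: "'i \<Rightarrow> complex"
  assumes A: "finite A" "\<And>i. i \<in> A \<Longrightarrow> p i \<ge> 0" "sum p A = 1" "\<And>i. i \<in> A \<Longrightarrow> 1 + Im (\<zeta> i) > 0"
  defines "\<zeta>b \<equiv> wmean A p \<zeta>" and "m \<equiv> \<Sum>i\<in>A. p i * DD (\<zeta> i)"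
  shows "defect (k+2) A p \<zeta> \<ge> m ^ k * (\<Sum>i\<in>A. p i * (DD (\<zeta> i) - m)\<^sup>2) +
    m ^ (k+1) * (\<Sum>i\<in>A. p i * ((1 + Im (\<zeta> i)) * (cmod (\<zeta> i / of_real (1 + Im (\<zeta> i)) - \<zeta>b / of_real (1 + Im \<zeta>b)))\<^sup>2))"
    (is "_ \<ge> _ + m ^ (k+1) * ?L")
proof -
  have D0: "DD (\<zeta> i) \<ge> 0" if "i \<in> A" for i using A(4) that DD_nonneg by blast
  have m0: "m \<ge> 0" unfolding m_def using A(2) D0 by (intro sum_nonneg) auto
  have b0: "DD \<zeta>b \<ge> 0" using wmean_Im_pos[OF A] DD_nonneg by (simp add: \<zeta>b_def)
  have L: "m - DD \<zeta>b = ?L"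
    using DD_jensen_defect[OF A] by (simp add: m_def \<zeta>b_def mult.assoc)
  have L0: "?L \<ge> 0" by (intro sum_nonneg mult_nonneg_nonneg A(2) less_imp_le[OF A(4)] zero_le_power2)
  have "(\<Sum>i\<in>A. p i * (DD (\<zeta> i) ^ (k+2))) \<ge>
     (\<Sum>i\<in>A. p i * (m ^ (k+2) + (real k + 2) * m ^ (k+1) * (DD (\<zeta> i) - m) + m ^ k * (DD (\<zeta> i) - m)\<^sup>2))"
    using A(2) by (intro sum_mono mult_left_mono) (use power_tangent_defect[OF D0 m0, of _ k] in \<open>auto simp: algebra_simps\<close>)
  also have "(\<Sum>i\<in>A. p i * (m ^ (k+2) + (real k + 2) * m ^ (k+1) * (DD (\<zeta> i) - m) + m ^ k * (DD (\<zeta> i) - m)\<^sup>2))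
     = (\<Sum>i\<in>A. p i * m ^ (k+2) + (real k + 2) * m ^ (k+1) * (p i * DD (\<zeta> i) - p i * m) + m ^ k * (p i * (DD (\<zeta> i) - m)\<^sup>2))"
    by (intro sum.cong refl) (simp add: algebra_simps)
  also have "\<dots> = m ^ (k+2) + m ^ k * (\<Sum>i\<in>A. p i * (DD (\<zeta> i) - m)\<^sup>2)"
    unfolding sum.distrib sum_distrib_left[symmetric] sum_distrib_right[symmetric] sum_subtractf A(3)
    by (simp add: m_def[symmetric])
  finally have 1: "(\<Sum>i\<in>A. p i * DD (\<zeta> i) ^ (k+2)) \<ge> m ^ (k+2) + m ^ k * (\<Sum>i\<in>A. p i * (DD (\<zeta> i) - m)\<^sup>2)" .
  have "DD \<zeta>b ^ (k+1) \<le> m ^ (k+1)" using b0 L L0 by (intro power_mono) linarith+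
  then have "DD \<zeta>b ^ (k+1) * DD \<zeta>b \<le> m ^ (k+1) * DD \<zeta>b" using b0 by (rule mult_right_mono)
  then have "m ^ (k+2) - DD \<zeta>b ^ (k+2) \<ge> m ^ (k+1) * (m - DD \<zeta>b)"
    by (simp add: algebra_simps)
  then show ?thesis using 1 L by (simp add: defect_def \<zeta>b_def)
qed

lemma defect_nonneg:
  assumes "finite A" "\<And>i. i \<in> A \<Longrightarrow> p i \<ge> 0" "sum p A = 1" "\<And>i. i \<in> A \<Longrightarrow> 1 + Im (\<zeta> i) > 0"
  shows "defect (k+2) A p \<zeta> \<ge> 0"
proof -
  have m0: "(\<Sum>i\<in>A. p i * DD (\<zeta> i)) \<ge> 0"
    using assms(2,4) DD_nonneg by (intro sum_nonneg mult_nonneg_nonneg) auto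
  show ?thesis
    by (rule order_trans[OF _ defect_lower[OF assms]])
      (intro add_nonneg_nonneg mult_nonneg_nonneg sum_nonneg zero_le_power zero_le_power2 m0 assms(2) less_imp_le[OF assms(4)])
qed

text \<open>
  A small loss forces the values \<open>DD (\<zeta> i)\<close> to be close to \<open>m\<close> and the directions
  \<open>\<tau> i = \<zeta> i / (1 + Im (\<zeta> i))\<close> to be close to a common \<open>tb\<close>. Since \<open>cnj (\<tau> i) * \<zeta> i = DD (\<zeta> i)\<close>,
  multiplication by \<open>cnj tb / m\<close> brings every \<open>\<zeta> i\<close> close to 1, so that the displacements are close
  to each other, relative to their size.
\<close>

lemma defect_small_close:
  fixes \<zeta> :: "'i \<Rightarrow> complex"
  assumes A: "finite A" "\<And>i. i \<in> A \<Longrightarrow> p i \<ge> p0" "p0 > 0" "sum p A = 1" "\<And>i. i \<in> A \<Longrightarrow> 1 + Im (\<zeta> i) > 0"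
    and \<epsilon>: "0 < \<epsilon>" "\<epsilon> \<le> 1/10"
  defines "m \<equiv> \<Sum>i\<in>A. p i * DD (\<zeta> i)"
  assumes m: "m > 0" and small: "defect (k+2) A p \<zeta> \<le> p0 * \<epsilon>\<^sup>2 * m ^ (k+2)"
  shows "i \<in> A \<Longrightarrow> \<bar>DD (\<zeta> i) - m\<bar> \<le> \<epsilon> * m"
    and "i \<in> A \<Longrightarrow> j \<in> A \<Longrightarrow> cmod (\<zeta> i - \<zeta> j) \<le> 10 * \<epsilon> * cmod (\<zeta> j)"
proof -
  define \<zeta>b where "\<zeta>b = wmean A p \<zeta>"
  define s where "s i = 1 + Im (\<zeta> i)" for i
  define tb where "tb = \<zeta>b / of_real (1 + Im \<zeta>b)"
  define L where "L i = s i * (cmod (\<zeta> i / of_real (s i) - tb))\<^sup>2" for i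
  have p: "i \<in> A \<Longrightarrow> p i \<ge> 0" for i using A(2,3) by (meson less_imp_le order_trans)
  have s0: "i \<in> A \<Longrightarrow> s i > 0" for i using A(5) by (simp add: s_def)
  have L0: "i \<in> A \<Longrightarrow> L i \<ge> 0" for i using s0 by (simp add: L_def less_imp_le)
  have low: "m ^ k * (\<Sum>i\<in>A. p i * (DD (\<zeta> i) - m)\<^sup>2) + m ^ (k+1) * (\<Sum>i\<in>A. p i * L i) \<le> p0 * \<epsilon>\<^sup>2 * m ^ (k+2)"
    unfolding m_def \<zeta>b_def L_def s_def tb_def
    by (rule order_trans[OF defect_lower[where p = p and \<zeta> = \<zeta>, OF A(1) p A(4,5)] small[unfolded m_def]])
  have each: "(DD (\<zeta> i) - m)\<^sup>2 \<le> (\<epsilon> * m)\<^sup>2 \<and> L i \<le> \<epsilon>\<^sup>2 * m" if i: "i \<in> A" for i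
  proof -
    have 1: "p0 * (DD (\<zeta> i) - m)\<^sup>2 \<le> (\<Sum>i\<in>A. p i * (DD (\<zeta> i) - m)\<^sup>2)"
    proof -
      have "p0 * (DD (\<zeta> i) - m)\<^sup>2 \<le> p i * (DD (\<zeta> i) - m)\<^sup>2" using A(2)[OF i] by (intro mult_right_mono) auto
      also have "\<dots> \<le> (\<Sum>i\<in>A. p i * (DD (\<zeta> i) - m)\<^sup>2)"
        using p by (intro member_le_sum[OF i _ A(1)]) auto
      finally show ?thesis .
    qed
    have 2: "p0 * L i \<le> (\<Sum>i\<in>A. p i * L i)"
    proof -
      have "p0 * L i \<le> p i * L i" using A(2)[OF i] L0[OF i] by (intro mult_right_mono) auto
      also have "\<dots> \<le> (\<Sum>i\<in>A. p i * L i)"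
        using p L0 by (intro member_le_sum[OF i _ A(1)]) auto
      finally show ?thesis .
    qed
    have s1: "(\<Sum>i\<in>A. p i * (DD (\<zeta> i) - m)\<^sup>2) \<ge> 0" "(\<Sum>i\<in>A. p i * L i) \<ge> 0"
      using p L0 by (auto intro!: sum_nonneg)
    have "m ^ k * (p0 * (DD (\<zeta> i) - m)\<^sup>2) \<le> m ^ k * (p0 * (\<epsilon> * m)\<^sup>2)"
    proof -
      have "m ^ k * (p0 * (DD (\<zeta> i) - m)\<^sup>2) \<le> m ^ k * (\<Sum>i\<in>A. p i * (DD (\<zeta> i) - m)\<^sup>2)"
        using 1 m by (intro mult_left_mono) auto
      also have "\<dots> \<le> p0 * \<epsilon>\<^sup>2 * m ^ (k+2)"
        using low s1(2) m by (smt (verit) mult_nonneg_nonneg zero_le_power)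
      finally show ?thesis by (simp add: power2_eq_square algebra_simps)
    qed
    moreover have "m ^ (k+1) * (p0 * L i) \<le> m ^ (k+1) * (p0 * (\<epsilon>\<^sup>2 * m))"
    proof -
      have "m ^ (k+1) * (p0 * L i) \<le> m ^ (k+1) * (\<Sum>i\<in>A. p i * L i)"
        using 2 m by (intro mult_left_mono) auto
      also have "\<dots> \<le> p0 * \<epsilon>\<^sup>2 * m ^ (k+2)"
        using low s1(1) m by (smt (verit) mult_nonneg_nonneg zero_le_power)
      finally show ?thesis by (simp add: power2_eq_square algebra_simps)
    qed
    ultimately show ?thesis using m A(3) by simp
  qed
  show D: "\<bar>DD (\<zeta> i) - m\<bar> \<le> \<epsilon> * m" if "i \<in> A" for i
    using each[OF that] \<epsilon>(1) m by (metis abs_le_square_iff abs_of_pos mult_pos_pos)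
  define c where "c = cnj tb / of_real m"
  have c: "cmod (c * \<zeta> i - 1) \<le> 3 * \<epsilon>" if i: "i \<in> A" for i
  proof -
    define d where "d = \<zeta> i / of_real (s i) - tb"
    have Dle: "DD (\<zeta> i) \<le> (11/10) * m"
      using D[OF i] mult_right_mono[OF \<epsilon>(2), of m] m by linarith
    have zz: "(cmod (\<zeta> i))\<^sup>2 = DD (\<zeta> i) * s i" using s0[OF i] by (simp add: DD_def s_def)
    have "(cmod d * cmod (\<zeta> i))\<^sup>2 = L i * DD (\<zeta> i)"
      by (simp add: power_mult_distrib zz L_def d_def)
    also have "\<dots> \<le> (\<epsilon>\<^sup>2 * m) * ((11/10) * m)"
      using each[OF i] Dle L0[OF i] DD_nonneg[OF A(5)[OF i]] m by (intro mult_mono) auto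
    also have "\<dots> \<le> ((11/10) * \<epsilon> * m)\<^sup>2" using \<epsilon>(1) m by (simp add: power2_eq_square)
    finally have dz: "cmod d * cmod (\<zeta> i) \<le> (11/10) * \<epsilon> * m"
      using \<epsilon>(1) m by (auto intro: power2_le_imp_le)
    have "cnj (\<zeta> i / of_real (s i)) * \<zeta> i = of_real (DD (\<zeta> i))"
      using complex_norm_square[of "\<zeta> i"] s0[OF i]
      by (simp add: DD_def s_def mult.commute)
    moreover have "cnj tb = cnj (\<zeta> i / of_real (s i)) - cnj d" by (simp add: d_def)
    ultimately have "cnj tb * \<zeta> i = of_real (DD (\<zeta> i)) - cnj d * \<zeta> i"
      by (simp only: left_diff_distrib)
    then have "c * \<zeta> i - 1 = (of_real (DD (\<zeta> i) - m) - cnj d * \<zeta> i) / of_real m"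
      using m by (simp add: c_def field_simps)
    then have "cmod (c * \<zeta> i - 1) = cmod (of_real (DD (\<zeta> i) - m) - cnj d * \<zeta> i) / m"
      using m by (simp add: norm_divide)
    also have "\<dots> \<le> (\<bar>DD (\<zeta> i) - m\<bar> + cmod d * cmod (\<zeta> i)) / m"
      using m by (intro divide_right_mono order_trans[OF norm_triangle_ineq4])
        (auto simp: norm_mult simp del: of_real_diff)
    also have "\<dots> \<le> (\<epsilon> * m + (11/10) * \<epsilon> * m) / m"
      using m D[OF i] dz by (intro divide_right_mono add_mono) auto
    also have "\<dots> \<le> 3 * \<epsilon>" using m \<epsilon>(1) by (simp add: field_simps)
    finally show ?thesis .
  qed
  show "cmod (\<zeta> i - \<zeta> j) \<le> 10 * \<epsilon> * cmod (\<zeta> j)" if ij: "i \<in> A" "j \<in> A"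
  proof -
    have "cmod c * cmod (\<zeta> i - \<zeta> j) = cmod ((c * \<zeta> i - 1) - (c * \<zeta> j - 1))"
      by (simp add: norm_mult[symmetric] algebra_simps)
    also have "\<dots> \<le> 6 * \<epsilon>" using norm_triangle_ineq4[of "c * \<zeta> i - 1" "c * \<zeta> j - 1"] c[OF ij(1)] c[OF ij(2)] by linarith
    finally have 1: "cmod c * cmod (\<zeta> i - \<zeta> j) \<le> 6 * \<epsilon>" .
    have "1 = cmod (c * \<zeta> j - (c * \<zeta> j - 1))" by simp
    also have "\<dots> \<le> cmod (c * \<zeta> j) + cmod (c * \<zeta> j - 1)" by (rule norm_triangle_ineq4)
    finally have 2: "cmod c * cmod (\<zeta> j) \<ge> 7/10" using c[OF ij(2)] \<epsilon> by (simp add: norm_mult)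
    then have c0: "cmod c > 0" by (cases "c = 0") auto
    have "6 * \<epsilon> \<le> 10 * \<epsilon> * (7/10)" using \<epsilon> by simp
    also have "\<dots> \<le> 10 * \<epsilon> * (cmod c * cmod (\<zeta> j))" using 2 \<epsilon> by (intro mult_left_mono) auto
    finally have "cmod c * cmod (\<zeta> i - \<zeta> j) \<le> cmod c * (10 * \<epsilon> * cmod (\<zeta> j))" using 1 by (simp add: algebra_simps)
    then show ?thesis using c0 by simp
  qed
qed

lemma weighted_sum_DD_ge:
  assumes "finite S" "i \<in> S" "\<And>i. i \<in> S \<Longrightarrow> r i \<ge> p0" "p0 > 0" "\<And>i. i \<in> S \<Longrightarrow> 1 + Im (f i) > 0"
  shows "p0 * DD (f i) \<le> (\<Sum>i\<in>S. r i * DD (f i))"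
proof -
  have r: "r i \<ge> 0" if "i \<in> S" for i using assms(3)[OF that] assms(4) by linarith
  have "p0 * DD (f i) \<le> r i * DD (f i)" using assms DD_nonneg by (intro mult_right_mono) auto
  also have "\<dots> \<le> (\<Sum>i\<in>S. r i * DD (f i))"
    by (rule member_le_sum[OF assms(2) _ assms(1)]) (use r assms(5) DD_nonneg in \<open>auto intro!: mult_nonneg_nonneg\<close>)
  finally show ?thesis .
qed

text \<open>
  Here \<open>A\<close> stands for the children of \<open>x'\<close> and \<open>B\<close> for its siblings together with \<open>x'\<close> itself, and \<open>\<zeta>'\<close>
  results from \<open>\<zeta>\<close> when the child \<open>y1\<close> is replaced by the sibling \<open>y\<close>. If one of the three defects is
  not small compared with the power of \<open>N = DD (\<eta> y)\<close>, it pays for \<open>N\<close>. Otherwise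
  \<open>defect_small_close\<close> gives a chain of approximate equalities \<open>\<eta> x' \<approx> \<eta> y\<close> (from \<open>B\<close>), \<open>\<eta> y \<approx> \<zeta> y2\<close>
  (from \<open>A\<close> with \<open>\<zeta>'\<close>) and \<open>\<zeta> y2 \<approx> wmean A p \<zeta>\<close> (from \<open>A\<close> with \<open>\<zeta>\<close>), while \<open>\<eta> x'\<close> differs from that mean,
  up to \<open>e\<close>, by the proportion \<open>\<sigma>\<close>. This is possible only if \<open>\<eta> y\<close> is of the order of \<open>e\<close>. The errors in the
  chain add up to \<open>40 \<epsilon>\<close>, a quarter of \<open>\<sigma>\<close>.
\<close>

lemma two_step_bound:
  fixes \<zeta> :: "'i \<Rightarrow> complex" and \<eta> :: "'j \<Rightarrow> complex"
  assumes p0: "0 < p0" and \<sigma>: "0 < \<sigma>" "\<sigma> \<le> 1"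
    and A: "finite A" "\<And>i. i \<in> A \<Longrightarrow> p i \<ge> p0" "sum p A = 1" "\<And>i. i \<in> A \<Longrightarrow> 1 + Im (\<zeta> i) > 0"
    and B: "finite B" "\<And>i. i \<in> B \<Longrightarrow> q i \<ge> p0" "sum q B = 1" "\<And>i. i \<in> B \<Longrightarrow> 1 + Im (\<eta> i) > 0"
    and y: "y1 \<in> A" "y2 \<in> A" "y1 \<noteq> y2" and x: "x' \<in> B" "y \<in> B"
    and rot: "cmod (\<eta> x' - (wmean A p \<zeta> - e)) \<ge> \<sigma> * cmod (wmean A p \<zeta> - e)"
    and e: "cmod e \<le> \<sigma> / 16"
  defines "\<epsilon> \<equiv> \<sigma> / 160" and "\<zeta>' \<equiv> \<zeta>(y1 := \<eta> y)"
  shows "DD (\<eta> y) ^ (k+2) \<le> (1 / (p0 * \<epsilon>\<^sup>2 * (p0/2) ^ (k+2))) *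
     (defect (k+2) A p \<zeta> + defect (k+2) A p \<zeta>' + defect (k+2) B q \<eta>) + (8 / \<sigma>) * cmod e"
proof -
  define N where "N = DD (\<eta> y)"
  define C where "C = 1 / (p0 * \<epsilon>\<^sup>2 * (p0/2) ^ (k+2))"
  define d1 where "d1 = defect (k+2) A p \<zeta>"
  define d2 where "d2 = defect (k+2) A p \<zeta>'"
  define d3 where "d3 = defect (k+2) B q \<eta>"
  have \<epsilon>: "0 < \<epsilon>" "\<epsilon> \<le> 1/10" using \<sigma> by (auto simp: \<epsilon>_def)
  have C: "C > 0" using p0 \<epsilon> by (simp add: C_def)
  have pA: "i \<in> A \<Longrightarrow> p i \<ge> 0" and qB: "j \<in> B \<Longrightarrow> q j \<ge> 0" for i j
    using A(2) B(2) p0 by (meson less_imp_le order_trans)+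
  have z': "i \<in> A \<Longrightarrow> 1 + Im (\<zeta>' i) > 0" for i using A(4) B(4)[OF x(2)] by (simp add: \<zeta>'_def)
  have d0: "d1 \<ge> 0" "d2 \<ge> 0" "d3 \<ge> 0"
    unfolding d1_def d2_def d3_def using A B pA qB z' by (auto intro!: defect_nonneg simp del: add_2_eq_Suc')
  have N0: "N \<ge> 0" using DD_nonneg B(4) x(2) by (simp add: N_def)
  have Cd: "N ^ (k+2) \<le> C * d" if "d \<ge> p0 * \<epsilon>\<^sup>2 * (p0 * N / 2) ^ (k+2)" for d
  proof -
    have "C * (p0 * \<epsilon>\<^sup>2 * (p0 * N / 2) ^ (k+2)) = N ^ (k+2)"
      using p0 \<epsilon> by (simp add: C_def power_mult_distrib power_divide)
    then show ?thesis using mult_left_mono[OF that less_imp_le[OF C]] by linarith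
  qed
  have "N ^ (k+2) \<le> C * (d1 + d2 + d3) + (8 / \<sigma>) * cmod e"
  proof (cases "N = 0")
    case True
    then show ?thesis using C d0 \<sigma> by simp
  next
    case False
    then have N: "N > 0" using N0 by simp
    have mono: "p0 * \<epsilon>\<^sup>2 * (p0 * N / 2) ^ (k+2) \<le> p0 * \<epsilon>\<^sup>2 * m ^ (k+2)" if "p0 * N / 2 \<le> m" for m
      using that p0 N \<epsilon> by (intro mult_left_mono power_mono) auto
    have rhs: "C * d1 \<le> C * (d1 + d2 + d3)" "C * d2 \<le> C * (d1 + d2 + d3)" "C * d3 \<le> C * (d1 + d2 + d3)"
      using C d0 by (auto intro!: mult_left_mono)
    have e0: "(8 / \<sigma>) * cmod e \<ge> 0" using \<sigma> by simp
    consider "d1 \<ge> p0 * \<epsilon>\<^sup>2 * (p0 * N / 2) ^ (k+2) \<or> d2 \<ge> p0 * \<epsilon>\<^sup>2 * (p0 * N / 2) ^ (k+2) \<or> d3 \<ge> p0 * \<epsilon>\<^sup>2 * (p0 * N / 2) ^ (k+2)"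
      | "d1 \<le> p0 * \<epsilon>\<^sup>2 * (p0 * N / 2) ^ (k+2)" "d2 \<le> p0 * \<epsilon>\<^sup>2 * (p0 * N / 2) ^ (k+2)" "d3 \<le> p0 * \<epsilon>\<^sup>2 * (p0 * N / 2) ^ (k+2)"
      by linarith
    then show ?thesis
    proof cases
      case 1
      then show ?thesis using Cd rhs e0 by (smt (verit))
    next
      case 2
      define z where "z = \<eta> y"
      have mB: "(\<Sum>i\<in>B. q i * DD (\<eta> i)) \<ge> p0 * N" unfolding N_def by (rule weighted_sum_DD_ge) (use B x p0 in auto)
      have mA': "(\<Sum>i\<in>A. p i * DD (\<zeta>' i)) \<ge> p0 * N"
        using weighted_sum_DD_ge[where f = \<zeta>' and r = p, OF A(1) y(1) A(2) p0 z'] by (simp add: N_def \<zeta>'_def)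
      have pN: "p0 * N > 0" "p0 * N / 2 \<le> p0 * N" using p0 N by auto
      have c3: "cmod (\<eta> x' - z) \<le> 10 * \<epsilon> * cmod z"
        unfolding z_def
        by (rule defect_small_close(2)[OF B(1,2) p0 B(3,4) \<epsilon>, where k = k])
          (use mB pN x 2(3) mono[of "\<Sum>i\<in>B. q i * DD (\<eta> i)"] in \<open>auto simp: d3_def simp del: add_2_eq_Suc'\<close>)
      have small': "0 < (\<Sum>i\<in>A. p i * DD (\<zeta>' i))" "defect (k+2) A p \<zeta>' \<le> p0 * \<epsilon>\<^sup>2 * (\<Sum>i\<in>A. p i * DD (\<zeta>' i)) ^ (k+2)"
        using mA' pN 2(2) mono[of "\<Sum>i\<in>A. p i * DD (\<zeta>' i)"] by (auto simp: d2_def simp del: add_2_eq_Suc')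
      have cl: "\<bar>DD (\<zeta>' i) - (\<Sum>i\<in>A. p i * DD (\<zeta>' i))\<bar> \<le> \<epsilon> * (\<Sum>i\<in>A. p i * DD (\<zeta>' i))"
        "cmod (\<zeta>' i - \<zeta>' j) \<le> 10 * \<epsilon> * cmod (\<zeta>' j)" if "i \<in> A" "j \<in> A" for i j
        using that
        by (auto intro: defect_small_close[where p = p and \<zeta> = \<zeta>' and k = k, OF A(1,2) p0 A(3) z' \<epsilon> small']
          simp del: add_2_eq_Suc')
      have c2: "cmod (\<zeta> y2 - z) \<le> 10 * \<epsilon> * cmod z"
        using cl(2)[OF y(2,1)] y(3) by (simp add: z_def \<zeta>'_def)
      define m' where "m' = (\<Sum>i\<in>A. p i * DD (\<zeta>' i))"
      have "\<bar>DD (\<zeta> y2) - m'\<bar> \<le> \<epsilon> * m'" "\<bar>N - m'\<bar> \<le> \<epsilon> * m'"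
        using cl(1)[OF y(2,2)] cl(1)[OF y(1,1)] y(3) by (simp_all add: m'_def N_def \<zeta>'_def)
      moreover have "\<epsilon> * m' \<le> (1/10) * m'" using \<epsilon> small'(1) by (intro mult_right_mono) (auto simp: m'_def)
      ultimately have D2: "DD (\<zeta> y2) \<ge> N / 2" by linarith
      have mA: "(\<Sum>i\<in>A. p i * DD (\<zeta> i)) \<ge> p0 * N / 2"
      proof -
        have "p0 * N / 2 \<le> p0 * DD (\<zeta> y2)" using mult_left_mono[OF D2 less_imp_le[OF p0]] by simp
        also have "\<dots> \<le> (\<Sum>i\<in>A. p i * DD (\<zeta> i))"
          by (rule weighted_sum_DD_ge) (use A y p0 in auto)
        finally show ?thesis .
      qed
      have c1: "cmod (\<zeta> i - \<zeta> y2) \<le> 10 * \<epsilon> * cmod (\<zeta> y2)" if "i \<in> A" for i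
        by (rule defect_small_close(2)[OF A(1,2) p0 A(3,4) \<epsilon>, where k = k])
          (use mA pN y 2(1) that mono[of "\<Sum>i\<in>A. p i * DD (\<zeta> i)"] in \<open>auto simp: d1_def simp del: add_2_eq_Suc'\<close>)
      define \<beta> where "\<beta> = wmean A p \<zeta>"
      have "\<beta> - \<zeta> y2 = (\<Sum>i\<in>A. p i *\<^sub>R (\<zeta> i - \<zeta> y2))"
        using A(3) by (simp add: \<beta>_def wmean_def scaleR_diff_right sum_subtractf scaleR_left.sum[symmetric])
      also have "cmod \<dots> \<le> (\<Sum>i\<in>A. p i * (10 * \<epsilon> * cmod (\<zeta> y2)))"
        by (rule sum_norm_le) (use c1 pA in \<open>auto intro!: mult_left_mono\<close>)
      also have "\<dots> = 10 * \<epsilon> * cmod (\<zeta> y2)" using A(3) by (simp add: sum_distrib_right[symmetric])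
      finally have b1: "cmod (\<beta> - \<zeta> y2) \<le> 10 * \<epsilon> * cmod (\<zeta> y2)" .
      have ez: "10 * \<epsilon> * cmod z \<le> cmod z" using \<epsilon> by (intro mult_left_le_one_le) auto
      have "cmod (\<zeta> y2) \<le> cmod z + cmod (\<zeta> y2 - z)" by (metis norm_triangle_sub)
      then have "cmod (\<zeta> y2) \<le> 2 * cmod z" using c2 ez by linarith
      then have "10 * \<epsilon> * cmod (\<zeta> y2) \<le> 10 * \<epsilon> * (2 * cmod z)" using \<epsilon> by (intro mult_left_mono) auto
      then have b2: "cmod (\<beta> - \<zeta> y2) \<le> 20 * \<epsilon> * cmod z" using b1 by linarith
      have b3: "cmod (\<beta> - z) \<le> 30 * \<epsilon> * cmod z"
        using norm_triangle_ineq[of "\<beta> - \<zeta> y2" "\<zeta> y2 - z"] b2 c2 by simp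
      have b4: "cmod (\<eta> x' - \<beta>) \<le> 40 * \<epsilon> * cmod z"
        using norm_triangle_ineq4[of "\<eta> x' - z" "\<beta> - z"] b3 c3 by simp
      have "cmod z \<le> cmod \<beta> + cmod (\<beta> - z)" by (metis norm_triangle_sub norm_minus_commute)
      moreover have "30 * \<epsilon> * cmod z \<le> (1/2) * cmod z" using \<sigma> by (intro mult_right_mono) (auto simp: \<epsilon>_def)
      ultimately have bz: "cmod \<beta> \<ge> cmod z / 2" using b3 by linarith
      have "\<sigma> * (cmod z / 2) \<le> \<sigma> * cmod \<beta>" using bz \<sigma> by (intro mult_left_mono) auto
      also have "\<dots> \<le> \<sigma> * (cmod (\<beta> - e) + cmod e)"
        using \<sigma> norm_triangle_ineq[of "\<beta> - e" e] by (intro mult_left_mono) auto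
      also have "\<dots> \<le> \<sigma> * cmod (\<beta> - e) + cmod e" using \<sigma> mult_right_mono[of \<sigma> 1 "cmod e"] by (simp add: distrib_left)
      also have "\<dots> \<le> cmod (\<eta> x' - (\<beta> - e)) + cmod e" using rot by (simp add: \<beta>_def)
      also have "\<dots> \<le> cmod (\<eta> x' - \<beta>) + 2 * cmod e"
        using norm_triangle_ineq[of "\<eta> x' - \<beta>" e] by (simp add: algebra_simps)
      also have "\<dots> \<le> \<sigma> / 4 * cmod z + 2 * cmod e" using b4 by (simp add: \<epsilon>_def)
      finally have "\<sigma> * cmod z \<le> 8 * cmod e" by (simp add: algebra_simps)
      then have ze: "cmod z \<le> (8 / \<sigma>) * cmod e" using \<sigma> by (simp add: field_simps)
      then have "cmod z \<le> (8 / \<sigma>) * (\<sigma> / 16)" using e \<sigma> by (meson mult_left_mono divide_nonneg_pos less_imp_le order_trans zero_le_numeral)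
      then have zh: "cmod z \<le> 1/2" using \<sigma> by simp
      have "1 + Im z \<ge> 1/2" using zh abs_Im_le_cmod[of z] by linarith
      then have "N \<le> (cmod z)\<^sup>2 / (1/2)" unfolding N_def DD_def z_def[symmetric] by (intro divide_left_mono) auto
      also have "\<dots> \<le> cmod z" using zh mult_right_mono[OF zh, of "cmod z"] by (simp add: power2_eq_square)
      finally have Nz: "N \<le> cmod z" .
      have "N ^ (k+2) \<le> N ^ 1" using N Nz zh by (intro power_decreasing) auto
      then have "N ^ (k+2) \<le> (8 / \<sigma>) * cmod e" using Nz ze by simp
      moreover have "C * (d1 + d2 + d3) \<ge> 0" using C d0 by simp
      ultimately show ?thesis by linarith
    qed
  qed
  then show ?thesis by (simp only: N_def C_def d1_def d2_def d3_def)
qed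

text \<open>
  Subtracting the two recursions shows that the displacement at the vertex is \<open>w * (\<kappa> * gx / cnj hx)\<close>
  with the shifted mean \<open>w = wmean U p \<zeta> - r / S\<close> and \<open>\<kappa> = S / (Im b + S)\<close>. As \<open>gx\<close> lies in the upper and \<open>cnj hx\<close> in the
  lower half plane, \<open>\<kappa> * gx\<close> keeps the distance \<open>Im hx\<close> from \<open>cnj hx\<close>. So the factor differs from 1 by at
  least \<open>Im hx / cmod hx\<close>, however small \<open>Im b\<close> is.
\<close>

lemma star_step:
  fixes c :: "'i \<Rightarrow> real" and g h :: "'i \<Rightarrow> complex"
  assumes U: "finite U" "U \<noteq> {}" "\<And>u. u \<in> U \<Longrightarrow> c u > 0"
    and H: "\<And>u. u \<in> U \<Longrightarrow> Im (h u) > 0" "\<And>u. u \<in> U \<Longrightarrow> Im (g u) > 0" "Im hx > 0" "Im gx > 0" "Im b \<ge> 0"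
    and hx: "- 1 / hx = b + (\<Sum>u\<in>U. of_real (c u) * h u)"
    and gx: "- 1 / gx = b - of_real r + (\<Sum>u\<in>U. of_real (c u) * g u)"
  defines "S \<equiv> \<Sum>u\<in>U. c u * Im (h u)"
  defines "p \<equiv> \<lambda>u. c u * Im (h u) / S" and "\<zeta> \<equiv> \<lambda>u. (g u - h u) / of_real (Im (h u))"
  shows "S > 0" and "sum p U = 1"
    and "hdist gx hx \<le> S / (Im b + S) * ((cmod (wmean U p \<zeta> - of_real (r / S)))\<^sup>2 / (1 + Im (wmean U p \<zeta>)))"
    and "cmod ((gx - hx) / of_real (Im hx) - (wmean U p \<zeta> - of_real (r / S))) \<ge>
      (Im hx / cmod hx) * cmod (wmean U p \<zeta> - of_real (r / S))"
    and "1 + Im (wmean U p \<zeta>) > 0"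
proof -
  show S: "S > 0" unfolding S_def using U H(1) by (intro sum_pos) auto
  show p1: "sum p U = 1" using S by (simp add: p_def sum_divide_distrib[symmetric] S_def)
  define w where "w = wmean U p \<zeta> - of_real (r / S)"
  define \<beta> where "\<beta> = wmean U p \<zeta>"
  have "S *\<^sub>R \<beta> = (\<Sum>u\<in>U. of_real (c u) * (g u - h u))"
    unfolding \<beta>_def wmean_def scaleR_sum_right
    by (intro sum.cong refl) (use S H(1) in \<open>force simp: p_def \<zeta>_def scaleR_conv_of_real\<close>)
  then have Sb: "of_real S * w = (- 1 / gx) - (- 1 / hx)"
    using S unfolding gx hx by (simp add: w_def \<beta>_def[symmetric] scaleR_conv_of_real right_diff_distrib sum_subtractf)
  have hx0: "hx \<noteq> 0" and gx0: "gx \<noteq> 0" using H by auto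
  have gh: "gx - hx = gx * hx * (of_real S * w)" unfolding Sb using hx0 gx0 by (simp add: field_simps)
  define b' where "b' = Im b"
  have ImI: "Im (- 1 / q) = Im q / (cmod q)\<^sup>2" for q by (simp add: Im_divide cmod_power2)
  have ih: "Im hx / (cmod hx)\<^sup>2 = b' + S" unfolding ImI[symmetric] hx by (simp add: b'_def S_def Im_sum)
  have iS: "S + (\<Sum>u\<in>U. c u * (Im (g u) - Im (h u))) = (\<Sum>u\<in>U. c u * Im (g u))"
    by (simp add: S_def right_diff_distrib sum_subtractf)
  have Imb: "S * Im \<beta> = (\<Sum>u\<in>U. c u * (Im (g u) - Im (h u)))"
    using arg_cong[OF \<open>S *\<^sub>R \<beta> = _\<close>, of Im] by (simp add: Im_sum)
  have ig: "Im gx / (cmod gx)\<^sup>2 = b' + S * (1 + Im \<beta>)"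
    unfolding ImI[symmetric] gx using iS Imb by (simp add: b'_def Im_sum distrib_left)
  have b'0: "b' \<ge> 0" using H(5) by (simp add: b'_def)
  have pz: "1 + Im (\<zeta> u) > 0" if "u \<in> U" for u using hdist_DD(2)[OF H(1,2)] that by (simp add: \<zeta>_def)
  have pp: "p u \<ge> 0" if "u \<in> U" for u using that U(3) H(1) S by (simp add: p_def less_imp_le)
  show B: "1 + Im (wmean U p \<zeta>) > 0" by (rule wmean_Im_pos[OF U(1) pp p1 pz])
  have "hdist gx hx = (S * cmod w)\<^sup>2 * ((cmod gx)\<^sup>2 / Im gx) * ((cmod hx)\<^sup>2 / Im hx)"
    unfolding hdist_def gh using S by (simp add: norm_mult power_mult_distrib)
  also have "\<dots> = (S * cmod w)\<^sup>2 / ((b' + S * (1 + Im \<beta>)) * (b' + S))"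
    unfolding ih[symmetric] ig[symmetric] by simp
  also have "\<dots> \<le> (S * cmod w)\<^sup>2 / ((S * (1 + Im \<beta>)) * (b' + S))"
  proof -
    define t where "t = S * (1 + Im \<beta>)"
    have "t > 0" using S B by (simp add: t_def \<beta>_def)
    then show ?thesis unfolding t_def[symmetric] using b'0 S
      by (intro divide_left_mono mult_mono mult_pos_pos add_nonneg_pos) auto
  qed
  also have "\<dots> = S / (b' + S) * ((cmod w)\<^sup>2 / (1 + Im \<beta>))" using S by (simp add: power2_eq_square ac_simps)
  finally show "hdist gx hx \<le> S / (Im b + S) * ((cmod (wmean U p \<zeta> - of_real (r / S)))\<^sup>2 / (1 + Im (wmean U p \<zeta>)))"
    by (simp add: w_def \<beta>_def b'_def)
  define \<kappa> where "\<kappa> = S / (b' + S)"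
  have k0: "\<kappa> \<ge> 0" using S b'0 by (simp add: \<kappa>_def)
  have ih': "Im hx = (cmod hx)\<^sup>2 * (b' + S)" using ih hx0 by (simp add: field_simps)
  have "(gx - hx) / of_real (Im hx) = w * (of_real \<kappa> * gx / cnj hx)"
  proof -
    define q where "q = complex_of_real (b' + S)"
    have "b' + S \<noteq> 0" using S b'0 by linarith
    then have q0: "q \<noteq> 0" unfolding q_def of_real_eq_0_iff .
    have q: "q \<noteq> 0" "cnj hx \<noteq> 0" "of_real \<kappa> = of_real S / q" using q0 hx0 by (auto simp: q_def \<kappa>_def)
    have e: "complex_of_real (Im hx) = hx * cnj hx * q" unfolding ih' of_real_mult complex_norm_square q_def by simp
    show ?thesis unfolding gh e q(3) using q hx0 by (simp add: field_simps)
  qed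
  then have "(gx - hx) / of_real (Im hx) - w = w * ((of_real \<kappa> * gx - cnj hx) / cnj hx)"
    using hx0 by (simp add: field_simps)
  then have "cmod ((gx - hx) / of_real (Im hx) - w) = cmod w * (cmod (of_real \<kappa> * gx - cnj hx) / cmod hx)"
    by (simp add: norm_mult norm_divide)
  moreover have "cmod (of_real \<kappa> * gx - cnj hx) \<ge> Im hx"
  proof -
    have "\<kappa> * Im gx \<ge> 0" using k0 H(4) by simp
    moreover have "\<bar>\<kappa> * Im gx + Im hx\<bar> \<le> cmod (of_real \<kappa> * gx - cnj hx)"
      using abs_Im_le_cmod[of "of_real \<kappa> * gx - cnj hx"] by simp
    ultimately show ?thesis by linarith
  qed
  ultimately show "cmod ((gx - hx) / of_real (Im hx) - (wmean U p \<zeta> - of_real (r / S))) \<ge>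
      (Im hx / cmod hx) * cmod (wmean U p \<zeta> - of_real (r / S))"
    unfolding w_def[symmetric] using hx0
    by (simp add: mult.commute[of _ "cmod w"] mult_left_mono divide_right_mono)
qed

text \<open>
  The shift by \<open>e\<close> produces a multiple of \<open>1 / (1 + Im \<beta>)\<close>. This is not bounded, but at most \<open>DD \<beta> + 2\<close>.
\<close>

lemma perturbed_DD:
  assumes "1 + Im \<beta> > 0" "0 \<le> lam" "lam \<le> 1" "\<bar>e\<bar> \<le> lam * \<kappa>"
  shows "(cmod (\<beta> - of_real e))\<^sup>2 / (1 + Im \<beta>) \<le> (1 + (1 + 4 * \<kappa>\<^sup>2) * lam) * DD \<beta> + (1 + 4 * \<kappa>\<^sup>2) * lam"
proof -
  have D0: "DD \<beta> \<ge> 0" using DD_nonneg assms(1) by blast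
  have "cmod (\<beta> - of_real e) \<le> cmod \<beta> + lam * \<kappa>" using norm_triangle_ineq4[of \<beta> "of_real e"] assms(4) by simp
  then have "(cmod (\<beta> - of_real e))\<^sup>2 \<le> (cmod \<beta> + lam * \<kappa>)\<^sup>2" by (intro power_mono) auto
  also have "\<dots> = (cmod \<beta>)\<^sup>2 + lam * (2 * cmod \<beta> * \<kappa>) + lam * (lam * \<kappa>\<^sup>2)" by (simp add: power2_eq_square algebra_simps)
  also have "\<dots> \<le> (cmod \<beta>)\<^sup>2 + lam * ((cmod \<beta>)\<^sup>2 + \<kappa>\<^sup>2) + lam * (1 * \<kappa>\<^sup>2)"
    using assms(2,3) sum_squares_bound[of "cmod \<beta>" \<kappa>] by (intro add_mono mult_left_mono mult_right_mono) auto
  also have "\<dots> = (1 + lam) * (cmod \<beta>)\<^sup>2 + 2 * lam * \<kappa>\<^sup>2" by (simp add: algebra_simps)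
  finally have "(cmod (\<beta> - of_real e))\<^sup>2 / (1 + Im \<beta>) \<le> ((1 + lam) * (cmod \<beta>)\<^sup>2 + 2 * lam * \<kappa>\<^sup>2) / (1 + Im \<beta>)"
    using assms(1) by (simp add: divide_right_mono)
  also have "\<dots> = (1 + lam) * DD \<beta> + 2 * lam * \<kappa>\<^sup>2 * (1 / (1 + Im \<beta>))" by (simp add: DD_def add_divide_distrib)
  also have "\<dots> \<le> (1 + lam) * DD \<beta> + 2 * lam * \<kappa>\<^sup>2 * (DD \<beta> + 2)"
    using inverse_le_DD[OF assms(1)] assms(2) by (intro add_left_mono mult_left_mono) auto
  also have "\<dots> \<le> (1 + (1 + 4 * \<kappa>\<^sup>2) * lam) * DD \<beta> + (1 + 4 * \<kappa>\<^sup>2) * lam"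
    using D0 assms(2) mult_nonneg_nonneg[OF mult_nonneg_nonneg[OF assms(2) zero_le_power2[of \<kappa>]] D0]
    by (simp add: algebra_simps)
  finally show ?thesis .
qed

text \<open>
  The form \<open>(1 + K * lam) * a + K * lam\<close> of the error survives powers, uniformly in \<open>a\<close>. This allows
  one to take expectations.
\<close>

lemma perturbed_power:
  fixes K :: real
  assumes "K \<ge> 0"
  shows "\<exists>K'\<ge>0. \<forall>lam\<in>{0..1}. \<forall>a\<ge>0. ((1 + K * lam) * a + K * lam) ^ n \<le> (1 + K' * lam) * a ^ n + K' * lam"
proof (induction n)
  case 0
  show ?case by (intro exI[of _ 0]) auto
next
  case (Suc n)
  then obtain J where J: "J \<ge> 0" "\<And>lam a. 0 \<le> lam \<Longrightarrow> lam \<le> 1 \<Longrightarrow> a \<ge> 0 \<Longrightarrow>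
      ((1 + K * lam) * a + K * lam) ^ n \<le> (1 + J * lam) * a ^ n + J * lam" by auto
  define K' where "K' = 2 * (K + J + K * J) + 2 * (K + J * K) + 2 * (J + J * K) + 2 * K * J"
  have "((1 + K * lam) * a + K * lam) ^ Suc n \<le> (1 + K' * lam) * a ^ Suc n + K' * lam"
    if l: "0 \<le> lam" "lam \<le> 1" and a: "a \<ge> 0" for lam a :: real
  proof -
    have l2: "lam * lam \<le> lam" using l by (simp add: mult_left_le)
    have an: "a ^ n \<le> 1 + a ^ Suc n"
    proof (cases "a \<le> 1")
      case True
      then have "a ^ n \<le> 1" using a by (simp add: power_le_one)
      then show ?thesis using a by (smt (verit) zero_le_power)
    next
      case False
      then have "a ^ n \<le> a ^ Suc n" by (intro power_increasing) auto
      then show ?thesis by simp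
    qed
    have a1: "a \<le> 1 + a ^ Suc n"
    proof (cases "a \<le> 1")
      case False
      then have "a ^ 1 \<le> a ^ Suc n" by (intro power_increasing) auto
      then show ?thesis by simp
    qed (use a in \<open>smt (verit) zero_le_power\<close>)
    define A where "A = a ^ Suc n"
    have A: "A \<ge> 0" using a by (simp add: A_def)
    have "((1 + K * lam) * a + K * lam) ^ Suc n = ((1 + K * lam) * a + K * lam) * ((1 + K * lam) * a + K * lam) ^ n" by simp
    also have "\<dots> \<le> ((1 + K * lam) * a + K * lam) * ((1 + J * lam) * a ^ n + J * lam)"
      using J(2)[OF l a] assms l a by (intro mult_left_mono) auto
    also have "\<dots> = (1 + (K + J) * lam + K * J * (lam * lam)) * A + (K * lam + J * K * (lam * lam)) * a ^ n
        + (J * lam + J * K * (lam * lam)) * a + K * J * (lam * lam)"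
      by (simp add: A_def algebra_simps)
    also have "\<dots> \<le> (1 + (K + J) * lam + K * J * lam) * A + (K * lam + J * K * lam) * (1 + A)
        + (J * lam + J * K * lam) * (1 + A) + K * J * lam"
      using an a1 assms J(1) l l2 A a unfolding A_def[symmetric]
      by (intro add_mono mult_mono mult_left_mono) (auto intro!: add_nonneg_nonneg mult_nonneg_nonneg)
    also have "\<dots> \<le> (1 + K' * lam) * A + K' * lam"
    proof -
      have "0 \<le> lam * A * (K + J + K * J + K + J * K + J + J * K + K * J) + lam * (K + J + K * J + K + J * K + J + J * K)"
        "0 \<le> lam * A * K" "0 \<le> lam * A * J" "0 \<le> lam * A * K * J" "0 \<le> lam * K" "0 \<le> lam * J" "0 \<le> lam * K * J"
        using l A assms J(1) by auto
      then show ?thesis by (simp add: K'_def algebra_simps)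
    qed
    finally show ?thesis by (simp add: A_def)
  qed
  moreover have "K' \<ge> 0" using assms J by (simp add: K'_def)
  ultimately show ?case by (intro exI[of _ K']) auto
qed

section \<open>The recursion of the forward Green functions\<close>

lemma finite_image_factor:
  assumes "finite (l ` S)" "\<And>x y. x \<in> S \<Longrightarrow> y \<in> S \<Longrightarrow> l x = l y \<Longrightarrow> f x = f y"
  shows "finite (f ` S)"
proof -
  have "f x = f (inv_into S l (l x))" if "x \<in> S" for x
    using assms(2)[OF that, of "inv_into S l (l x)"] that by (simp add: inv_into_into f_inv_into_f)
  then have "f ` S \<subseteq> (\<lambda>k. f (inv_into S l k)) ` (l ` S)" by auto
  then show ?thesis using assms(1) by (meson finite_imageI finite_subset)
qed

lemma DD_jensen:
  assumes "finite A" "\<And>i. i \<in> A \<Longrightarrow> p i \<ge> 0" "sum p A = 1" "\<And>i. i \<in> A \<Longrightarrow> 1 + Im (\<zeta> i) > 0"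
  shows "DD (wmean A p \<zeta>) \<le> (\<Sum>i\<in>A. p i * DD (\<zeta> i))"
proof -
  have "0 \<le> (\<Sum>i\<in>A. p i * (1 + Im (\<zeta> i)) *
     (cmod (\<zeta> i / of_real (1 + Im (\<zeta> i)) - wmean A p \<zeta> / of_real (1 + Im (wmean A p \<zeta>))))\<^sup>2)"
    by (intro sum_nonneg mult_nonneg_nonneg assms(2) less_imp_le[OF assms(4)] zero_le_power2)
  also have "\<dots> = (\<Sum>i\<in>A. p i * DD (\<zeta> i)) - DD (wmean A p \<zeta>)"
    by (rule DD_jensen_defect[symmetric]) (use assms in auto)
  finally show ?thesis by simp
qed

text \<open>
  The conditions (M0), (M1) and (M2) enter through the last two assumptions. The random potential is
  added later; the lemmas of this locale concern an arbitrary potential \<open>W\<close>.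
\<close>

locale tree_op = substitution V adj rt M a
  for V :: "'v set" and adj rt and M :: "nat ^'a ^('a::finite)" and a +
  fixes \<nu> :: "'v \<Rightarrow> real" and t :: "'v \<Rightarrow> 'v \<Rightarrow> complex"
  assumes nu_pos: "y \<in> V \<Longrightarrow> \<nu> y > 0"
    and nu_label: "y \<in> V \<Longrightarrow> y' \<in> V \<Longrightarrow> a y = a y' \<Longrightarrow> \<nu> y = \<nu> y'"
    and t_nz: "x \<in> V \<Longrightarrow> y \<in> ch x \<Longrightarrow> t x y \<noteq> 0"
    and t_sym: "x \<in> V \<Longrightarrow> y \<in> V \<Longrightarrow> t x y * of_real (\<nu> x) = cnj (t y x) * of_real (\<nu> y)"
    and t_label: "x \<in> V \<Longrightarrow> x' \<in> V \<Longrightarrow> y \<in> ch x \<Longrightarrow> y' \<in> ch x' \<Longrightarrow> a x = a x' \<Longrightarrow> a y = a y'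
      \<Longrightarrow> cmod (t x y) = cmod (t x' y')"
    and two_children: "x \<in> V \<Longrightarrow> 2 \<le> card (ch x)"
    and self_child: "x \<in> V \<Longrightarrow> \<exists>y\<in>ch x. a y = a x"
begin

text \<open>
  By the symmetry of \<open>t\<close> this is the product \<open>t x y * t y x\<close>, which the elimination of the children of \<open>x\<close>
  produces.
\<close>

definition "cc x y = (cmod (t x y))\<^sup>2 * \<nu> x / \<nu> y"

lemma cc_pos: "y \<in> ch x \<Longrightarrow> cc x y > 0"
  using nu_pos ch_V t_nz[of x y] by (simp add: cc_def)

lemma t_rev: assumes "x \<in> V" "y \<in> V" shows "t y x = cnj (t x y) * of_real (\<nu> x / \<nu> y)"
  using t_sym[OF assms(2,1)] nu_pos[OF assms(2)] by (simp add: field_simps)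

lemma cc_t: assumes "y \<in> ch x" shows "of_real (cc x y) = t x y * t y x"
  unfolding t_rev[OF ch_V[OF assms]] cc_def of_real_mult of_real_divide complex_norm_square by simp

lemma cc_rev: assumes "y \<in> ch x" shows "cc x y * \<nu> x = (cmod (t y x))\<^sup>2 * \<nu> y" "cc x y = cc y x"
proof -
  have "\<nu> x > 0" "\<nu> y > 0" using nu_pos ch_V[OF assms] by auto
  then show "cc x y * \<nu> x = (cmod (t y x))\<^sup>2 * \<nu> y" "cc x y = cc y x"
    unfolding cc_def t_rev[OF ch_V[OF assms]]
    by (simp_all add: norm_mult norm_divide power_mult_distrib power_divide power2_eq_square field_simps)
qed

lemma cc_label:
  assumes "y \<in> ch x" "y' \<in> ch x'" "a x = a x'" "a y = a y'" shows "cc x y = cc x' y'"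
  using assms t_label[of x x' y y'] nu_label[of x x'] nu_label[of y y'] ch_V by (simp add: cc_def)

definition "edges = (SIGMA x:V. ch x)"

lemma finite_edge_image:
  fixes f :: "'v \<Rightarrow> 'v \<Rightarrow> 'b"
  assumes "\<And>x y x' y'. y \<in> ch x \<Longrightarrow> y' \<in> ch x' \<Longrightarrow> a x = a x' \<Longrightarrow> a y = a y' \<Longrightarrow> f x y = f x' y'"
  shows "finite ((\<lambda>(x, y). f x y) ` edges)"
  by (rule finite_image_factor[where l = "\<lambda>(x, y). (a x, a y)"]) (auto simp: edges_def intro: assms finite_subset[OF subset_UNIV])

lemma edge_bounded:
  fixes f :: "'v \<Rightarrow> 'v \<Rightarrow> real"
  assumes "\<And>x y x' y'. y \<in> ch x \<Longrightarrow> y' \<in> ch x' \<Longrightarrow> a x = a x' \<Longrightarrow> a y = a y' \<Longrightarrow> f x y = f x' y'"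
  shows "\<exists>C>0. \<forall>x\<in>V. \<forall>y\<in>ch x. f x y \<le> C"
proof -
  have "bdd_above ((\<lambda>(x, y). f x y) ` edges)" using finite_edge_image[OF assms] by (rule bdd_above_finite)
  then obtain C where C: "\<forall>r\<in>(\<lambda>(x, y). f x y) ` edges. r \<le> C" unfolding bdd_above_def by blast
  have "f x y \<le> max 1 C" if "x \<in> V" "y \<in> ch x" for x y
  proof -
    have "f x y \<in> (\<lambda>(x, y). f x y) ` edges" using that by (auto simp: edges_def image_iff)
    from bspec[OF C this] show ?thesis by (simp add: le_max_iff_disj)
  qed
  then show ?thesis by (intro exI[of _ "max 1 C"]) auto
qed

lemma vertex_bounded:
  fixes f :: "'v \<Rightarrow> real"
  assumes "\<And>x y. x \<in> V \<Longrightarrow> y \<in> V \<Longrightarrow> a x = a y \<Longrightarrow> f x = f y"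
  shows "\<exists>C>0. \<forall>x\<in>V. f x \<le> C"
proof -
  have "finite (f ` V)" by (rule finite_image_factor[where l = a]) (auto intro: assms finite_subset[OF subset_UNIV])
  then have "bdd_above (f ` V)" by (rule bdd_above_finite)
  then obtain C where "\<And>e. e \<in> V \<Longrightarrow> f e \<le> C" by (auto simp: bdd_above_def)
  then show ?thesis by (intro exI[of _ "max 1 C"]) (auto simp: le_max_iff_disj)
qed

lemma card_ch_label: "x \<in> V \<Longrightarrow> y \<in> V \<Longrightarrow> a x = a y \<Longrightarrow> card (ch x) = card (ch y)"
  using ch_label_bij bij_betw_same_card by blast

lemma sum_ch_eq:
  fixes f :: "'v \<Rightarrow> 'v \<Rightarrow> 'b::comm_monoid_add"
  assumes "x \<in> V" "x' \<in> V" "a x = a x'"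
    and "\<And>y y'. y \<in> ch x \<Longrightarrow> y' \<in> ch x' \<Longrightarrow> a y = a y' \<Longrightarrow> f x y = f x' y'"
  shows "(\<Sum>y\<in>ch x. f x y) = (\<Sum>y\<in>ch x'. f x' y)"
proof -
  obtain \<beta> where b: "bij_betw \<beta> (ch x) (ch x')" "\<And>u. u \<in> ch x \<Longrightarrow> a (\<beta> u) = a u" using ch_label_bij[OF assms(1-3)] by blast
  have "(\<Sum>y\<in>ch x'. f x' y) = (\<Sum>y\<in>ch x. f x' (\<beta> y))" by (rule sum.reindex_bij_betw[OF b(1), symmetric])
  also have "\<dots> = (\<Sum>y\<in>ch x. f x y)"
    by (intro sum.cong refl) (use b assms(4) bij_betwE[OF b(1)] in metis)
  finally show ?thesis by simp
qed

definition "cc_sum_bound = (SOME K. K > 0 \<and> (\<forall>x\<in>V. (\<Sum>y\<in>ch x. cc x y) \<le> K))"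

lemma cc_sum_bound: "cc_sum_bound > 0" "x \<in> V \<Longrightarrow> (\<Sum>y\<in>ch x. cc x y) \<le> cc_sum_bound"
proof -
  have "\<exists>K>0. \<forall>x\<in>V. (\<Sum>y\<in>ch x. cc x y) \<le> K"
    by (rule vertex_bounded) (intro sum_ch_eq cc_label)
  then have "cc_sum_bound > 0 \<and> (\<forall>x\<in>V. (\<Sum>y\<in>ch x. cc x y) \<le> cc_sum_bound)" unfolding cc_sum_bound_def by (rule someI_ex)
  then show "cc_sum_bound > 0" "x \<in> V \<Longrightarrow> (\<Sum>y\<in>ch x. cc x y) \<le> cc_sum_bound" by auto
qed

lemma ch_ne: "x \<in> V \<Longrightarrow> ch x \<noteq> {}" using two_children[of x] by auto

text \<open>
  The recursion of the forward Green functions, started from \<open>\<i>\<close> in the \<open>n\<close>-th generation below \<open>y\<close>.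
\<close>

primrec green_iter :: "nat \<Rightarrow> ('v \<Rightarrow> real) \<Rightarrow> complex \<Rightarrow> 'v \<Rightarrow> complex" where
  "green_iter 0 W z y = \<i>"
| "green_iter (Suc n) W z y = - 1 / (z - of_real (W y) + (\<Sum>u\<in>ch y. of_real (cc y u) * green_iter n W z u))"

declare green_iter.simps(2) [simp del]

definition "fwd_green W z y = lim (\<lambda>n. green_iter n W z y)"

definition "herglotz_solution W z g \<longleftrightarrow> (\<forall>y\<in>V. Im (g y) > 0 \<and>
   - 1 / g y = z - of_real (W y) + (\<Sum>u\<in>ch y. of_real (cc y u) * g u))"

lemma Im_neg_inverse: "Im (- 1 / q) = Im q / (cmod q)\<^sup>2" by (simp add: Im_divide cmod_power2)

lemma Im_sum_ge:
  assumes "\<And>u. u \<in> ch y \<Longrightarrow> Im (g u) \<ge> 0"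
  shows "Im (z - of_real r + (\<Sum>u\<in>ch y. of_real (cc y u) * g u)) \<ge> Im z"
  using assms cc_pos[of _ y] by (simp add: sum_nonneg mult_nonneg_nonneg less_imp_le)

lemma Im_neg_inverse_pos: "Im b > 0 \<Longrightarrow> Im (- 1 / b) > 0"
  unfolding Im_neg_inverse by (intro divide_pos_pos) auto

lemma cmod_neg_inverse_le: "0 < \<eta> \<Longrightarrow> \<eta> \<le> Im b \<Longrightarrow> cmod (- 1 / b) \<le> 1 / \<eta>"
  using abs_Im_le_cmod[of b] by (simp add: norm_divide) (intro divide_left_mono mult_pos_pos; auto)

lemma Im_green_iter_pos: assumes "Im z > 0" shows "y \<in> V \<Longrightarrow> Im (green_iter n W z y) > 0"
proof (induction n arbitrary: y)
  case (Suc n)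
  have "Im (z - of_real (W y) + (\<Sum>u\<in>ch y. of_real (cc y u) * green_iter n W z u)) \<ge> Im z"
    by (rule Im_sum_ge) (use Suc ch_V in \<open>auto intro: less_imp_le\<close>)
  then show ?case unfolding green_iter.simps using Im_neg_inverse_pos assms by (meson less_le_trans)
qed simp

lemma cmod_green_iter_le: assumes "Im z > 0" "y \<in> V" shows "cmod (green_iter (Suc n) W z y) \<le> 1 / Im z"
proof -
  have "Im (z - of_real (W y) + (\<Sum>u\<in>ch y. of_real (cc y u) * green_iter n W z u)) \<ge> Im z"
    by (rule Im_sum_ge) (use Im_green_iter_pos[OF assms(1)] ch_V in \<open>auto intro: less_imp_le\<close>)
  then show ?thesis unfolding green_iter.simps by (rule cmod_neg_inverse_le[OF assms(1)])
qed

lemma cmod_denominator_le: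
  assumes "y \<in> V" "\<And>u. u \<in> ch y \<Longrightarrow> cmod (g u) \<le> c" "\<bar>r\<bar> \<le> B" "c \<ge> 0"
  shows "cmod (z - of_real r + (\<Sum>u\<in>ch y. of_real (cc y u) * g u)) \<le> cmod z + B + cc_sum_bound * c"
proof -
  have "cmod (\<Sum>u\<in>ch y. of_real (cc y u) * g u) \<le> (\<Sum>u\<in>ch y. cc y u * c)"
    by (rule sum_norm_le)
      (auto simp: norm_mult abs_of_pos[OF cc_pos] intro!: mult_left_mono less_imp_le[OF cc_pos] assms(2))
  also have "\<dots> \<le> cc_sum_bound * c" unfolding sum_distrib_right[symmetric] using cc_sum_bound assms by (intro mult_right_mono) auto
  finally show ?thesis
    using norm_triangle_ineq[of "z - of_real r" "\<Sum>u\<in>ch y. of_real (cc y u) * g u"]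
      norm_triangle_ineq4[of z "of_real r"] assms(3) by simp
qed

text \<open>
  From the second iteration on, the imaginary parts stay above this number as long as \<open>\<eta> \<le> Im z\<close>,
  \<open>cmod z \<le> R\<close> and \<open>B\<close> bounds the potential.
\<close>

definition "Imlow B R \<eta> = \<eta> / (R + B + cc_sum_bound * (1 / \<eta>))\<^sup>2"

lemma Imlow_pos: "0 < \<eta> \<Longrightarrow> 0 \<le> R \<Longrightarrow> 0 \<le> B \<Longrightarrow> Imlow B R \<eta> > 0"
  using cc_sum_bound(1) by (auto simp: Imlow_def intro!: divide_pos_pos zero_less_power add_nonneg_pos)

lemma Im_green_iter_ge:
  assumes "0 < \<eta>" "\<eta> \<le> Im z" "cmod z \<le> R" "y \<in> V" "\<And>y. y \<in> V \<Longrightarrow> \<bar>W y\<bar> \<le> B"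
  shows "Im (green_iter (Suc (Suc n)) W z y) \<ge> Imlow B R \<eta>"
proof -
  define b where "b = z - of_real (W y) + (\<Sum>u\<in>ch y. of_real (cc y u) * green_iter (Suc n) W z u)"
  have Iz: "Im z > 0" using assms by simp
  have "cmod (green_iter (Suc n) W z u) \<le> 1 / \<eta>" if "u \<in> ch y" for u
    using cmod_green_iter_le[OF Iz, of u n W] ch_V that assms(1,2)
    by (meson frac_le le_numeral_extra(4) order_trans zero_le_one)
  then have "cmod b \<le> cmod z + B + cc_sum_bound * (1 / \<eta>)" unfolding b_def
    by (intro cmod_denominator_le) (use assms in auto)
  then have b1: "cmod b \<le> R + B + cc_sum_bound * (1 / \<eta>)" using assms(3) by linarith
  have b2: "Im b \<ge> \<eta>" unfolding b_def
    by (rule order_trans[OF assms(2) Im_sum_ge]) (use Im_green_iter_pos[OF Iz] ch_V in \<open>auto intro: less_imp_le\<close>)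
  then have "cmod b > 0" using abs_Im_le_cmod[of b] assms(1) by linarith
  then have "\<eta> / (R + B + cc_sum_bound * (1 / \<eta>))\<^sup>2 \<le> Im b / (cmod b)\<^sup>2"
    using b1 b2 assms(1) by (intro frac_le power_mono) auto
  then show ?thesis unfolding Im_neg_inverse[symmetric] Imlow_def b_def green_iter.simps(2)[of "Suc n"] .
qed

text \<open>
  The factor \<open>S / (Im z + S)\<close> of \<open>star_step\<close> makes the recursion strictly contracting at a fixed distance
  from the real axis. It tends to 1 near the axis, so it serves to solve the recursion but not to
  bound the moments.
\<close>

lemma hdist_step:
  assumes y: "y \<in> V" and z: "Im z > 0"
    and g: "\<And>u. u \<in> ch y \<Longrightarrow> Im (g u) > 0" and h: "\<And>u. u \<in> ch y \<Longrightarrow> Im (h u) > 0"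
    and hb: "\<And>u. u \<in> ch y \<Longrightarrow> Im (h u) \<le> 1 / Im z"
    and D: "\<And>u. u \<in> ch y \<Longrightarrow> hdist (g u) (h u) \<le> D"
  shows "hdist (- 1 / (z - of_real r + (\<Sum>u\<in>ch y. of_real (cc y u) * g u)))
     (- 1 / (z - of_real r + (\<Sum>u\<in>ch y. of_real (cc y u) * h u))) \<le> cc_sum_bound / (cc_sum_bound + (Im z)\<^sup>2) * D"
    (is "hdist ?gx ?hx \<le> _")
proof -
  define S where "S = (\<Sum>u\<in>ch y. cc y u * Im (h u))"
  define p where "p u = cc y u * Im (h u) / S" for u
  define \<zeta> where "\<zeta> u = (g u - h u) / of_real (Im (h u))" for u
  have "Im (z - of_real r + (\<Sum>u\<in>ch y. of_real (cc y u) * g u)) \<ge> Im z"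
    "Im (z - of_real r + (\<Sum>u\<in>ch y. of_real (cc y u) * h u)) \<ge> Im z"
    by (rule Im_sum_ge, use g h in \<open>blast intro: less_imp_le\<close>)+
  then have pos: "Im ?gx > 0" "Im ?hx > 0" using z by (meson Im_neg_inverse_pos less_le_trans)+
  have b: "0 \<le> Im (z - of_real r)" using z by simp
  have e: "- 1 / ?hx = z - of_real r + (\<Sum>u\<in>ch y. of_real (cc y u) * h u)"
    "- 1 / ?gx = z - of_real r - of_real 0 + (\<Sum>u\<in>ch y. of_real (cc y u) * g u)" by simp_all
  note st = star_step[where c = "cc y" and g = g and h = h, OF finite_ch[of y] ch_ne[OF y] cc_pos h g pos(2,1) b e,
    folded S_def, folded p_def \<zeta>_def, simplified]
  have S: "S > 0" and p1: "sum p (ch y) = 1" using st(1,2) by auto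
  have st3: "hdist ?gx ?hx \<le> S / (Im z + S) * DD (wmean (ch y) p \<zeta>)"
    using st(3) by (simp add: DD_def)
  have pp: "p u \<ge> 0" if "u \<in> ch y" for u using that cc_pos[OF that] h[OF that] S by (simp add: p_def less_imp_le)
  have zz: "1 + Im (\<zeta> u) > 0" if "u \<in> ch y" for u using hdist_DD(2)[OF h g] that by (simp add: \<zeta>_def)
  have "DD (wmean (ch y) p \<zeta>) \<le> (\<Sum>u\<in>ch y. p u * DD (\<zeta> u))"
    by (rule DD_jensen[OF finite_ch pp p1 zz])
  also have "\<dots> \<le> (\<Sum>u\<in>ch y. p u * D)"
    using D pp h g by (intro sum_mono mult_left_mono) (auto simp: \<zeta>_def hdist_DD(1)[symmetric])
  also have "\<dots> = D" using p1 by (simp add: sum_distrib_right[symmetric])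
  finally have DDle: "DD (wmean (ch y) p \<zeta>) \<le> D" .
  obtain u where u: "u \<in> ch y" using ch_ne[OF y] by auto
  have D0: "D \<ge> 0" using D[OF u] hdist_nonneg[OF g[OF u] h[OF u]] by linarith
  have "S \<le> (\<Sum>u\<in>ch y. cc y u * (1 / Im z))" unfolding S_def
    using hb cc_pos by (intro sum_mono mult_left_mono) (auto intro: less_imp_le)
  also have "\<dots> \<le> cc_sum_bound * (1 / Im z)" unfolding sum_distrib_right[symmetric] using cc_sum_bound y z by (intro mult_right_mono) auto
  finally have "S * Im z \<le> cc_sum_bound" using z by (simp add: field_simps)
  then have "S * (Im z * Im z) \<le> cc_sum_bound * Im z" using z mult_right_mono[of "S * Im z" cc_sum_bound "Im z"] by (simp add: mult.assoc)
  then have "S / (Im z + S) \<le> cc_sum_bound / (cc_sum_bound + (Im z)\<^sup>2)"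
    using S z cc_sum_bound(1) by (simp add: divide_simps power2_eq_square add_pos_pos) (simp add: algebra_simps)
  moreover have "S / (Im z + S) \<ge> 0" using S z by simp
  ultimately have "S / (Im z + S) * DD (wmean (ch y) p \<zeta>) \<le> cc_sum_bound / (cc_sum_bound + (Im z)\<^sup>2) * D"
    using DDle D0 cc_sum_bound(1) by (meson add_nonneg_nonneg divide_nonneg_nonneg less_imp_le mult_mono' mult_left_mono mult_right_mono order_trans zero_le_power2)
  then show ?thesis using st3 by linarith
qed

lemma green_iter_cauchy:
  assumes \<eta>: "0 < \<eta>" "\<eta> \<le> 1" and R: "0 \<le> R" and B: "0 \<le> B"
  defines "\<rho> \<equiv> sqrt (cc_sum_bound / (cc_sum_bound + \<eta>\<^sup>2))" and "C \<equiv> 2 / (\<eta>\<^sup>2 * Imlow B R \<eta>)"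
  assumes z: "\<eta> \<le> Im z" "cmod z \<le> R" and W: "\<And>y. y \<in> V \<Longrightarrow> \<bar>W y\<bar> \<le> B" and y: "y \<in> V"
  shows "cmod (green_iter (Suc (Suc n) + k) W z y - green_iter (Suc (Suc m) + k) W z y) \<le> C * \<rho> ^ k"
proof -
  define l where "l = Imlow B R \<eta>"
  have l: "l > 0" unfolding l_def by (rule Imlow_pos) (use \<eta> R B in auto)
  have Iz: "Im z > 0" using \<eta> z by linarith
  have le: "cmod (green_iter (Suc n) W z u) \<le> 1 / \<eta>" if "u \<in> V" for u n
    using cmod_green_iter_le[OF Iz, of u n W] that \<eta> z by (meson frac_le le_numeral_extra(4) order_trans zero_le_one)
  have \<rho>2: "\<rho>\<^sup>2 = cc_sum_bound / (cc_sum_bound + \<eta>\<^sup>2)" "\<rho> \<ge> 0" using cc_sum_bound(1) by (auto simp: \<rho>_def intro!: divide_nonneg_nonneg)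
  have main: "hdist (green_iter (Suc (Suc n) + k) W z y) (green_iter (Suc (Suc m) + k) W z y) \<le> (\<rho>\<^sup>2) ^ k * ((2 / \<eta>)\<^sup>2 / (l * l))" if "y \<in> V" for y
    using that
  proof (induction k arbitrary: y)
    case 0
    have "cmod (green_iter (Suc (Suc n)) W z y - green_iter (Suc (Suc m)) W z y) \<le> 2 / \<eta>"
      using norm_triangle_ineq4[of "green_iter (Suc (Suc n)) W z y" "green_iter (Suc (Suc m)) W z y"]
        le[OF 0, of "Suc n"] le[OF 0, of "Suc m"] by linarith
    moreover have "Im (green_iter (Suc (Suc i)) W z y) \<ge> l" for i unfolding l_def
      by (rule Im_green_iter_ge) (use \<eta> z W 0 in auto)
    ultimately show ?case using l unfolding hdist_def add_0_right power_0 mult_1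
      by (intro frac_le power_mono mult_mono) (auto intro: order_trans[OF less_imp_le[OF l]])
  next
    case (Suc k)
    have "hdist (green_iter (Suc (Suc (Suc n) + k)) W z y) (green_iter (Suc (Suc (Suc m) + k)) W z y)
        \<le> cc_sum_bound / (cc_sum_bound + (Im z)\<^sup>2) * ((\<rho>\<^sup>2) ^ k * ((2 / \<eta>)\<^sup>2 / (l * l)))"
      unfolding green_iter.simps(2)[of "Suc (Suc n) + k"] green_iter.simps(2)[of "Suc (Suc m) + k"]
    proof (rule hdist_step[OF Suc.prems Iz])
      fix u assume u: "u \<in> ch y"
      then have uV: "u \<in> V" using ch_V by blast
      show "Im (green_iter (Suc (Suc n) + k) W z u) > 0" "Im (green_iter (Suc (Suc m) + k) W z u) > 0"
        using Im_green_iter_pos[OF Iz uV] by blast+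
      show "hdist (green_iter (Suc (Suc n) + k) W z u) (green_iter (Suc (Suc m) + k) W z u) \<le> (\<rho>\<^sup>2) ^ k * ((2 / \<eta>)\<^sup>2 / (l * l))"
        by (rule Suc.IH[OF uV])
      show "Im (green_iter (Suc (Suc m) + k) W z u) \<le> 1 / Im z"
        using cmod_green_iter_le[OF Iz uV, of "Suc m + k" W] abs_Im_le_cmod[of "green_iter (Suc (Suc m) + k) W z u"] by simp
    qed
    also have "\<dots> \<le> \<rho>\<^sup>2 * ((\<rho>\<^sup>2) ^ k * ((2 / \<eta>)\<^sup>2 / (l * l)))"
      unfolding \<rho>2(1) using cc_sum_bound(1) z(1) \<eta> l
      by (intro mult_right_mono divide_left_mono add_left_mono power_mono mult_pos_pos add_pos_nonneg) auto
    finally show ?case by (simp add: mult.assoc)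
  qed
  define g where "g = green_iter (Suc (Suc n) + k) W z y"
  define h where "h = green_iter (Suc (Suc m) + k) W z y"
  have pos: "Im g > 0" "Im h > 0" unfolding g_def h_def by (rule Im_green_iter_pos[OF Iz y])+
  have bd: "Im g \<le> 1 / \<eta>" "Im h \<le> 1 / \<eta>"
    using le[OF y, of "Suc n + k"] le[OF y, of "Suc m + k"] abs_Im_le_cmod[of g] abs_Im_le_cmod[of h]
    by (simp_all add: g_def h_def)
  have "(cmod (g - h))\<^sup>2 = hdist g h * (Im g * Im h)" using pos by (simp add: hdist_def)
  also have "\<dots> \<le> ((\<rho>\<^sup>2) ^ k * ((2 / \<eta>)\<^sup>2 / (l * l))) * (1 / \<eta> * (1 / \<eta>))"
    using main[OF y] bd pos l \<eta> \<rho>2(2) hdist_nonneg[OF pos] unfolding g_def[symmetric] h_def[symmetric]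
    by (intro mult_mono) auto
  also have "\<dots> = (C * \<rho> ^ k)\<^sup>2"
    by (simp add: C_def l_def[symmetric] power2_eq_square power_mult_distrib field_simps)
  finally show ?thesis unfolding g_def h_def
    by (rule power2_le_imp_le) (use \<rho>2 l \<eta> in \<open>auto simp: C_def l_def[symmetric]\<close>)
qed

lemma rho_less1: "0 < \<eta> \<Longrightarrow> sqrt (cc_sum_bound / (cc_sum_bound + \<eta>\<^sup>2)) < 1"
  using cc_sum_bound(1) by (simp add: divide_less_eq_1 add_pos_pos)

lemma green_iter_tendsto:
  assumes z: "Im z > 0" and W: "\<And>y. y \<in> V \<Longrightarrow> \<bar>W y\<bar> \<le> B" and y: "y \<in> V"
  shows "(\<lambda>n. green_iter n W z y) \<longlonglongrightarrow> fwd_green W z y"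
proof -
  have B: "B \<ge> 0" using W[OF y] by linarith
  define \<eta> where "\<eta> = min 1 (Im z)"
  have \<eta>: "0 < \<eta>" "\<eta> \<le> 1" "\<eta> \<le> Im z" using z by (auto simp: \<eta>_def)
  define \<rho> where "\<rho> = sqrt (cc_sum_bound / (cc_sum_bound + \<eta>\<^sup>2))"
  define C where "C = 2 / (\<eta>\<^sup>2 * Imlow B (cmod z) \<eta>)"
  have \<rho>: "0 \<le> \<rho>" "\<rho> < 1" using rho_less1[OF \<eta>(1)] cc_sum_bound(1) by (auto simp: \<rho>_def)
  have le: "cmod (green_iter (Suc (Suc n) + k) W z y - green_iter (Suc (Suc m) + k) W z y) \<le> C * \<rho> ^ k" for n m k
    unfolding C_def \<rho>_def by (rule green_iter_cauchy) (use \<eta> B W y in auto)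
  have "Cauchy (\<lambda>n. green_iter n W z y)"
  proof (rule CauchyI)
    fix e :: real assume e: "e > 0"
    have "(\<lambda>k. C * \<rho> ^ k) \<longlonglongrightarrow> C * 0" by (rule tendsto_mult[OF tendsto_const LIMSEQ_power_zero]) (use \<rho> in simp)
    then have "eventually (\<lambda>k. C * \<rho> ^ k < e) sequentially" by (rule order_tendstoD(2)) (use e in simp)
    then obtain k where k: "C * \<rho> ^ k < e" by (auto simp: eventually_sequentially)
    show "\<exists>M. \<forall>m\<ge>M. \<forall>n\<ge>M. cmod (green_iter m W z y - green_iter n W z y) < e"
    proof (intro exI[of _ "Suc (Suc k)"] allI impI)
      fix m n assume "Suc (Suc k) \<le> m" "Suc (Suc k) \<le> n"
      then obtain m' n' where "m = Suc (Suc m') + k" "n = Suc (Suc n') + k"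
        by (metis add.commute add_Suc le_Suc_ex)
      then show "cmod (green_iter m W z y - green_iter n W z y) < e" using le[of m' k n'] k by simp
    qed
  qed
  then show ?thesis unfolding fwd_green_def by (simp add: Cauchy_convergent_iff convergent_LIMSEQ_iff)
qed

lemma fwd_green_uniform:
  assumes \<eta>: "0 < \<eta>" "\<eta> \<le> 1" and R: "0 \<le> R" and B: "0 \<le> B"
    and z: "\<eta> \<le> Im z" "cmod z \<le> R" and W: "\<And>y. y \<in> V \<Longrightarrow> \<bar>W y\<bar> \<le> B" and y: "y \<in> V"
  shows "cmod (green_iter (Suc (Suc k)) W z y - fwd_green W z y) \<le> 2 / (\<eta>\<^sup>2 * Imlow B R \<eta>) * sqrt (cc_sum_bound / (cc_sum_bound + \<eta>\<^sup>2)) ^ k"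
proof (rule LIMSEQ_le_const2)
  have "(\<lambda>m. green_iter (m + (2 + k)) W z y) \<longlonglongrightarrow> fwd_green W z y"
    by (rule LIMSEQ_ignore_initial_segment, rule green_iter_tendsto[where B = B]) (use z \<eta> W y in auto)
  then show "(\<lambda>m. cmod (green_iter (Suc (Suc k)) W z y - green_iter (Suc (Suc m) + k) W z y)) \<longlonglongrightarrow> cmod (green_iter (Suc (Suc k)) W z y - fwd_green W z y)"
    by (intro tendsto_intros) (simp add: add.commute add.left_commute)
  show "\<exists>N. \<forall>n\<ge>N. cmod (green_iter (Suc (Suc k)) W z y - green_iter (Suc (Suc n) + k) W z y) \<le> 2 / (\<eta>\<^sup>2 * Imlow B R \<eta>) * sqrt (cc_sum_bound / (cc_sum_bound + \<eta>\<^sup>2)) ^ k"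
    using green_iter_cauchy[OF \<eta> R B z W y, where n = 0 and k = k] by auto
qed

lemma fwd_green_solution:
  assumes z: "Im z > 0" and W: "\<And>y. y \<in> V \<Longrightarrow> \<bar>W y\<bar> \<le> B"
  shows "herglotz_solution W z (fwd_green W z)"
  unfolding herglotz_solution_def
proof (intro ballI conjI)
  fix y assume y: "y \<in> V"
  have B: "B \<ge> 0" using W[OF y] by linarith
  have lim: "(\<lambda>n. green_iter n W z u) \<longlonglongrightarrow> fwd_green W z u" if "u \<in> V" for u
    by (rule green_iter_tendsto) (use z W that in auto)
  have "Im (fwd_green W z y) \<ge> Imlow B (cmod z) (Im z)"
  proof (rule LIMSEQ_le_const)
    show "(\<lambda>n. Im (green_iter n W z y)) \<longlonglongrightarrow> Im (fwd_green W z y)" using lim[OF y] by (intro tendsto_intros)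
    show "\<exists>N. \<forall>n\<ge>N. Imlow B (cmod z) (Im z) \<le> Im (green_iter n W z y)"
    proof (intro exI[of _ 2] allI impI)
      fix n :: nat assume "n \<ge> 2"
      then obtain m where "n = 2 + m" using le_Suc_ex by blast
      then have "n = Suc (Suc m)" by simp
      then show "Imlow B (cmod z) (Im z) \<le> Im (green_iter n W z y)"
        using Im_green_iter_ge[of "Im z" z "cmod z" y W B m] z W y by simp
    qed
  qed
  then show pos: "Im (fwd_green W z y) > 0" using Imlow_pos[of "Im z" "cmod z" B] z B by auto
  let ?b = "\<lambda>g. z - of_real (W y) + (\<Sum>u\<in>ch y. of_real (cc y u) * g u)"
  have "(\<lambda>n. green_iter (Suc n) W z y * ?b (green_iter n W z)) \<longlonglongrightarrow> fwd_green W z y * ?b (fwd_green W z)"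
    using lim ch_V y by (intro tendsto_intros LIMSEQ_Suc) auto
  moreover have "green_iter (Suc n) W z y * ?b (green_iter n W z) = -1" for n
  proof -
    have "Im (?b (green_iter n W z)) \<ge> Im z" by (rule Im_sum_ge) (use Im_green_iter_pos[OF z] ch_V in \<open>auto intro: less_imp_le\<close>)
    then have "?b (green_iter n W z) \<noteq> 0" using z by (metis not_le zero_complex.sel(2))
    then show ?thesis by (simp add: green_iter.simps(2))
  qed
  ultimately have "fwd_green W z y * ?b (fwd_green W z) = -1" by (simp add: LIMSEQ_const_iff)
  moreover have "fwd_green W z y \<noteq> 0" using pos by auto
  ultimately show "- 1 / fwd_green W z y = ?b (fwd_green W z)" by (simp add: field_simps)
qed

lemma green_iter_label:
  assumes "\<And>x y. x \<in> V \<Longrightarrow> y \<in> V \<Longrightarrow> a x = a y \<Longrightarrow> W x = W y"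
  shows "x \<in> V \<Longrightarrow> y \<in> V \<Longrightarrow> a x = a y \<Longrightarrow> green_iter n W z x = green_iter n W z y"
proof (induction n arbitrary: x y)
  case (Suc n)
  have "(\<Sum>u\<in>ch x. of_real (cc x u) * green_iter n W z u) = (\<Sum>u\<in>ch y. of_real (cc y u) * green_iter n W z u)"
    by (rule sum_ch_eq[OF Suc.prems]) (use Suc cc_label ch_V in metis)
  then show ?case using assms[OF Suc.prems] by (simp add: green_iter.simps(2))
qed simp

lemma fwd_green_label:
  assumes "\<And>x y. x \<in> V \<Longrightarrow> y \<in> V \<Longrightarrow> a x = a y \<Longrightarrow> W x = W y"
  shows "x \<in> V \<Longrightarrow> y \<in> V \<Longrightarrow> a x = a y \<Longrightarrow> fwd_green W z x = fwd_green W z y"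
proof -
  assume xy: "x \<in> V" "y \<in> V" "a x = a y"
  have "green_iter n W z x = green_iter n W z y" for n by (rule green_iter_label[OF assms xy])
  then show ?thesis by (simp add: fwd_green_def)
qed

lemma green_iter_cong: "(\<And>u. u \<in> fwd x \<Longrightarrow> W u = W' u) \<Longrightarrow> x \<in> V \<Longrightarrow> green_iter n W z x = green_iter n W' z x"
proof (induction n arbitrary: x)
  case (Suc n)
  have "green_iter n W z u = green_iter n W' z u" if "u \<in> ch x" for u
    using Suc.IH[of u] Suc.prems(1) fwd_ch_sub(1)[OF that] ch_V(2)[OF that] by blast
  then show ?case using Suc.prems fwd_self by (simp add: green_iter.simps(2))
qed simp

lemma green_iter_iso:
  assumes \<psi>: "\<forall>u\<in>fwd x. \<psi> u \<in> fwd y \<and> a (\<psi> u) = a u \<and> bij_betw \<psi> (ch u) (ch (\<psi> u))"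
    and W: "\<And>u. u \<in> fwd x \<Longrightarrow> W' u = W (\<psi> u)"
  shows "u \<in> fwd x \<Longrightarrow> green_iter n W' z u = green_iter n W z (\<psi> u)"
proof (induction n arbitrary: u)
  case (Suc n)
  have b: "bij_betw \<psi> (ch u) (ch (\<psi> u))" using \<psi> Suc.prems by blast
  have "(\<Sum>w\<in>ch (\<psi> u). of_real (cc (\<psi> u) w) * green_iter n W z w) = (\<Sum>w\<in>ch u. of_real (cc (\<psi> u) (\<psi> w)) * green_iter n W z (\<psi> w))"
    by (rule sum.reindex_bij_betw[OF b, symmetric])
  also have "\<dots> = (\<Sum>w\<in>ch u. of_real (cc u w) * green_iter n W' z w)"
  proof (intro sum.cong refl)
    fix w assume w: "w \<in> ch u"
    then have "\<psi> w \<in> ch (\<psi> u)" using b by (auto dest: bij_betwE)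
    then have "cc (\<psi> u) (\<psi> w) = cc u w"
      using cc_label[OF _ w] \<psi> Suc.prems fwd_ch[OF Suc.prems w] by metis
    then show "of_real (cc (\<psi> u) (\<psi> w)) * green_iter n W z (\<psi> w) = of_real (cc u w) * green_iter n W' z w"
      using Suc.IH[OF fwd_ch[OF Suc.prems w]] by simp
  qed
  finally show ?case using W[OF Suc.prems] by (simp add: green_iter.simps(2))
qed simp

end

section \<open>Green functions as solutions of the recursion\<close>

context tree_op
begin

definition "tree_action W \<phi> y = (\<Sum>u\<in>{u. adj y u}. t y u * \<phi> u) + of_real (W y) * \<phi> y"

text \<open>
  The product of \<open>g x\<close> and the factors \<open>- t u (par u) * g u\<close> over the vertices \<open>u\<close> that follow \<open>x\<close> on the
  path to the argument, the argument included. Up to normalisation, this is the column of the resolvent of the forward tree of \<open>x\<close> that belongs to \<open>x\<close>.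
\<close>

definition "fwd_solution g x u = (if u \<in> fwd x
   then rec_nat g (\<lambda>_ e u. - t u (par u) * e (par u) * g u) (dd u - dd x) u else 0 :: complex)"

lemma fwd_solution_root: "x \<in> V \<Longrightarrow> fwd_solution g x x = g x"
  by (simp add: fwd_solution_def fwd_self)

lemma fwd_solution_ch: "u \<in> fwd x \<Longrightarrow> w \<in> ch u \<Longrightarrow> fwd_solution g x w = - t w u * fwd_solution g x u * g w"
  using fwd_dd[of u x] ch_dd[of w u] par_ch[of w u] fwd_ch[of u x w]
  by (simp add: fwd_solution_def Suc_diff_le)

lemma fwd_solution_out: "u \<notin> fwd x \<Longrightarrow> fwd_solution g x u = 0"
  by (simp add: fwd_solution_def)

lemma sum_neighbours:
  fixes f :: "'v \<Rightarrow> complex"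
  assumes "y \<in> V"
  shows "(\<Sum>u\<in>{u. adj y u}. f u) = (\<Sum>u\<in>ch y. f u) + (if y = rt then 0 else f (par y))"
  using neighbours[OF assms] finite_ch[of y] ch_par_not_ch[OF assms] by (simp add: add.commute)

lemma par_not_fwd: "x \<in> V \<Longrightarrow> x \<noteq> rt \<Longrightarrow> par x \<notin> fwd x"
  using fwd_ch_sub(3) in_ch_par by blast

text \<open>
  Extended by 0 to the whole tree, the forward solution of \<open>x\<close> solves the equation except at \<open>x\<close> and at
  the parent of \<open>x\<close>. The value at the parent is what \<open>full_solution\<close> has to cancel.
\<close>

lemma fwd_solution_eq:
  assumes g: "herglotz_solution W z g" and x: "x \<in> V" and y: "y \<in> V"
  shows "tree_action W (fwd_solution g x) y - z * fwd_solution g x y = (if y = x then 1 else if x \<noteq> rt \<and> y = par x then t y x * g x else 0)"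
proof (cases "y \<in> fwd x")
  case True
  let ?\<phi> = "fwd_solution g x"
  have gy: "Im (g y) > 0" "- 1 / g y = z - of_real (W y) + (\<Sum>u\<in>ch y. of_real (cc y u) * g u)"
    using g y by (auto simp: herglotz_solution_def)
  have g0: "g y \<noteq> 0" using gy(1) by auto
  have "(\<Sum>u\<in>ch y. t y u * ?\<phi> u) = (\<Sum>u\<in>ch y. - ?\<phi> y * (of_real (cc y u) * g u))"
    by (intro sum.cong refl) (simp add: fwd_solution_ch[OF True] cc_t algebra_simps)
  also have "\<dots> = - ?\<phi> y * (- 1 / g y - z + of_real (W y))"
    unfolding sum_distrib_left[symmetric] gy(2) by simp
  finally have e: "tree_action W ?\<phi> y - z * ?\<phi> y = ?\<phi> y / g y + (if y = rt then 0 else t y (par y) * ?\<phi> (par y))"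
    by (simp add: tree_action_def sum_neighbours[OF y] algebra_simps)
  show ?thesis
  proof (cases "y = x")
    case True
    then show ?thesis using e x g0 fwd_solution_root fwd_solution_out par_not_fwd by auto
  next
    case False
    note f = fwd_par[OF True False]
    have "?\<phi> y / g y = - t y (par y) * ?\<phi> (par y)" using fwd_solution_ch[OF f(1,3)] g0 by simp
    moreover have "\<not> (x \<noteq> rt \<and> y = par x)" using True par_not_fwd x by auto
    ultimately show ?thesis using e f(2) False by auto
  qed
next
  case False
  let ?\<phi> = "fwd_solution g x"
  have yx: "y \<noteq> x" using False x fwd_self by auto
  have p: "?\<phi> (par y) = 0" if "y \<noteq> rt"
    using False fwd_ch[of "par y" x y] in_ch_par[OF y that] by (intro fwd_solution_out) auto
  have c: "?\<phi> u = (if u = x then g x else 0)" if u: "u \<in> ch y" for u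
  proof (cases "u = x")
    case uF: False
    have "u \<notin> fwd x" using fwd_par(1)[of u x] uF False par_ch[OF u] by auto
    then show ?thesis using uF fwd_solution_out by simp
  qed (use x fwd_solution_root in simp)
  have "(\<Sum>u\<in>ch y. t y u * ?\<phi> u) = (\<Sum>u\<in>ch y. if u = x then t y x * g x else 0)"
    by (intro sum.cong refl) (simp add: c)
  also have "\<dots> = (if x \<in> ch y then t y x * g x else 0)" by (simp add: finite_ch)
  also have "x \<in> ch y \<longleftrightarrow> x \<noteq> rt \<and> y = par x" using par_ch in_ch_par x rt_not_ch by blast
  finally show ?thesis using False p yx fwd_solution_out by (simp add: tree_action_def sum_neighbours[OF y])
qed

lemma sum_levels:
  fixes f :: "'v \<Rightarrow> real"
  assumes "x \<in> V"
  shows "(\<Sum>i<n. \<Sum>y\<in>lev x i. f y) = sum f (\<Union>i<n. lev x i)"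
  using finite_lev[OF assms] lev_disjoint by (intro sum.UNION_disjoint[symmetric]) auto

lemma fwd_summable_iff_levels:
  fixes f :: "'v \<Rightarrow> real"
  assumes x: "x \<in> V" and f: "\<And>y. f y \<ge> 0" and bd: "\<And>n. (\<Sum>i<n. \<Sum>y\<in>lev x i. f y) \<le> C"
  shows "f summable_on fwd x"
proof (rule nonneg_bdd_above_summable_on)
  show "bdd_above (sum f ` {F. F \<subseteq> fwd x \<and> finite F})"
  proof (rule bdd_aboveI2[of _ _ C])
    fix F assume "F \<in> {F. F \<subseteq> fwd x \<and> finite F}"
    then have F: "F \<subseteq> fwd x" "finite F" by auto
    define n where "n = Suc (Max (insert 0 (dd ` F)))"
    have "F \<subseteq> (\<Union>i<n. lev x i)"
    proof
      fix u assume u: "u \<in> F"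
      then have "dd u < n" using F(2) by (simp add: n_def less_Suc_eq_le)
      moreover have "u \<in> lev x (dd u - dd x)" using u F(1) fwd_dd[of u x] by (auto simp: lev_def)
      ultimately show "u \<in> (\<Union>i<n. lev x i)" by (intro UN_I[of "dd u - dd x"]) auto
    qed
    then have "sum f F \<le> sum f (\<Union>i<n. lev x i)" using f finite_lev[OF x] by (intro sum_mono2) auto
    then show "sum f F \<le> C" using bd[of n] sum_levels[OF x, of f n] by simp
  qed
qed (use f in auto)

text \<open>
  Taking imaginary parts in the recursion, \<open>Im z\<close> times the mass of a level is the difference of the
  weighted sums \<open>A n\<close> over this level and the next one. These are nonnegative, so the masses are summable.
\<close>

lemma fwd_solution_l2:
  assumes g: "herglotz_solution W z g" and x: "x \<in> V" and z: "Im z > 0"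
  shows "fwd_solution g x \<in> l2 (fwd x) \<nu>"
proof -
  let ?\<phi> = "fwd_solution g x"
  define f where "f y = (if y \<in> V then (cmod (?\<phi> y))\<^sup>2 * \<nu> y else 0)" for y
  define A where "A n = (\<Sum>y\<in>lev x n. f y * (Im (g y) / (cmod (g y))\<^sup>2))" for n
  have gp: "Im (g y) > 0" "Im (g y) / (cmod (g y))\<^sup>2 = Im z + (\<Sum>u\<in>ch y. cc y u * Im (g u))" if "y \<in> V" for y
  proof -
    show "Im (g y) > 0" using g that by (auto simp: herglotz_solution_def)
    have "- 1 / g y = z - of_real (W y) + (\<Sum>u\<in>ch y. of_real (cc y u) * g u)" using g that by (auto simp: herglotz_solution_def)
    then show "Im (g y) / (cmod (g y))\<^sup>2 = Im z + (\<Sum>u\<in>ch y. cc y u * Im (g u))"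
      unfolding Im_neg_inverse[symmetric] by simp
  qed
  have f0: "f y \<ge> 0" for y by (cases "y \<in> V") (simp_all add: f_def nu_pos less_imp_le)
  have levV: "lev x n \<subseteq> V" for n using fwd_V by (auto simp: lev_def)
  have A0: "A n \<ge> 0" for n unfolding A_def using levV
    by (intro sum_nonneg mult_nonneg_nonneg divide_nonneg_nonneg f0 less_imp_le[OF gp(1)]) auto
  have step: "A n = Im z * (\<Sum>y\<in>lev x n. f y) + A (Suc n)" for n
  proof -
    have "f y * (Im (g y) / (cmod (g y))\<^sup>2) = Im z * f y + (\<Sum>u\<in>ch y. f u * (Im (g u) / (cmod (g u))\<^sup>2))"
      if y: "y \<in> lev x n" for y
    proof -
      have yV: "y \<in> V" "y \<in> fwd x" using y levV by (auto simp: lev_def)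
      have "f u * (Im (g u) / (cmod (g u))\<^sup>2) = f y * (cc y u * Im (g u))" if u: "u \<in> ch y" for u
      proof -
        have "g u \<noteq> 0" using gp(1)[of u] ch_V u by auto
        then have "f u * (Im (g u) / (cmod (g u))\<^sup>2) = (cmod (?\<phi> y))\<^sup>2 * ((cmod (t u y))\<^sup>2 * \<nu> u) * Im (g u)"
          using ch_V[OF u] by (simp add: f_def fwd_solution_ch[OF yV(2) u] norm_mult power_mult_distrib)
        then show ?thesis unfolding cc_rev(1)[OF u, symmetric] using yV by (simp add: f_def)
      qed
      then show ?thesis unfolding gp(2)[OF yV(1)] by (simp add: distrib_left sum_distrib_left mult.commute)
    qed
    then show ?thesis unfolding A_def sum_lev_Suc[OF x] by (simp add: sum.distrib sum_distrib_left)
  qed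
  have tele: "Im z * (\<Sum>i<n. \<Sum>y\<in>lev x i. f y) + A n = A 0" for n
  proof (induction n)
    case (Suc n)
    have "Im z * (\<Sum>i<Suc n. \<Sum>y\<in>lev x i. f y) = Im z * (\<Sum>i<n. \<Sum>y\<in>lev x i. f y) + Im z * (\<Sum>y\<in>lev x n. f y)"
      by (simp add: distrib_left)
    then show ?case using Suc.IH step[of n] by linarith
  qed simp
  then have "Im z * (\<Sum>i<n. \<Sum>y\<in>lev x i. f y) \<le> A 0" for n
    using A0[of n] tele[of n] by linarith
  then have "(\<Sum>i<n. \<Sum>y\<in>lev x i. f y) \<le> A 0 / Im z" for n using z by (simp add: field_simps)
  then have "f summable_on fwd x" by (rule fwd_summable_iff_levels[OF x f0])
  moreover have "f summable_on fwd x \<longleftrightarrow> (\<lambda>y. (cmod (?\<phi> y))\<^sup>2 * \<nu> y) summable_on fwd x"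
    by (rule summable_on_cong) (use fwd_V in \<open>auto simp: f_def\<close>)
  ultimately show ?thesis using fwd_solution_out by (simp add: l2_def)
qed

lemma l2_scale: "\<phi> \<in> l2 B \<nu> \<Longrightarrow> (\<lambda>y. c * \<phi> y) \<in> l2 B \<nu>"
  by (auto simp: l2_def norm_mult power_mult_distrib mult.assoc intro!: summable_on_cmult_right)

lemma l2_add:
  assumes "\<phi> \<in> l2 B \<nu>" "\<psi> \<in> l2 B \<nu>" "B \<subseteq> V" shows "(\<lambda>y. \<phi> y + \<psi> y) \<in> l2 B \<nu>"
proof -
  have "(\<lambda>y. 2 * ((cmod (\<phi> y))\<^sup>2 * \<nu> y) + 2 * ((cmod (\<psi> y))\<^sup>2 * \<nu> y)) summable_on B"
    using assms by (intro summable_on_add summable_on_cmult_right) (auto simp: l2_def)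
  then have "(\<lambda>y. (cmod (\<phi> y + \<psi> y))\<^sup>2 * \<nu> y) summable_on B"
  proof (rule summable_on_comparison_test)
    fix y assume "y \<in> B"
    then have n: "\<nu> y > 0" using assms(3) nu_pos by blast
    have "(cmod (\<phi> y + \<psi> y))\<^sup>2 \<le> (cmod (\<phi> y) + cmod (\<psi> y))\<^sup>2" by (intro power_mono norm_triangle_ineq) auto
    also have "\<dots> \<le> 2 * (cmod (\<phi> y))\<^sup>2 + 2 * (cmod (\<psi> y))\<^sup>2"
      using sum_squares_bound[of "cmod (\<phi> y)" "cmod (\<psi> y)"] by (simp add: power2_sum)
    finally have "(cmod (\<phi> y + \<psi> y))\<^sup>2 * \<nu> y \<le> (2 * (cmod (\<phi> y))\<^sup>2 + 2 * (cmod (\<psi> y))\<^sup>2) * \<nu> y"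
      by (rule mult_right_mono) (use n in simp)
    then show "(cmod (\<phi> y + \<psi> y))\<^sup>2 * \<nu> y \<le> 2 * ((cmod (\<phi> y))\<^sup>2 * \<nu> y) + 2 * ((cmod (\<psi> y))\<^sup>2 * \<nu> y)"
      by (simp add: distrib_right mult.assoc)
    show "0 \<le> (cmod (\<phi> y + \<psi> y))\<^sup>2 * \<nu> y" using n by simp
  qed
  then show ?thesis using assms by (auto simp: l2_def)
qed

lemma l2_mono: "\<phi> \<in> l2 B \<nu> \<Longrightarrow> B \<subseteq> B' \<Longrightarrow> \<phi> \<in> l2 B' \<nu>"
  using summable_on_cong_neutral[of B' B "\<lambda>x. (cmod (\<phi> x))\<^sup>2 * \<nu> x" "\<lambda>x. (cmod (\<phi> x))\<^sup>2 * \<nu> x"]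
  by (auto simp: l2_def)

lemma edge_constants:
  "\<exists>C>0. \<forall>y\<in>V. \<forall>u\<in>ch y. cmod (t y u) \<le> C \<and> \<nu> y \<le> C * \<nu> u \<and> real (card (ch y)) \<le> C"
proof -
  obtain C1 where C1: "C1 > 0" "\<And>y u. y \<in> V \<Longrightarrow> u \<in> ch y \<Longrightarrow> cmod (t y u) \<le> C1"
    using edge_bounded[of "\<lambda>y u. cmod (t y u)"] t_label ch_V by metis
  have "\<exists>C>0. \<forall>y\<in>V. \<forall>u\<in>ch y. \<nu> y / \<nu> u \<le> C"
    by (rule edge_bounded) (use nu_label ch_V in metis)
  then obtain C2 where C2: "C2 > 0" "\<And>y u. y \<in> V \<Longrightarrow> u \<in> ch y \<Longrightarrow> \<nu> y / \<nu> u \<le> C2" by blast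
  obtain C3 where C3: "C3 > 0" "\<And>y. y \<in> V \<Longrightarrow> real (card (ch y)) \<le> C3"
    using vertex_bounded[of "\<lambda>y. real (card (ch y))"] card_ch_label by metis
  define C where "C = C1 + C2 + C3"
  have "cmod (t y u) \<le> C \<and> \<nu> y \<le> C * \<nu> u \<and> real (card (ch y)) \<le> C" if "y \<in> V" "u \<in> ch y" for y u
  proof -
    have nu: "\<nu> u > 0" using nu_pos ch_V that by blast
    have "\<nu> y \<le> C2 * \<nu> u" using C2(2)[OF that] nu by (simp add: field_simps)
    also have "\<dots> \<le> C * \<nu> u" using C1 C2 C3 nu by (intro mult_right_mono) (auto simp: C_def)
    finally show ?thesis using C1(1) C1(2)[OF that] C2(1) C3(1) C3(2)[OF that(1)] by (auto simp: C_def)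
  qed
  moreover have "C > 0" using C1 C2 C3 by (simp add: C_def)
  ultimately show ?thesis by blast
qed

text \<open>
  The current \<open>J n\<close> through the edges below level \<open>n\<close> equals \<open>Im z\<close> times the mass up to level \<open>n\<close>. On the
  other hand it is bounded by the masses of the levels \<open>n\<close> and \<open>n + 1\<close>, which tend to 0.
\<close>

lemma eigenfunction_zero:
  assumes r: "r \<in> V" and z: "Im z > 0" and \<xi>: "\<xi> \<in> l2 (fwd r) \<nu>"
    and eq: "\<And>y. y \<in> fwd r \<Longrightarrow> tree_action W \<xi> y = z * \<xi> y"
  shows "\<xi> = (\<lambda>_. 0)"
proof -
  define N where "N n = (\<Sum>y\<in>lev r n. (cmod (\<xi> y))\<^sup>2 * \<nu> y)" for n
  define c where "c y u = Im (cnj (\<xi> y) * t y u * \<xi> u) * \<nu> y" for y u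
  define J where "J n = (\<Sum>y\<in>lev r n. \<Sum>u\<in>ch y. c y u)" for n
  have out: "\<xi> y = 0" if "y \<notin> fwd r" for y using \<xi> that by (auto simp: l2_def)
  have levV: "lev r n \<subseteq> V" "lev r n \<subseteq> fwd r" for n using fwd_V by (auto simp: lev_def)
  have bal: "(\<Sum>u\<in>ch y. c y u) = Im z * ((cmod (\<xi> y))\<^sup>2 * \<nu> y) + (if y = r then 0 else c (par y) y)" if y: "y \<in> fwd r" for y
  proof -
    have yV: "y \<in> V" using y fwd_V by blast
    have "(\<Sum>u\<in>ch y. t y u * \<xi> u) + (if y = rt then 0 else t y (par y) * \<xi> (par y)) = (z - of_real (W y)) * \<xi> y"
      using eq[OF y] unfolding tree_action_def sum_neighbours[OF yV] by (simp add: algebra_simps)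
    then have "Im (cnj (\<xi> y) * ((\<Sum>u\<in>ch y. t y u * \<xi> u) + (if y = rt then 0 else t y (par y) * \<xi> (par y)))) * \<nu> y
       = Im (cnj (\<xi> y) * ((z - of_real (W y)) * \<xi> y)) * \<nu> y" by simp
    also have "cnj (\<xi> y) * ((z - of_real (W y)) * \<xi> y) = (z - of_real (W y)) * of_real ((cmod (\<xi> y))\<^sup>2)"
      unfolding complex_norm_square by (simp add: algebra_simps)
    finally have 1: "(\<Sum>u\<in>ch y. c y u) + (if y = rt then 0 else Im (cnj (\<xi> y) * t y (par y) * \<xi> (par y)) * \<nu> y) = Im z * ((cmod (\<xi> y))\<^sup>2 * \<nu> y)"
      by (simp add: c_def distrib_left distrib_right sum_distrib_left sum_distrib_right mult.assoc split: if_splits del: of_real_power)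
    have 2: "(if y = rt then 0 else Im (cnj (\<xi> y) * t y (par y) * \<xi> (par y)) * \<nu> y) = - (if y = r then 0 else c (par y) y)"
    proof (cases "y = r")
      case True
      then show ?thesis using out par_not_fwd[OF yV] by auto
    next
      case False
      note f = fwd_par[OF y False]
      define p where "p = par y"
      have pV: "p \<in> V" using f(1) fwd_V by (auto simp: p_def)
      have "Im (cnj (\<xi> y) * t y p * \<xi> p) * \<nu> y = Im (cnj (\<xi> y) * (t y p * of_real (\<nu> y)) * \<xi> p)"
        by (simp add: algebra_simps)
      also have "\<dots> = Im (cnj (cnj (\<xi> p) * t p y * \<xi> y) * of_real (\<nu> p))"
        unfolding t_sym[OF yV pV] by (simp add: algebra_simps)
      also have "\<dots> = - c p y" unfolding c_def by (simp add: algebra_simps)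
      finally show ?thesis using False f(2) by (simp add: p_def)
    qed
    show ?thesis using 1 2 by linarith
  qed
  have par_lev: "par u = y" if "u \<in> ch y" for u y using par_ch that by blast
  have J: "J n = Im z * (\<Sum>i\<le>n. N i)" for n
  proof (induction n)
    case 0
    show ?case using bal[OF fwd_self[OF r]] by (simp add: J_def N_def lev_0[OF r])
  next
    case (Suc n)
    have ne: "u \<noteq> r" if "y \<in> lev r n" "u \<in> ch y" for u y
      using that ch_dd[of u y] by (auto simp: lev_def)
    have "J (Suc n) = (\<Sum>y\<in>lev r (Suc n). Im z * ((cmod (\<xi> y))\<^sup>2 * \<nu> y) + (if y = r then 0 else c (par y) y))"
      unfolding J_def by (intro sum.cong refl bal) (use levV in auto)
    also have "\<dots> = Im z * N (Suc n) + (\<Sum>y\<in>lev r (Suc n). if y = r then 0 else c (par y) y)"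
      by (simp add: sum.distrib N_def sum_distrib_left)
    also have "(\<Sum>y\<in>lev r (Suc n). if y = r then 0 else c (par y) y) = J n"
      unfolding sum_lev_Suc[OF r] J_def using ne par_lev by (intro sum.cong refl) auto
    finally show ?case using Suc by (simp add: distrib_left)
  qed
  obtain C where C: "C > 0" "\<And>y u. y \<in> V \<Longrightarrow> u \<in> ch y \<Longrightarrow> cmod (t y u) \<le> C \<and> \<nu> y \<le> C * \<nu> u \<and> real (card (ch y)) \<le> C"
    using edge_constants by blast
  have cle: "c y u \<le> C * ((cmod (\<xi> y))\<^sup>2 * \<nu> y) + C * (C * ((cmod (\<xi> u))\<^sup>2 * \<nu> u))" if y: "y \<in> V" "u \<in> ch y" for y u
  proof -
    have nu: "\<nu> y > 0" using nu_pos y by blast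
    have "c y u \<le> cmod (cnj (\<xi> y) * t y u * \<xi> u) * \<nu> y" unfolding c_def
      using nu by (intro mult_right_mono order_trans[OF abs_ge_self abs_Im_le_cmod]) auto
    also have "\<dots> = cmod (t y u) * (cmod (\<xi> y) * cmod (\<xi> u)) * \<nu> y" by (simp add: norm_mult)
    also have "\<dots> \<le> C * ((cmod (\<xi> y))\<^sup>2 + (cmod (\<xi> u))\<^sup>2) * \<nu> y"
    proof -
      have "2 * cmod (\<xi> y) * cmod (\<xi> u) \<le> (cmod (\<xi> y))\<^sup>2 + (cmod (\<xi> u))\<^sup>2" by (rule sum_squares_bound)
      moreover have "0 \<le> cmod (\<xi> y) * cmod (\<xi> u)" by simp
      ultimately have "cmod (\<xi> y) * cmod (\<xi> u) \<le> (cmod (\<xi> y))\<^sup>2 + (cmod (\<xi> u))\<^sup>2" by linarith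
      then show ?thesis using C(1) C(2)[OF y] nu by (intro mult_right_mono mult_mono) auto
    qed
    also have "\<dots> = C * ((cmod (\<xi> y))\<^sup>2 * \<nu> y) + C * (cmod (\<xi> u))\<^sup>2 * \<nu> y" by (simp add: algebra_simps)
    also have "C * (cmod (\<xi> u))\<^sup>2 * \<nu> y \<le> C * (cmod (\<xi> u))\<^sup>2 * (C * \<nu> u)"
      using C(1) C(2)[OF y] by (intro mult_left_mono) auto
    finally show ?thesis by (simp add: algebra_simps)
  qed
  have Jle: "J n \<le> C * C * N n + C * C * N (Suc n)" for n
  proof -
    have "J n \<le> (\<Sum>y\<in>lev r n. \<Sum>u\<in>ch y. C * ((cmod (\<xi> y))\<^sup>2 * \<nu> y) + C * (C * ((cmod (\<xi> u))\<^sup>2 * \<nu> u)))"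
      unfolding J_def by (intro sum_mono cle) (use levV in auto)
    also have "\<dots> = (\<Sum>y\<in>lev r n. real (card (ch y)) * (C * ((cmod (\<xi> y))\<^sup>2 * \<nu> y))) + C * C * N (Suc n)"
      unfolding N_def sum_lev_Suc[OF r] by (simp add: sum.distrib sum_distrib_left mult.assoc)
    also have "(\<Sum>y\<in>lev r n. real (card (ch y)) * (C * ((cmod (\<xi> y))\<^sup>2 * \<nu> y))) \<le> (\<Sum>y\<in>lev r n. C * (C * ((cmod (\<xi> y))\<^sup>2 * \<nu> y)))"
    proof (intro sum_mono mult_right_mono)
      fix y assume "y \<in> lev r n"
      then have y: "y \<in> V" using levV by blast
      show "real (card (ch y)) \<le> C" using C(2)[OF y] ch_ne[OF y] by blast
      show "0 \<le> C * ((cmod (\<xi> y))\<^sup>2 * \<nu> y)" using C(1) nu_pos[OF y] by simp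
    qed
    also have "\<dots> = C * C * N n" by (simp add: N_def sum_distrib_left mult.assoc)
    finally show ?thesis by simp
  qed
  have N0: "N n \<ge> 0" for n unfolding N_def using levV by (intro sum_nonneg mult_nonneg_nonneg less_imp_le[OF nu_pos]) auto
  have f0: "0 \<le> (cmod (\<xi> y))\<^sup>2 * \<nu> y" if "y \<in> V" for y using nu_pos[OF that] by simp
  have sm: "(\<lambda>y. (cmod (\<xi> y))\<^sup>2 * \<nu> y) summable_on fwd r" using \<xi> by (simp add: l2_def)
  have "summable N"
  proof (rule summableI_nonneg_bounded[OF N0])
    fix n
    have "(\<Sum>i<n. N i) = sum (\<lambda>y. (cmod (\<xi> y))\<^sup>2 * \<nu> y) (\<Union>i<n. lev r i)" unfolding N_def by (rule sum_levels[OF r])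
    also have "\<dots> \<le> infsum (\<lambda>y. (cmod (\<xi> y))\<^sup>2 * \<nu> y) (fwd r)"
      by (rule finite_sum_le_infsum[OF sm]) (use finite_lev[OF r] subsetD[OF levV(2)] fwd_V f0 in auto)
    finally show "(\<Sum>i<n. N i) \<le> infsum (\<lambda>y. (cmod (\<xi> y))\<^sup>2 * \<nu> y) (fwd r)" .
  qed
  then have "N \<longlonglongrightarrow> 0" by (rule summable_LIMSEQ_zero)
  then have "(\<lambda>n. C * C * N n + C * C * N (Suc n)) \<longlonglongrightarrow> C * C * 0 + C * C * 0"
    by (intro tendsto_intros LIMSEQ_Suc)
  then have lim: "(\<lambda>n. C * C * N n + C * C * N (Suc n)) \<longlonglongrightarrow> 0" by simp
  have Nz: "N k = 0" for k
  proof -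
    have "Im z * N k \<le> C * C * N n + C * C * N (Suc n)" if "n \<ge> k" for n
    proof -
      have "N k \<le> (\<Sum>i\<le>n. N i)" using that N0 by (intro member_le_sum) auto
      then have "Im z * N k \<le> J n" unfolding J using z by (intro mult_left_mono) auto
      then show ?thesis using Jle[of n] by linarith
    qed
    then have "Im z * N k \<le> 0" by (intro LIMSEQ_le_const[OF lim]) blast
    then show ?thesis using z N0[of k] by (simp add: mult_le_0_iff)
  qed
  have "\<xi> y = 0" for y
  proof (cases "y \<in> fwd r")
    case True
    then obtain n where n: "y \<in> lev r n" using fwd_lev by blast
    have "(cmod (\<xi> y))\<^sup>2 * \<nu> y \<le> N n" unfolding N_def
      using finite_lev[OF r] n f0 subsetD[OF levV(1)] by (intro member_le_sum) auto
    then have "(cmod (\<xi> y))\<^sup>2 * \<nu> y \<le> 0" using Nz by simp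
    moreover have "\<nu> y > 0" using True nu_pos fwd_V by blast
    ultimately show ?thesis by (simp add: mult_le_0_iff)
  qed (use out in simp)
  then show ?thesis by blast
qed

lemma tree_action_linear: "y \<in> V \<Longrightarrow> tree_action W (\<lambda>u. c * \<phi> u + d * \<psi> u) y = c * tree_action W \<phi> y + d * tree_action W \<psi> y"
  by (simp add: tree_action_def sum.distrib sum_distrib_left algebra_simps)

text \<open>
  \<open>resolvent\<close> picks some preimage of \<open>delta \<nu> x\<close>; by \<open>eigenfunction_zero\<close> there is only one. So a Green
  function is known as soon as one square-summable solution is.
\<close>

lemma green_eqI:
  assumes r: "r \<in> V" and x: "x \<in> fwd r" and z: "Im z > 0"
    and K: "\<And>\<xi> y. \<xi> \<in> l2 (fwd r) \<nu> \<Longrightarrow> K \<xi> y = (if y \<in> fwd r then tree_action W \<xi> y else 0)"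
    and \<phi>: "\<phi> \<in> l2 (fwd r) \<nu>" and eq: "\<And>y. y \<in> fwd r \<Longrightarrow> tree_action W \<phi> y - z * \<phi> y = (if y = x then 1 else 0)"
  shows "green (fwd r) \<nu> x z K = \<phi> x"
proof -
  have xV: "x \<in> V" using x fwd_V by blast
  have nu: "\<nu> x > 0" using nu_pos xV by blast
  define c :: complex where "c = of_real (\<nu> x powr (-1/2))"
  define \<psi> where "\<psi> y = c * \<phi> y" for y
  have \<psi>: "\<psi> \<in> l2 (fwd r) \<nu>" unfolding \<psi>_def by (rule l2_scale[OF \<phi>])
  have out: "\<xi> y = 0" if "\<xi> \<in> l2 (fwd r) \<nu>" "y \<notin> fwd r" for \<xi> y using that by (auto simp: l2_def)
  define F where "F = (\<lambda>\<xi> y. K \<xi> y - z * \<xi> y)"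
  have F: "F \<psi> = delta \<nu> x"
  proof
    fix y
    show "F \<psi> y = delta \<nu> x y"
    proof (cases "y \<in> fwd r")
      case True
      then have "F \<psi> y = tree_action W (\<lambda>u. c * \<phi> u + 0 * \<phi> u) y - z * (c * \<phi> y)" using K[OF \<psi>] by (simp add: F_def \<psi>_def[abs_def])
      also have "\<dots> = c * (tree_action W \<phi> y - z * \<phi> y)" using tree_action_linear[of y W c \<phi> 0 \<phi>] True fwd_V(1) by (simp add: algebra_simps)
      also have "\<dots> = delta \<nu> x y" using eq[OF True] by (simp add: delta_def c_def)
      finally show ?thesis .
    next
      case False
      then have "y \<noteq> x" using x by auto
      then show ?thesis using False K[OF \<psi>] out[OF \<psi>] by (simp add: F_def delta_def)
    qed
  qed
  have inj: "\<xi> = \<psi>" if \<xi>: "\<xi> \<in> l2 (fwd r) \<nu>" and e: "F \<xi> = delta \<nu> x" for \<xi>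
  proof -
    define \<omega> where "\<omega> y = 1 * \<xi> y + (-1) * \<psi> y" for y
    have "\<omega> \<in> l2 (fwd r) \<nu>" unfolding \<omega>_def by (intro l2_add l2_scale \<xi> \<psi> fwd_V)
    moreover have "tree_action W \<omega> y = z * \<omega> y" if y: "y \<in> fwd r" for y
    proof -
      have "K \<xi> y - z * \<xi> y = K \<psi> y - z * \<psi> y" using fun_cong[OF e, of y] fun_cong[OF F, of y] by (simp add: F_def)
      then have "tree_action W \<xi> y - z * \<xi> y = tree_action W \<psi> y - z * \<psi> y" using K[OF \<xi>] K[OF \<psi>] y by simp
      moreover have yV: "y \<in> V" using y fwd_V by blast
      ultimately show ?thesis unfolding \<omega>_def[abs_def] tree_action_linear[OF yV] by (simp add: algebra_simps)
    qed
    ultimately have "\<omega> = (\<lambda>_. 0)" by (rule eigenfunction_zero[OF r z])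
    then show ?thesis by (auto simp: \<omega>_def fun_eq_iff)
  qed
  have "delta \<nu> x \<in> F ` l2 (fwd r) \<nu>" using F \<psi> by (metis imageI)
  then have "resolvent (fwd r) \<nu> K z (delta \<nu> x) = \<psi>"
    unfolding resolvent_def F_def[symmetric] using inj inv_into_into f_inv_into_f by metis
  then have "green (fwd r) \<nu> x z K = (\<Sum>\<^sub>\<infinity>y\<in>fwd r. cnj (delta \<nu> x y) * \<psi> y * of_real (\<nu> y))"
    by (simp add: green_def l2_inner_def)
  also have "\<dots> = (\<Sum>\<^sub>\<infinity>y\<in>{x}. cnj (delta \<nu> x y) * \<psi> y * of_real (\<nu> y))"
    by (rule infsum_cong_neutral) (use x in \<open>auto simp: delta_def\<close>)
  also have "\<dots> = c * (c * \<phi> x) * of_real (\<nu> x)" by (simp add: delta_def \<psi>_def c_def)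
  also have "\<dots> = of_real (\<nu> x powr (-1/2) * \<nu> x powr (-1/2) * \<nu> x powr 1) * \<phi> x" using nu by (simp add: c_def)
  also have "\<nu> x powr (-1/2) * \<nu> x powr (-1/2) * \<nu> x powr 1 = 1" unfolding powr_add[symmetric] using nu by simp
  finally show ?thesis by simp
qed

lemma green_forward_eq:
  assumes x: "x \<in> V" and z: "Im z > 0" and W: "\<And>y. y \<in> V \<Longrightarrow> \<bar>W y\<bar> \<le> B"
  shows "green_forward V adj rt \<nu> x z (tree_operator V adj t W) = fwd_green W z x"
proof -
  note g = fwd_green_solution[where W = W, OF z W]
  have "green (fwd x) \<nu> x z (compression (fwd x) (tree_operator V adj t W)) = fwd_solution (fwd_green W z) x x"
  proof (rule green_eqI[OF x fwd_self[OF x] z, where W = W and \<phi> = "fwd_solution (fwd_green W z) x"])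
    show "compression (fwd x) (tree_operator V adj t W) \<xi> y = (if y \<in> fwd x then tree_action W \<xi> y else 0)" for \<xi> y
      using fwd_V by (simp add: compression_def tree_operator_def tree_action_def)
    show "fwd_solution (fwd_green W z) x \<in> l2 (fwd x) \<nu>" by (rule fwd_solution_l2[OF g x z])
    show "tree_action W (fwd_solution (fwd_green W z) x) y - z * fwd_solution (fwd_green W z) x y = (if y = x then 1 else 0)" if "y \<in> fwd x" for y
      using fwd_solution_eq[OF g x, of y] that fwd_V par_not_fwd[OF x] by auto
  qed
  then show ?thesis using fwd_solution_root[OF x] by (simp add: green_forward_def)
qed

text \<open>
  \<open>parent_green g W z (dd x) x\<close> is the Green function at the parent of \<open>x\<close> of the tree without the forward tree
  of \<open>x\<close>. The recursion ascends the path to the root, where nothing remains.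
\<close>

primrec parent_green :: "('v \<Rightarrow> complex) \<Rightarrow> ('v \<Rightarrow> real) \<Rightarrow> complex \<Rightarrow> nat \<Rightarrow> 'v \<Rightarrow> complex" where
  "parent_green g W z 0 x = 0"
| "parent_green g W z (Suc n) x = - 1 / (z - of_real (W (par x)) + (\<Sum>u\<in>ch (par x) - {x}. of_real (cc (par x) u) * g u)
     + of_real (cc (par (par x)) (par x)) * parent_green g W z n (par x))"

definition "parent_term g W z x = of_real (cc (par x) x) * parent_green g W z (dd x) x"

definition "full_green g W z x = - 1 / (z - of_real (W x) + (\<Sum>u\<in>ch x. of_real (cc x u) * g u) + parent_term g W z x)"

lemma dd_rt: "dd rt = 0" using dd_pth[OF rt_V] pth_rt by simp

lemma parent_term_rt: "parent_term g W z rt = 0" by (simp add: parent_term_def dd_rt)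

lemma parent_term_ch: "y \<in> ch x \<Longrightarrow> parent_term g W z y =
   of_real (cc x y) * (- 1 / (z - of_real (W x) + (\<Sum>u\<in>ch x - {y}. of_real (cc x u) * g u) + parent_term g W z x))"
  by (simp add: parent_term_def ch_dd par_ch)

lemma tree_induct [consumes 1, case_names root step]:
  assumes "x \<in> V" "P rt" "\<And>x y. x \<in> V \<Longrightarrow> P x \<Longrightarrow> y \<in> ch x \<Longrightarrow> P y" shows "P x"
proof -
  have "x \<in> fwd rt" using assms(1) fwd_rt by simp
  then show ?thesis by (induction rule: fwd_induct) (use assms(2,3) fwd_rt in auto)
qed

lemma Im_sum_minus:
  assumes "\<And>u. u \<in> V \<Longrightarrow> Im (g u) > 0"
  shows "Im (\<Sum>u\<in>ch x - A. of_real (cc x u) * g u) \<ge> 0"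
proof -
  have "0 \<le> cc x u * Im (g u)" if "u \<in> ch x" for u
    using assms[OF ch_V(2)[OF that]] cc_pos[OF that] by simp
  then show ?thesis by (auto intro!: sum_nonneg)
qed

lemma Im_of_real_mult: "Im (of_real c * q) = c * Im q" by simp

lemma Im_parent_term:
  assumes "\<And>u. u \<in> V \<Longrightarrow> Im (g u) > 0" and z: "Im z > 0"
  shows "x \<in> V \<Longrightarrow> Im (parent_term g W z x) \<ge> 0"
proof (induction rule: tree_induct)
  case root
  show ?case by (simp add: parent_term_rt)
next
  case (step x y)
  have "Im (z - of_real (W x) + (\<Sum>u\<in>ch x - {y}. of_real (cc x u) * g u) + parent_term g W z x) > 0"
    using Im_sum_minus[of g x "{y}"] assms step.IH by simp
  from Im_neg_inverse_pos[OF this] show ?case unfolding parent_term_ch[OF step.hyps(2)] Im_of_real_mult using cc_pos[OF step.hyps(2)] by (intro mult_nonneg_nonneg less_imp_le)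
qed

lemma Im_full_green_denominator:
  assumes "\<And>u. u \<in> V \<Longrightarrow> Im (g u) > 0" and z: "Im z > 0" and x: "x \<in> V"
  shows "Im (z - of_real (W x) + (\<Sum>u\<in>ch x. of_real (cc x u) * g u) + parent_term g W z x) \<ge> Im z + (\<Sum>u\<in>ch x. cc x u * Im (g u))"
  using Im_parent_term[OF assms] by simp

lemma Im_full_green_pos:
  assumes "\<And>u. u \<in> V \<Longrightarrow> Im (g u) > 0" and z: "Im z > 0" and x: "x \<in> V"
  shows "Im (full_green g W z x) > 0"
proof -
  have "(\<Sum>u\<in>ch x. cc x u * Im (g u)) \<ge> 0" using Im_sum_minus[of g x "{}"] assms by simp
  then show ?thesis unfolding full_green_def using Im_full_green_denominator[where W = W and g = g, OF assms] z by (intro Im_neg_inverse_pos) linarith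
qed

text \<open>
  The column of the resolvent at a child \<open>y\<close> of \<open>x\<close> is the forward solution of \<open>y\<close> plus the multiple of the
  column at \<open>x\<close> that cancels the value at \<open>x\<close>. To evaluate the result at \<open>y\<close> one needs the old column there,
  hence the last clause: off the path to \<open>x\<close> it continues by the same product as a forward solution.
\<close>

lemma full_solution:
  assumes g: "herglotz_solution W z g" and z: "Im z > 0"
  shows "x \<in> V \<Longrightarrow> \<exists>\<phi>\<in>l2 V \<nu>. (\<forall>y\<in>V. tree_action W \<phi> y - z * \<phi> y = (if y = x then 1 else 0)) \<and> \<phi> x = full_green g W z x \<and>
     (\<forall>u\<in>V. u \<notin> set (pth x) \<longrightarrow> \<phi> u = - t u (par u) * \<phi> (par u) * g u)"
proof (induction rule: tree_induct)
  case root
  have gr: "- 1 / g rt = z - of_real (W rt) + (\<Sum>u\<in>ch rt. of_real (cc rt u) * g u)"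
    using g rt_V by (simp add: herglotz_solution_def)
  have "full_green g W z rt = g rt" unfolding full_green_def parent_term_rt add_0_right gr[symmetric] by simp
  moreover have "fwd_solution g rt \<in> l2 V \<nu>" using fwd_solution_l2[OF g rt_V z] fwd_rt by simp
  moreover have "fwd_solution g rt u = - t u (par u) * fwd_solution g rt (par u) * g u" if "u \<in> V" "u \<noteq> rt" for u
    using fwd_solution_ch[of "par u" rt u g] in_ch_par[OF that] par_V[OF that] fwd_rt by simp
  ultimately show ?case using fwd_solution_eq[OF g rt_V] fwd_solution_root[OF rt_V]
    by (intro bexI[of _ "fwd_solution g rt"]) (auto simp: pth_rt)
next
  case (step x y)
  note y = step.hyps(2)
  have yV: "y \<in> V" using y ch_V by blast
  from step.IH obtain \<phi> where \<phi>: "\<phi> \<in> l2 V \<nu>" "\<And>y. y \<in> V \<Longrightarrow> tree_action W \<phi> y - z * \<phi> y = (if y = x then 1 else 0)"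
    "\<phi> x = full_green g W z x" "\<And>u. u \<in> V \<Longrightarrow> u \<notin> set (pth x) \<Longrightarrow> \<phi> u = - t u (par u) * \<phi> (par u) * g u" by blast
  define \<phi>' where "\<phi>' u = 1 * fwd_solution g y u + (- t x y * g y) * \<phi> u" for u
  have y_rt: "y \<noteq> rt" using y rt_not_ch by blast
  have gp: "\<And>u. u \<in> V \<Longrightarrow> Im (g u) > 0" using g by (auto simp: herglotz_solution_def)
  have ypth: "y \<notin> set (pth x)" using ch_pth[OF y] pth_simps(5)[OF yV] by simp
  have l2: "\<phi>' \<in> l2 V \<nu>" unfolding \<phi>'_def
    by (intro l2_add l2_scale \<phi>(1) l2_mono[OF fwd_solution_l2[OF g yV z] fwd_V(2)]) simp
  have eq: "tree_action W \<phi>' u - z * \<phi>' u = (if u = y then 1 else 0)" if u: "u \<in> V" for u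
  proof -
    have "tree_action W \<phi>' u - z * \<phi>' u = (tree_action W (fwd_solution g y) u - z * fwd_solution g y u) + (- t x y * g y) * (tree_action W \<phi> u - z * \<phi> u)"
      unfolding \<phi>'_def[abs_def] tree_action_linear[OF u] by (simp add: algebra_simps)
    also have "\<dots> = (if u = y then 1 else 0)"
      unfolding fwd_solution_eq[OF g yV u] \<phi>(2)[OF u] using y_rt par_ch[OF y] ch_dd[OF y] by auto
    finally show ?thesis .
  qed
  have val: "\<phi>' y = full_green g W z y"
  proof -
    define c where "c = complex_of_real (cc x y)"
    define q where "q = z - of_real (W y) + (\<Sum>u\<in>ch y. of_real (cc y u) * g u)"
    define b where "b = z - of_real (W x) + (\<Sum>u\<in>ch x - {y}. of_real (cc x u) * g u) + parent_term g W z x"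
    have xV: "x \<in> V" using y ch_V by blast
    have Ib: "Im b > 0" unfolding b_def using Im_sum_minus[of g x "{y}"] gp Im_parent_term[of g z x W] z xV by simp
    have gy: "- 1 / g y = q" using g yV by (auto simp: herglotz_solution_def q_def)
    have gy0: "g y \<noteq> 0" using gp[OF yV] by auto
    have q0: "q \<noteq> 0" using gy gy0 by (metis divide_eq_0_iff neg_equal_0_iff_equal zero_neq_one)
    have gq: "g y = - 1 / q" using gy gy0 q0 by (simp add: field_simps)
    have Gx: "full_green g W z x = - 1 / (b + c * g y)"
    proof -
      have "(\<Sum>u\<in>ch x. of_real (cc x u) * g u) = c * g y + (\<Sum>u\<in>ch x - {y}. of_real (cc x u) * g u)"
        unfolding c_def by (rule sum.remove[OF finite_ch y])
      then show ?thesis by (simp add: full_green_def b_def algebra_simps)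
    qed
    have Gy: "full_green g W z y = - 1 / (q + c * (- 1 / b))" unfolding full_green_def parent_term_ch[OF y] q_def b_def c_def ..
    have b0: "b \<noteq> 0" using Ib by auto
    have "Im (q + c * (- 1 / b)) > 0"
      using Im_full_green_denominator[where W = W and g = g, OF gp z yV] z Im_sum_minus[of g y "{}"] gp unfolding parent_term_ch[OF y]
      by (simp add: q_def b_def c_def)
    then have "q + c * (- 1 / b) \<noteq> 0" by (metis less_irrefl zero_complex.sel(2))
    then have n0: "q * b - c \<noteq> 0" using b0 by (simp add: field_simps)
    have "\<phi>' y = g y + (- t x y * g y) * (- t y x * full_green g W z x * g y)"
      unfolding \<phi>'_def using \<phi>(4)[OF yV ypth] par_ch[OF y] \<phi>(3) fwd_solution_root[OF yV] by simp
    also have "\<dots> = g y + c * g y * g y * full_green g W z x" by (simp add: c_def cc_t[OF y] algebra_simps)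
    also have "\<dots> = - 1 / q - c / (q * q) * (1 / (b - c / q))" unfolding Gx gq by simp
    also have "b - c / q = (q * b - c) / q" using q0 by (simp add: field_simps)
    also have "- 1 / q - c / (q * q) * (1 / ((q * b - c) / q)) = - b / (q * b - c)" using q0 n0 by (simp add: field_simps)
    also have "\<dots> = - 1 / (q + c * (- 1 / b))" using b0 n0 by (simp add: field_simps)
    finally show ?thesis using Gy by simp
  qed
  have "\<phi>' u = - t u (par u) * \<phi>' (par u) * g u" if u: "u \<in> V" "u \<notin> set (pth y)" for u
  proof -
    have uy: "u \<noteq> y" "u \<notin> set (pth x)" using u ch_pth[OF y] by auto
    have ur: "u \<noteq> rt" using u pth_simps(8)[OF yV] by auto
    have "fwd_solution g y u = - t u (par u) * fwd_solution g y (par u) * g u"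
    proof (cases "u \<in> fwd y")
      case True
      from fwd_par[OF True uy(1)] show ?thesis using fwd_solution_ch by blast
    next
      case False
      then have "par u \<notin> fwd y" using fwd_ch in_ch_par[OF u(1) ur] by blast
      then show ?thesis using False fwd_solution_out by simp
    qed
    then show ?thesis unfolding \<phi>'_def using \<phi>(4)[OF u(1) uy(2)] by (simp add: algebra_simps)
  qed
  then show ?case using l2 eq val by (intro bexI[of _ \<phi>']) auto
qed

lemma green_full_eq:
  assumes x: "x \<in> V" and z: "Im z > 0" and W: "\<And>y. y \<in> V \<Longrightarrow> \<bar>W y\<bar> \<le> B"
    and K: "\<And>\<xi> y. \<xi> \<in> l2 V \<nu> \<Longrightarrow> K \<xi> y = (if y \<in> V then tree_action W \<xi> y else 0)"
  shows "green V \<nu> x z K = full_green (fwd_green W z) W z x"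
proof -
  note g = fwd_green_solution[where W = W, OF z W]
  from full_solution[OF g z x] obtain \<phi> where \<phi>: "\<phi> \<in> l2 V \<nu>"
    "\<And>y. y \<in> V \<Longrightarrow> tree_action W \<phi> y - z * \<phi> y = (if y = x then 1 else 0)" "\<phi> x = full_green (fwd_green W z) W z x" by blast
  have "green (fwd rt) \<nu> x z K = \<phi> x"
    by (rule green_eqI[OF rt_V _ z, where \<phi> = \<phi> and W = W]) (use K \<phi> x in \<open>simp_all add: fwd_rt\<close>)
  then show ?thesis using \<phi>(3) by (simp add: fwd_rt)
qed

lemma green_iter_holomorphic: "y \<in> V \<Longrightarrow> (\<lambda>z. green_iter n W z y) holomorphic_on {z. Im z > 0}"
proof (induction n arbitrary: y)
  case (Suc n)
  have "z - of_real (W y) + (\<Sum>u\<in>ch y. of_real (cc y u) * green_iter n W z u) \<noteq> 0" if "Im z > 0" for z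
  proof -
    have "Im (z - of_real (W y) + (\<Sum>u\<in>ch y. of_real (cc y u) * green_iter n W z u)) \<ge> Im z"
      by (rule Im_sum_ge) (use Im_green_iter_pos[OF that] ch_V in \<open>auto intro: less_imp_le\<close>)
    then show ?thesis using that by (metis not_le zero_complex.sel(2))
  qed
  then show ?case unfolding green_iter.simps using Suc ch_V by (intro holomorphic_intros) auto
qed simp

lemma fwd_green_holomorphic:
  assumes y: "y \<in> V" and W: "\<And>y. y \<in> V \<Longrightarrow> \<bar>W y\<bar> \<le> B"
  shows "(\<lambda>z. fwd_green W z y) holomorphic_on {z. Im z > 0}"
proof (rule holomorphic_uniform_sequence)
  show "open {z. Im z > 0}" by (simp add: open_halfspace_Im_gt)
  show "(\<lambda>z. green_iter (Suc (Suc n)) W z y) holomorphic_on {z. Im z > 0}" for n by (rule green_iter_holomorphic[OF y])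
  fix z0 assume "z0 \<in> {z. Im z > 0}"
  then have z0: "Im z0 > 0" by simp
  define \<eta> where "\<eta> = min 1 (Im z0 / 2)"
  have \<eta>: "0 < \<eta>" "\<eta> \<le> 1" using z0 by (auto simp: \<eta>_def)
  define R where "R = cmod z0 + \<eta>"
  have B: "B \<ge> 0" using W[OF y] by linarith
  have ball: "\<eta> \<le> Im z \<and> cmod z \<le> R" if "z \<in> cball z0 \<eta>" for z
  proof -
    have d: "cmod (z0 - z) \<le> \<eta>" using that by (simp add: dist_norm)
    have "Im z0 - Im z \<le> \<eta>" using d abs_Im_le_cmod[of "z0 - z"] by simp
    moreover have "2 * \<eta> \<le> Im z0" by (simp add: \<eta>_def)
    moreover have "cmod z \<le> cmod z0 + cmod (z0 - z)" by (metis norm_minus_commute norm_triangle_sub)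
    ultimately show ?thesis using d by (simp add: R_def)
  qed
  define C where "C = 2 / (\<eta>\<^sup>2 * Imlow B R \<eta>)"
  define \<rho> where "\<rho> = sqrt (cc_sum_bound / (cc_sum_bound + \<eta>\<^sup>2))"
  have \<rho>: "0 \<le> \<rho>" "\<rho> < 1" using rho_less1[OF \<eta>(1)] cc_sum_bound(1) by (auto simp: \<rho>_def)
  have "(\<lambda>k. C * \<rho> ^ k) \<longlonglongrightarrow> C * 0" by (rule tendsto_mult[OF tendsto_const LIMSEQ_power_zero]) (use \<rho> in simp)
  then have lim: "(\<lambda>k. C * \<rho> ^ k) \<longlonglongrightarrow> 0" by simp
  have "uniform_limit (cball z0 \<eta>) (\<lambda>n z. green_iter (Suc (Suc n)) W z y) (\<lambda>z. fwd_green W z y) sequentially"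
  proof (rule uniform_limitI)
    fix e :: real assume "e > 0"
    then have "eventually (\<lambda>k. C * \<rho> ^ k < e) sequentially" by (rule order_tendstoD(2)[OF lim])
    then show "\<forall>\<^sub>F n in sequentially. \<forall>z\<in>cball z0 \<eta>. dist (green_iter (Suc (Suc n)) W z y) (fwd_green W z y) < e"
    proof eventually_elim
      case (elim k)
      have "cmod (green_iter (Suc (Suc k)) W z y - fwd_green W z y) \<le> C * \<rho> ^ k" if "z \<in> cball z0 \<eta>" for z
        unfolding C_def \<rho>_def by (rule fwd_green_uniform) (use \<eta> B W y ball[OF that] in \<open>auto simp: R_def\<close>)
      then show ?case using elim by (force simp: dist_norm)
    qed
  qed
  moreover have "cball z0 \<eta> \<subseteq> {z. Im z > 0}" using ball \<eta> by force
  ultimately show "\<exists>d. 0 < d \<and> cball z0 d \<subseteq> {z. Im z > 0} \<and>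
      uniform_limit (cball z0 d) (\<lambda>n z. green_iter (Suc (Suc n)) W z y) (\<lambda>z. fwd_green W z y) sequentially"
    using \<eta> by blast
qed

lemma full_green_holomorphic:
  assumes x: "x \<in> V" and W: "\<And>y. y \<in> V \<Longrightarrow> \<bar>W y\<bar> \<le> B"
  shows "(\<lambda>z. full_green (fwd_green W z) W z x) holomorphic_on {z. Im z > 0}"
proof -
  have gp: "Im (fwd_green W z u) > 0" if "Im z > 0" "u \<in> V" for z u
    using fwd_green_solution[where W = W, OF that(1) W] that(2) by (auto simp: herglotz_solution_def)
  note hol = fwd_green_holomorphic[where W = W, OF _ W]
  have parent_term: "(\<lambda>z. parent_term (fwd_green W z) W z x) holomorphic_on {z. Im z > 0}" using x
  proof (induction rule: tree_induct)
    case (step x y)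
    have "z - of_real (W x) + (\<Sum>u\<in>ch x - {y}. of_real (cc x u) * fwd_green W z u) + parent_term (fwd_green W z) W z x \<noteq> 0" if z: "Im z > 0" for z
    proof -
      have "Im (z - of_real (W x) + (\<Sum>u\<in>ch x - {y}. of_real (cc x u) * fwd_green W z u) + parent_term (fwd_green W z) W z x) > 0"
        using Im_sum_minus[of "fwd_green W z" x "{y}"] gp[OF z] Im_parent_term[of "fwd_green W z" z x W] z step.hyps(1) by simp
      then show ?thesis by (metis less_irrefl zero_complex.sel(2))
    qed
    then show ?case unfolding parent_term_ch[OF step.hyps(2)] using step ch_V hol by (intro holomorphic_intros) auto
  qed (simp add: parent_term_rt)
  have "z - of_real (W x) + (\<Sum>u\<in>ch x. of_real (cc x u) * fwd_green W z u) + parent_term (fwd_green W z) W z x \<noteq> 0" if z: "Im z > 0" for z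
  proof -
    have "Im (z - of_real (W x) + (\<Sum>u\<in>ch x. of_real (cc x u) * fwd_green W z u) + parent_term (fwd_green W z) W z x) > 0"
      using Im_sum_minus[of "fwd_green W z" x "{}"] gp[OF z] Im_parent_term[of "fwd_green W z" z x W] z x by simp
    then show ?thesis by (metis less_irrefl zero_complex.sel(2))
  qed
  then show ?thesis unfolding full_green_def using parent_term ch_V hol by (intro holomorphic_intros) auto
qed

end

section \<open>Moments of the random displacement\<close>

context tree_op
begin

lemma green_iter_measurable:
  assumes "\<And>y. y \<in> V \<Longrightarrow> (\<lambda>x. W x y) \<in> borel_measurable N" "Z \<in> borel_measurable N" "y \<in> V"
  shows "(\<lambda>x. green_iter n (W x) (Z x) y) \<in> borel_measurable N"
  using assms(3)
proof (induction n arbitrary: y)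
  case (Suc n)
  have [measurable]: "(\<lambda>x. green_iter n (W x) (Z x) u) \<in> borel_measurable N" if "u \<in> ch y" for u using Suc.IH ch_V that by blast
  have [measurable]: "(\<lambda>x. W x y) \<in> borel_measurable N" "Z \<in> borel_measurable N" using assms Suc.prems by auto
  show ?case unfolding green_iter.simps by measurable
qed simp

lemma fwd_green_measurable:
  assumes "\<And>y. y \<in> V \<Longrightarrow> (\<lambda>x. W x y) \<in> borel_measurable N" "Z \<in> borel_measurable N" "y \<in> V"
    and "\<And>x. x \<in> space N \<Longrightarrow> Im (Z x) > 0" "\<And>x y. x \<in> space N \<Longrightarrow> y \<in> V \<Longrightarrow> \<bar>W x y\<bar> \<le> B"
  shows "(\<lambda>x. fwd_green (W x) (Z x) y) \<in> borel_measurable N"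
  by (rule borel_measurable_LIMSEQ_metric[OF green_iter_measurable[OF assms(1-3)] green_iter_tendsto]) (use assms(3-5) in auto)

lemma parent_term_measurable:
  assumes W: "\<And>y. y \<in> V \<Longrightarrow> (\<lambda>x. W x y) \<in> borel_measurable N" and Z: "Z \<in> borel_measurable N" and y: "y \<in> V"
    and pos: "\<And>x. x \<in> space N \<Longrightarrow> Im (Z x) > 0" and bd: "\<And>x y. x \<in> space N \<Longrightarrow> y \<in> V \<Longrightarrow> \<bar>W x y\<bar> \<le> B"
  shows "(\<lambda>x. parent_term (fwd_green (W x) (Z x)) (W x) (Z x) y) \<in> borel_measurable N"
  using y
proof (induction rule: tree_induct)
  case (step x y)
  note [measurable] = Z
  have [measurable]: "(\<lambda>w. W w x) \<in> borel_measurable N" "(\<lambda>w. parent_term (fwd_green (W w) (Z w)) (W w) (Z w) x) \<in> borel_measurable N"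
    using W step by auto
  have [measurable]: "(\<lambda>w. fwd_green (W w) (Z w) u) \<in> borel_measurable N" if "u \<in> ch x - {y}" for u
    by (rule fwd_green_measurable[where B = B]) (use W Z pos bd ch_V that in auto)
  show ?case unfolding parent_term_ch[OF step.hyps(2)] by measurable
qed (simp add: parent_term_rt)

lemma full_green_measurable:
  assumes W: "\<And>y. y \<in> V \<Longrightarrow> (\<lambda>x. W x y) \<in> borel_measurable N" and Z: "Z \<in> borel_measurable N" and y: "y \<in> V"
    and pos: "\<And>x. x \<in> space N \<Longrightarrow> Im (Z x) > 0" and bd: "\<And>x y. x \<in> space N \<Longrightarrow> y \<in> V \<Longrightarrow> \<bar>W x y\<bar> \<le> B"
  shows "(\<lambda>x. full_green (fwd_green (W x) (Z x)) (W x) (Z x) y) \<in> borel_measurable N"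
proof -
  note [measurable] = Z
  have G [measurable]: "(\<lambda>x. fwd_green (W x) (Z x) u) \<in> borel_measurable N" if "u \<in> V" for u
    by (rule fwd_green_measurable[where B = B]) (use W Z pos bd that in auto)
  have parent_term: "(\<lambda>x. parent_term (fwd_green (W x) (Z x)) (W x) (Z x) y) \<in> borel_measurable N"
    by (rule parent_term_measurable[where B = B]) (use W Z y pos bd in auto)
  have [measurable]: "(\<lambda>w. fwd_green (W w) (Z w) u) \<in> borel_measurable N" if "u \<in> ch y" for u using G ch_V that by blast
  note [measurable] = parent_term W[OF y]
  show ?thesis unfolding full_green_def by measurable
qed

lemma fwd_green_cong: "(\<And>u. u \<in> fwd x \<Longrightarrow> W u = W' u) \<Longrightarrow> x \<in> V \<Longrightarrow> fwd_green W z x = fwd_green W' z x"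
  unfolding fwd_green_def using green_iter_cong[of x W W'] by simp

lemma fwd_green_iso:
  assumes "\<forall>u\<in>fwd x. \<psi> u \<in> fwd y \<and> a (\<psi> u) = a u \<and> bij_betw \<psi> (ch u) (ch (\<psi> u))"
    and "\<And>u. u \<in> fwd x \<Longrightarrow> W' u = W (\<psi> u)" and "x \<in> V"
  shows "fwd_green W' z x = fwd_green W z (\<psi> x)"
proof -
  have "green_iter n W' z x = green_iter n W z (\<psi> x)" for n
    by (rule green_iter_iso[OF assms(1)]) (use assms fwd_self in auto)
  then show ?thesis by (simp add: fwd_green_def)
qed

lemma fwd_green_bounds:
  assumes z: "Im z > 0" and W: "\<And>y. y \<in> V \<Longrightarrow> \<bar>W y\<bar> \<le> B" and y: "y \<in> V"
  shows "cmod (fwd_green W z y) \<le> 1 / Im z" "Im (fwd_green W z y) \<ge> Imlow B (cmod z) (Im z)"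
proof -
  have lim: "(\<lambda>n. green_iter n W z y) \<longlonglongrightarrow> fwd_green W z y" by (rule green_iter_tendsto) (use z W y in auto)
  have "(\<lambda>n. cmod (green_iter n W z y)) \<longlonglongrightarrow> cmod (fwd_green W z y)" using lim by (rule tendsto_norm)
  moreover have "\<exists>N. \<forall>n\<ge>N. cmod (green_iter n W z y) \<le> 1 / Im z"
  proof (intro exI[of _ 1] allI impI)
    fix n :: nat assume "1 \<le> n"
    then obtain m where "n = Suc m" by (cases n) auto
    then show "cmod (green_iter n W z y) \<le> 1 / Im z" using cmod_green_iter_le[OF z y] by simp
  qed
  ultimately show "cmod (fwd_green W z y) \<le> 1 / Im z" by (rule LIMSEQ_le_const2)
  have "(\<lambda>n. Im (green_iter n W z y)) \<longlonglongrightarrow> Im (fwd_green W z y)" using lim by (rule tendsto_Im)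
  moreover have "\<exists>N. \<forall>n\<ge>N. Imlow B (cmod z) (Im z) \<le> Im (green_iter n W z y)"
  proof (intro exI[of _ 2] allI impI)
    fix n :: nat assume "2 \<le> n"
    then obtain m where "n = 2 + m" using le_Suc_ex by blast
    then have "n = Suc (Suc m)" by simp
    then show "Imlow B (cmod z) (Im z) \<le> Im (green_iter n W z y)" using Im_green_iter_ge[OF z order_refl order_refl y W] by simp
  qed
  ultimately show "Im (fwd_green W z y) \<ge> Imlow B (cmod z) (Im z)" by (rule LIMSEQ_le_const)
qed

end

locale random_tree_op = tree_op V adj rt M a \<nu> t + prob_space P
  for V :: "'v set" and adj rt and M :: "nat ^'a ^('a::finite)" and a \<nu> t and P :: "'w measure" +
  fixes w :: "'v \<Rightarrow> real" and v :: "'w \<Rightarrow> 'v \<Rightarrow> real"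
  assumes w_label: "x \<in> V \<Longrightarrow> y \<in> V \<Longrightarrow> a x = a y \<Longrightarrow> w x = w y"
    and rpot: "random_potential P V adj rt a v"
begin

text \<open>
  On \<open>space P\<close> the potential takes values in \<open>[-1, 1]\<close>, where clamping changes nothing. Outside it only
  serves to have the bounds below for every \<open>\<omega>\<close>.
\<close>

definition "clamp1 r = max (-1) (min 1 (r::real))"

lemma clamp1: "\<bar>clamp1 r\<bar> \<le> 1" "-1 \<le> r \<Longrightarrow> r \<le> 1 \<Longrightarrow> clamp1 r = r"
  by (auto simp: clamp1_def)

lemma clamp1_measurable [measurable]: "clamp1 \<in> borel_measurable borel"
  unfolding clamp1_def by measurable

definition "pot lam \<omega> y = w y + lam * clamp1 (v \<omega> y)"
definition "gr lam z \<omega> y = fwd_green (pot lam \<omega>) z y"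
definition "g0 z y = fwd_green w z y"
text \<open>
  The summand 1 is the room taken by the random potential for \<open>lam \<le> 1\<close>.
\<close>

definition "Bw = (SOME B. B > 0 \<and> (\<forall>y\<in>V. \<bar>w y\<bar> \<le> B)) + 1"

lemma pot_bound: assumes "y \<in> V" shows "\<bar>w y\<bar> \<le> Bw" "0 \<le> lam \<Longrightarrow> lam \<le> 1 \<Longrightarrow> \<bar>pot lam \<omega> y\<bar> \<le> Bw"
proof -
  have "\<exists>B>0. \<forall>y\<in>V. \<bar>w y\<bar> \<le> B" by (rule vertex_bounded) (metis w_label)
  from someI_ex[OF this] have B: "\<bar>w y\<bar> + 1 \<le> Bw" using assms by (auto simp: Bw_def)
  then show "\<bar>w y\<bar> \<le> Bw" by simp
  assume l: "0 \<le> lam" "lam \<le> 1"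
  have "\<bar>lam * clamp1 (v \<omega> y)\<bar> \<le> 1 * 1" unfolding abs_mult using l clamp1 by (intro mult_mono) auto
  then show "\<bar>pot lam \<omega> y\<bar> \<le> Bw" unfolding pot_def using B by linarith
qed

lemma v_measurable: "y \<in> V \<Longrightarrow> (\<lambda>\<omega>. v \<omega> y) \<in> borel_measurable P"
  using rpot by (simp add: random_potential_def)

lemma pot_measurable: "y \<in> V \<Longrightarrow> (\<lambda>\<omega>. pot lam \<omega> y) \<in> borel_measurable P"
  unfolding pot_def using v_measurable by measurable

lemma pot_eq: "\<omega> \<in> space P \<Longrightarrow> y \<in> V \<Longrightarrow> pot lam \<omega> y = w y + lam * v \<omega> y"
  using rpot clamp1(2) by (auto simp: pot_def random_potential_def)

lemma gr_solution: "Im z > 0 \<Longrightarrow> 0 \<le> lam \<Longrightarrow> lam \<le> 1 \<Longrightarrow> herglotz_solution (pot lam \<omega>) z (gr lam z \<omega>)"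
  unfolding gr_def[abs_def] by (rule fwd_green_solution) (use pot_bound in auto)

lemma g0_solution: "Im z > 0 \<Longrightarrow> herglotz_solution w z (g0 z)"
  unfolding g0_def[abs_def] by (rule fwd_green_solution) (use pot_bound in auto)

lemma gr_pos: "Im z > 0 \<Longrightarrow> 0 \<le> lam \<Longrightarrow> lam \<le> 1 \<Longrightarrow> y \<in> V \<Longrightarrow> Im (gr lam z \<omega> y) > 0"
  using gr_solution by (auto simp: herglotz_solution_def)

lemma g0_pos: "Im z > 0 \<Longrightarrow> y \<in> V \<Longrightarrow> Im (g0 z y) > 0"
  using g0_solution by (auto simp: herglotz_solution_def)

lemma g0_label: "x \<in> V \<Longrightarrow> y \<in> V \<Longrightarrow> a x = a y \<Longrightarrow> g0 z x = g0 z y"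
  unfolding g0_def by (rule fwd_green_label[where W = w]) (assumption | rule w_label)+

lemma gr_measurable:
  assumes "Im z > 0" "0 \<le> lam" "lam \<le> 1" "y \<in> V"
  shows "(\<lambda>\<omega>. gr lam z \<omega> y) \<in> borel_measurable P"
  unfolding gr_def by (rule fwd_green_measurable[where B = Bw]) (use assms pot_measurable pot_bound in auto)

text \<open>
  The forward Green function at \<open>y\<close> as a function of the potential on the forward tree of \<open>y\<close> alone, to
  which (P1) and (P2) refer.
\<close>

definition "gr_of_potential lam z y f = fwd_green (\<lambda>u. w u + lam * clamp1 (if u \<in> fwd y then f u else 0)) z y"

lemma gr_of_potential_measurable:
  assumes "Im z > 0" "0 \<le> lam" "lam \<le> 1" "y \<in> V"
  shows "gr_of_potential lam z y \<in> borel_measurable (\<Pi>\<^sub>M u\<in>fwd y. borel)"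
  unfolding gr_of_potential_def
proof (rule fwd_green_measurable[where B = Bw])
  fix u assume u: "u \<in> V"
  show "(\<lambda>f. w u + lam * clamp1 (if u \<in> fwd y then f u else 0)) \<in> borel_measurable (\<Pi>\<^sub>M u\<in>fwd y. borel)"
    by (cases "u \<in> fwd y") (simp_all, measurable)
  show "\<bar>w u + lam * clamp1 (if u \<in> fwd y then f u else 0)\<bar> \<le> Bw" for f
    using pot_bound(2)[OF u assms(2,3)] assms u
  proof -
    have "\<exists>B>0. \<forall>y\<in>V. \<bar>w y\<bar> \<le> B" by (rule vertex_bounded) (metis w_label)
    from someI_ex[OF this] have B: "\<bar>w u\<bar> + 1 \<le> Bw" using u by (auto simp: Bw_def)
    have "\<bar>lam * clamp1 (if u \<in> fwd y then f u else 0)\<bar> \<le> 1 * 1"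
      unfolding abs_mult using assms clamp1(1) by (intro mult_mono) auto
    then show ?thesis using B by linarith
  qed
qed (use assms in auto)

lemma gr_gr_of_potential: "y \<in> V \<Longrightarrow> gr lam z \<omega> y = gr_of_potential lam z y (\<lambda>u\<in>fwd y. v \<omega> u)"
  unfolding gr_def gr_of_potential_def by (rule fwd_green_cong) (auto simp: pot_def)

lemma gr_indep:
  assumes z: "Im z > 0" "0 \<le> lam" "lam \<le> 1" and X: "finite X" "X \<subseteq> V" "disjoint_family_on fwd X"
  shows "indep_vars (\<lambda>_. borel) (\<lambda>y \<omega>. gr lam z \<omega> y) X"
proof -
  have "indep_vars (\<lambda>x. \<Pi>\<^sub>M u\<in>fwd x. borel) (\<lambda>x \<omega>. \<lambda>u\<in>fwd x. v \<omega> u) X"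
    using rpot X by (simp add: random_potential_def P1_def)
  then have "indep_vars (\<lambda>_. borel) (\<lambda>x \<omega>. gr_of_potential lam z x (\<lambda>u\<in>fwd x. v \<omega> u)) X"
    by (rule indep_vars_compose2) (use gr_of_potential_measurable z X in auto)
  then show ?thesis
    by (rule indep_vars_cong[THEN iffD1, rotated 3]) (use X gr_gr_of_potential in auto)
qed

text \<open>
  An isomorphism of forward trees that preserves labels leaves the recursion unchanged, and by (P2)
  the distribution of the potential.
\<close>

lemma gr_law:
  assumes z: "Im z > 0" "0 \<le> lam" "lam \<le> 1" and xy: "x \<in> V" "y \<in> V" "a x = a y"
  shows "distr P borel (\<lambda>\<omega>. gr lam z \<omega> x) = distr P borel (\<lambda>\<omega>. gr lam z \<omega> y)"
proof -
  obtain \<psi> where \<psi>: "graph_isomorphism adj (fwd x) (fwd y) \<psi>" "\<psi> x = y"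
    "\<forall>u\<in>fwd x. \<psi> u \<in> fwd y \<and> a (\<psi> u) = a u \<and> bij_betw \<psi> (ch u) (ch (\<psi> u))"
    using forward_tree_iso[OF xy] by blast
  have law: "distr P (\<Pi>\<^sub>M u\<in>fwd x. borel) (\<lambda>\<omega>. \<lambda>u\<in>fwd x. v \<omega> u) = distr P (\<Pi>\<^sub>M u\<in>fwd x. borel) (\<lambda>\<omega>. \<lambda>u\<in>fwd x. v \<omega> (\<psi> u))"
    using rpot xy \<psi>(1) by (auto simp: random_potential_def P2_def)
  note [measurable] = gr_of_potential_measurable[OF z xy(1)]
  have m1: "(\<lambda>\<omega>. \<lambda>u\<in>fwd x. v \<omega> u) \<in> measurable P (\<Pi>\<^sub>M u\<in>fwd x. borel)"
    by (rule measurable_restrict) (use v_measurable fwd_V in auto)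
  have m2: "(\<lambda>\<omega>. \<lambda>u\<in>fwd x. v \<omega> (\<psi> u)) \<in> measurable P (\<Pi>\<^sub>M u\<in>fwd x. borel)"
    by (rule measurable_restrict) (use v_measurable fwd_V \<psi>(3) in blast)
  have e: "gr lam z \<omega> y = gr_of_potential lam z x (\<lambda>u\<in>fwd x. v \<omega> (\<psi> u))" for \<omega>
    unfolding gr_def gr_of_potential_def
  proof (subst \<psi>(2)[symmetric], rule fwd_green_iso[OF \<psi>(3) _ xy(1), symmetric])
    fix u assume u: "u \<in> fwd x"
    then have "w (\<psi> u) = w u" using w_label \<psi>(3) fwd_V by metis
    then show "w u + lam * clamp1 (if u \<in> fwd x then (\<lambda>u\<in>fwd x. v \<omega> (\<psi> u)) u else 0) = pot lam \<omega> (\<psi> u)"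
      using u by (simp add: pot_def)
  qed
  have "distr P borel (\<lambda>\<omega>. gr lam z \<omega> x) = distr (distr P (\<Pi>\<^sub>M u\<in>fwd x. borel) (\<lambda>\<omega>. \<lambda>u\<in>fwd x. v \<omega> u)) borel (gr_of_potential lam z x)"
    by (subst distr_distr) (use m1 gr_of_potential_measurable[OF z xy(1)] in \<open>auto simp: comp_def gr_gr_of_potential[OF xy(1)]\<close>)
  also have "\<dots> = distr P borel (\<lambda>\<omega>. gr lam z \<omega> y)"
    unfolding law by (subst distr_distr) (use m2 gr_of_potential_measurable[OF z xy(1)] in \<open>auto simp: comp_def e\<close>)
  finally show ?thesis .
qed

lemma gr_joint_law:
  assumes z: "Im z > 0" "0 \<le> lam" "lam \<le> 1" and J: "finite J" "J \<noteq> {}"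
    and \<pi>: "inj_on \<pi> J" "\<pi> ` J \<subseteq> V" "disjoint_family_on fwd (\<pi> ` J)"
  shows "distr P (\<Pi>\<^sub>M j\<in>J. borel) (\<lambda>\<omega>. \<lambda>j\<in>J. gr lam z \<omega> (\<pi> j)) = (\<Pi>\<^sub>M j\<in>J. distr P borel (\<lambda>\<omega>. gr lam z \<omega> (\<pi> j)))"
proof -
  define X where "X = \<pi> ` J"
  have rv: "random_variable borel (\<lambda>\<omega>. gr lam z \<omega> x)" if "x \<in> X" for x using gr_measurable[OF z] \<pi> that by (auto simp: X_def)
  have "indep_vars (\<lambda>_. borel) (\<lambda>y \<omega>. gr lam z \<omega> y) X" by (rule gr_indep[OF z]) (use J \<pi> in \<open>auto simp: X_def\<close>)
  then have d: "distr P (\<Pi>\<^sub>M x\<in>X. borel) (\<lambda>\<omega>. \<lambda>x\<in>X. gr lam z \<omega> x) = (\<Pi>\<^sub>M x\<in>X. distr P borel (\<lambda>\<omega>. gr lam z \<omega> x))"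
    using indep_vars_iff_distr_eq_PiM'[where I = X and M' = "\<lambda>_. borel" and X = "\<lambda>x \<omega>. gr lam z \<omega> x"] rv J by (auto simp: X_def)
  have m: "(\<lambda>f. \<lambda>j\<in>J. f (\<pi> j)) \<in> measurable (\<Pi>\<^sub>M x\<in>X. borel) (\<Pi>\<^sub>M j\<in>J. borel :: complex measure)"
    by (rule measurable_restrict) (auto simp: X_def intro: measurable_component_singleton)
  have m': "(\<lambda>\<omega>. \<lambda>x\<in>X. gr lam z \<omega> x) \<in> measurable P (\<Pi>\<^sub>M x\<in>X. borel)" by (rule measurable_restrict) (use rv in auto)
  have "distr P (\<Pi>\<^sub>M j\<in>J. borel) (\<lambda>\<omega>. \<lambda>j\<in>J. gr lam z \<omega> (\<pi> j))
     = distr (distr P (\<Pi>\<^sub>M x\<in>X. borel) (\<lambda>\<omega>. \<lambda>x\<in>X. gr lam z \<omega> x)) (\<Pi>\<^sub>M j\<in>J. borel) (\<lambda>f. \<lambda>j\<in>J. f (\<pi> j))"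
    by (subst distr_distr[OF m m']) (auto simp: comp_def X_def intro!: distr_cong)
  also have "\<dots> = distr (\<Pi>\<^sub>M x\<in>X. distr P borel (\<lambda>\<omega>. gr lam z \<omega> x)) (\<Pi>\<^sub>M j\<in>J. distr P borel (\<lambda>\<omega>. gr lam z \<omega> (\<pi> j))) (\<lambda>f. \<lambda>j\<in>J. f (\<pi> j))"
    unfolding d by (intro distr_cong refl sets_PiM_cong) auto
  also have "\<dots> = (\<Pi>\<^sub>M j\<in>J. distr P borel (\<lambda>\<omega>. gr lam z \<omega> (\<pi> j)))"
    by (rule distr_PiM_reindex) (use rv \<pi> in \<open>auto simp: X_def intro!: prob_space_distr\<close>)
  finally show ?thesis .
qed

text \<open>
  Over disjoint forward trees the joint law is the product of the single laws, which depend on labels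
  only.
\<close>

lemma expectation_relabel:
  fixes F :: "('v \<Rightarrow> complex) \<Rightarrow> real"
  assumes z: "Im z > 0" "0 \<le> lam" "lam \<le> 1" and J: "finite J" "J \<noteq> {}"
    and F: "F \<in> borel_measurable (\<Pi>\<^sub>M j\<in>J. borel)"
    and \<pi>: "inj_on \<pi> J" "\<pi> ` J \<subseteq> V" "disjoint_family_on fwd (\<pi> ` J)"
    and \<pi>': "inj_on \<pi>' J" "\<pi>' ` J \<subseteq> V" "disjoint_family_on fwd (\<pi>' ` J)"
    and lab: "\<And>j. j \<in> J \<Longrightarrow> a (\<pi> j) = a (\<pi>' j)"
  shows "expectation (\<lambda>\<omega>. F (\<lambda>j\<in>J. gr lam z \<omega> (\<pi> j))) = expectation (\<lambda>\<omega>. F (\<lambda>j\<in>J. gr lam z \<omega> (\<pi>' j)))"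
proof -
  have m: "(\<lambda>\<omega>. \<lambda>j\<in>J. gr lam z \<omega> (\<rho> j)) \<in> measurable P (\<Pi>\<^sub>M j\<in>J. borel)" if "\<rho> ` J \<subseteq> V" for \<rho>
    by (rule measurable_restrict) (use gr_measurable[OF z] that in auto)
  have "distr P (\<Pi>\<^sub>M j\<in>J. borel) (\<lambda>\<omega>. \<lambda>j\<in>J. gr lam z \<omega> (\<pi> j)) = distr P (\<Pi>\<^sub>M j\<in>J. borel) (\<lambda>\<omega>. \<lambda>j\<in>J. gr lam z \<omega> (\<pi>' j))"
    unfolding gr_joint_law[OF z J \<pi>] gr_joint_law[OF z J \<pi>']
    by (intro PiM_cong refl gr_law[OF z]) (use \<pi> \<pi>' lab in auto)
  then have "integral\<^sup>L (distr P (\<Pi>\<^sub>M j\<in>J. borel) (\<lambda>\<omega>. \<lambda>j\<in>J. gr lam z \<omega> (\<pi> j))) F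
     = integral\<^sup>L (distr P (\<Pi>\<^sub>M j\<in>J. borel) (\<lambda>\<omega>. \<lambda>j\<in>J. gr lam z \<omega> (\<pi>' j))) F" by simp
  then show ?thesis using F m \<pi> \<pi>' by (simp add: integral_distr)
qed

lemma expectation_label:
  fixes F :: "complex \<Rightarrow> real"
  assumes z: "Im z > 0" "0 \<le> lam" "lam \<le> 1" and xy: "x \<in> V" "y \<in> V" "a x = a y" and F: "F \<in> borel_measurable borel"
  shows "expectation (\<lambda>\<omega>. F (gr lam z \<omega> x)) = expectation (\<lambda>\<omega>. F (gr lam z \<omega> y))"
  using arg_cong[OF gr_law[OF z xy], of "\<lambda>N. integral\<^sup>L N F"] gr_measurable[OF z] xy F by (simp add: integral_distr)

definition "rel_disp lam z \<omega> y = (gr lam z \<omega> y - g0 z y) / of_real (Im (g0 z y))"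
definition "child_sum z x = (\<Sum>u\<in>ch x. cc x u * Im (g0 z u))"
definition "child_weight z x u = cc x u * Im (g0 z u) / child_sum z x"
definition "DD_moment n lam z y = expectation (\<lambda>\<omega>. DD (rel_disp lam z \<omega> y) ^ n)"

lemma rel_disp_pos: "Im z > 0 \<Longrightarrow> 0 \<le> lam \<Longrightarrow> lam \<le> 1 \<Longrightarrow> y \<in> V \<Longrightarrow> 1 + Im (rel_disp lam z \<omega> y) > 0"
  unfolding rel_disp_def using hdist_DD(2)[OF g0_pos gr_pos] by blast

lemma child_sum_pos: "Im z > 0 \<Longrightarrow> x \<in> V \<Longrightarrow> child_sum z x > 0"
  unfolding child_sum_def using finite_ch ch_ne cc_pos g0_pos ch_V by (intro sum_pos) auto

lemma child_weight_pos: "Im z > 0 \<Longrightarrow> u \<in> ch x \<Longrightarrow> child_weight z x u > 0"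
  unfolding child_weight_def using child_sum_pos ch_V cc_pos g0_pos by auto

lemma child_weight_sum: "Im z > 0 \<Longrightarrow> x \<in> V \<Longrightarrow> sum (child_weight z x) (ch x) = 1"
  using child_sum_pos[of z x] by (simp add: child_weight_def[abs_def] sum_divide_distrib[symmetric] child_sum_def)

lemma DD_measurable [measurable]: "DD \<in> borel_measurable borel"
  unfolding DD_def[abs_def] by measurable

lemma rel_disp_measurable:
  assumes "Im z > 0" "0 \<le> lam" "lam \<le> 1" "y \<in> V" shows "(\<lambda>\<omega>. rel_disp lam z \<omega> y) \<in> borel_measurable P"
  unfolding rel_disp_def using gr_measurable[OF assms] by measurable

text \<open>
  The bound explodes as \<open>Im z\<close> tends to 0. Its purpose is that all moments exist.
\<close>

lemma DD_rel_disp_bounded: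
  assumes z: "Im z > 0" "0 \<le> lam" "lam \<le> 1"
  shows "\<exists>C\<ge>0. \<forall>y\<in>V. \<forall>\<omega>. DD (rel_disp lam z \<omega> y) \<le> C"
proof -
  define l where "l = Imlow Bw (cmod z) (Im z)"
  have B0: "Bw \<ge> 0" using pot_bound(1)[OF rt_V] by linarith
  have l: "l > 0" unfolding l_def by (rule Imlow_pos) (use z B0 in auto)
  have "DD (rel_disp lam z \<omega> y) \<le> (2 / Im z)\<^sup>2 / (l * l)" if y: "y \<in> V" for y \<omega>
  proof -
    define g where "g = gr lam z \<omega> y"
    define h where "h = g0 z y"
    have b: "cmod g \<le> 1 / Im z" "Im g \<ge> l" "cmod h \<le> 1 / Im z" "Im h \<ge> l"
      unfolding g_def h_def l_def gr_def g0_def by (rule fwd_green_bounds; use z y pot_bound in auto)+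
    have "cmod (g - h) \<le> 2 / Im z" using norm_triangle_ineq4[of g h] b by linarith
    then have "hdist g h \<le> (2 / Im z)\<^sup>2 / (l * l)" unfolding hdist_def
      using b l by (intro frac_le power_mono mult_mono) auto
    then show ?thesis using hdist_DD(1)[of h g] b l by (simp add: rel_disp_def g_def h_def)
  qed
  moreover have "(2 / Im z)\<^sup>2 / (l * l) \<ge> 0" using l by simp
  ultimately show ?thesis by blast
qed

lemma wmean_rel_disp_bounded:
  assumes z: "Im z > 0" "0 \<le> lam" "lam \<le> 1" and A: "finite A" "\<And>i. i \<in> A \<Longrightarrow> p i \<ge> 0" "sum p A = 1" "\<pi> ` A \<subseteq> V"
  shows "1 + Im (wmean A p (\<lambda>i. rel_disp lam z \<omega> (\<pi> i))) > 0"
    and "(\<And>y. y \<in> V \<Longrightarrow> DD (rel_disp lam z \<omega> y) \<le> C) \<Longrightarrow> DD (wmean A p (\<lambda>i. rel_disp lam z \<omega> (\<pi> i))) \<le> C"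
proof -
  have pos: "1 + Im (rel_disp lam z \<omega> (\<pi> i)) > 0" if "i \<in> A" for i using rel_disp_pos z A(4) that by blast
  show "1 + Im (wmean A p (\<lambda>i. rel_disp lam z \<omega> (\<pi> i))) > 0"
    by (rule wmean_Im_pos) (use A pos in auto)
  assume C: "\<And>y. y \<in> V \<Longrightarrow> DD (rel_disp lam z \<omega> y) \<le> C"
  have "DD (wmean A p (\<lambda>i. rel_disp lam z \<omega> (\<pi> i))) \<le> (\<Sum>i\<in>A. p i * DD (rel_disp lam z \<omega> (\<pi> i)))"
    by (rule DD_jensen) (use A pos in auto)
  also have "\<dots> \<le> (\<Sum>i\<in>A. p i * C)" using A C by (intro sum_mono mult_left_mono) auto
  also have "\<dots> = C" using A(3) by (simp add: sum_distrib_right[symmetric])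
  finally show "DD (wmean A p (\<lambda>i. rel_disp lam z \<omega> (\<pi> i))) \<le> C" .
qed

lemma integrable_DD_rel_disp:
  assumes z: "Im z > 0" "0 \<le> lam" "lam \<le> 1" and y: "y \<in> V"
  shows "integrable P (\<lambda>\<omega>. DD (rel_disp lam z \<omega> y) ^ n)"
proof -
  obtain C where C: "C \<ge> 0" "\<forall>y\<in>V. \<forall>\<omega>. DD (rel_disp lam z \<omega> y) \<le> C" using DD_rel_disp_bounded[OF z] by blast
  note [measurable] = rel_disp_measurable[OF z y]
  show ?thesis
  proof (rule integrable_const_bound[of _ "C ^ n"])
    show "AE \<omega> in P. norm (DD (rel_disp lam z \<omega> y) ^ n) \<le> C ^ n"
      using C y DD_nonneg[OF rel_disp_pos[OF z y]] by (auto intro!: power_mono simp: norm_power)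
  qed measurable
qed

lemma integrable_DD_wmean:
  assumes z: "Im z > 0" "0 \<le> lam" "lam \<le> 1" and A: "finite A" "\<And>i. i \<in> A \<Longrightarrow> p i \<ge> 0" "sum p A = 1" "\<pi> ` A \<subseteq> V"
  shows "integrable P (\<lambda>\<omega>. DD (wmean A p (\<lambda>i. rel_disp lam z \<omega> (\<pi> i))) ^ n)"
proof -
  obtain C where C: "C \<ge> 0" "\<forall>y\<in>V. \<forall>\<omega>. DD (rel_disp lam z \<omega> y) \<le> C" using DD_rel_disp_bounded[OF z] by blast
  have [measurable]: "(\<lambda>\<omega>. rel_disp lam z \<omega> (\<pi> i)) \<in> borel_measurable P" if "i \<in> A" for i
    using rel_disp_measurable[OF z] A(4) that by blast
  show ?thesis
  proof (rule integrable_const_bound[of _ "C ^ n"])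
    have "norm (DD (wmean A p (\<lambda>i. rel_disp lam z \<omega> (\<pi> i))) ^ n) \<le> C ^ n" for \<omega>
      using C wmean_rel_disp_bounded(2)[OF z A, where C = C and \<omega> = \<omega>] DD_nonneg[OF wmean_rel_disp_bounded(1)[OF z A, where \<omega> = \<omega>]]
      by (auto intro!: power_mono simp: norm_power)
    then show "AE \<omega> in P. norm (DD (wmean A p (\<lambda>i. rel_disp lam z \<omega> (\<pi> i))) ^ n) \<le> C ^ n" by simp
    show "(\<lambda>\<omega>. DD (wmean A p (\<lambda>i. rel_disp lam z \<omega> (\<pi> i))) ^ n) \<in> borel_measurable P" unfolding wmean_def by measurable
  qed
qed

lemma DD_moment_label:
  assumes z: "Im z > 0" "0 \<le> lam" "lam \<le> 1" and xy: "x \<in> V" "y \<in> V" "a x = a y"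
  shows "DD_moment n lam z x = DD_moment n lam z y"
proof -
  have "(\<lambda>g. DD ((g - g0 z x) / of_real (Im (g0 z x))) ^ n) \<in> borel_measurable borel" by measurable
  from expectation_label[OF z xy this] show ?thesis unfolding DD_moment_def rel_disp_def g0_label[OF xy] .
qed

lemma DD_moment_nonneg: assumes z: "Im z > 0" "0 \<le> lam" "lam \<le> 1" and y: "y \<in> V" shows "DD_moment n lam z y \<ge> 0"
  unfolding DD_moment_def using DD_nonneg[OF rel_disp_pos[OF z y]] by (intro Bochner_Integration.integral_nonneg) auto

text \<open>
  The constant \<open>C\<close> does not depend on \<open>z\<close>, only on bounds for the unperturbed Green functions. Let the moment
  be maximal at \<open>x\<close>. Maximality bounds by \<open>O(lam)\<close> the expected defect at every vertex of the label of \<open>x\<close>, and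
  also the amount by which the moments of its children fall short of the maximum (\<open>two\<close>). Therefore it
  suffices to bound the moment at one child \<open>y\<close> of \<open>x\<close>, and \<open>two_step_bound\<close> does this by defects at
  vertices of the label of \<open>x\<close>.
\<close>

lemma contraction:
  assumes c: "0 < p0" "0 < \<sigma>" "\<sigma> \<le> 1" "0 < S0"
  shows "\<exists>C>0. \<forall>z lam. Im z > 0 \<longrightarrow> 0 \<le> lam \<longrightarrow> lam \<le> 1 \<longrightarrow> lam * C \<le> 1/2 \<longrightarrow>
     (\<forall>x\<in>V. S0 \<le> child_sum z x \<and> \<sigma> \<le> Im (g0 z x) / cmod (g0 z x) \<and> (\<forall>u\<in>ch x. p0 \<le> child_weight z x u)) \<longrightarrow>
     (\<forall>y\<in>V. DD_moment (k+2) lam z y \<le> 2 * C * lam)"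
proof -
  define n where "n = k + 2"
  define K where "K = 1 + 4 * (1 / S0)\<^sup>2"
  have "K \<ge> 0" by (simp add: K_def)
  then obtain K' where K': "K' \<ge> 0" "\<And>lam a. 0 \<le> lam \<Longrightarrow> lam \<le> 1 \<Longrightarrow> a \<ge> 0 \<Longrightarrow>
      ((1 + K * lam) * a + K * lam) ^ n \<le> (1 + K' * lam) * a ^ n + K' * lam"
    using perturbed_power[of K n] by auto
  define \<epsilon> where "\<epsilon> = \<sigma> / 160"
  define C1 where "C1 = 1 / (p0 * \<epsilon>\<^sup>2 * (p0/2) ^ (k+2))"
  have C1: "C1 > 0" using c by (simp add: C1_def \<epsilon>_def)
  define C where "C = C1 * (3 * K') + 8 / (\<sigma> * S0) + K' / p0"
  have "C1 * (3 * K') \<ge> 0" "8 / (\<sigma> * S0) > 0" "K' / p0 \<ge> 0" using c C1 K'(1) by auto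
  then have C0: "C > 0" unfolding C_def by linarith
  have "DD_moment n lam z y0 \<le> 2 * C * lam"
    if z: "Im z > 0" "0 \<le> lam" "lam \<le> 1" and lamC: "lam * C \<le> 1/2"
      and hyp: "\<And>x. x \<in> V \<Longrightarrow> S0 \<le> child_sum z x \<and> \<sigma> \<le> Im (g0 z x) / cmod (g0 z x) \<and> (\<forall>u\<in>ch x. p0 \<le> child_weight z x u)"
      and y0: "y0 \<in> V" for z lam y0
  proof -
    let ?X = "\<lambda>y. DD_moment n lam z y"
    let ?\<zeta> = "\<lambda>\<omega> y. rel_disp lam z \<omega> y"
    have "finite (?X ` V)"
      by (rule finite_image_factor[where l = a]) (auto intro: DD_moment_label[OF z] finite_subset[OF subset_UNIV])
    then have "\<exists>x\<in>V. \<forall>y\<in>V. ?X y \<le> ?X x"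
      using Max_in[of "?X ` V"] Max_ge[of "?X ` V"] rt_V by fastforce
    then obtain x where x: "x \<in> V" and mx: "\<And>y. y \<in> V \<Longrightarrow> ?X y \<le> ?X x" by blast
    define X where "X = ?X x"
    have X0: "X \<ge> 0" unfolding X_def by (rule DD_moment_nonneg[OF z x])
    have pp: "u \<in> ch q \<Longrightarrow> child_weight z q u \<ge> 0" for q u using child_weight_pos[OF z(1)] by (simp add: less_imp_le)
    define Edef where "Edef q = expectation (\<lambda>\<omega>. defect n (ch q) (child_weight z q) (?\<zeta> \<omega>))" for q
    have chV: "(\<lambda>u. u) ` ch q \<subseteq> V" for q using ch_V by auto
    have int1: "integrable P (\<lambda>\<omega>. DD (wmean (ch q) (child_weight z q) (?\<zeta> \<omega>)) ^ n)" if "q \<in> V" for q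
      using integrable_DD_wmean[OF z finite_ch pp child_weight_sum[OF z(1) that] chV] by simp
    have int2: "integrable P (\<lambda>\<omega>. \<Sum>u\<in>ch q. child_weight z q u * DD (?\<zeta> \<omega> u) ^ n)" for q
      using integrable_DD_rel_disp[OF z] ch_V by (intro Bochner_Integration.integrable_sum integrable_mult_right) auto
    have Edef: "Edef q = (\<Sum>u\<in>ch q. child_weight z q u * ?X u) - expectation (\<lambda>\<omega>. DD (wmean (ch q) (child_weight z q) (?\<zeta> \<omega>)) ^ n)"
      "integrable P (\<lambda>\<omega>. defect n (ch q) (child_weight z q) (?\<zeta> \<omega>))" if q: "q \<in> V" for q
    proof -
      have "expectation (\<lambda>\<omega>. \<Sum>u\<in>ch q. child_weight z q u * DD (?\<zeta> \<omega> u) ^ n) = (\<Sum>u\<in>ch q. child_weight z q u * ?X u)"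
        using integrable_DD_rel_disp[OF z] ch_V unfolding DD_moment_def by (subst Bochner_Integration.integral_sum) auto
      then show "Edef q = (\<Sum>u\<in>ch q. child_weight z q u * ?X u) - expectation (\<lambda>\<omega>. DD (wmean (ch q) (child_weight z q) (?\<zeta> \<omega>)) ^ n)"
        unfolding Edef_def defect_def using int1[OF q] int2 by simp
      show "integrable P (\<lambda>\<omega>. defect n (ch q) (child_weight z q) (?\<zeta> \<omega>))" unfolding defect_def using int1[OF q] int2 by simp
    qed
    have st: "DD (?\<zeta> \<omega> q) \<le> (1 + K * lam) * DD (wmean (ch q) (child_weight z q) (?\<zeta> \<omega>)) + K * lam
        \<and> cmod (?\<zeta> \<omega> q - (wmean (ch q) (child_weight z q) (?\<zeta> \<omega>) - of_real (lam * clamp1 (v \<omega> q) / child_sum z q)))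
           \<ge> \<sigma> * cmod (wmean (ch q) (child_weight z q) (?\<zeta> \<omega>) - of_real (lam * clamp1 (v \<omega> q) / child_sum z q))
        \<and> cmod (of_real (lam * clamp1 (v \<omega> q) / child_sum z q) :: complex) \<le> lam / S0" if q: "q \<in> V" for q \<omega>
    proof -
      define \<beta> where "\<beta> = wmean (ch q) (child_weight z q) (?\<zeta> \<omega>)"
      define r where "r = lam * clamp1 (v \<omega> q)"
      have hx: "- 1 / g0 z q = (z - of_real (w q)) + (\<Sum>u\<in>ch q. of_real (cc q u) * g0 z u)"
        using g0_solution[OF z(1)] q by (auto simp: herglotz_solution_def)
      have gx: "- 1 / gr lam z \<omega> q = (z - of_real (w q)) - of_real r + (\<Sum>u\<in>ch q. of_real (cc q u) * gr lam z \<omega> u)"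
        using gr_solution[OF z, of \<omega>] q by (auto simp: herglotz_solution_def pot_def r_def)
      have b0: "0 \<le> Im (z - of_real (w q))" using z by simp
      have chp: "Im (g0 z u) > 0" "Im (gr lam z \<omega> u) > 0" if "u \<in> ch q" for u
        using g0_pos gr_pos z ch_V that by blast+
      note ss = star_step[where c = "cc q" and h = "g0 z" and g = "gr lam z \<omega>", OF finite_ch[of q] ch_ne[OF q] cc_pos chp
          g0_pos[OF z(1) q] gr_pos[OF z q] b0 hx gx, folded child_sum_def, folded child_weight_def rel_disp_def, folded child_weight_def[abs_def] rel_disp_def[abs_def]]
      have S: "child_sum z q > 0" "child_sum z q \<ge> S0" using child_sum_pos[OF z(1) q] hyp[OF q] by auto
      have \<beta>1: "1 + Im \<beta> > 0" using wmean_rel_disp_bounded(1)[OF z finite_ch pp child_weight_sum[OF z(1) q] chV] by (simp add: \<beta>_def)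
      have "hdist (gr lam z \<omega> q) (g0 z q) \<le> child_sum z q / (Im (z - of_real (w q)) + child_sum z q) * ((cmod (\<beta> - of_real (r / child_sum z q)))\<^sup>2 / (1 + Im \<beta>))"
        using ss(3) by (simp add: \<beta>_def)
      also have "\<dots> \<le> 1 * ((cmod (\<beta> - of_real (r / child_sum z q)))\<^sup>2 / (1 + Im \<beta>))"
        using S b0 \<beta>1 by (intro mult_right_mono) (auto simp: divide_le_eq_1)
      finally have 1: "DD (?\<zeta> \<omega> q) \<le> (cmod (\<beta> - of_real (r / child_sum z q)))\<^sup>2 / (1 + Im \<beta>)"
        using hdist_DD(1)[OF g0_pos[OF z(1) q] gr_pos[OF z q]] by (simp add: rel_disp_def)
      have re: "\<bar>r / child_sum z q\<bar> \<le> lam * (1 / S0)"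
      proof -
        have "\<bar>r\<bar> \<le> lam * 1" unfolding r_def abs_mult using z clamp1(1) by (intro mult_mono) auto
        then have "\<bar>r\<bar> / child_sum z q \<le> lam / S0" using S c by (intro frac_le) auto
        then show ?thesis using S by simp
      qed
      have 2: "(cmod (\<beta> - of_real (r / child_sum z q)))\<^sup>2 / (1 + Im \<beta>) \<le> (1 + K * lam) * DD \<beta> + K * lam"
        unfolding K_def by (rule perturbed_DD[OF \<beta>1 z(2,3) re])
      have "\<sigma> * cmod (\<beta> - of_real (r / child_sum z q)) \<le> Im (g0 z q) / cmod (g0 z q) * cmod (\<beta> - of_real (r / child_sum z q))"
        using hyp[OF q] by (intro mult_right_mono) auto
      also have "\<dots> \<le> cmod (?\<zeta> \<omega> q - (\<beta> - of_real (r / child_sum z q)))"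
        using ss(4) by (simp add: \<beta>_def)
      finally have 3: "\<sigma> * cmod (\<beta> - of_real (r / child_sum z q)) \<le> cmod (?\<zeta> \<omega> q - (\<beta> - of_real (r / child_sum z q)))" .
      have 4: "cmod (of_real (r / child_sum z q) :: complex) \<le> lam / S0" using re by (simp add: norm_of_real del: of_real_divide)
      show ?thesis using 1 2 3 4 unfolding \<beta>_def r_def by linarith
    qed
    have one: "?X q \<le> (1 + K' * lam) * ((\<Sum>u\<in>ch q. child_weight z q u * ?X u) - Edef q) + K' * lam" if q: "q \<in> V" for q
    proof -
      have "?X q \<le> expectation (\<lambda>\<omega>. (1 + K' * lam) * DD (wmean (ch q) (child_weight z q) (?\<zeta> \<omega>)) ^ n + K' * lam)"
        unfolding DD_moment_def
      proof (rule integral_mono[OF integrable_DD_rel_disp[OF z q]])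
        show "integrable P (\<lambda>\<omega>. (1 + K' * lam) * DD (wmean (ch q) (child_weight z q) (?\<zeta> \<omega>)) ^ n + K' * lam)" using int1[OF q] by simp
        fix \<omega>
        have b0: "DD (wmean (ch q) (child_weight z q) (?\<zeta> \<omega>)) \<ge> 0"
          using DD_nonneg wmean_rel_disp_bounded(1)[OF z finite_ch pp child_weight_sum[OF z(1) q] chV] by simp
        have "DD (?\<zeta> \<omega> q) ^ n \<le> ((1 + K * lam) * DD (wmean (ch q) (child_weight z q) (?\<zeta> \<omega>)) + K * lam) ^ n"
          using st[OF q] DD_nonneg[OF rel_disp_pos[OF z q]] by (intro power_mono) auto
        also have "\<dots> \<le> (1 + K' * lam) * DD (wmean (ch q) (child_weight z q) (?\<zeta> \<omega>)) ^ n + K' * lam" by (rule K'(2)[OF z(2,3) b0])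
        finally show "DD (?\<zeta> \<omega> q) ^ n \<le> (1 + K' * lam) * DD (wmean (ch q) (child_weight z q) (?\<zeta> \<omega>)) ^ n + K' * lam" .
      qed
      also have "\<dots> = (1 + K' * lam) * expectation (\<lambda>\<omega>. DD (wmean (ch q) (child_weight z q) (?\<zeta> \<omega>)) ^ n) + K' * lam"
        using int1[OF q] by (simp add: prob_space)
      finally show ?thesis using Edef(1)[OF q] by simp
    qed
    have Edef0: "Edef q \<ge> 0" if q: "q \<in> V" for q
      unfolding Edef_def n_def
      by (intro Bochner_Integration.integral_nonneg defect_nonneg finite_ch pp child_weight_sum[OF z(1) q] rel_disp_pos[OF z] ch_V)
    have pX: "(\<Sum>u\<in>ch q. child_weight z q u * ?X u) \<le> X" if q: "q \<in> V" for q
    proof -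
      have "(\<Sum>u\<in>ch q. child_weight z q u * ?X u) \<le> (\<Sum>u\<in>ch q. child_weight z q u * X)"
        unfolding X_def using mx ch_V pp by (intro sum_mono mult_left_mono) auto
      then show ?thesis using child_weight_sum[OF z(1) q] by (simp add: sum_distrib_right[symmetric])
    qed
    have two: "Edef q \<le> K' * lam * (1 + X) \<and> (\<forall>u\<in>ch q. p0 * (X - ?X u) \<le> K' * lam * (1 + X))"
      if q: "q \<in> V" "a q = a x" for q
    proof -
      have Xq: "?X q = X" unfolding X_def by (rule DD_moment_label[OF z q(1) x q(2)])
      define s where "s = (\<Sum>u\<in>ch q. child_weight z q u * ?X u)"
      have "K' * lam * (s - Edef q) \<le> K' * lam * X"
        using pX[OF q(1)] Edef0[OF q(1)] K'(1) z by (intro mult_left_mono) (auto simp: s_def)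
      then have 1: "X \<le> s - Edef q + K' * lam * (1 + X)" using one[OF q(1)] unfolding Xq s_def[symmetric] by (simp add: algebra_simps)
      have "p0 * (X - ?X u) \<le> X - s" if u: "u \<in> ch q" for u
      proof -
        have "p0 * (X - ?X u) \<le> child_weight z q u * (X - ?X u)"
          using hyp[OF q(1)] u mx[OF ch_V(2)[OF u]] by (intro mult_right_mono) (auto simp: X_def)
        also have "\<dots> \<le> (\<Sum>u\<in>ch q. child_weight z q u * (X - ?X u))"
          using u pp mx ch_V by (intro member_le_sum finite_ch) (auto simp: X_def intro!: mult_nonneg_nonneg)
        also have "\<dots> = X - s" using child_weight_sum[OF z(1) q(1)] by (simp add: right_diff_distrib sum_subtractf sum_distrib_right[symmetric] s_def)
        finally show ?thesis .
      qed
      then show ?thesis using 1 pX[OF q(1)] Edef0[OF q(1)] unfolding s_def by fastforce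
    qed
    obtain x' where x': "x' \<in> ch x" "a x' = a x" using self_child[OF x] by blast
    have x'V: "x' \<in> V" using ch_V x' by blast
    have "\<not> ch x \<subseteq> {x'}" using two_children[OF x] card_mono[of "{x'}" "ch x"] by auto
    then obtain y where y: "y \<in> ch x" "y \<noteq> x'" by blast
    have yV: "y \<in> V" using ch_V y by blast
    obtain \<beta> where \<beta>: "bij_betw \<beta> (ch x) (ch x')" "\<forall>u\<in>ch x. a (\<beta> u) = a u" using ch_label_bij[OF x x'V] x' by auto
    define y1 where "y1 = \<beta> y"
    have y1: "y1 \<in> ch x'" "a y1 = a y" using \<beta> y bij_betwE[OF \<beta>(1)] by (auto simp: y1_def)
    have y1V: "y1 \<in> V" using ch_V y1 by blast
    have "\<not> ch x' \<subseteq> {y1}" using two_children[OF x'V] card_mono[of "{y1}" "ch x'"] by auto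
    then obtain y2 where y2: "y2 \<in> ch x'" "y2 \<noteq> y1" by blast
    let ?A = "ch x'"
    let ?p = "child_weight z x'"
    \<comment> \<open>Under \<open>\<pi>\<close> the sibling \<open>y\<close> of \<open>x'\<close> takes the place of \<open>y1\<close>. Its forward tree is disjoint from those of the children of \<open>x'\<close>, so no joint law changes.\<close>
    define \<pi> where "\<pi> = (\<lambda>u. u)(y1 := y)"
    have sw: "(?\<zeta> \<omega>)(y1 := ?\<zeta> \<omega> y) = (\<lambda>u. ?\<zeta> \<omega> (\<pi> u))" for \<omega> by (auto simp: \<pi>_def)
    have \<pi>V: "\<pi> ` ?A \<subseteq> V" using yV ch_V by (auto simp: \<pi>_def)
    have yA: "fwd y \<inter> fwd u = {}" if "u \<in> ?A" for u
      using fwd_disjoint_ch[OF y(1) x'(1) y(2)] fwd_ch_sub(1)[OF that] by blast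
    have y_notA: "y \<notin> ?A" using yA fwd_self[OF yV] by blast
    have \<pi>inj: "inj_on \<pi> ?A" using y_notA by (auto simp: \<pi>_def inj_on_def)
    have \<pi>disj: "disjoint_family_on fwd (\<pi> ` ?A)"
      unfolding disjoint_family_on_def \<pi>_def using yA fwd_disjoint_ch by (auto split: if_splits) (metis disjoint_iff)+
    have iddisj: "disjoint_family_on fwd ((\<lambda>u. u) ` ?A)"
      unfolding disjoint_family_on_def using fwd_disjoint_ch by auto
    have lab: "a (\<pi> u) = a u" for u using y1 by (simp add: \<pi>_def)
    define F where "F f = DD (wmean ?A ?p (\<lambda>u. (f u - g0 z u) / of_real (Im (g0 z u)))) ^ n" for f
    have Fm: "F \<in> borel_measurable (\<Pi>\<^sub>M j\<in>?A. borel)"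
    proof -
      have [measurable]: "(\<lambda>f. f u) \<in> borel_measurable (\<Pi>\<^sub>M j\<in>?A. borel :: complex measure)" if "u \<in> ?A" for u
        using that by (rule measurable_component_singleton)
      show ?thesis unfolding F_def[abs_def] wmean_def by measurable
    qed
    have Fr: "F (\<lambda>j\<in>?A. gr lam z \<omega> (\<pi>' j)) = DD (wmean ?A ?p (\<lambda>u. ?\<zeta> \<omega> (\<pi>' u))) ^ n"
      if "\<And>u. u \<in> ?A \<Longrightarrow> \<pi>' u \<in> V \<and> a (\<pi>' u) = a u" for \<omega> \<pi>'
    proof -
      have "g0 z (\<pi>' u) = g0 z u" if "u \<in> ?A" for u using g0_label \<open>\<And>u. u \<in> ?A \<Longrightarrow> \<pi>' u \<in> V \<and> a (\<pi>' u) = a u\<close>[OF that] ch_V that by blast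
      then show ?thesis unfolding F_def wmean_def rel_disp_def by (intro arg_cong[where f = "\<lambda>s. DD s ^ n"] sum.cong) auto
    qed
    have rel: "expectation (\<lambda>\<omega>. DD (wmean ?A ?p (\<lambda>u. ?\<zeta> \<omega> (\<pi> u))) ^ n) = expectation (\<lambda>\<omega>. DD (wmean ?A ?p (\<lambda>u. ?\<zeta> \<omega> u)) ^ n)"
    proof -
      have "expectation (\<lambda>\<omega>. F (\<lambda>j\<in>?A. gr lam z \<omega> (\<pi> j))) = expectation (\<lambda>\<omega>. F (\<lambda>j\<in>?A. gr lam z \<omega> ((\<lambda>u. u) j)))"
        by (rule expectation_relabel[OF z finite_ch ch_ne[OF x'V] Fm \<pi>inj \<pi>V \<pi>disj _ chV iddisj lab]) simp
      moreover have "F (\<lambda>j\<in>?A. gr lam z \<omega> (\<pi> j)) = DD (wmean ?A ?p (\<lambda>u. ?\<zeta> \<omega> (\<pi> u))) ^ n" for \<omega>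
        by (rule Fr) (use \<pi>V lab in auto)
      moreover have "F (\<lambda>j\<in>?A. gr lam z \<omega> ((\<lambda>u. u) j)) = DD (wmean ?A ?p (\<lambda>u. ?\<zeta> \<omega> u)) ^ n" for \<omega>
        by (rule Fr) (use ch_V in auto)
      ultimately show ?thesis by simp
    qed
    have XpI: "?X (\<pi> u) = ?X u" if "u \<in> ?A" for u using DD_moment_label[OF z _ _ lab] \<pi>V ch_V that by blast
    have intw: "integrable P (\<lambda>\<omega>. DD (wmean ?A ?p (\<lambda>u. ?\<zeta> \<omega> (\<pi> u))) ^ n)"
      by (rule integrable_DD_wmean[OF z finite_ch pp child_weight_sum[OF z(1) x'V] \<pi>V])
    have intd: "integrable P (\<lambda>\<omega>. defect n ?A ?p (\<lambda>u. ?\<zeta> \<omega> (\<pi> u)))"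
      unfolding defect_def using intw integrable_DD_rel_disp[OF z] \<pi>V
      by (intro Bochner_Integration.integrable_diff Bochner_Integration.integrable_sum integrable_mult_right) auto
    have Esw: "expectation (\<lambda>\<omega>. defect n ?A ?p (\<lambda>u. ?\<zeta> \<omega> (\<pi> u))) = Edef x'"
    proof -
      have "expectation (\<lambda>\<omega>. \<Sum>u\<in>?A. ?p u * DD (?\<zeta> \<omega> (\<pi> u)) ^ n) = (\<Sum>u\<in>?A. ?p u * ?X (\<pi> u))"
        using integrable_DD_rel_disp[OF z] \<pi>V unfolding DD_moment_def by (subst Bochner_Integration.integral_sum) auto
      also have "\<dots> = (\<Sum>u\<in>?A. ?p u * ?X u)" using XpI by simp
      finally have "expectation (\<lambda>\<omega>. \<Sum>u\<in>?A. ?p u * DD (?\<zeta> \<omega> (\<pi> u)) ^ n) = (\<Sum>u\<in>?A. ?p u * ?X u)" .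
      moreover have "integrable P (\<lambda>\<omega>. \<Sum>u\<in>?A. ?p u * DD (?\<zeta> \<omega> (\<pi> u)) ^ n)"
        using integrable_DD_rel_disp[OF z] \<pi>V by (intro Bochner_Integration.integrable_sum integrable_mult_right) auto
      ultimately show ?thesis unfolding Edef(1)[OF x'V] defect_def using intw rel by simp
    qed
    have lamS: "lam / S0 \<le> \<sigma> / 16"
    proof -
      have "lam * (8 / (\<sigma> * S0)) \<le> lam * C" using z c C1 K' by (intro mult_left_mono) (auto simp: C_def intro!: add_nonneg_nonneg)
      then have "lam * (8 / (\<sigma> * S0)) \<le> 1/2" using lamC by linarith
      then show ?thesis using c by (simp add: field_simps)
    qed
    have "?X y \<le> expectation (\<lambda>\<omega>. C1 * (defect n ?A ?p (?\<zeta> \<omega>) + defect n ?A ?p (\<lambda>u. ?\<zeta> \<omega> (\<pi> u)) + defect n (ch x) (child_weight z x) (?\<zeta> \<omega>)) + 8 / \<sigma> * (lam / S0))"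
      unfolding DD_moment_def
    proof (rule integral_mono[OF integrable_DD_rel_disp[OF z yV]])
      show "integrable P (\<lambda>\<omega>. C1 * (defect n ?A ?p (?\<zeta> \<omega>) + defect n ?A ?p (\<lambda>u. ?\<zeta> \<omega> (\<pi> u)) + defect n (ch x) (child_weight z x) (?\<zeta> \<omega>)) + 8 / \<sigma> * (lam / S0))"
        using Edef(2)[OF x] Edef(2)[OF x'V] intd by simp
      fix \<omega>
      define e :: complex where "e = of_real (lam * clamp1 (v \<omega> x') / child_sum z x')"
      have s3: "cmod (?\<zeta> \<omega> x' - (wmean ?A ?p (?\<zeta> \<omega>) - e)) \<ge> \<sigma> * cmod (wmean ?A ?p (?\<zeta> \<omega>) - e)" "cmod e \<le> lam / S0"
        using st[OF x'V, of \<omega>] unfolding e_def by blast+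
      have pos: "1 + Im (?\<zeta> \<omega> u) > 0" if "u \<in> ch q" for u q using rel_disp_pos[OF z] ch_V that by blast
      have "DD (?\<zeta> \<omega> y) ^ (k+2) \<le> C1 * (defect (k+2) ?A ?p (?\<zeta> \<omega>) + defect (k+2) ?A ?p ((?\<zeta> \<omega>)(y1 := ?\<zeta> \<omega> y)) + defect (k+2) (ch x) (child_weight z x) (?\<zeta> \<omega>)) + (8 / \<sigma>) * cmod e"
        unfolding C1_def \<epsilon>_def
      proof (rule two_step_bound[where \<zeta> = "?\<zeta> \<omega>" and \<eta> = "?\<zeta> \<omega>" and p = ?p and q = "child_weight z x"
            and ?y1.0 = y1 and ?y2.0 = y2 and x' = x' and y = y, OF c(1-3) finite_ch _ child_weight_sum[OF z(1) x'V] _ finite_ch _ child_weight_sum[OF z(1) x]])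
        show "\<sigma> * cmod (wmean ?A ?p (?\<zeta> \<omega>) - e) \<le> cmod (?\<zeta> \<omega> x' - (wmean ?A ?p (?\<zeta> \<omega>) - e))" by (rule s3(1))
        show "cmod e \<le> \<sigma> / 16" using s3(2) lamS by linarith
      qed (use hyp[OF x] hyp[OF x'V] pos y1 y2 x' y in auto)
      also have "\<dots> \<le> C1 * (defect (k+2) ?A ?p (?\<zeta> \<omega>) + defect (k+2) ?A ?p ((?\<zeta> \<omega>)(y1 := ?\<zeta> \<omega> y)) + defect (k+2) (ch x) (child_weight z x) (?\<zeta> \<omega>)) + (8 / \<sigma>) * (lam / S0)"
        using s3(2) c by (intro add_left_mono mult_left_mono) auto
      finally show "DD (?\<zeta> \<omega> y) ^ n \<le> C1 * (defect n ?A ?p (?\<zeta> \<omega>) + defect n ?A ?p (\<lambda>u. ?\<zeta> \<omega> (\<pi> u)) + defect n (ch x) (child_weight z x) (?\<zeta> \<omega>)) + 8 / \<sigma> * (lam / S0)"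
        unfolding n_def sw .
    qed
    also have "\<dots> = C1 * (Edef x' + Edef x' + Edef x) + 8 / \<sigma> * (lam / S0)"
      using Edef(2)[OF x] Edef(2)[OF x'V] intd Esw by (simp add: prob_space Edef_def)
    also have "\<dots> \<le> C1 * (3 * (K' * lam * (1 + X))) + 8 / \<sigma> * (lam / S0)"
      using two[OF x refl] two[OF x'V x'(2)] C1 by (intro add_right_mono mult_left_mono) auto
    finally have "?X y \<le> C1 * (3 * (K' * lam * (1 + X))) + 8 / \<sigma> * (lam / S0)" .
    moreover have "X - ?X y \<le> K' / p0 * lam * (1 + X)"
      using two[OF x refl] y c by (simp add: field_simps)
    moreover have "8 / \<sigma> * (lam / S0) \<le> 8 / (\<sigma> * S0) * lam * (1 + X)"
      using c z X0 mult_left_mono[of 1 "1 + X" "8 / (\<sigma> * S0) * lam"] by simp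
    ultimately have "X \<le> C1 * (3 * (K' * lam * (1 + X))) + 8 / (\<sigma> * S0) * lam * (1 + X) + K' / p0 * lam * (1 + X)" by linarith
    also have "\<dots> = C * lam * (1 + X)" by (simp add: C_def algebra_simps)
    also have "\<dots> = C * lam + lam * C * X" by (simp add: algebra_simps)
    also have "\<dots> \<le> C * lam + 1/2 * X" using lamC X0 by (intro add_left_mono mult_right_mono) auto
    finally have "X \<le> 2 * C * lam" by simp
    then show ?thesis using mx[OF y0] by (simp add: X_def)
  qed
  then show ?thesis using C0 unfolding n_def by (intro exI[of _ C]) blast
qed

end

section \<open>Families with bounded and with vanishing moments\<close>

context tree_op
begin

lemma cc_lower: "\<exists>c>0. \<forall>x\<in>V. \<forall>y\<in>ch x. c \<le> cc x y"
proof -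
  have "\<exists>C>0. \<forall>x\<in>V. \<forall>y\<in>ch x. 1 / cc x y \<le> C"
    by (rule edge_bounded) (metis cc_label)
  then obtain C where C: "C > 0" "\<And>x y. x \<in> V \<Longrightarrow> y \<in> ch x \<Longrightarrow> 1 / cc x y \<le> C" by blast
  have "1 / C \<le> cc x y" if "x \<in> V" "y \<in> ch x" for x y
    using C(2)[OF that] C(1) cc_pos[OF that(2)] by (simp add: field_simps)
  then show ?thesis using C(1) by (intro exI[of _ "1 / C"]) auto
qed

lemma sibling: assumes "x \<in> V" shows "\<exists>u. u \<in> ch x - {y}"
proof -
  have "\<not> ch x \<subseteq> {y}" using two_children[OF assms] card_mono[of "{y}" "ch x"] by auto
  then show ?thesis by blast
qed

end

text \<open>
  Reduces moments of real order to moments of integral order.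
\<close>

lemma small_power_le:
  fixes X \<delta> :: real
  assumes "X \<ge> 0" "\<delta> > 0" "p \<ge> 0" "p \<le> real n"
  shows "X powr p \<le> \<delta> powr p + X ^ n / \<delta> powr (real n - p)"
proof (cases "X \<le> \<delta>")
  case True
  then have "X powr p \<le> \<delta> powr p" using assms by (intro powr_mono2) auto
  then show ?thesis using assms by (simp add: add_increasing2)
next
  case False
  then have X: "X > 0" using assms by linarith
  have "X powr p * \<delta> powr (real n - p) \<le> X powr p * X powr (real n - p)"
    using False assms by (intro mult_left_mono powr_mono2) auto
  also have "\<dots> = X ^ n" using X by (simp add: powr_add[symmetric] powr_realpow)
  finally have "X powr p \<le> X ^ n / \<delta> powr (real n - p)" using assms by (simp add: pos_le_divide_eq)
  then show ?thesis using assms by (simp add: add_increasing)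
qed

context random_tree_op
begin

definition "Gr lam z \<omega> x = full_green (gr lam z \<omega>) (pot lam \<omega>) z x"
definition "G0 z x = full_green (g0 z) w z x"

end

text \<open>
  A set of energies above which the unperturbed forward Green functions stay in a compact part of
  the upper half plane. Everything below is uniform over the strip \<open>Z\<close> of height 1 above it.
\<close>

locale energy_window = random_tree_op V adj rt M a \<nu> t P w v
  for V :: "'v set" and adj rt and M :: "nat ^'a ^('a::finite)" and a \<nu> t and P :: "'w measure" and w v +
  fixes I :: "real set" and mI MI :: real
  assumes mI: "mI > 0"
    and Im_g0: "E \<in> I \<Longrightarrow> 0 < \<eta> \<Longrightarrow> \<eta> \<le> 1 \<Longrightarrow> y \<in> V \<Longrightarrow> mI \<le> Im (g0 (Complex E \<eta>) y)"
    and cmod_g0: "E \<in> I \<Longrightarrow> 0 < \<eta> \<Longrightarrow> \<eta> \<le> 1 \<Longrightarrow> y \<in> V \<Longrightarrow> cmod (g0 (Complex E \<eta>) y) \<le> MI"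
    and I_bdd: "bounded I"
begin

definition "Z = {Complex E \<eta> | E \<eta>. E \<in> I \<and> 0 < \<eta> \<and> \<eta> \<le> 1}"

lemma ZI: "z \<in> Z \<Longrightarrow> Im z > 0" "z \<in> Z \<Longrightarrow> y \<in> V \<Longrightarrow> mI \<le> Im (g0 z y)" "z \<in> Z \<Longrightarrow> y \<in> V \<Longrightarrow> cmod (g0 z y) \<le> MI"
  using Im_g0 cmod_g0 by (auto simp: Z_def)

text \<open>
  A family of random variables indexed by \<open>lam\<close> and \<open>z\<close> is \<open>good\<close> if each of its moments is bounded
  uniformly in \<open>z\<close>, and \<open>null\<close> if each moment of positive order tends to 0 with \<open>lam\<close> uniformly in \<open>z\<close>. The range of
  \<open>lam\<close> may depend on the order of the moment. With all orders at hand, both classes are closed under sums,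
  and products with good families stay in them, by the inequality between the arithmetic and the geometric mean.
\<close>

definition moment_family :: "(real \<Rightarrow> complex \<Rightarrow> 'w \<Rightarrow> real) \<Rightarrow> bool" where
  "moment_family X \<longleftrightarrow> (\<forall>lam z. 0 \<le> lam \<longrightarrow> lam \<le> 1 \<longrightarrow> z \<in> Z \<longrightarrow>
    X lam z \<in> borel_measurable P \<and> (\<forall>\<omega>. (0::real) \<le> X lam z \<omega>))"

definition good :: "(real \<Rightarrow> complex \<Rightarrow> 'w \<Rightarrow> real) \<Rightarrow> bool" where
  "good X \<longleftrightarrow> moment_family X \<and> (\<forall>n. \<exists>C::real. \<exists>l0>0. \<forall>lam z. 0 \<le> lam \<longrightarrow> lam < l0 \<longrightarrow> lam \<le> 1 \<longrightarrow> z \<in> Z \<longrightarrow>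
    (\<integral>\<^sup>+\<omega>. ennreal (X lam z \<omega> ^ n) \<partial>P) \<le> ennreal C)"

definition null :: "(real \<Rightarrow> complex \<Rightarrow> 'w \<Rightarrow> real) \<Rightarrow> bool" where
  "null X \<longleftrightarrow> moment_family X \<and> (\<forall>n\<ge>1. \<forall>e>0. \<exists>l0>0. \<forall>lam z. 0 \<le> lam \<longrightarrow> lam < l0 \<longrightarrow> lam \<le> 1 \<longrightarrow> z \<in> Z \<longrightarrow>
    (\<integral>\<^sup>+\<omega>. ennreal (X lam z \<omega> ^ n) \<partial>P) \<le> ennreal e)"

lemma mfamD: "moment_family X \<Longrightarrow> 0 \<le> lam \<Longrightarrow> lam \<le> 1 \<Longrightarrow> z \<in> Z \<Longrightarrow> X lam z \<in> borel_measurable P"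
  "moment_family X \<Longrightarrow> 0 \<le> lam \<Longrightarrow> lam \<le> 1 \<Longrightarrow> z \<in> Z \<Longrightarrow> 0 \<le> X lam z \<omega>"
  by (auto simp: moment_family_def)

lemma good_moment_family: "good X \<Longrightarrow> moment_family X" and null_moment_family: "null X \<Longrightarrow> moment_family X"
  by (auto simp: good_def null_def)

lemma goodD:
  assumes "good X"
  shows "\<exists>C>0. \<exists>l0>0. \<forall>lam z. 0 \<le> lam \<longrightarrow> lam < l0 \<longrightarrow> lam \<le> 1 \<longrightarrow> z \<in> Z \<longrightarrow>
    (\<integral>\<^sup>+\<omega>. ennreal (X lam z \<omega> ^ n) \<partial>P) \<le> ennreal C"
proof -
  obtain C l0 where l0: "l0 > 0" and C: "\<And>lam z. 0 \<le> lam \<Longrightarrow> lam < l0 \<Longrightarrow> lam \<le> 1 \<Longrightarrow> z \<in> Z \<Longrightarrow>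
    (\<integral>\<^sup>+\<omega>. ennreal (X lam z \<omega> ^ n) \<partial>P) \<le> ennreal C"
    using assms unfolding good_def by metis
  have "ennreal C \<le> ennreal (max 1 C)" by (rule ennreal_leI) simp
  then show ?thesis using l0 order_trans[OF C] by (intro exI[of _ "max 1 C"] conjI exI[of _ l0] allI impI) auto
qed

lemma good_const: "c \<ge> 0 \<Longrightarrow> good (\<lambda>_ _ _. c)"
  unfolding good_def
proof (intro conjI allI)
  assume c: "c \<ge> 0"
  then show "moment_family (\<lambda>_ _ _. c)" by (simp add: moment_family_def)
  fix n
  show "\<exists>C. \<exists>l0>0. \<forall>(lam::real) z. 0 \<le> lam \<longrightarrow> lam < l0 \<longrightarrow> lam \<le> 1 \<longrightarrow> z \<in> Z \<longrightarrow>
    (\<integral>\<^sup>+\<omega>. ennreal (c ^ n) \<partial>P) \<le> ennreal C"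
    by (rule exI[of _ "c ^ n"], rule exI[of _ 1]) (simp add: emeasure_space_1)
qed

lemma moment_family_add: "moment_family X \<Longrightarrow> moment_family Y \<Longrightarrow> moment_family (\<lambda>lam z \<omega>. X lam z \<omega> + Y lam z \<omega>)"
  unfolding moment_family_def by (auto intro!: borel_measurable_add)

lemma moment_family_mult: "moment_family X \<Longrightarrow> moment_family Y \<Longrightarrow> moment_family (\<lambda>lam z \<omega>. X lam z \<omega> * Y lam z \<omega>)"
  unfolding moment_family_def by (auto intro!: borel_measurable_times)

lemma null_lam: "null (\<lambda>lam _ _. lam)"
proof -
  have "(\<integral>\<^sup>+\<omega>. ennreal (lam ^ n) \<partial>P) \<le> ennreal e" if "n \<ge> 1" "0 \<le> lam" "lam < min 1 e" for n lam e
  proof -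
    have "lam ^ n \<le> lam ^ 1" using that by (intro power_decreasing) auto
    then show ?thesis using that by (simp add: emeasure_space_1 ennreal_leI)
  qed
  then show ?thesis unfolding null_def moment_family_def by (auto intro!: exI[of _ "min 1 _"])
qed

lemma good_mono:
  assumes Y: "good Y" and X: "moment_family X" and le: "\<And>lam z \<omega>. 0 \<le> lam \<Longrightarrow> lam \<le> 1 \<Longrightarrow> z \<in> Z \<Longrightarrow> X lam z \<omega> \<le> Y lam z \<omega>"
  shows "good X"
  unfolding good_def
proof (intro conjI X allI)
  fix n
  from goodD[OF Y, of n] obtain C l0 where l0: "l0 > 0" and C: "\<And>lam z. 0 \<le> lam \<Longrightarrow> lam < l0 \<Longrightarrow> lam \<le> 1 \<Longrightarrow> z \<in> Z \<Longrightarrow>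
    (\<integral>\<^sup>+\<omega>. ennreal (Y lam z \<omega> ^ n) \<partial>P) \<le> ennreal C" by metis
  have "(\<integral>\<^sup>+\<omega>. ennreal (X lam z \<omega> ^ n) \<partial>P) \<le> ennreal C" if l: "0 \<le> lam" "lam < l0" "lam \<le> 1" "z \<in> Z" for lam z
    by (rule order_trans[OF nn_integral_mono C[OF l]]) (use le mfamD(2)[OF X] l in \<open>auto intro!: ennreal_leI power_mono\<close>)
  then show "\<exists>C. \<exists>l0>0. \<forall>lam z. 0 \<le> lam \<longrightarrow> lam < l0 \<longrightarrow> lam \<le> 1 \<longrightarrow> z \<in> Z \<longrightarrow>
    (\<integral>\<^sup>+\<omega>. ennreal (X lam z \<omega> ^ n) \<partial>P) \<le> ennreal C" using l0 by blast
qed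

lemma null_mono:
  assumes Y: "null Y" and X: "moment_family X" and le: "\<And>lam z \<omega>. 0 \<le> lam \<Longrightarrow> lam \<le> 1 \<Longrightarrow> z \<in> Z \<Longrightarrow> X lam z \<omega> \<le> Y lam z \<omega>"
  shows "null X"
  unfolding null_def
proof (intro conjI X allI impI)
  fix n :: nat and e :: real assume ne: "n \<ge> 1" "e > 0"
  from Y ne obtain l0 where l0: "l0 > 0" and C: "\<And>lam z. 0 \<le> lam \<Longrightarrow> lam < l0 \<Longrightarrow> lam \<le> 1 \<Longrightarrow> z \<in> Z \<Longrightarrow>
    (\<integral>\<^sup>+\<omega>. ennreal (Y lam z \<omega> ^ n) \<partial>P) \<le> ennreal e" unfolding null_def by metis
  have "(\<integral>\<^sup>+\<omega>. ennreal (X lam z \<omega> ^ n) \<partial>P) \<le> ennreal e" if l: "0 \<le> lam" "lam < l0" "lam \<le> 1" "z \<in> Z" for lam z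
    by (rule order_trans[OF nn_integral_mono C[OF l]]) (use le mfamD(2)[OF X] l in \<open>auto intro!: ennreal_leI power_mono\<close>)
  then show "\<exists>l0>0. \<forall>lam z. 0 \<le> lam \<longrightarrow> lam < l0 \<longrightarrow> lam \<le> 1 \<longrightarrow> z \<in> Z \<longrightarrow>
    (\<integral>\<^sup>+\<omega>. ennreal (X lam z \<omega> ^ n) \<partial>P) \<le> ennreal e" using l0 by blast
qed

lemma nn_integral_power_sum_le:
  assumes X: "moment_family X" and Y: "moment_family Y" and l: "0 \<le> lam" "lam \<le> 1" "z \<in> Z" and c: "c \<ge> 0" "d \<ge> 0"
  shows "(\<integral>\<^sup>+\<omega>. ennreal (c * X lam z \<omega> ^ n + d * Y lam z \<omega> ^ m) \<partial>P)
    = ennreal c * (\<integral>\<^sup>+\<omega>. ennreal (X lam z \<omega> ^ n) \<partial>P) + ennreal d * (\<integral>\<^sup>+\<omega>. ennreal (Y lam z \<omega> ^ m) \<partial>P)"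
proof -
  note [measurable] = mfamD(1)[OF X l] mfamD(1)[OF Y l]
  have "(\<integral>\<^sup>+\<omega>. ennreal (c * X lam z \<omega> ^ n + d * Y lam z \<omega> ^ m) \<partial>P)
     = (\<integral>\<^sup>+\<omega>. ennreal c * ennreal (X lam z \<omega> ^ n) + ennreal d * ennreal (Y lam z \<omega> ^ m) \<partial>P)"
    using mfamD(2)[OF X l] mfamD(2)[OF Y l] c by (intro nn_integral_cong) (simp add: ennreal_mult[symmetric] ennreal_plus[symmetric] del: ennreal_plus)
  also have "\<dots> = ennreal c * (\<integral>\<^sup>+\<omega>. ennreal (X lam z \<omega> ^ n) \<partial>P) + ennreal d * (\<integral>\<^sup>+\<omega>. ennreal (Y lam z \<omega> ^ m) \<partial>P)"
    by (subst nn_integral_add) (auto simp: nn_integral_cmult)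
  finally show ?thesis .
qed

lemma power_sum_le: fixes x y :: real assumes "x \<ge> 0" "y \<ge> 0" shows "(x + y) ^ n \<le> 2 ^ n * x ^ n + 2 ^ n * y ^ n"
proof -
  have "(x + y) ^ n \<le> (2 * max x y) ^ n" using assms by (intro power_mono) auto
  also have "\<dots> = 2 ^ n * max x y ^ n" by (simp add: power_mult_distrib)
  also have "\<dots> \<le> 2 ^ n * (x ^ n + y ^ n)" using assms by (intro mult_left_mono) (auto simp: max_def)
  finally show ?thesis by (simp add: distrib_left)
qed

lemma good_add: assumes X: "good X" and Y: "good Y" shows "good (\<lambda>lam z \<omega>. X lam z \<omega> + Y lam z \<omega>)"
  unfolding good_def
proof (intro conjI allI)
  note mX = good_moment_family[OF X] and mY = good_moment_family[OF Y]
  show "moment_family (\<lambda>lam z \<omega>. X lam z \<omega> + Y lam z \<omega>)" by (rule moment_family_add[OF mX mY])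
  fix n
  from goodD[OF X, of n] obtain C l0 where l0: "l0 > 0" "C > 0" and C: "\<And>lam z. 0 \<le> lam \<Longrightarrow> lam < l0 \<Longrightarrow> lam \<le> 1 \<Longrightarrow> z \<in> Z \<Longrightarrow>
    (\<integral>\<^sup>+\<omega>. ennreal (X lam z \<omega> ^ n) \<partial>P) \<le> ennreal C" by metis
  from goodD[OF Y, of n] obtain D l1 where l1: "l1 > 0" "D > 0" and D: "\<And>lam z. 0 \<le> lam \<Longrightarrow> lam < l1 \<Longrightarrow> lam \<le> 1 \<Longrightarrow> z \<in> Z \<Longrightarrow>
    (\<integral>\<^sup>+\<omega>. ennreal (Y lam z \<omega> ^ n) \<partial>P) \<le> ennreal D" by metis
  have "(\<integral>\<^sup>+\<omega>. ennreal ((X lam z \<omega> + Y lam z \<omega>) ^ n) \<partial>P) \<le> ennreal (2 ^ n * C + 2 ^ n * D)"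
    if l: "0 \<le> lam" "lam < min l0 l1" "lam \<le> 1" "z \<in> Z" for lam z
  proof -
    have "(\<integral>\<^sup>+\<omega>. ennreal ((X lam z \<omega> + Y lam z \<omega>) ^ n) \<partial>P) \<le> (\<integral>\<^sup>+\<omega>. ennreal (2 ^ n * X lam z \<omega> ^ n + 2 ^ n * Y lam z \<omega> ^ n) \<partial>P)"
      using mfamD(2)[OF mX l(1,3,4)] mfamD(2)[OF mY l(1,3,4)] by (intro nn_integral_mono ennreal_leI power_sum_le) auto
    also have "\<dots> \<le> ennreal (2 ^ n) * ennreal C + ennreal (2 ^ n) * ennreal D"
      unfolding nn_integral_power_sum_le[OF mX mY l(1,3,4), of "2 ^ n" "2 ^ n", simplified]
      using C[of lam z] D[of lam z] l by (intro add_mono mult_left_mono) auto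
    also have "\<dots> = ennreal (2 ^ n * C + 2 ^ n * D)" using l0 l1 by (simp add: ennreal_mult ennreal_plus)
    finally show ?thesis .
  qed
  then show "\<exists>C. \<exists>l0>0. \<forall>lam z. 0 \<le> lam \<longrightarrow> lam < l0 \<longrightarrow> lam \<le> 1 \<longrightarrow> z \<in> Z \<longrightarrow>
    (\<integral>\<^sup>+\<omega>. ennreal ((X lam z \<omega> + Y lam z \<omega>) ^ n) \<partial>P) \<le> ennreal C"
    using l0 l1 by (intro exI[of _ "2 ^ n * C + 2 ^ n * D"] exI[of _ "min l0 l1"]) auto
qed

lemma null_add: assumes X: "null X" and Y: "null Y" shows "null (\<lambda>lam z \<omega>. X lam z \<omega> + Y lam z \<omega>)"
  unfolding null_def
proof (intro conjI allI impI)
  note mX = null_moment_family[OF X] and mY = null_moment_family[OF Y]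
  show "moment_family (\<lambda>lam z \<omega>. X lam z \<omega> + Y lam z \<omega>)" by (rule moment_family_add[OF mX mY])
  fix n :: nat and e :: real assume n: "n \<ge> 1" and e: "e > 0"
  define e' where "e' = e / (2 * 2 ^ n)"
  have e': "e' > 0" using e by (simp add: e'_def)
  from X n e' obtain l0 where l0: "l0 > 0" and C: "\<And>lam z. 0 \<le> lam \<Longrightarrow> lam < l0 \<Longrightarrow> lam \<le> 1 \<Longrightarrow> z \<in> Z \<Longrightarrow>
    (\<integral>\<^sup>+\<omega>. ennreal (X lam z \<omega> ^ n) \<partial>P) \<le> ennreal e'" unfolding null_def by metis
  from Y n e' obtain l1 where l1: "l1 > 0" and D: "\<And>lam z. 0 \<le> lam \<Longrightarrow> lam < l1 \<Longrightarrow> lam \<le> 1 \<Longrightarrow> z \<in> Z \<Longrightarrow>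
    (\<integral>\<^sup>+\<omega>. ennreal (Y lam z \<omega> ^ n) \<partial>P) \<le> ennreal e'" unfolding null_def by metis
  have "(\<integral>\<^sup>+\<omega>. ennreal ((X lam z \<omega> + Y lam z \<omega>) ^ n) \<partial>P) \<le> ennreal e"
    if l: "0 \<le> lam" "lam < min l0 l1" "lam \<le> 1" "z \<in> Z" for lam z
  proof -
    have "(\<integral>\<^sup>+\<omega>. ennreal ((X lam z \<omega> + Y lam z \<omega>) ^ n) \<partial>P) \<le> (\<integral>\<^sup>+\<omega>. ennreal (2 ^ n * X lam z \<omega> ^ n + 2 ^ n * Y lam z \<omega> ^ n) \<partial>P)"
      using mfamD(2)[OF mX l(1,3,4)] mfamD(2)[OF mY l(1,3,4)] by (intro nn_integral_mono ennreal_leI power_sum_le) auto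
    also have "\<dots> \<le> ennreal (2 ^ n) * ennreal e' + ennreal (2 ^ n) * ennreal e'"
      unfolding nn_integral_power_sum_le[OF mX mY l(1,3,4), of "2 ^ n" "2 ^ n", simplified]
      using C[of lam z] D[of lam z] l by (intro add_mono mult_left_mono) auto
    also have "\<dots> = ennreal (2 ^ n * e' + 2 ^ n * e')" using e' by (simp add: ennreal_mult[symmetric] ennreal_plus[symmetric] del: ennreal_plus)
    also have "2 ^ n * e' + 2 ^ n * e' = e" by (simp add: e'_def)
    finally show ?thesis .
  qed
  then show "\<exists>l0>0. \<forall>lam z. 0 \<le> lam \<longrightarrow> lam < l0 \<longrightarrow> lam \<le> 1 \<longrightarrow> z \<in> Z \<longrightarrow>
    (\<integral>\<^sup>+\<omega>. ennreal ((X lam z \<omega> + Y lam z \<omega>) ^ n) \<partial>P) \<le> ennreal e"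
    using l0 l1 by (intro exI[of _ "min l0 l1"]) auto
qed

lemma young: fixes x y \<delta> :: real assumes "\<delta> > 0" shows "x * y \<le> (1 / \<delta>) * x\<^sup>2 + \<delta> * y\<^sup>2"
proof -
  have "0 \<le> (1 / \<delta>) * (x - \<delta> * y / 2)\<^sup>2" using assms by simp
  also have "\<dots> = (1 / \<delta>) * x\<^sup>2 - x * y + \<delta> * y\<^sup>2 / 4" using assms by (simp add: power2_eq_square field_simps)
  finally have "x * y \<le> (1 / \<delta>) * x\<^sup>2 + \<delta> * y\<^sup>2 / 4" by linarith
  moreover have "\<delta> * y\<^sup>2 \<ge> 0" using assms by simp
  ultimately show ?thesis by linarith
qed

lemma good_mult: assumes X: "good X" and Y: "good Y" shows "good (\<lambda>lam z \<omega>. X lam z \<omega> * Y lam z \<omega>)"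
  unfolding good_def
proof (intro conjI allI)
  note mX = good_moment_family[OF X] and mY = good_moment_family[OF Y]
  show "moment_family (\<lambda>lam z \<omega>. X lam z \<omega> * Y lam z \<omega>)" by (rule moment_family_mult[OF mX mY])
  fix n
  from goodD[OF X, of "n * 2"] obtain C l0 where l0: "l0 > 0" "C > 0" and C: "\<And>lam z. 0 \<le> lam \<Longrightarrow> lam < l0 \<Longrightarrow> lam \<le> 1 \<Longrightarrow> z \<in> Z \<Longrightarrow>
    (\<integral>\<^sup>+\<omega>. ennreal (X lam z \<omega> ^ (n * 2)) \<partial>P) \<le> ennreal C" by metis
  from goodD[OF Y, of "n * 2"] obtain D l1 where l1: "l1 > 0" "D > 0" and D: "\<And>lam z. 0 \<le> lam \<Longrightarrow> lam < l1 \<Longrightarrow> lam \<le> 1 \<Longrightarrow> z \<in> Z \<Longrightarrow>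
    (\<integral>\<^sup>+\<omega>. ennreal (Y lam z \<omega> ^ (n * 2)) \<partial>P) \<le> ennreal D" by metis
  have "(\<integral>\<^sup>+\<omega>. ennreal ((X lam z \<omega> * Y lam z \<omega>) ^ n) \<partial>P) \<le> ennreal (C + D)"
    if l: "0 \<le> lam" "lam < min l0 l1" "lam \<le> 1" "z \<in> Z" for lam z
  proof -
    have "(\<integral>\<^sup>+\<omega>. ennreal ((X lam z \<omega> * Y lam z \<omega>) ^ n) \<partial>P) \<le> (\<integral>\<^sup>+\<omega>. ennreal (1 * X lam z \<omega> ^ (n * 2) + 1 * Y lam z \<omega> ^ (n * 2)) \<partial>P)"
      using young[of 1 "X lam z _ ^ n" "Y lam z _ ^ n"] by (intro nn_integral_mono ennreal_leI) (simp add: power_mult_distrib power_mult)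
    also have "\<dots> \<le> ennreal 1 * ennreal C + ennreal 1 * ennreal D"
      unfolding nn_integral_power_sum_le[OF mX mY l(1,3,4) zero_le_one zero_le_one]
      using C[of lam z] D[of lam z] l by (intro add_mono mult_left_mono) auto
    also have "\<dots> = ennreal (C + D)" using l0 l1 by (simp add: ennreal_plus)
    finally show ?thesis .
  qed
  then show "\<exists>C. \<exists>l0>0. \<forall>lam z. 0 \<le> lam \<longrightarrow> lam < l0 \<longrightarrow> lam \<le> 1 \<longrightarrow> z \<in> Z \<longrightarrow>
    (\<integral>\<^sup>+\<omega>. ennreal ((X lam z \<omega> * Y lam z \<omega>) ^ n) \<partial>P) \<le> ennreal C"
    using l0 l1 by (intro exI[of _ "C + D"] exI[of _ "min l0 l1"]) auto
qed

lemma null_mult: assumes X: "null X" and Y: "good Y" shows "null (\<lambda>lam z \<omega>. X lam z \<omega> * Y lam z \<omega>)"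
  unfolding null_def
proof (intro conjI allI impI)
  note mX = null_moment_family[OF X] and mY = good_moment_family[OF Y]
  show "moment_family (\<lambda>lam z \<omega>. X lam z \<omega> * Y lam z \<omega>)" by (rule moment_family_mult[OF mX mY])
  fix n :: nat and e :: real assume n: "n \<ge> 1" and e: "e > 0"
  from goodD[OF Y, of "n * 2"] obtain D l1 where l1: "l1 > 0" "D > 0" and D: "\<And>lam z. 0 \<le> lam \<Longrightarrow> lam < l1 \<Longrightarrow> lam \<le> 1 \<Longrightarrow> z \<in> Z \<Longrightarrow>
    (\<integral>\<^sup>+\<omega>. ennreal (Y lam z \<omega> ^ (n * 2)) \<partial>P) \<le> ennreal D" by metis
  define \<delta> where "\<delta> = e / (2 * D)"
  have \<delta>: "\<delta> > 0" using e l1 by (simp add: \<delta>_def)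
  have "n * 2 \<ge> 1" "\<delta> * e / 2 > 0" using n \<delta> e by auto
  with X obtain l0 where l0: "l0 > 0" and C: "\<And>lam z. 0 \<le> lam \<Longrightarrow> lam < l0 \<Longrightarrow> lam \<le> 1 \<Longrightarrow> z \<in> Z \<Longrightarrow>
    (\<integral>\<^sup>+\<omega>. ennreal (X lam z \<omega> ^ (n * 2)) \<partial>P) \<le> ennreal (\<delta> * e / 2)" unfolding null_def by metis
  have "(\<integral>\<^sup>+\<omega>. ennreal ((X lam z \<omega> * Y lam z \<omega>) ^ n) \<partial>P) \<le> ennreal e"
    if l: "0 \<le> lam" "lam < min l0 l1" "lam \<le> 1" "z \<in> Z" for lam z
  proof -
    have "(\<integral>\<^sup>+\<omega>. ennreal ((X lam z \<omega> * Y lam z \<omega>) ^ n) \<partial>P) \<le> (\<integral>\<^sup>+\<omega>. ennreal ((1 / \<delta>) * X lam z \<omega> ^ (n * 2) + \<delta> * Y lam z \<omega> ^ (n * 2)) \<partial>P)"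
      using young[OF \<delta>, of "X lam z _ ^ n" "Y lam z _ ^ n"] by (intro nn_integral_mono ennreal_leI) (simp add: power_mult_distrib power_mult)
    also have "\<dots> \<le> ennreal (1 / \<delta>) * ennreal (\<delta> * e / 2) + ennreal \<delta> * ennreal D"
      using \<delta> nn_integral_power_sum_le[OF mX mY l(1,3,4), of "1 / \<delta>" \<delta> "n * 2" "n * 2"]
        C[of lam z] D[of lam z] l by (auto intro!: add_mono mult_left_mono)
    also have "\<dots> = ennreal ((1 / \<delta>) * (\<delta> * e / 2) + \<delta> * D)" using \<delta> e l1 by (simp add: ennreal_mult[symmetric] ennreal_plus[symmetric] del: ennreal_plus)
    also have "(1 / \<delta>) * (\<delta> * e / 2) + \<delta> * D = e" using \<delta> l1 by (simp add: \<delta>_def)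
    finally show ?thesis .
  qed
  then show "\<exists>l0>0. \<forall>lam z. 0 \<le> lam \<longrightarrow> lam < l0 \<longrightarrow> lam \<le> 1 \<longrightarrow> z \<in> Z \<longrightarrow>
    (\<integral>\<^sup>+\<omega>. ennreal ((X lam z \<omega> * Y lam z \<omega>) ^ n) \<partial>P) \<le> ennreal e"
    using l0 l1 by (intro exI[of _ "min l0 l1"]) auto
qed

lemma good_null: assumes X: "null X" shows "good X"
  unfolding good_def
proof (intro conjI allI null_moment_family[OF X])
  fix n
  show "\<exists>C. \<exists>l0>0. \<forall>lam z. 0 \<le> lam \<longrightarrow> lam < l0 \<longrightarrow> lam \<le> 1 \<longrightarrow> z \<in> Z \<longrightarrow> (\<integral>\<^sup>+\<omega>. ennreal (X lam z \<omega> ^ n) \<partial>P) \<le> ennreal C"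
  proof (cases "n = 0")
    case True
    show ?thesis by (rule exI[of _ 1], rule exI[of _ 1]) (simp add: emeasure_space_1 True)
  next
    case False
    then have n: "n \<ge> 1" by simp
    have "\<forall>e>0. \<exists>l0>0. \<forall>lam z. 0 \<le> lam \<longrightarrow> lam < l0 \<longrightarrow> lam \<le> 1 \<longrightarrow> z \<in> Z \<longrightarrow> (\<integral>\<^sup>+\<omega>. ennreal (X lam z \<omega> ^ n) \<partial>P) \<le> ennreal e"
      using X n unfolding null_def by blast
    from this[rule_format, OF zero_less_one] show ?thesis by blast
  qed
qed

text \<open>
  \<open>contraction\<close> speaks of orders at least 2. Moments of even order dominate those of half the order.
\<close>

lemma nullI:
  assumes m: "moment_family X" and h: "\<And>n e. n \<ge> 1 \<Longrightarrow> e > 0 \<Longrightarrow> \<exists>l0>0. \<forall>lam z. 0 \<le> lam \<longrightarrow> lam < l0 \<longrightarrow> lam \<le> 1 \<longrightarrow> z \<in> Z \<longrightarrow>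
    (\<integral>\<^sup>+\<omega>. ennreal (X lam z \<omega> ^ (n * 2)) \<partial>P) \<le> ennreal e"
  shows "null X"
  unfolding null_def
proof (intro conjI m allI impI)
  fix n :: nat and e :: real assume n: "n \<ge> 1" and e: "e > 0"
  from h[OF n, of "e\<^sup>2 / 4"] e obtain l0 where l0: "l0 > 0" and C: "\<And>lam z. 0 \<le> lam \<Longrightarrow> lam < l0 \<Longrightarrow> lam \<le> 1 \<Longrightarrow> z \<in> Z \<Longrightarrow>
    (\<integral>\<^sup>+\<omega>. ennreal (X lam z \<omega> ^ (n * 2)) \<partial>P) \<le> ennreal (e\<^sup>2 / 4)" by auto
  have "(\<integral>\<^sup>+\<omega>. ennreal (X lam z \<omega> ^ n) \<partial>P) \<le> ennreal e" if l: "0 \<le> lam" "lam < l0" "lam \<le> 1" "z \<in> Z" for lam z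
  proof -
    have "X lam z \<omega> ^ n \<le> (2 / e) * X lam z \<omega> ^ (n * 2) + (e / 2) * X lam z \<omega> ^ 0" for \<omega>
      using young[of "e / 2" "X lam z \<omega> ^ n" 1] e by (simp add: power_mult)
    then have "(\<integral>\<^sup>+\<omega>. ennreal (X lam z \<omega> ^ n) \<partial>P) \<le> (\<integral>\<^sup>+\<omega>. ennreal ((2 / e) * X lam z \<omega> ^ (n * 2) + (e / 2) * X lam z \<omega> ^ 0) \<partial>P)"
      by (intro nn_integral_mono ennreal_leI)
    also have "\<dots> = ennreal (2 / e) * (\<integral>\<^sup>+\<omega>. ennreal (X lam z \<omega> ^ (n * 2)) \<partial>P) + ennreal (e / 2) * (\<integral>\<^sup>+\<omega>. ennreal (X lam z \<omega> ^ 0) \<partial>P)"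
      by (rule nn_integral_power_sum_le[OF m m l(1,3,4)]) (use e in auto)
    also have "\<dots> \<le> ennreal (2 / e) * ennreal (e\<^sup>2 / 4) + ennreal (e / 2) * 1"
      using C[OF l] by (intro add_mono mult_left_mono) (auto simp: emeasure_space_1)
    also have "\<dots> = ennreal ((2 / e) * (e\<^sup>2 / 4) + e / 2)" using e by (simp add: ennreal_mult[symmetric] ennreal_plus[symmetric] del: ennreal_plus)
    also have "(2 / e) * (e\<^sup>2 / 4) + e / 2 = e" using e by (simp add: power2_eq_square)
    finally show ?thesis .
  qed
  then show "\<exists>l0>0. \<forall>lam z. 0 \<le> lam \<longrightarrow> lam < l0 \<longrightarrow> lam \<le> 1 \<longrightarrow> z \<in> Z \<longrightarrow>
    (\<integral>\<^sup>+\<omega>. ennreal (X lam z \<omega> ^ n) \<partial>P) \<le> ennreal e" using l0 by blast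
qed

lemma null_square: assumes m: "moment_family X" and X: "null (\<lambda>lam z \<omega>. (X lam z \<omega>)\<^sup>2)" shows "null X"
proof (rule nullI[OF m])
  fix n :: nat and e :: real assume "n \<ge> 1" "e > 0"
  then have "\<exists>l0>0. \<forall>lam z. 0 \<le> lam \<longrightarrow> lam < l0 \<longrightarrow> lam \<le> 1 \<longrightarrow> z \<in> Z \<longrightarrow>
    (\<integral>\<^sup>+\<omega>. ennreal (((X lam z \<omega>)\<^sup>2) ^ n) \<partial>P) \<le> ennreal e" using X unfolding null_def by blast
  then show "\<exists>l0>0. \<forall>lam z. 0 \<le> lam \<longrightarrow> lam < l0 \<longrightarrow> lam \<le> 1 \<longrightarrow> z \<in> Z \<longrightarrow>
    (\<integral>\<^sup>+\<omega>. ennreal (X lam z \<omega> ^ (n * 2)) \<partial>P) \<le> ennreal e" by (simp add: power_mult[symmetric] mult.commute)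
qed

lemma null_sum: "finite A \<Longrightarrow> (\<And>i. i \<in> A \<Longrightarrow> null (X i)) \<Longrightarrow> null (\<lambda>lam z \<omega>. \<Sum>i\<in>A. X i lam z \<omega>)"
proof (induction A rule: finite_induct)
  case empty
  show ?case by (rule null_mono[OF null_lam]) (auto simp: moment_family_def)
qed (auto intro: null_add)

definition "disp_family y lam z \<omega> = DD (rel_disp lam z \<omega> y)"

text \<open>
  This is \<open>contraction\<close>: over the window, its constants are controlled by \<open>mI\<close>, \<open>MI\<close> and the edge weights.
\<close>

lemma disp_family_null: assumes y: "y \<in> V" shows "null (disp_family y)"
proof (cases "I = {}")
  case True
  then have "Z = {}" unfolding Z_def by blast
  then show ?thesis by (auto simp: null_def moment_family_def intro!: exI[of _ 1])
next
  case False
  have MI: "MI > 0"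
  proof -
    from False obtain E where E: "E \<in> I" by blast
    have "mI \<le> Im (g0 (Complex E 1) rt)" "cmod (g0 (Complex E 1) rt) \<le> MI" using Im_g0[OF E] cmod_g0[OF E] rt_V by auto
    then show ?thesis using mI abs_Im_le_cmod[of "g0 (Complex E 1) rt"] by linarith
  qed
  show ?thesis
  proof (rule nullI)
    show "moment_family (disp_family y)" unfolding moment_family_def disp_family_def using rel_disp_measurable[OF ZI(1) _ _ y] DD_nonneg[OF rel_disp_pos[OF ZI(1) _ _ y]] by auto
    fix n :: nat and e :: real assume n: "n \<ge> 1" and e: "e > 0"
    obtain c where c: "c > 0" "\<And>x u. x \<in> V \<Longrightarrow> u \<in> ch x \<Longrightarrow> c \<le> cc x u" using cc_lower by blast
    define S0 where "S0 = c * mI"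
    define p0 where "p0 = c * mI / (cc_sum_bound * MI)"
    define \<sigma> where "\<sigma> = min 1 (mI / MI)"
    have pos: "0 < p0" "0 < \<sigma>" "\<sigma> \<le> 1" "0 < S0" using c mI MI cc_sum_bound(1) by (auto simp: p0_def \<sigma>_def S0_def)
    define k where "k = n * 2 - 2"
    have k: "k + 2 = n * 2" using n by (simp add: k_def)
    obtain C where C: "C > 0" "\<And>z lam y. Im z > 0 \<Longrightarrow> 0 \<le> lam \<Longrightarrow> lam \<le> 1 \<Longrightarrow> lam * C \<le> 1/2 \<Longrightarrow>
       (\<forall>x\<in>V. S0 \<le> child_sum z x \<and> \<sigma> \<le> Im (g0 z x) / cmod (g0 z x) \<and> (\<forall>u\<in>ch x. p0 \<le> child_weight z x u)) \<Longrightarrow> y \<in> V \<Longrightarrow>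
       DD_moment (k+2) lam z y \<le> 2 * C * lam" using contraction[OF pos, of k] by blast
    have hyp: "S0 \<le> child_sum z x \<and> \<sigma> \<le> Im (g0 z x) / cmod (g0 z x) \<and> (\<forall>u\<in>ch x. p0 \<le> child_weight z x u)" if z: "z \<in> Z" and x: "x \<in> V" for z x
    proof (intro conjI ballI)
      have lower: "c * mI \<le> cc x u * Im (g0 z u)" if u: "u \<in> ch x" for u
        using c(1) c(2)[OF x u] ZI(2)[OF z ch_V(2)[OF u]] mI by (intro mult_mono) auto
      obtain u0 where u0: "u0 \<in> ch x" using ch_ne[OF x] by blast
      have "cc x u0 * Im (g0 z u0) \<le> child_sum z x" unfolding child_sum_def
        using cc_pos g0_pos[OF ZI(1)[OF z]] ch_V by (intro member_le_sum u0 finite_ch) (auto intro!: mult_nonneg_nonneg less_imp_le)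
      then show "S0 \<le> child_sum z x" using lower[OF u0] by (simp add: S0_def)
      have g: "Im (g0 z x) > 0" using g0_pos ZI(1) z x by blast
      have "mI / MI \<le> Im (g0 z x) / cmod (g0 z x)"
        using ZI(2,3)[OF z x] mI g by (intro frac_le) auto
      then show "\<sigma> \<le> Im (g0 z x) / cmod (g0 z x)" by (simp add: \<sigma>_def)
      fix u assume u: "u \<in> ch x"
      have "child_sum z x \<le> (\<Sum>u\<in>ch x. cc x u * MI)" unfolding child_sum_def
        using cc_pos ZI(3)[OF z] ch_V order_trans[OF order_trans[OF abs_ge_self abs_Im_le_cmod]]
        by (intro sum_mono mult_left_mono) (auto intro: less_imp_le)
      also have "\<dots> \<le> cc_sum_bound * MI" unfolding sum_distrib_right[symmetric] using cc_sum_bound x MI by (intro mult_right_mono) auto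
      finally have "child_sum z x \<le> cc_sum_bound * MI" .
      moreover have "0 \<le> cc x u * Im (g0 z u)"
        using lower[OF u] mult_nonneg_nonneg[of c mI] c mI by linarith
      ultimately show "p0 \<le> child_weight z x u" unfolding p0_def child_weight_def
        using lower[OF u] child_sum_pos[OF ZI(1)[OF z] x] c mI by (intro frac_le) auto
    qed
    define l0 where "l0 = min (1 / (2 * C)) (e / (2 * C))"
    have l0: "l0 > 0" using C e by (simp add: l0_def)
    have "(\<integral>\<^sup>+\<omega>. ennreal (disp_family y lam z \<omega> ^ (n * 2)) \<partial>P) \<le> ennreal e" if l: "0 \<le> lam" "lam < l0" "lam \<le> 1" "z \<in> Z" for lam z
    proof -
      have lC: "lam * C \<le> 1/2" "2 * C * lam \<le> e" using l C(1) by (auto simp: l0_def field_simps)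
      have "(\<integral>\<^sup>+\<omega>. ennreal (disp_family y lam z \<omega> ^ (n * 2)) \<partial>P) = ennreal (DD_moment (n * 2) lam z y)"
        unfolding disp_family_def DD_moment_def using DD_nonneg[OF rel_disp_pos[OF ZI(1)[OF l(4)] l(1,3) y]]
        by (intro nn_integral_eq_integral integrable_DD_rel_disp[OF ZI(1)[OF l(4)] l(1,3) y]) auto
      also have "\<dots> \<le> ennreal e"
      proof (rule ennreal_leI)
        have "DD_moment (k + 2) lam z y \<le> 2 * C * lam"
          by (rule C(2)[OF ZI(1)[OF l(4)] l(1,3) lC(1) _ y]) (use hyp l(4) in blast)
        then show "DD_moment (n * 2) lam z y \<le> e" using lC(2) unfolding k by linarith
      qed
      finally show ?thesis .
    qed
    then show "\<exists>l0>0. \<forall>lam z. 0 \<le> lam \<longrightarrow> lam < l0 \<longrightarrow> lam \<le> 1 \<longrightarrow> z \<in> Z \<longrightarrow>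
      (\<integral>\<^sup>+\<omega>. ennreal (disp_family y lam z \<omega> ^ (n * 2)) \<partial>P) \<le> ennreal e" using l0 by blast
  qed
qed

lemma disp_family_hdist: "z \<in> Z \<Longrightarrow> 0 \<le> lam \<Longrightarrow> lam \<le> 1 \<Longrightarrow> y \<in> V \<Longrightarrow> disp_family y lam z \<omega> = hdist (gr lam z \<omega> y) (g0 z y)"
  unfolding disp_family_def rel_disp_def using hdist_DD(1)[OF g0_pos gr_pos] ZI(1) by simp

text \<open>
  The hyperbolic distance from \<open>g0\<close> also controls how close the random Green function comes to the real axis.
\<close>

lemma inverse_Im_good: assumes y: "y \<in> V" shows "good (\<lambda>lam z \<omega>. 1 / Im (gr lam z \<omega> y))"
proof (rule good_mono)
  show "good (\<lambda>lam z \<omega>. (1 / mI) * (disp_family y lam z \<omega> + 2))"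
    using mI by (intro good_mult good_add good_const good_null[OF disp_family_null[OF y]]) auto
  show "moment_family (\<lambda>lam z \<omega>. 1 / Im (gr lam z \<omega> y))"
    using gr_measurable[OF ZI(1) _ _ y] gr_pos[OF ZI(1) _ _ y] by (auto simp: moment_family_def intro: less_imp_le)
  fix lam :: real and z \<omega> assume l: "0 \<le> lam" "lam \<le> 1" "z \<in> Z"
  define g where "g = gr lam z \<omega> y"
  have g: "Im g > 0" "Im (g0 z y) > 0" using gr_pos[OF ZI(1) l(1,2) y] g0_pos[OF ZI(1) y] l by (auto simp: g_def)
  have "mI / Im g \<le> Im (g0 z y) / Im g" using ZI(2)[OF l(3) y] g by (intro divide_right_mono) auto
  also have "\<dots> \<le> disp_family y lam z \<omega> + 2" using le_hdist(1)[OF g] disp_family_hdist[OF l(3,1,2) y] by (simp add: g_def)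
  finally show "1 / Im (gr lam z \<omega> y) \<le> (1 / mI) * (disp_family y lam z \<omega> + 2)" using mI g by (simp add: g_def field_simps)
qed

lemma dg_null: assumes y: "y \<in> V" shows "null (\<lambda>lam z \<omega>. cmod (gr lam z \<omega> y - g0 z y))"
proof (rule null_square)
  have m: "(\<lambda>\<omega>. gr lam z \<omega> y) \<in> borel_measurable P" if "0 \<le> lam" "lam \<le> 1" "z \<in> Z" for lam z
    using gr_measurable[OF ZI(1) _ _ y] that by blast
  then show "moment_family (\<lambda>lam z \<omega>. cmod (gr lam z \<omega> y - g0 z y))" by (auto simp: moment_family_def)
  show "null (\<lambda>lam z \<omega>. (cmod (gr lam z \<omega> y - g0 z y))\<^sup>2)"
  proof (rule null_mono)
    show "null (\<lambda>lam z \<omega>. disp_family y lam z \<omega> * ((disp_family y lam z \<omega> + 2) * MI\<^sup>2))"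
      by (intro null_mult disp_family_null[OF y] good_mult good_add good_const good_null[OF disp_family_null[OF y]]) auto
    show "moment_family (\<lambda>lam z \<omega>. (cmod (gr lam z \<omega> y - g0 z y))\<^sup>2)" using m by (auto simp: moment_family_def)
    fix lam :: real and z \<omega> assume l: "0 \<le> lam" "lam \<le> 1" "z \<in> Z"
    define g where "g = gr lam z \<omega> y"
    define h where "h = g0 z y"
    have g: "Im g > 0" "Im h > 0" using gr_pos[OF ZI(1) l(1,2) y] g0_pos[OF ZI(1) y] l by (auto simp: g_def h_def)
    have D: "disp_family y lam z \<omega> = hdist g h" using disp_family_hdist[OF l(3,1,2) y] by (simp add: g_def h_def)
    have hM: "Im h \<le> MI" using ZI(3)[OF l(3) y] abs_Im_le_cmod[of h] by (simp add: h_def)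
    have "(cmod (g - h))\<^sup>2 = hdist g h * ((Im g / Im h) * (Im h)\<^sup>2)" using g by (simp add: hdist_def power2_eq_square)
    also have "\<dots> \<le> hdist g h * ((hdist g h + 2) * MI\<^sup>2)"
      using le_hdist(2)[OF g] g hM hdist_nonneg[OF g] by (intro mult_left_mono mult_mono power_mono) auto
    finally show "(cmod (gr lam z \<omega> y - g0 z y))\<^sup>2 \<le> disp_family y lam z \<omega> * ((disp_family y lam z \<omega> + 2) * MI\<^sup>2)" by (simp add: D g_def h_def)
  qed
qed

definition "br lam z \<omega> x = parent_term (gr lam z \<omega>) (pot lam \<omega>) z x"
definition "b0 z x = parent_term (g0 z) w z x"

text \<open>
  The denominators occurring in Green functions have imaginary parts at least that of some forward Green
  function, whose inverse has bounded moments. So inverting them preserves null differences.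
\<close>

lemma reciprocal_families:
  fixes Q :: "real \<Rightarrow> complex \<Rightarrow> 'w \<Rightarrow> complex" and Q0 :: "complex \<Rightarrow> complex"
  assumes u: "u \<in> V" and k: "k > 0"
    and meas: "\<And>lam z. 0 \<le> lam \<Longrightarrow> lam \<le> 1 \<Longrightarrow> z \<in> Z \<Longrightarrow> Q lam z \<in> borel_measurable P"
    and Q: "\<And>lam z \<omega>. 0 \<le> lam \<Longrightarrow> lam \<le> 1 \<Longrightarrow> z \<in> Z \<Longrightarrow> Im (Q lam z \<omega>) \<ge> k * Im (gr lam z \<omega> u)"
    and Q0: "\<And>z. z \<in> Z \<Longrightarrow> Im (Q0 z) \<ge> k * Im (g0 z u)"
    and d: "null (\<lambda>lam z \<omega>. cmod (Q lam z \<omega> - Q0 z))"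
  shows "good (\<lambda>lam z \<omega>. cmod (- 1 / Q lam z \<omega>))" "null (\<lambda>lam z \<omega>. cmod (- 1 / Q lam z \<omega> - (- 1 / Q0 z)))"
proof -
  have m: "moment_family (\<lambda>lam z \<omega>. cmod (- 1 / Q lam z \<omega>))" "moment_family (\<lambda>lam z \<omega>. cmod (- 1 / Q lam z \<omega> - (- 1 / Q0 z)))"
    using meas by (auto simp: moment_family_def)
  have le: "cmod (- 1 / Q lam z \<omega>) \<le> (1 / k) * (1 / Im (gr lam z \<omega> u))" "Q lam z \<omega> \<noteq> 0" if l: "0 \<le> lam" "lam \<le> 1" "z \<in> Z" for lam z \<omega>
  proof -
    have g: "k * Im (gr lam z \<omega> u) > 0" using gr_pos[OF ZI(1)[OF l(3)] l(1,2) u] k by simp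
    show "cmod (- 1 / Q lam z \<omega>) \<le> (1 / k) * (1 / Im (gr lam z \<omega> u))"
      using cmod_neg_inverse_le[OF g Q[OF l]] by simp
    show "Q lam z \<omega> \<noteq> 0" using Q[OF l, of \<omega>] g by auto
  qed
  have le0: "cmod (- 1 / Q0 z) \<le> 1 / (k * mI)" "Q0 z \<noteq> 0" if z: "z \<in> Z" for z
  proof -
    have "k * mI \<le> k * Im (g0 z u)" using ZI(2)[OF z u] k by (intro mult_left_mono) auto
    then have g: "0 < k * mI" "k * mI \<le> Im (Q0 z)" using k mI Q0[OF z] by (simp, linarith)
    show "cmod (- 1 / Q0 z) \<le> 1 / (k * mI)" by (rule cmod_neg_inverse_le[OF g])
    show "Q0 z \<noteq> 0" using g by auto
  qed
  show G: "good (\<lambda>lam z \<omega>. cmod (- 1 / Q lam z \<omega>))"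
    by (rule good_mono[OF good_mult[OF good_const[of "1/k"] inverse_Im_good[OF u]] m(1)]) (use le(1) k in auto)
  show "null (\<lambda>lam z \<omega>. cmod (- 1 / Q lam z \<omega> - (- 1 / Q0 z)))"
  proof (rule null_mono[OF null_mult[OF d good_mult[OF G good_const[of "1 / (k * mI)"]]] m(2)])
    show "1 / (k * mI) \<ge> 0" using k mI by simp
    fix lam :: real and z \<omega> assume l: "0 \<le> lam" "lam \<le> 1" "z \<in> Z"
    have "- 1 / Q lam z \<omega> - (- 1 / Q0 z) = (Q lam z \<omega> - Q0 z) * ((- 1 / Q lam z \<omega>) * (- 1 / Q0 z))"
      using le(2)[OF l] le0(2)[OF l(3)] by (simp add: field_simps)
    then have "cmod (- 1 / Q lam z \<omega> - (- 1 / Q0 z)) = cmod (Q lam z \<omega> - Q0 z) * (cmod (- 1 / Q lam z \<omega>) * cmod (- 1 / Q0 z))"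
      by (simp only: norm_mult)
    also have "\<dots> \<le> cmod (Q lam z \<omega> - Q0 z) * (cmod (- 1 / Q lam z \<omega>) * (1 / (k * mI)))"
      using le0(1)[OF l(3)] by (intro mult_left_mono) auto
    finally show "cmod (- 1 / Q lam z \<omega> - (- 1 / Q0 z)) \<le> cmod (Q lam z \<omega> - Q0 z) * (cmod (- 1 / Q lam z \<omega>) * (1 / (k * mI)))" .
  qed
qed

text \<open>
  The set \<open>A\<close> is \<open>ch x\<close> for the full Green function, and \<open>ch x\<close> without one child for the step from \<open>x\<close> to
  that child in the recursion of \<open>parent_term\<close>. In both cases a child remains that bounds the denominator below.
\<close>

lemma denominator_families:
  assumes x: "x \<in> V" and A: "A \<subseteq> ch x" "A \<noteq> {}"
    and b: "null (\<lambda>lam z \<omega>. cmod (br lam z \<omega> x - b0 z x))"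
  defines "Q \<equiv> \<lambda>lam z \<omega>. z - of_real (pot lam \<omega> x) + (\<Sum>u\<in>A. of_real (cc x u) * gr lam z \<omega> u) + br lam z \<omega> x"
    and "Q0 \<equiv> \<lambda>z. z - of_real (w x) + (\<Sum>u\<in>A. of_real (cc x u) * g0 z u) + b0 z x"
  shows "good (\<lambda>lam z \<omega>. cmod (- 1 / Q lam z \<omega>))" "null (\<lambda>lam z \<omega>. cmod (- 1 / Q lam z \<omega> - (- 1 / Q0 z)))"
    "null (\<lambda>lam z \<omega>. cmod (Q lam z \<omega> - Q0 z))" "\<And>lam z. 0 \<le> lam \<Longrightarrow> lam \<le> 1 \<Longrightarrow> z \<in> Z \<Longrightarrow> Q lam z \<in> borel_measurable P"
    "\<And>u lam z \<omega>. u \<in> A \<Longrightarrow> 0 \<le> lam \<Longrightarrow> lam \<le> 1 \<Longrightarrow> z \<in> Z \<Longrightarrow> Im (Q lam z \<omega>) \<ge> cc x u * Im (gr lam z \<omega> u)"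
proof -
  have fin: "finite A" using A(1) finite_ch finite_subset by blast
  have AV: "u \<in> V" if "u \<in> A" for u using A(1) ch_V that by blast
  have Acc: "cc x u > 0" if "u \<in> A" for u using A(1) cc_pos that by blast
  have brm: "(\<lambda>\<omega>. br lam z \<omega> x) \<in> borel_measurable P" if "0 \<le> lam" "lam \<le> 1" "z \<in> Z" for lam z
    unfolding br_def gr_def[abs_def] by (rule parent_term_measurable[where B = Bw]) (use pot_measurable pot_bound ZI(1) x that in auto)
  show meas: "Q lam z \<in> borel_measurable P" if l: "0 \<le> lam" "lam \<le> 1" "z \<in> Z" for lam z
  proof -
    have [measurable]: "(\<lambda>\<omega>. gr lam z \<omega> u) \<in> borel_measurable P" if "u \<in> A" for u using gr_measurable[OF ZI(1)] AV l that by blast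
    note [measurable] = brm[OF l] pot_measurable[OF x]
    show ?thesis unfolding Q_def by measurable
  qed
  have ImQ: "Im (z - of_real r + (\<Sum>u\<in>A. of_real (cc x u) * g u) + q) \<ge> cc x u * Im (g u)"
    if z: "Im z > 0" and u: "u \<in> A" and g: "\<And>u. u \<in> V \<Longrightarrow> Im (g u) > 0" and q: "Im q \<ge> 0" for z r g u q
  proof -
    have "cc x u * Im (g u) \<le> (\<Sum>u\<in>A. cc x u * Im (g u))"
      using g AV Acc by (intro member_le_sum u fin) (auto intro!: mult_nonneg_nonneg less_imp_le)
    then show ?thesis using z q by simp
  qed
  show Qb: "Im (Q lam z \<omega>) \<ge> cc x u * Im (gr lam z \<omega> u)" if "u \<in> A" "0 \<le> lam" "lam \<le> 1" "z \<in> Z" for u lam z \<omega>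
    unfolding Q_def br_def
    by (rule ImQ) (use that ZI(1) gr_pos Im_parent_term[of "gr lam z \<omega>" z x "pot lam \<omega>"] x in auto)
  have Q0b: "Im (Q0 z) \<ge> cc x u * Im (g0 z u)" if "u \<in> A" "z \<in> Z" for u z
    unfolding Q0_def b0_def
    by (rule ImQ) (use that ZI(1) g0_pos Im_parent_term[of "g0 z" z x w] x in auto)
  show d: "null (\<lambda>lam z \<omega>. cmod (Q lam z \<omega> - Q0 z))"
  proof (rule null_mono)
    show "null (\<lambda>lam z \<omega>. lam + ((\<Sum>u\<in>A. cmod (gr lam z \<omega> u - g0 z u) * cc x u) + cmod (br lam z \<omega> x - b0 z x)))"
      using AV Acc by (intro null_add null_lam null_sum fin null_mult dg_null good_const b) (auto intro: less_imp_le)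
    show "moment_family (\<lambda>lam z \<omega>. cmod (Q lam z \<omega> - Q0 z))" using meas by (auto simp: moment_family_def)
    fix lam :: real and z \<omega> assume l: "0 \<le> lam" "lam \<le> 1" "z \<in> Z"
    have "Q lam z \<omega> - Q0 z = - of_real (lam * clamp1 (v \<omega> x)) + ((\<Sum>u\<in>A. of_real (cc x u) * (gr lam z \<omega> u - g0 z u)) + (br lam z \<omega> x - b0 z x))"
      by (simp add: Q_def Q0_def pot_def right_diff_distrib sum_subtractf)
    moreover have "cmod (- of_real (lam * clamp1 (v \<omega> x)) :: complex) \<le> lam"
    proof -
      have "\<bar>lam * clamp1 (v \<omega> x)\<bar> \<le> lam * 1" unfolding abs_mult using l clamp1(1) by (intro mult_mono) auto
      then show ?thesis by (simp only: norm_minus_cancel norm_of_real mult_1_right)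
    qed
    moreover have "cmod (\<Sum>u\<in>A. of_real (cc x u) * (gr lam z \<omega> u - g0 z u)) \<le> (\<Sum>u\<in>A. cmod (gr lam z \<omega> u - g0 z u) * cc x u)"
      by (rule sum_norm_le) (simp add: norm_mult abs_of_pos[OF Acc] mult.commute)
    ultimately show "cmod (Q lam z \<omega> - Q0 z) \<le> lam + ((\<Sum>u\<in>A. cmod (gr lam z \<omega> u - g0 z u) * cc x u) + cmod (br lam z \<omega> x - b0 z x))"
      by (simp only:) (intro norm_triangle_mono order_refl)
  qed
  obtain u where u: "u \<in> A" using A(2) by blast
  show "good (\<lambda>lam z \<omega>. cmod (- 1 / Q lam z \<omega>))" "null (\<lambda>lam z \<omega>. cmod (- 1 / Q lam z \<omega> - (- 1 / Q0 z)))"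
    by (rule reciprocal_families[OF AV[OF u] Acc[OF u] meas Qb[OF u] Q0b[OF u] d]; assumption)+
qed

lemma br_null: "x \<in> V \<Longrightarrow> null (\<lambda>lam z \<omega>. cmod (br lam z \<omega> x - b0 z x))"
proof (induction rule: tree_induct)
  case root
  show ?case by (rule null_mono[OF null_lam]) (auto simp: moment_family_def br_def b0_def parent_term_rt)
next
  case (step x y)
  have A: "ch x - {y} \<subseteq> ch x" "ch x - {y} \<noteq> {}" using sibling[OF step.hyps(1)] by auto
  have c: "cc x y > 0" using cc_pos step by blast
  note df = denominator_families(2)[OF step.hyps(1) A step.IH]
  show ?case
  proof (rule null_mono[OF null_mult[OF df good_const[of "cc x y"]]])
    show "0 \<le> cc x y" using c by simp
    show "moment_family (\<lambda>lam z \<omega>. cmod (br lam z \<omega> y - b0 z y))"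
    proof -
      have "(\<lambda>\<omega>. br lam z \<omega> y) \<in> borel_measurable P" if "0 \<le> lam" "lam \<le> 1" "z \<in> Z" for lam z
        unfolding br_def gr_def[abs_def] by (rule parent_term_measurable[where B = Bw]) (use pot_measurable pot_bound ZI(1) ch_V(2)[OF step.hyps(2)] that in auto)
      then show ?thesis by (auto simp: moment_family_def)
    qed
    fix lam :: real and z \<omega>
    show "cmod (br lam z \<omega> y - b0 z y) \<le> cmod (- 1 / (z - of_real (pot lam \<omega> x) + (\<Sum>u\<in>ch x - {y}. of_real (cc x u) * gr lam z \<omega> u) + br lam z \<omega> x)
       - - 1 / (z - of_real (w x) + (\<Sum>u\<in>ch x - {y}. of_real (cc x u) * g0 z u) + b0 z x)) * cc x y"
      unfolding br_def[of _ _ _ y] b0_def[of _ y] parent_term_ch[OF step.hyps(2)] right_diff_distrib[symmetric] norm_mult norm_of_real abs_of_pos[OF c]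
        br_def[symmetric] b0_def[symmetric] by (simp add: mult.commute)
  qed
qed

text \<open>
  With the denominator \<open>Q\<close>, \<open>1 / Im G = |Q|\<^sup>2 / Im Q\<close>; the numerator has bounded moments because \<open>Q\<close> differs
  from the bounded \<open>Q0\<close> by a null family, and \<open>Im Q\<close> is at least a multiple of \<open>Im (gr lam z \<omega> u)\<close>.
\<close>

lemma Gr_families:
  assumes x: "x \<in> V"
  shows "good (\<lambda>lam z \<omega>. cmod (Gr lam z \<omega> x))" "null (\<lambda>lam z \<omega>. cmod (Gr lam z \<omega> x - G0 z x))"
    "good (\<lambda>lam z \<omega>. 1 / Im (Gr lam z \<omega> x))"
proof -
  define Q where "Q = (\<lambda>lam z \<omega>. z - of_real (pot lam \<omega> x) + (\<Sum>u\<in>ch x. of_real (cc x u) * gr lam z \<omega> u) + br lam z \<omega> x)"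
  define Q0 where "Q0 = (\<lambda>z. z - of_real (w x) + (\<Sum>u\<in>ch x. of_real (cc x u) * g0 z u) + b0 z x)"
  have Qa: "z - of_real (pot lam \<omega> x) + (\<Sum>u\<in>ch x. of_real (cc x u) * gr lam z \<omega> u) + br lam z \<omega> x = Q lam z \<omega>"
    "z - of_real (w x) + (\<Sum>u\<in>ch x. of_real (cc x u) * g0 z u) + b0 z x = Q0 z" for lam z \<omega>
    by (simp_all add: Q_def Q0_def)
  note df = denominator_families[OF x order_refl ch_ne[OF x] br_null[OF x], unfolded Qa]
  have Gr: "Gr lam z \<omega> x = - 1 / Q lam z \<omega>" for lam z \<omega> by (simp add: Gr_def full_green_def Q_def br_def)
  have G0: "G0 z x = - 1 / Q0 z" for z by (simp add: G0_def full_green_def Q0_def b0_def)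
  show "good (\<lambda>lam z \<omega>. cmod (Gr lam z \<omega> x))" unfolding Gr by (rule df(1))
  show "null (\<lambda>lam z \<omega>. cmod (Gr lam z \<omega> x - G0 z x))" unfolding Gr G0 by (rule df(2))
  obtain u where u: "u \<in> ch x" using ch_ne[OF x] by blast
  have c: "cc x u > 0" using cc_pos u by blast
  have Q0b: "\<exists>C\<ge>0. \<forall>z\<in>Z. cmod (Q0 z) \<le> C"
  proof -
    obtain R where R: "\<And>E. E \<in> I \<Longrightarrow> \<bar>E\<bar> \<le> R" using I_bdd by (auto simp: bounded_iff)
    have b0b: "y \<in> V \<Longrightarrow> \<exists>C. \<forall>z\<in>Z. cmod (b0 z y) \<le> C" for y
    proof (induction rule: tree_induct)
      case root
      show ?case by (auto simp: b0_def parent_term_rt)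
    next
      case (step x y)
      obtain s where s: "s \<in> ch x - {y}" using sibling[OF step.hyps(1)] by blast
      have cs: "cc x s > 0" "cc x y > 0" using cc_pos s step by auto
      have "cmod (b0 z y) \<le> cc x y * (1 / (cc x s * mI))" if z: "z \<in> Z" for z
      proof -
        let ?q = "z - of_real (w x) + (\<Sum>u\<in>ch x - {y}. of_real (cc x u) * g0 z u) + parent_term (g0 z) w z x"
        have "cc x s * mI \<le> cc x s * Im (g0 z s)" using ZI(2)[OF z] ch_V(2)[of s x] s cs by (intro mult_left_mono) auto
        also have "\<dots> \<le> (\<Sum>u\<in>ch x - {y}. cc x u * Im (g0 z u))"
          using s finite_ch g0_pos[OF ZI(1)[OF z]] cc_pos ch_V by (intro member_le_sum) (auto intro!: mult_nonneg_nonneg less_imp_le)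
        also have "\<dots> \<le> Im ?q" using Im_parent_term[of "g0 z" z x w] g0_pos[OF ZI(1)[OF z]] ZI(1)[OF z] step.hyps(1) by simp
        finally have "cmod (- 1 / ?q) \<le> 1 / (cc x s * mI)" using cs mI by (intro cmod_neg_inverse_le) auto
        then show ?thesis unfolding b0_def parent_term_ch[OF step.hyps(2)] norm_mult norm_of_real abs_of_pos[OF cs(2)]
          using cs by (intro mult_left_mono) auto
      qed
      then show ?case by blast
    qed
    from b0b[OF x] obtain Cb where Cb: "\<And>z. z \<in> Z \<Longrightarrow> cmod (b0 z x) \<le> Cb" by blast
    have "cmod (Q0 z) \<le> max 0 (R + 1 + Bw + cc_sum_bound * MI + Cb)" if z: "z \<in> Z" for z
    proof -
      have zR: "cmod z \<le> R + 1" using z R cmod_le[of z] by (force simp: Z_def)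
      have MI0: "MI \<ge> 0" using ZI(3)[OF z x] norm_ge_zero order_trans by blast
      have "cmod (z - of_real (w x) + (\<Sum>u\<in>ch x. of_real (cc x u) * g0 z u)) \<le> cmod z + Bw + cc_sum_bound * MI"
        by (rule cmod_denominator_le[OF x]) (use ZI(3)[OF z] ch_V pot_bound(1)[OF x] MI0 in auto)
      then show ?thesis unfolding Q0_def
        using norm_triangle_ineq[of "z - of_real (w x) + (\<Sum>u\<in>ch x. of_real (cc x u) * g0 z u)" "b0 z x"] Cb[OF z] zR by linarith
    qed
    then show ?thesis by (intro exI[of _ "max 0 (R + 1 + Bw + cc_sum_bound * MI + Cb)"]) auto
  qed
  then obtain CQ where CQ: "CQ \<ge> 0" "\<And>z. z \<in> Z \<Longrightarrow> cmod (Q0 z) \<le> CQ" by blast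
  have Qg: "good (\<lambda>lam z \<omega>. cmod (Q lam z \<omega>))"
  proof (rule good_mono[OF good_add[OF good_null[OF df(3)] good_const[OF CQ(1)]]])
    show "moment_family (\<lambda>lam z \<omega>. cmod (Q lam z \<omega>))" using df(4) by (auto simp: moment_family_def)
    fix lam :: real and z \<omega> assume "z \<in> Z"
    then show "cmod (Q lam z \<omega>) \<le> cmod (Q lam z \<omega> - Q0 z) + CQ" using CQ(2)[of z] norm_triangle_sub[of "Q lam z \<omega>" "Q0 z"] by simp
  qed
  have uV: "u \<in> V" using u ch_V by blast
  have IG: "Im (Gr lam z \<omega> x) = Im (Q lam z \<omega>) / (cmod (Q lam z \<omega>))\<^sup>2" for lam z \<omega> unfolding Gr Im_neg_inverse ..
  show "good (\<lambda>lam z \<omega>. 1 / Im (Gr lam z \<omega> x))"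
  proof (rule good_mono[OF good_mult[OF good_mult[OF Qg Qg] good_mult[OF good_const[of "1 / cc x u"] inverse_Im_good[OF uV]]]])
    show "0 \<le> 1 / cc x u" using c by simp
    have ImQp: "Im (Q lam z \<omega>) > 0" if "0 \<le> lam" "lam \<le> 1" "z \<in> Z" for lam z \<omega>
    proof -
      have "0 < cc x u * Im (gr lam z \<omega> u)" using c gr_pos[OF ZI(1)[OF that(3)] that(1,2) uV] by simp
      then show ?thesis using df(5)[OF u that, of \<omega>] by linarith
    qed
    show "moment_family (\<lambda>lam z \<omega>. 1 / Im (Gr lam z \<omega> x))" unfolding moment_family_def IG
      using df(4) ImQp by (auto intro!: divide_nonneg_pos)
    fix lam :: real and z \<omega> assume l: "0 \<le> lam" "lam \<le> 1" "z \<in> Z"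
    have g: "0 < cc x u * Im (gr lam z \<omega> u)" using c gr_pos[OF ZI(1)[OF l(3)] l(1,2) uV] by simp
    have "1 / Im (Gr lam z \<omega> x) = (cmod (Q lam z \<omega>))\<^sup>2 / Im (Q lam z \<omega>)" unfolding IG by simp
    also have "\<dots> \<le> (cmod (Q lam z \<omega>))\<^sup>2 / (cc x u * Im (gr lam z \<omega> u))"
      using df(5)[OF u l, of \<omega>] g by (intro divide_left_mono) auto
    also have "\<dots> = cmod (Q lam z \<omega>) * cmod (Q lam z \<omega>) * (1 / cc x u * (1 / Im (gr lam z \<omega> u)))" by (simp add: power2_eq_square)
    finally show "1 / Im (Gr lam z \<omega> x) \<le> cmod (Q lam z \<omega>) * cmod (Q lam z \<omega>) * (1 / cc x u * (1 / Im (gr lam z \<omega> u)))" .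
  qed
qed

end

section \<open>A weak-type bound for Herglotz functions\<close>

lemma circle_mean_value:
  assumes "F holomorphic_on ball 0 1" "0 < r" "r < 1"
  shows "((\<lambda>t. F (of_real r * exp (2 * of_real pi * \<i> * of_real t))) has_integral F 0) {0..1}"
proof -
  have "F holomorphic_on cball 0 r" by (rule holomorphic_on_subset[OF assms(1)]) (use assms in auto)
  then have "((\<lambda>u. F u / (u - 0)) has_contour_integral (2 * of_real pi * \<i> * F 0)) (circlepath 0 r)"
    by (rule Cauchy_integral_circlepath_simple) (use assms in auto)
  then have "((\<lambda>t. F (circlepath 0 r t) / circlepath 0 r t * vector_derivative (circlepath 0 r) (at t within {0..1}))
      has_integral (2 * of_real pi * \<i> * F 0)) {0..1}" by (simp add: has_contour_integral_def)
  then have "((\<lambda>t. (2 * of_real pi * \<i>) * F (of_real r * exp (2 * of_real pi * \<i> * of_real t)))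
      has_integral (2 * of_real pi * \<i> * F 0)) {0..1}"
  proof (rule has_integral_eq[rotated])
    fix t :: real assume "t \<in> {0..1}"
    then have "vector_derivative (circlepath 0 r) (at t within {0..1}) = 2 * pi * \<i> * r * exp (2 * of_real pi * \<i> * t)"
      by (intro vector_derivative_circlepath01) auto
    then show "F (circlepath 0 r t) / circlepath 0 r t * vector_derivative (circlepath 0 r) (at t within {0..1})
      = 2 * of_real pi * \<i> * F (of_real r * exp (2 * of_real pi * \<i> * of_real t))"
      using assms by (simp add: circlepath)
  qed
  then have "((\<lambda>t. inverse (2 * of_real pi * \<i>) * ((2 * of_real pi * \<i>) * F (of_real r * exp (2 * of_real pi * \<i> * of_real t))))
      has_integral (inverse (2 * of_real pi * \<i>) * (2 * of_real pi * \<i> * F 0))) {0..1}"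
    by (rule has_integral_mult_right)
  then show ?thesis by (simp add: field_simps)
qed

text \<open>
  The mean value property for radii \<open>r < 1\<close>, restricted to the left half circle by positivity, in the
  limit \<open>r \<rightarrow> 1\<close>. Continuity is assumed on the left half of the closed disc only, because the Cayley
  transform used below is singular at 1.
\<close>

lemma half_circle_le_mean:
  fixes F :: "complex \<Rightarrow> complex"
  assumes hol: "F holomorphic_on ball 0 1" and pos: "\<And>w. w \<in> ball 0 1 \<Longrightarrow> Im (F w) \<ge> 0"
    and cont: "continuous_on {w. cmod w \<le> 1 \<and> Re w \<le> 0} F"
  shows "integral {1/4..3/4} (\<lambda>t. Im (F (exp (2 * of_real pi * \<i> * of_real t)))) \<le> Im (F 0)"
proof -
  define I where "I r = integral (cbox (1/4) (3/4)) (\<lambda>t. Im (F (of_real r * exp (2 * of_real pi * \<i> * of_real t))))" for r :: real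
  have Re: "Re (exp (2 * of_real pi * \<i> * of_real t)) \<le> 0" if "t \<in> {1/4..3/4}" for t :: real
  proof -
    have "cos (2 * pi * t) = - cos (2 * pi * t - pi)" by simp
    moreover have "cos (2 * pi * t - pi) \<ge> 0"
    proof (rule cos_ge_zero)
      have "pi * 2 * (1/4) \<le> pi * 2 * t" "pi * 2 * t \<le> pi * 2 * (3/4)"
        using that by (auto intro!: mult_left_mono)
      then show "- (pi / 2) \<le> 2 * pi * t - pi" "2 * pi * t - pi \<le> pi / 2" by (auto simp: algebra_simps)
    qed
    ultimately show ?thesis by (simp add: Re_exp)
  qed
  have "continuous_on {1/2..1} I"
    unfolding I_def
  proof (rule integral_continuous_on_param)
    have "continuous_on ({1/2..1} \<times> cbox (1/4) (3/4)) (\<lambda>x. Im (F (of_real (fst x) * exp (2 * of_real pi * \<i> * of_real (snd x)))))"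
    proof (intro continuous_intros continuous_on_compose2[OF cont])
      show "(\<lambda>x. of_real (fst x) * exp (2 * of_real pi * \<i> * of_real (snd x))) ` ({1/2..1} \<times> cbox (1/4) (3/4))
          \<subseteq> {w. cmod w \<le> 1 \<and> Re w \<le> 0}"
        using Re by (auto simp: norm_mult mult_nonneg_nonpos)
    qed
    then show "continuous_on ({1/2..1} \<times> cbox (1/4) (3/4)) (\<lambda>(r, t). Im (F (of_real r * exp (2 * of_real pi * \<i> * of_real t))))"
      by (simp add: case_prod_unfold)
  qed
  then have "(I \<longlongrightarrow> I 1) (at 1 within {1/2..1})" by (simp add: continuous_on_def)
  then have "(I \<longlongrightarrow> I 1) (at 1 within {1/2..<1})" by (rule tendsto_within_subset) auto
  moreover have "at 1 within {1/2..<1} = (at_left 1 :: real filter)"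
    by (rule at_within_nhd[of _ "{1/2<..}"]) auto
  ultimately have lim: "(I \<longlongrightarrow> I 1) (at_left 1)" by simp
  have le: "I r \<le> Im (F 0)" if r: "1/2 \<le> r" "r < 1" for r
  proof -
    have m: "((\<lambda>t. Im (F (of_real r * exp (2 * of_real pi * \<i> * of_real t)))) has_integral Im (F 0)) {0..1}"
      using has_integral_Im[OF circle_mean_value[OF hol, of r]] r by simp
    have "integral {1/4..3/4} (\<lambda>t. Im (F (of_real r * exp (2 * of_real pi * \<i> * of_real t))))
        \<le> integral {0..1} (\<lambda>t. Im (F (of_real r * exp (2 * of_real pi * \<i> * of_real t))))"
    proof -
      have i1: "(\<lambda>t. Im (F (of_real r * exp (2 * of_real pi * \<i> * of_real t)))) integrable_on {0..1}" using m by blast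
      then have i2: "(\<lambda>t. Im (F (of_real r * exp (2 * of_real pi * \<i> * of_real t)))) integrable_on {1/4..3/4}"
        by (rule integrable_on_subinterval) auto
      have "0 \<le> Im (F (of_real r * exp (2 * of_real pi * \<i> * of_real t)))" for t
        by (rule pos) (use r in \<open>simp add: norm_mult\<close>)
      then show ?thesis by (intro integral_subset_le i1 i2) auto
    qed
    then show ?thesis using integral_unique[OF m] by (simp add: I_def)
  qed
  have "I 1 \<le> Im (F 0)"
    by (rule tendsto_upperbound[OF lim]) (use le in \<open>auto simp: eventually_at_left_field intro!: exI[of _ "1/2"]\<close>)
  then show ?thesis by (simp add: I_def)
qed

text \<open>
  A Cayley transform \<open>\<phi>\<close> maps the disc to the half plane above height \<open>\<epsilon>\<close>, with centre going to
  \<open>E + i(\<epsilon>+\<eta>)\<close> and the left half circle to the segment \<open>[E-\<eta>, E+\<eta>] + i\<epsilon>\<close>, on which the density of the image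
  of the normalised arc length is at least \<open>1 / (2 \<pi> \<eta>)\<close>.
\<close>

lemma Herglotz_average_le:
  fixes F :: "complex \<Rightarrow> complex"
  assumes hol: "F holomorphic_on {z. Im z > 0}" and pos: "\<And>z. Im z > 0 \<Longrightarrow> Im (F z) \<ge> 0"
    and \<epsilon>: "\<epsilon> > 0" and \<eta>: "\<eta> > 0"
  shows "integral {E - \<eta>..E + \<eta>} (\<lambda>s. Im (F (Complex s \<epsilon>))) \<le> 2 * pi * \<eta> * Im (F (Complex E (\<epsilon> + \<eta>)))"
proof -
  define \<phi> where "\<phi> w = Complex E \<epsilon> + \<i> * of_real \<eta> * ((1 + w) / (1 - w))" for w :: complex
  have Re: "Re ((1 + w) / (1 - w)) = (1 - (cmod w)\<^sup>2) / (cmod (1 - w))\<^sup>2" for w :: complex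
    unfolding Re_divide cmod_power2 by (simp add: power2_eq_square algebra_simps)
  have Im\<phi>: "Im (\<phi> w) > 0" if "cmod w \<le> 1" for w
  proof -
    have "(cmod w)\<^sup>2 \<le> 1" using that by (simp add: power_le_one)
    then have "Re ((1 + w) / (1 - w)) \<ge> 0" unfolding Re by simp
    moreover have "Im (\<phi> w) = \<epsilon> + \<eta> * Re ((1 + w) / (1 - w))"
    proof -
      have "Im (Complex E \<epsilon> + \<i> * of_real \<eta> * q) = \<epsilon> + \<eta> * Re q" for q by simp
      then show ?thesis unfolding \<phi>_def .
    qed
    ultimately show ?thesis using \<epsilon> \<eta> by (simp add: add_pos_nonneg del: Re_divide)
  qed
  have contF: "continuous_on {z. Im z > 0} F" using hol by (rule holomorphic_on_imp_continuous_on)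
  define u where "u s = Im (F (Complex s \<epsilon>))" for s
  have contu: "continuous_on UNIV u" unfolding u_def
    by (intro continuous_intros continuous_on_compose2[OF contF]) (use \<epsilon> in \<open>auto simp: Complex_eq intro!: continuous_intros\<close>)
  have "integral {1/4..3/4} (\<lambda>t. Im ((F \<circ> \<phi>) (exp (2 * of_real pi * \<i> * of_real t)))) \<le> Im ((F \<circ> \<phi>) 0)"
  proof (rule half_circle_le_mean)
    show "F \<circ> \<phi> holomorphic_on ball 0 1"
    proof (rule holomorphic_on_compose_gen[OF _ hol])
      show "\<phi> holomorphic_on ball 0 1" unfolding \<phi>_def by (intro holomorphic_intros) auto
      show "\<phi> ` ball 0 1 \<subseteq> {z. Im z > 0}" using Im\<phi> by auto
    qed
    show "Im ((F \<circ> \<phi>) w) \<ge> 0" if "w \<in> ball 0 1" for w using pos Im\<phi> that by simp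
    show "continuous_on {w. cmod w \<le> 1 \<and> Re w \<le> 0} (F \<circ> \<phi>)"
    proof (rule continuous_on_compose)
      show "continuous_on {w. cmod w \<le> 1 \<and> Re w \<le> 0} \<phi>" unfolding \<phi>_def by (intro continuous_intros) auto
      show "continuous_on (\<phi> ` {w. cmod w \<le> 1 \<and> Re w \<le> 0}) F"
        by (rule continuous_on_subset[OF contF]) (use Im\<phi> in auto)
    qed
  qed
  moreover have "(F \<circ> \<phi>) 0 = F (Complex E (\<epsilon> + \<eta>))" by (simp add: \<phi>_def Complex_eq algebra_simps)
  moreover have ex: "\<phi> (exp (2 * of_real pi * \<i> * of_real t)) = Complex (E - \<eta> * cot (pi * t)) \<epsilon>" if "t \<in> {1/4..3/4}" for t
  proof -
    have pt: "0 < pi * t" "pi * t < pi" using that by auto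
    then have s0: "sin (pi * t) > 0" by (rule sin_gt_zero)
    define e where "e = exp (\<i> * of_real (pi * t))"
    have e0: "e \<noteq> 0" by (simp add: e_def)
    have ee: "exp (2 * of_real pi * \<i> * of_real t) = e * e" unfolding e_def exp_add[symmetric] by (simp add: algebra_simps)
    have ei: "inverse e = exp (- (\<i> * of_real (pi * t)))" by (simp add: e_def exp_minus)
    have c: "e + inverse e = 2 * of_real (cos (pi * t))" and s: "inverse e - e = - 2 * \<i> * of_real (sin (pi * t))"
      unfolding ei unfolding e_def by (simp_all add: complex_eq_iff Re_exp Im_exp)
    have "(1 + e * e) / (1 - e * e) = (e * (e + inverse e)) / (e * (inverse e - e))" using e0 by (simp add: algebra_simps)
    also have "\<dots> = (e + inverse e) / (inverse e - e)" using e0 by simp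
    also have "\<dots> = \<i> * of_real (cot (pi * t))" unfolding c s using s0 by (simp add: cot_def field_simps)
    finally have q: "(1 + e * e) / (1 - e * e) = \<i> * of_real (cot (pi * t))" .
    show ?thesis unfolding \<phi>_def ee q by (simp add: complex_eq_iff)
  qed
  ultimately have 1: "integral {1/4..3/4} (\<lambda>t. u (E - \<eta> * cot (pi * t))) \<le> Im (F (Complex E (\<epsilon> + \<eta>)))"
    using integral_cong[of "{1/4..3/4}" "\<lambda>t. Im ((F \<circ> \<phi>) (exp (2 * of_real pi * \<i> * of_real t)))" "\<lambda>t. u (E - \<eta> * cot (pi * t))"]
    by (simp add: u_def)
  define g where "g t = E - \<eta> * cot (pi * t)" for t :: real
  define g' where "g' t = \<eta> * pi / (sin (pi * t))\<^sup>2" for t :: real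
  have sin2: "(sin (pi * t))\<^sup>2 \<ge> 1/2" "sin (pi * t) > 0" if t: "t \<in> {1/4..3/4}" for t
  proof -
    show sp: "sin (pi * t) > 0" using t by (intro sin_gt_zero) auto
    have "pi * t \<le> pi * (3/4)" "pi * (1/4) \<le> pi * t" using t by (auto intro!: mult_left_mono)
    then have "\<bar>pi * t - pi/2\<bar> \<le> pi / 4" by (intro abs_leI) auto
    then have "cos (pi / 4) \<le> cos \<bar>pi * t - pi/2\<bar>" using pi_gt_zero by (intro cos_monotone_0_pi_le) auto
    then have "sqrt 2 / 2 \<le> sin (pi * t)" by (simp add: cos_45 cos_diff)
    then have "(sqrt 2 / 2)\<^sup>2 \<le> (sin (pi * t))\<^sup>2" by (intro power_mono) auto
    then show "(sin (pi * t))\<^sup>2 \<ge> 1/2" by (simp add: power_divide)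
  qed
  have ends: "g (1/4) = E - \<eta>" "g (3/4) = E + \<eta>"
  proof -
    show "g (1/4) = E - \<eta>" by (simp add: g_def cot_def cos_45 sin_45)
    have q: "pi * (3/4) = pi - pi / 4" by simp
    show "g (3/4) = E + \<eta>" unfolding g_def cot_def q cos_pi_minus sin_pi_minus by (simp add: cos_45 sin_45)
  qed
  have deriv: "(g has_field_derivative g' t) (at t within {1/4..3/4})" if "t \<in> {1/4..3/4}" for t
  proof -
    have s0: "sin (pi * t) > 0" using sin2(2)[OF that] .
    have "((\<lambda>t. cot (pi * t)) has_field_derivative - inverse ((sin (pi * t))\<^sup>2) * pi) (at t within {1/4..3/4})"
      by (rule DERIV_chain2[OF DERIV_cot DERIV_cmult_Id]) (use s0 in simp)
    from DERIV_diff[OF DERIV_const[of E] DERIV_cmult[OF this, of \<eta>]]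
    show ?thesis unfolding g_def g'_def by (rule DERIV_cong) (simp add: field_simps)
  qed
  have contg: "continuous_on {1/4..3/4} g" using deriv by (rule DERIV_continuous_on)
  have "compact (g ` {1/4..3/4})" by (rule compact_continuous_image[OF contg]) simp
  then have "bounded (g ` {1/4..3/4})" by (rule compact_imp_bounded)
  then obtain c where "g ` {1/4..3/4} \<subseteq> {-c..c}" using bounded_subset_cbox_symmetric[of "g ` {1/4..3/4}"] by auto
  then have 2: "((\<lambda>t. g' t *\<^sub>R u (g t)) has_integral (integral {g (1/4)..g (3/4)} u)) {1/4..3/4}"
    by (intro has_integral_substitution[where c = "-c" and d = c] deriv continuous_on_subset[OF contu]) (use ends \<eta> in auto)
  have int: "(\<lambda>t. u (g t)) integrable_on {1/4..3/4}"
    by (rule integrable_continuous_interval) (intro continuous_on_compose2[OF contu contg] subset_UNIV)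
  have "integral {g (1/4)..g (3/4)} u \<le> integral {1/4..3/4} (\<lambda>t. (2 * pi * \<eta>) * u (g t))"
  proof (rule has_integral_le[OF 2])
    show "((\<lambda>t. (2 * pi * \<eta>) * u (g t)) has_integral integral {1/4..3/4} (\<lambda>t. (2 * pi * \<eta>) * u (g t))) {1/4..3/4}"
      using integrable_integral[OF integrable_on_mult_right[OF int]] by simp
    fix t :: real assume t: "t \<in> {1/4..3/4}"
    have "g' t \<le> \<eta> * pi / (1/2)" unfolding g'_def using sin2[OF t] \<eta> by (intro divide_left_mono) auto
    moreover have "u (g t) \<ge> 0" using pos \<epsilon> by (simp add: u_def)
    ultimately show "g' t *\<^sub>R u (g t) \<le> (2 * pi * \<eta>) * u (g t)" by (auto simp: algebra_simps intro: mult_right_mono dest: mult_right_mono[of "g' t" _ "u (g t)"])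
  qed
  also have "\<dots> = 2 * pi * \<eta> * integral {1/4..3/4} (\<lambda>t. u (E - \<eta> * cot (pi * t)))" by (simp add: g_def)
  also have "\<dots> \<le> 2 * pi * \<eta> * Im (F (Complex E (\<epsilon> + \<eta>)))" using 1 \<eta> by (intro mult_left_mono) auto
  finally show ?thesis unfolding ends u_def[abs_def] .
qed

text \<open>
  The tangent inequality \<open>1 / u \<ge> 2 c - c\<^sup>2 u\<close>, averaged with the optimal \<open>c = A / \<pi>\<close>, turns an upper bound for the average
  of \<open>Im F\<close> into a lower bound for that of \<open>1 / Im F\<close>.
\<close>

lemma Herglotz_inverse_average:
  fixes F :: "complex \<Rightarrow> complex"
  assumes hol: "F holomorphic_on {z. Im z > 0}" and pos: "\<And>z. Im z > 0 \<Longrightarrow> Im (F z) > 0"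
    and \<epsilon>: "\<epsilon> > 0" and \<eta>: "\<eta> > 0" and A: "A > 0" and small: "Im (F (Complex E (\<epsilon> + \<eta>))) < 1 / A"
  shows "ennreal (2 * A / pi * \<eta>) \<le> (\<integral>\<^sup>+s\<in>cball E \<eta>. ennreal (1 / Im (F (Complex s \<epsilon>))) \<partial>lborel)"
proof -
  define u where "u s = Im (F (Complex s \<epsilon>))" for s
  have u0: "u s > 0" for s using pos \<epsilon> by (simp add: u_def)
  have contF: "continuous_on {z. Im z > 0} F" using hol by (rule holomorphic_on_imp_continuous_on)
  have contu: "continuous_on X u" for X unfolding u_def
    by (intro continuous_intros continuous_on_compose2[OF contF]) (use \<epsilon> in \<open>auto simp: Complex_eq intro!: continuous_intros\<close>)
  have cb: "cball E \<eta> = {E - \<eta>..E + \<eta>}" by (auto simp: dist_real_def)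
  have iu: "u integrable_on {E - \<eta>..E + \<eta>}" by (intro integrable_continuous_interval contu)
  have iv: "(\<lambda>s. 1 / u s) integrable_on {E - \<eta>..E + \<eta>}"
    by (intro integrable_continuous_interval continuous_intros contu) (use u0 in \<open>metis less_irrefl\<close>)
  define c where "c = A / pi"
  have "integral {E - \<eta>..E + \<eta>} (\<lambda>s. 2 * c - c\<^sup>2 * u s) \<le> integral {E - \<eta>..E + \<eta>} (\<lambda>s. 1 / u s)"
  proof (rule integral_le[OF _ iv])
    show "(\<lambda>s. 2 * c - c\<^sup>2 * u s) integrable_on {E - \<eta>..E + \<eta>}"
      by (intro integrable_continuous_interval continuous_intros contu)
    fix s
    have "0 \<le> (1 - c * u s)\<^sup>2 / u s" using u0[of s] by simp
    also have "\<dots> = 1 / u s - (2 * c - c\<^sup>2 * u s)" using u0[of s] by (simp add: power2_eq_square field_simps)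
    finally show "2 * c - c\<^sup>2 * u s \<le> 1 / u s" by simp
  qed
  moreover have "integral {E - \<eta>..E + \<eta>} (\<lambda>s. 2 * c - c\<^sup>2 * u s) = 2 * c * (2 * \<eta>) - c\<^sup>2 * integral {E - \<eta>..E + \<eta>} u"
    using \<eta> by (subst integral_diff) (auto intro!: integrable_on_mult_right iu)
  moreover have "c\<^sup>2 * integral {E - \<eta>..E + \<eta>} u \<le> c\<^sup>2 * (2 * pi * \<eta> * (1 / A))"
  proof (rule mult_left_mono)
    have "integral {E - \<eta>..E + \<eta>} u \<le> 2 * pi * \<eta> * Im (F (Complex E (\<epsilon> + \<eta>)))"
      unfolding u_def by (rule Herglotz_average_le[OF hol _ \<epsilon> \<eta>]) (use pos in \<open>auto intro: less_imp_le\<close>)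
    also have "\<dots> \<le> 2 * pi * \<eta> * (1 / A)" using small \<eta> by (intro mult_left_mono) auto
    finally show "integral {E - \<eta>..E + \<eta>} u \<le> 2 * pi * \<eta> * (1 / A)" .
  qed simp
  moreover have "c\<^sup>2 * (2 * pi * \<eta> * (1 / A)) = 2 * A / pi * \<eta>" using A by (simp add: c_def power2_eq_square)
  moreover have "2 * c * (2 * \<eta>) = 2 * (2 * A / pi * \<eta>)" by (simp add: c_def)
  ultimately have "2 * A / pi * \<eta> \<le> integral {E - \<eta>..E + \<eta>} (\<lambda>s. 1 / u s)" by linarith
  then have "ennreal (2 * A / pi * \<eta>) \<le> ennreal (integral {E - \<eta>..E + \<eta>} (\<lambda>s. 1 / u s))" by (rule ennreal_leI)
  also have "\<dots> = (\<integral>\<^sup>+s\<in>{E - \<eta>..E + \<eta>}. ennreal (1 / u s) \<partial>lborel)"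
    by (rule nn_integral_has_integral_lebesgue'[symmetric]) (use iv u0 in \<open>auto simp: less_imp_le integrable_integral\<close>)
  finally show ?thesis by (simp add: cb u_def)
qed

text \<open>
  The Hardy-Littlewood argument: disjoint intervals among those given carry at least the proportion
  \<open>1 / 5\<close> of the measure to be estimated.
\<close>

lemma vitali_weak_type:
  fixes f :: "real \<Rightarrow> ennreal" and rad :: "real \<Rightarrow> real"
  assumes f: "f \<in> borel_measurable lborel" and K: "K \<in> sets lborel" and c: "c > 0"
    and rad: "\<And>E. E \<in> S \<Longrightarrow> 0 < rad E \<and> rad E \<le> B" "\<And>E. E \<in> S \<Longrightarrow> cball E (rad E) \<subseteq> K"
    and big: "\<And>E. E \<in> S \<Longrightarrow> ennreal (c * rad E) \<le> (\<integral>\<^sup>+s\<in>cball E (rad E). f s \<partial>lborel)"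
  shows "emeasure lborel S \<le> ennreal (10 / c) * (\<integral>\<^sup>+s\<in>K. f s \<partial>lborel)"
proof -
  have cov: "S \<subseteq> (\<Union>i\<in>S. cball i (rad i))" using rad(1) by (force simp: less_imp_le)
  obtain C where C: "countable C" "C \<subseteq> S" "pairwise (\<lambda>i j. disjnt (cball i (rad i)) (cball j (rad j))) C"
    "S \<subseteq> (\<Union>i\<in>C. cball i (5 * rad i))"
    by (rule Vitali_covering_lemma_cballs[OF cov rad(1)])
  \<comment> \<open>Enumerating the countable family by \<open>to_nat_on\<close> leaves empty slots for unused numbers, hence the case distinction in \<open>single\<close>.\<close>
  define D where "D n = (\<Union>i\<in>{i \<in> C. to_nat_on C i = n}. cball i (rad i))" for n
  define D5 where "D5 n = (\<Union>i\<in>{i \<in> C. to_nat_on C i = n}. cball i (5 * rad i))" for n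
  define \<mu> where "\<mu> = density lborel f"
  have sets: "range D \<subseteq> sets lborel" "range D5 \<subseteq> sets lborel"
    using C(1) by (auto simp: D_def D5_def intro!: sets.countable_UN' countable_subset[OF _ C(1)])
  have single: "{i \<in> C. to_nat_on C i = n} = {} \<or> (\<exists>i\<in>C. {i \<in> C. to_nat_on C i = n} = {i})" for n
  proof (cases "{i \<in> C. to_nat_on C i = n} = {}")
    case False
    then obtain i where i: "i \<in> C" "to_nat_on C i = n" by blast
    have "k = i" if "k \<in> C" "to_nat_on C k = n" for k
      using inj_onD[OF inj_on_to_nat_on[OF C(1)], of k i] that i by simp
    then have "{i \<in> C. to_nat_on C i = n} = {i}" using i by blast
    then show ?thesis using i(1) by blast
  qed simp
  have each: "emeasure lborel (D5 n) \<le> ennreal (10 / c) * emeasure \<mu> (D n)" for n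
    using single[of n]
  proof
    assume e: "{i \<in> C. to_nat_on C i = n} = {}"
    show ?thesis unfolding D5_def e by simp
  next
    assume "\<exists>i\<in>C. {i \<in> C. to_nat_on C i = n} = {i}"
    then obtain i where i: "i \<in> C" "{i \<in> C. to_nat_on C i = n} = {i}" by blast
    have iS: "i \<in> S" using i C by blast
    have "emeasure lborel (D5 n) = emeasure lborel {i - 5 * rad i..i + 5 * rad i}"
      unfolding D5_def i(2) by (simp add: cball_eq_atLeastAtMost)
    also have "\<dots> = ennreal (10 / c * (c * rad i))" using rad(1)[OF iS] c by simp
    also have "\<dots> = ennreal (10 / c) * ennreal (c * rad i)" using c rad(1)[OF iS] by (intro ennreal_mult) auto
    also have "\<dots> \<le> ennreal (10 / c) * (\<integral>\<^sup>+s\<in>cball i (rad i). f s \<partial>lborel)" using big[OF iS] by (intro mult_left_mono) auto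
    also have "(\<integral>\<^sup>+s\<in>cball i (rad i). f s \<partial>lborel) = emeasure \<mu> (D n)"
      unfolding D_def i(2) \<mu>_def using f by (simp add: emeasure_density)
    finally show ?thesis .
  qed
  have disj: "disjoint_family D"
    unfolding disjoint_family_on_def
  proof (intro ballI impI)
    fix m n :: nat assume mn: "m \<noteq> n"
    show "D m \<inter> D n = {}"
    proof (rule ccontr)
      assume "D m \<inter> D n \<noteq> {}"
      then obtain s i k where "i \<in> C" "to_nat_on C i = m" "s \<in> cball i (rad i)" "k \<in> C" "to_nat_on C k = n" "s \<in> cball k (rad k)"
        unfolding D_def by blast
      then show False using pairwiseD[OF C(3), of i k] mn unfolding disjnt_def by blast
    qed
  qed
  have "S \<subseteq> (\<Union>n. D5 n)"
  proof
    fix x assume "x \<in> S"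
    then obtain i where "i \<in> C" "x \<in> cball i (5 * rad i)" using C(4) by blast
    then have "x \<in> D5 (to_nat_on C i)" unfolding D5_def by blast
    then show "x \<in> (\<Union>n. D5 n)" by blast
  qed
  then have "emeasure lborel S \<le> emeasure lborel (\<Union>n. D5 n)" using sets by (intro emeasure_mono) auto
  also have "\<dots> \<le> (\<Sum>n. emeasure lborel (D5 n))" by (rule emeasure_subadditive_countably[OF sets(2)])
  also have "\<dots> \<le> (\<Sum>n. ennreal (10 / c) * emeasure \<mu> (D n))" by (intro suminf_le each) auto
  also have "\<dots> = ennreal (10 / c) * emeasure \<mu> (\<Union>n. D n)"
    using suminf_emeasure[of D \<mu>] sets(1) disj by (simp add: \<mu>_def)
  also have "\<dots> \<le> ennreal (10 / c) * emeasure \<mu> K"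
  proof (intro mult_left_mono emeasure_mono)
    show "(\<Union>n. D n) \<subseteq> K" using C(2) rad(2) unfolding D_def by blast
    show "K \<in> sets \<mu>" using K by (simp add: \<mu>_def)
  qed simp
  also have "emeasure \<mu> K = (\<integral>\<^sup>+s\<in>K. f s \<partial>lborel)" unfolding \<mu>_def using f K by (rule emeasure_density)
  finally show ?thesis .
qed

lemma Herglotz_weak_type:
  fixes F :: "complex \<Rightarrow> complex"
  assumes hol: "F holomorphic_on {z. Im z > 0}" and pos: "\<And>z. Im z > 0 \<Longrightarrow> Im (F z) > 0"
    and \<epsilon>: "\<epsilon> > 0" and A: "A > 0" and K: "K \<in> sets lborel"
    and S: "\<And>E. E \<in> S \<Longrightarrow> \<exists>\<eta>. 0 < \<eta> \<and> \<eta> \<le> B \<and> cball E \<eta> \<subseteq> K \<and> Im (F (Complex E (\<epsilon> + \<eta>))) < 1 / A"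
  shows "emeasure lborel S \<le> ennreal (5 * pi / A) * (\<integral>\<^sup>+s\<in>K. ennreal (1 / Im (F (Complex s \<epsilon>))) \<partial>lborel)"
proof -
  obtain rad where rad: "\<And>E. E \<in> S \<Longrightarrow> 0 < rad E \<and> rad E \<le> B \<and> cball E (rad E) \<subseteq> K \<and> Im (F (Complex E (\<epsilon> + rad E))) < 1 / A"
    using S by metis
  have contF: "continuous_on {z. Im z > 0} F" using hol by (rule holomorphic_on_imp_continuous_on)
  have contu: "continuous_on UNIV (\<lambda>s. Im (F (Complex s \<epsilon>)))"
    by (intro continuous_intros continuous_on_compose2[OF contF]) (use \<epsilon> in \<open>auto simp: Complex_eq intro!: continuous_intros\<close>)
  then have "(\<lambda>s. Im (F (Complex s \<epsilon>))) \<in> borel_measurable lborel" by (simp add: borel_measurable_continuous_onI)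
  then have meas: "(\<lambda>s. ennreal (1 / Im (F (Complex s \<epsilon>)))) \<in> borel_measurable lborel" by measurable
  have "emeasure lborel S \<le> ennreal (10 / (2 * A / pi)) * (\<integral>\<^sup>+s\<in>K. ennreal (1 / Im (F (Complex s \<epsilon>))) \<partial>lborel)"
    by (rule vitali_weak_type[where rad = rad and B = B, OF meas K])
      (use rad A Herglotz_inverse_average[OF hol pos \<epsilon> _ A] in auto)
  then show ?thesis by simp
qed

section \<open>Almost sure statements and the theorem\<close>

context random_tree_op
begin

lemma Gr_pos: "Im z > 0 \<Longrightarrow> 0 \<le> lam \<Longrightarrow> lam \<le> 1 \<Longrightarrow> x \<in> V \<Longrightarrow> Im (Gr lam z \<omega> x) > 0"
  unfolding Gr_def by (rule Im_full_green_pos) (use gr_pos in auto)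

lemma Gr_holomorphic:
  assumes "0 \<le> lam" "lam \<le> 1" "x \<in> V"
  shows "(\<lambda>z. Gr lam z \<omega> x) holomorphic_on {z. Im z > 0}"
  unfolding Gr_def gr_def[abs_def] by (rule full_green_holomorphic[where B = Bw]) (use assms pot_bound in auto)

lemma Gr_measurable:
  assumes "0 \<le> lam" "lam \<le> 1" "0 < \<eta>" "x \<in> V"
  shows "(\<lambda>y. Gr lam (Complex (snd y) \<eta>) (fst y) x) \<in> borel_measurable (P \<Otimes>\<^sub>M lborel)"
  unfolding Gr_def gr_def[abs_def]
proof (rule full_green_measurable[where B = Bw])
  show "(\<lambda>y. pot lam (fst y) u) \<in> borel_measurable (P \<Otimes>\<^sub>M lborel)" if "u \<in> V" for u
    using measurable_compose[OF measurable_fst pot_measurable[OF that]] .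
  show "(\<lambda>y. Complex (snd y) \<eta>) \<in> borel_measurable (P \<Otimes>\<^sub>M lborel)"
    unfolding Complex_eq by measurable
qed (use assms pot_bound in auto)

lemma green_perturbed:
  assumes "\<omega> \<in> space P" "0 \<le> lam" "lam \<le> 1" "Im z > 0" "x \<in> V"
  shows "green V \<nu> x z (add_potential (tree_operator V adj t w) lam (v \<omega>)) = Gr lam z \<omega> x"
  unfolding Gr_def gr_def[abs_def]
proof (rule green_full_eq[where B = Bw])
  fix \<xi> y assume "\<xi> \<in> l2 V \<nu>"
  then show "add_potential (tree_operator V adj t w) lam (v \<omega>) \<xi> y = (if y \<in> V then tree_action (pot lam \<omega>) \<xi> y else 0)"
    using pot_eq[OF assms(1)] by (auto simp: add_potential_def tree_operator_def tree_action_def l2_def algebra_simps)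
qed (use assms pot_bound in auto)

lemma green_unperturbed:
  assumes "Im z > 0" "x \<in> V"
  shows "green V \<nu> x z (tree_operator V adj t w) = G0 z x"
  unfolding G0_def g0_def[abs_def]
  by (rule green_full_eq[where B = Bw]) (use assms pot_bound in \<open>auto simp: tree_operator_def tree_action_def\<close>)

text \<open>
  The set of all \<open>E + i\<eta>\<close> with \<open>E \<in> I\<close> and \<open>0 \<le> \<eta> \<le> 1\<close> is compact, and the extensions of the
  forward Green functions are continuous on it with values in the open half plane. As the Green functions
  depend on labels only, it is enough to bound finitely many of them.
\<close>

lemma compact_window:
  assumes I: "I \<subseteq> Sigma_set V adj rt \<nu> (tree_operator V adj t w)" "compact I"
  shows "\<exists>mI MI. energy_window V adj rt M a \<nu> t P w v I mI MI"
proof (cases "I = {}")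
  case True
  then show ?thesis by (intro exI[of _ 1]) (unfold_locales, auto)
next
  case False
  define T where "T = tree_operator V adj t w"
  define f where "f = (\<lambda>x z. green_forward V adj rt \<nu> x z T)"
  define \<Sigma> where "\<Sigma> = Sigma_set V adj rt \<nu> T"
  have "\<Sigma> \<noteq> {}" using False I by (auto simp: \<Sigma>_def T_def)
  then obtain S where "common_extension_set V f S"
    by (auto simp: \<Sigma>_def Sigma_set_def largest_extension_set_def f_def)
  from common_extension_set_largest(1)[OF this] have ext: "y \<in> V \<Longrightarrow> has_unique_extension (f y) \<Sigma>" for y
    by (auto simp: common_extension_set_def \<Sigma>_def Sigma_set_def f_def)
  define K where "K = (\<lambda>(E, \<eta>). Complex E \<eta>) ` (I \<times> {0..1})"
  have KS: "K \<subseteq> \<H> \<union> of_real ` \<Sigma>"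
  proof
    fix z assume "z \<in> K"
    then obtain E \<eta> where z: "z = Complex E \<eta>" "E \<in> I" "0 \<le> \<eta>" by (auto simp: K_def)
    show "z \<in> \<H> \<union> of_real ` \<Sigma>"
    proof (cases "\<eta> = 0")
      case True
      then have "z = of_real E" "E \<in> \<Sigma>" using z I by (auto simp: complex_eq_iff \<Sigma>_def T_def)
      then show ?thesis by blast
    qed (use z in \<open>auto simp: upper_half_plane_def\<close>)
  qed
  have Kc: "compact K" unfolding K_def case_prod_beta Complex_eq
    by (intro compact_continuous_image compact_Times compact_Icc I(2) continuous_intros)
  have bound: "\<exists>m>0. \<exists>C. \<forall>z\<in>K \<inter> \<H>. m \<le> Im (g0 z y) \<and> cmod (g0 z y) \<le> C" if y: "y \<in> V" for y
  proof -
    from ex1_implies_ex[OF ext[OF y, unfolded has_unique_extension_def]] obtain g where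
      g: "g \<in> (\<H> \<union> of_real ` \<Sigma>) \<rightarrow>\<^sub>E \<H>" "continuous_on (\<H> \<union> of_real ` \<Sigma>) g" "\<And>z. z \<in> \<H> \<Longrightarrow> g z = f y z" by blast
    have fg: "g z = g0 z y" if "z \<in> \<H>" for z
      using green_forward_eq[OF y, of z w Bw] that pot_bound(1)
      by (simp add: g(3)[OF that] f_def T_def g0_def upper_half_plane_def)
    have gK: "continuous_on K g" by (rule continuous_on_subset[OF g(2) KS])
    have cI: "compact ((\<lambda>z. Im (g z)) ` K)" and cN: "compact ((\<lambda>z. cmod (g z)) ` K)"
      by (intro compact_continuous_image Kc continuous_intros gK)+
    have ne: "K \<noteq> {}" using False by (auto simp: K_def)
    from compact_attains_inf[OF cI] ne obtain z0 where z0: "z0 \<in> K" "\<And>z. z \<in> K \<Longrightarrow> Im (g z0) \<le> Im (g z)" by auto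
    from compact_attains_sup[OF cN] ne obtain z1 where z1: "\<And>z. z \<in> K \<Longrightarrow> cmod (g z) \<le> cmod (g z1)" by auto
    have "Im (g z0) > 0" using g(1) z0(1) KS by (auto simp: upper_half_plane_def PiE_def Pi_def)
    moreover have "\<forall>z\<in>K \<inter> \<H>. Im (g z0) \<le> Im (g0 z y) \<and> cmod (g0 z y) \<le> cmod (g z1)"
      using z0(2) z1 fg by fastforce
    ultimately show ?thesis by blast
  qed
  have "\<exists>m>0. \<exists>C. \<forall>y\<in>V. a y = l \<longrightarrow> (\<forall>z\<in>K \<inter> \<H>. m \<le> Im (g0 z y) \<and> cmod (g0 z y) \<le> C)" for l
  proof (cases "\<exists>y\<in>V. a y = l")
    case True
    then obtain y where y: "y \<in> V" "a y = l" by blast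
    from bound[OF y(1)] show ?thesis using g0_label[OF y(1)] y(2) by metis
  qed (auto intro: exI[of _ 1])
  then obtain m C where mC: "\<And>l. m l > 0" "\<And>y z. y \<in> V \<Longrightarrow> z \<in> K \<inter> \<H> \<Longrightarrow> m (a y) \<le> Im (g0 z y) \<and> cmod (g0 z y) \<le> C (a y)"
    by metis
  have "energy_window V adj rt M a \<nu> t P w v I (Min (range m)) (Max (range C))"
  proof unfold_locales
    show "Min (range m) > 0" using mC(1) by (subst Min_gr_iff) auto
    show "bounded I" by (rule compact_imp_bounded[OF I(2)])
    fix E \<eta> :: real and y assume h: "E \<in> I" "0 < \<eta>" "\<eta> \<le> 1" "y \<in> V"
    have "Complex E \<eta> \<in> K \<inter> \<H>" using h by (force simp: K_def upper_half_plane_def)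
    note b = mC(2)[OF h(4) this]
    have "Min (range m) \<le> m (a y)" "C (a y) \<le> Max (range C)" by (auto intro: Min_le Max_ge)
    then show "Min (range m) \<le> Im (g0 (Complex E \<eta>) y)" "cmod (g0 (Complex E \<eta>) y) \<le> Max (range C)" using b by linarith+
  qed
  then show ?thesis by blast
qed

end

lemma Liminf_le_along_sequence:
  fixes g :: "'b \<Rightarrow> 'c::complete_lattice"
  assumes "filterlim s F sequentially"
  shows "Liminf F g \<le> liminf (\<lambda>n. g (s n))"
proof (rule Liminf_least)
  fix Q assume "eventually Q F"
  then have "\<forall>\<^sub>F n in sequentially. Q (s n)" using assms by (simp add: filterlim_iff)
  then show "(INF x\<in>Collect Q. g x) \<le> liminf (\<lambda>n. g (s n))"
    by (intro Liminf_bounded) (auto elim!: eventually_mono intro: INF_lower)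
qed

context energy_window
begin

lemma Z_memI: "E \<in> I \<Longrightarrow> 0 < \<eta> \<Longrightarrow> \<eta> \<le> 1 \<Longrightarrow> Complex E \<eta> \<in> Z"
  by (auto simp: Z_def)

lemma moment_bound:
  assumes x: "x \<in> V" and p: "p \<ge> 0"
  shows "\<exists>C::real. \<exists>l0>0. \<forall>lam z. 0 \<le> lam \<longrightarrow> lam < l0 \<longrightarrow> lam \<le> 1 \<longrightarrow> z \<in> Z \<longrightarrow>
    (\<integral>\<^sup>+\<omega>. ennreal (cmod (Gr lam z \<omega> x) powr p) \<partial>P) \<le> ennreal C"
proof -
  define n where "n = nat \<lceil>p\<rceil>"
  have pn: "p \<le> real n" by (simp add: n_def) linarith
  obtain C l0 where C: "C > 0" "l0 > 0" "\<And>lam z. 0 \<le> lam \<Longrightarrow> lam < l0 \<Longrightarrow> lam \<le> 1 \<Longrightarrow> z \<in> Z \<Longrightarrow>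
    (\<integral>\<^sup>+\<omega>. ennreal (cmod (Gr lam z \<omega> x) ^ n) \<partial>P) \<le> ennreal C"
    using goodD[OF Gr_families(1)[OF x], of n] by blast
  have "(\<integral>\<^sup>+\<omega>. ennreal (cmod (Gr lam z \<omega> x) powr p) \<partial>P) \<le> ennreal (1 + C)"
    if l: "0 \<le> lam" "lam < l0" "lam \<le> 1" "z \<in> Z" for lam z
  proof -
    have [measurable]: "(\<lambda>\<omega>. cmod (Gr lam z \<omega> x)) \<in> borel_measurable P"
      by (rule mfamD(1)[OF good_moment_family[OF Gr_families(1)[OF x]] l(1,3,4)])
    have "ennreal (cmod (Gr lam z \<omega> x) powr p) \<le> 1 + ennreal (cmod (Gr lam z \<omega> x) ^ n)" for \<omega>
    proof -
      have "cmod (Gr lam z \<omega> x) powr p \<le> 1 + cmod (Gr lam z \<omega> x) ^ n"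
        using small_power_le[OF norm_ge_zero zero_less_one p pn, of "Gr lam z \<omega> x"] by simp
      then have "ennreal (cmod (Gr lam z \<omega> x) powr p) \<le> ennreal (1 + cmod (Gr lam z \<omega> x) ^ n)" by (rule ennreal_leI)
      then show ?thesis by (simp add: ennreal_plus)
    qed
    then have "(\<integral>\<^sup>+\<omega>. ennreal (cmod (Gr lam z \<omega> x) powr p) \<partial>P) \<le> (\<integral>\<^sup>+\<omega>. 1 + ennreal (cmod (Gr lam z \<omega> x) ^ n) \<partial>P)"
      by (intro nn_integral_mono)
    also have "\<dots> = 1 + (\<integral>\<^sup>+\<omega>. ennreal (cmod (Gr lam z \<omega> x) ^ n) \<partial>P)"
      by (subst nn_integral_add) (auto simp: emeasure_space_1)
    also have "\<dots> \<le> 1 + ennreal C" using C(3)[OF l] by (rule add_left_mono)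
    also have "\<dots> = ennreal (1 + C)" using C(1) by (simp add: ennreal_plus)
    finally show ?thesis .
  qed
  then show ?thesis using C(2) by blast
qed

lemma difference_small:
  assumes x: "x \<in> V" and p: "p > 0" and e: "e > 0"
  shows "\<exists>l0>0. \<forall>lam z. 0 \<le> lam \<longrightarrow> lam < l0 \<longrightarrow> lam \<le> 1 \<longrightarrow> z \<in> Z \<longrightarrow>
    (\<integral>\<^sup>+\<omega>. ennreal (cmod (Gr lam z \<omega> x - G0 z x) powr p) \<partial>P) \<le> ennreal e"
proof -
  define n where "n = nat \<lceil>p\<rceil>"
  have pn: "p \<le> real n" "n \<ge> 1" using p by (simp_all add: n_def) linarith+
  define \<delta> where "\<delta> = (e / 2) powr (1 / p)"
  have \<delta>: "\<delta> > 0" "\<delta> powr p = e / 2" using e p by (auto simp: \<delta>_def powr_powr)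
  define c where "c = \<delta> powr (real n - p)"
  have c: "c > 0" using \<delta> by (simp add: c_def)
  obtain l0 where l0: "l0 > 0" "\<And>lam z. 0 \<le> lam \<Longrightarrow> lam < l0 \<Longrightarrow> lam \<le> 1 \<Longrightarrow> z \<in> Z \<Longrightarrow>
    (\<integral>\<^sup>+\<omega>. ennreal (cmod (Gr lam z \<omega> x - G0 z x) ^ n) \<partial>P) \<le> ennreal (e / 2 * c)"
  proof -
    have "e / 2 * c > 0" using e c by simp
    then show ?thesis using that Gr_families(2)[OF x, unfolded null_def, THEN conjunct2, rule_format, OF pn(2), of "e / 2 * c"] by blast
  qed
  have "(\<integral>\<^sup>+\<omega>. ennreal (cmod (Gr lam z \<omega> x - G0 z x) powr p) \<partial>P) \<le> ennreal e"
    if l: "0 \<le> lam" "lam < l0" "lam \<le> 1" "z \<in> Z" for lam z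
  proof -
    define X where "X = (\<lambda>\<omega>. cmod (Gr lam z \<omega> x - G0 z x))"
    have [measurable]: "X \<in> borel_measurable P"
      unfolding X_def by (rule mfamD(1)[OF null_moment_family[OF Gr_families(2)[OF x]] l(1,3,4)])
    have X0: "X \<omega> \<ge> 0" for \<omega> by (simp add: X_def)
    have "ennreal (X \<omega> powr p) \<le> ennreal (e / 2) + ennreal (1 / c) * ennreal (X \<omega> ^ n)" for \<omega>
    proof -
      have "X \<omega> powr p \<le> e / 2 + 1 / c * X \<omega> ^ n"
        using small_power_le[OF X0[of \<omega>] \<delta>(1) _ pn(1)] p \<delta>(2) by (simp add: c_def)
      then have "ennreal (X \<omega> powr p) \<le> ennreal (e / 2 + 1 / c * X \<omega> ^ n)" by (rule ennreal_leI)
      then show ?thesis using e c X0[of \<omega>] by (simp add: ennreal_plus[symmetric] ennreal_mult[symmetric] del: ennreal_plus)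
    qed
    then have "(\<integral>\<^sup>+\<omega>. ennreal (X \<omega> powr p) \<partial>P) \<le> (\<integral>\<^sup>+\<omega>. ennreal (e / 2) + ennreal (1 / c) * ennreal (X \<omega> ^ n) \<partial>P)"
      by (intro nn_integral_mono)
    also have "\<dots> = ennreal (e / 2) + ennreal (1 / c) * (\<integral>\<^sup>+\<omega>. ennreal (X \<omega> ^ n) \<partial>P)"
      by (subst nn_integral_add) (auto simp: emeasure_space_1 nn_integral_cmult)
    also have "\<dots> \<le> ennreal (e / 2) + ennreal (1 / c) * ennreal (e / 2 * c)"
      using l0(2)[OF l] by (intro add_left_mono mult_left_mono) (auto simp: X_def)
    also have "\<dots> = ennreal (e / 2 + 1 / c * (e / 2 * c))"
      using e c by (simp add: ennreal_plus[symmetric] ennreal_mult[symmetric] del: ennreal_plus)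
    also have "e / 2 + 1 / c * (e / 2 * c) = e" using c by simp
    finally show ?thesis by (simp add: X_def)
  qed
  then show ?thesis using l0(1) by blast
qed

text \<open>
  The moments integrated over \<open>S\<close> are bounded uniformly in the height. Fatou's lemma along the heights
  \<open>1 / (n + 1)\<close> makes the lower limit along these heights integrable, and it dominates the one over all heights.
\<close>

lemma integrated_moment_liminf:
  assumes x: "x \<in> V" and lam: "0 \<le> lam" "lam \<le> 1" and S: "S \<in> sets lborel" "S \<subseteq> I"
    and C: "\<And>z. z \<in> Z \<Longrightarrow> (\<integral>\<^sup>+\<omega>. ennreal (cmod (Gr lam z \<omega> x) powr p) \<partial>P) \<le> ennreal C"
  shows "AE \<omega> in P. Liminf (at_right 0) (\<lambda>\<eta>. \<integral>\<^sup>+E\<in>S. ennreal (cmod (Gr lam (Complex E \<eta>) \<omega> x) powr p) \<partial>lborel) < \<infinity>"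
proof -
  interpret PL: pair_sigma_finite P lborel by unfold_locales
  define s where "s n = 1 / real (Suc n)" for n
  have s: "0 < s n" "s n \<le> 1" for n by (auto simp: s_def field_simps)
  have "s \<longlonglongrightarrow> 0" unfolding s_def[abs_def] by (rule LIMSEQ_Suc[OF lim_1_over_n[where 'a = real]])
  moreover have pos_neq: "s n \<noteq> 0" for n using s(1)[of n] by linarith
  ultimately have slim: "filterlim s (at_right 0) sequentially"
    unfolding filterlim_at using s(1) by (simp add: pos_neq)
  define f where "f n \<omega> E = ennreal (cmod (Gr lam (Complex E (s n)) \<omega> x) powr p) * indicator S E" for n \<omega> E
  have fm: "case_prod (f n) \<in> borel_measurable (P \<Otimes>\<^sub>M lborel)" for n
  proof -
    note [measurable] = Gr_measurable[OF lam s(1)[of n] x] S(1)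
    have "(\<lambda>y. ennreal (cmod (Gr lam (Complex (snd y) (s n)) (fst y) x) powr p) * indicator S (snd y)) \<in> borel_measurable (P \<Otimes>\<^sub>M lborel)"
      by measurable
    moreover have "case_prod (f n) = (\<lambda>y. ennreal (cmod (Gr lam (Complex (snd y) (s n)) (fst y) x) powr p) * indicator S (snd y))"
      by (simp add: fun_eq_iff f_def)
    ultimately show ?thesis by (simp only:)
  qed
  define g where "g n \<omega> = (\<integral>\<^sup>+E. f n \<omega> E \<partial>lborel)" for n \<omega>
  have gm [measurable]: "g n \<in> borel_measurable P" for n
    unfolding g_def by (rule lborel.borel_measurable_nn_integral[OF fm])
  have gb: "(\<integral>\<^sup>+\<omega>. g n \<omega> \<partial>P) \<le> ennreal C * emeasure lborel S" for n
  proof -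
    have "(\<integral>\<^sup>+\<omega>. g n \<omega> \<partial>P) = (\<integral>\<^sup>+E. (\<integral>\<^sup>+\<omega>. f n \<omega> E \<partial>P) \<partial>lborel)"
      unfolding g_def by (rule PL.Fubini'[OF fm, symmetric])
    also have "\<dots> \<le> (\<integral>\<^sup>+E. ennreal C * indicator S E \<partial>lborel)"
    proof (rule nn_integral_mono)
      fix E
      show "(\<integral>\<^sup>+\<omega>. f n \<omega> E \<partial>P) \<le> ennreal C * indicator S E"
        using C[OF Z_memI[OF _ s]] S(2) by (cases "E \<in> S") (auto simp: f_def)
    qed
    also have "\<dots> = ennreal C * emeasure lborel S" using S(1) by (simp add: nn_integral_cmult_indicator)
    finally show ?thesis .
  qed
  have "bounded S" using I_bdd S(2) bounded_subset by blast
  then have "emeasure lborel S < \<infinity>" by (rule emeasure_bounded_finite)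
  then have fin: "ennreal C * emeasure lborel S < \<infinity>" by (simp add: ennreal_mult_less_top)
  have "(\<integral>\<^sup>+\<omega>. liminf (\<lambda>n. g n \<omega>) \<partial>P) \<le> liminf (\<lambda>n. \<integral>\<^sup>+\<omega>. g n \<omega> \<partial>P)"
    by (rule nn_integral_liminf) (rule gm)
  also have "\<dots> \<le> liminf (\<lambda>n. ennreal C * emeasure lborel S)"
    by (rule Liminf_mono) (use gb in auto)
  also have "\<dots> = ennreal C * emeasure lborel S" by (rule Liminf_const) simp
  finally have "(\<integral>\<^sup>+\<omega>. liminf (\<lambda>n. g n \<omega>) \<partial>P) \<noteq> \<infinity>" using fin by (metis infinity_ennreal_def leD)
  then have "AE \<omega> in P. liminf (\<lambda>n. g n \<omega>) \<noteq> \<infinity>" by (intro nn_integral_PInf_AE) auto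
  then show ?thesis
  proof (rule AE_mp, intro AE_I2 impI)
    fix \<omega> assume "liminf (\<lambda>n. g n \<omega>) \<noteq> \<infinity>"
    moreover have "Liminf (at_right 0) (\<lambda>\<eta>. \<integral>\<^sup>+E\<in>S. ennreal (cmod (Gr lam (Complex E \<eta>) \<omega> x) powr p) \<partial>lborel) \<le> liminf (\<lambda>n. g n \<omega>)"
      unfolding g_def f_def by (rule Liminf_le_along_sequence[OF slim])
    ultimately show "Liminf (at_right 0) (\<lambda>\<eta>. \<integral>\<^sup>+E\<in>S. ennreal (cmod (Gr lam (Complex E \<eta>) \<omega> x) powr p) \<partial>lborel) < \<infinity>"
      by (simp add: less_top[symmetric] neq_top_trans)
  qed
qed

text \<open>
  For fixed \<open>\<epsilon> j\<close>, the event \<open>bad k j\<close> that \<open>Im G\<close> falls below \<open>1 / (k + 1)\<close> at some height in \<open>(\<epsilon> j, \<rho>]\<close> has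
  measure \<open>O(1 / k)\<close> by \<open>Herglotz_weak_type\<close>, with a constant that does not depend on \<open>j\<close> by the bound \<open>C\<close>. As \<open>j\<close>
  grows, these events increase to the one for heights in \<open>(0, \<rho>]\<close>. So almost surely some \<open>1 / (k + 1)\<close> is a lower
  bound on all of \<open>(0, \<rho>]\<close>. Rational heights make the events measurable, and continuity in the height covers
  the others. The neighbourhoods \<open>cball E r\<close> leave room for the averages around points of \<open>S\<close>.
\<close>

lemma Im_Gr_liminf_pos:
  assumes x: "x \<in> V" and lam: "0 \<le> lam" "lam \<le> 1" and Ib: "I \<in> sets lborel"
    and S: "S \<in> sets lborel" "\<And>E. E \<in> S \<Longrightarrow> cball E r \<subseteq> I" and r: "r > 0"
    and C: "\<And>z. z \<in> Z \<Longrightarrow> (\<integral>\<^sup>+\<omega>. ennreal (1 / Im (Gr lam z \<omega> x)) \<partial>P) \<le> ennreal C"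
  shows "AE (\<omega>, E) in P \<Otimes>\<^sub>M lborel. E \<in> S \<longrightarrow> Liminf (at_right 0) (\<lambda>\<eta>. ereal (Im (Gr lam (Complex E \<eta>) \<omega> x))) > 0"
proof -
  interpret PL: pair_sigma_finite P lborel by unfold_locales
  define \<rho> where "\<rho> = min r (1/2)"
  have \<rho>: "\<rho> > 0" "\<rho> \<le> r" "\<rho> \<le> 1/2" using r by (auto simp: \<rho>_def)
  define \<epsilon> where "\<epsilon> j = 1 / real (j + 2)" for j :: nat
  have \<epsilon>: "0 < \<epsilon> j" "\<epsilon> j \<le> 1" "i \<le> j \<Longrightarrow> \<epsilon> j \<le> \<epsilon> i" for i j by (auto simp: \<epsilon>_def field_simps)
  define slice where "slice k q = {y \<in> space (P \<Otimes>\<^sub>M lborel). snd y \<in> S \<and> Im (Gr lam (Complex (snd y) q) (fst y) x) < 1 / real (Suc k)}"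
    for k and q :: real
  define bad where "bad k j = (\<Union>q\<in>\<rat> \<inter> {\<epsilon> j<..\<rho>}. slice k q)" for k j
  have slice_sets: "slice k q \<in> sets (P \<Otimes>\<^sub>M lborel)" if "0 < q" for k q
  proof -
    note [measurable] = Gr_measurable[OF lam that x] S(1)
    show ?thesis unfolding slice_def by measurable
  qed
  have bad_sets: "bad k j \<in> sets (P \<Otimes>\<^sub>M lborel)" for k j
  proof -
    have "countable (\<rat> \<inter> {\<epsilon> j<..\<rho>})" by (rule countable_Int1[OF countable_rat])
    then show ?thesis unfolding bad_def
    proof (rule sets.countable_UN'')
      fix q assume "q \<in> \<rat> \<inter> {\<epsilon> j<..\<rho>}"
      then have "0 < q" using \<epsilon>(1)[of j] by simp
      then show "slice k q \<in> sets (P \<Otimes>\<^sub>M lborel)" by (rule slice_sets)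
    qed
  qed
  have bad_mono: "bad k i \<subseteq> bad k j" if "i \<le> j" for i j k
    using \<epsilon>(3)[OF that] by (force simp: bad_def)
  have "bounded I" by (rule I_bdd)
  then have If: "emeasure lborel I < \<infinity>" by (rule emeasure_bounded_finite)
  define D where "D = ennreal C * emeasure lborel I"
  have D: "D < \<infinity>" using If by (simp add: D_def ennreal_mult_less_top)
  have bad_le: "emeasure (P \<Otimes>\<^sub>M lborel) (bad k j) \<le> ennreal (5 * pi / real (Suc k)) * D" for k j
  proof -
    define h where "h \<omega> E = ennreal (1 / Im (Gr lam (Complex E (\<epsilon> j)) \<omega> x)) * indicator I E" for \<omega> E
    have hm: "case_prod h \<in> borel_measurable (P \<Otimes>\<^sub>M lborel)"
    proof -
      note [measurable] = Gr_measurable[OF lam \<epsilon>(1)[of j] x] Ib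
      have "(\<lambda>y. ennreal (1 / Im (Gr lam (Complex (snd y) (\<epsilon> j)) (fst y) x)) * indicator I (snd y)) \<in> borel_measurable (P \<Otimes>\<^sub>M lborel)"
        by measurable
      moreover have "case_prod h = (\<lambda>y. ennreal (1 / Im (Gr lam (Complex (snd y) (\<epsilon> j)) (fst y) x)) * indicator I (snd y))"
        by (simp add: fun_eq_iff h_def)
      ultimately show ?thesis by (simp only:)
    qed
    have sec: "emeasure lborel (Pair \<omega> -` bad k j) \<le> ennreal (5 * pi / real (Suc k)) * (\<integral>\<^sup>+E. h \<omega> E \<partial>lborel)" for \<omega>
      unfolding h_def
    proof (rule Herglotz_weak_type[where F = "\<lambda>z. Gr lam z \<omega> x" and B = r])
      show "(\<lambda>z. Gr lam z \<omega> x) holomorphic_on {z. Im z > 0}" by (rule Gr_holomorphic[OF lam x])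
      show "\<And>z. 0 < Im z \<Longrightarrow> 0 < Im (Gr lam z \<omega> x)" using Gr_pos lam x by blast
      fix E assume "E \<in> Pair \<omega> -` bad k j"
      then obtain q where q: "\<epsilon> j < q" "q \<le> \<rho>" "E \<in> S" "Im (Gr lam (Complex E q) \<omega> x) < 1 / real (Suc k)"
        by (auto simp: bad_def slice_def)
      have "cball E (q - \<epsilon> j) \<subseteq> cball E r" using q \<rho> \<epsilon>(1)[of j] by (intro subset_cball) linarith
      then show "\<exists>\<eta>>0. \<eta> \<le> r \<and> cball E \<eta> \<subseteq> I \<and> Im (Gr lam (Complex E (\<epsilon> j + \<eta>)) \<omega> x) < 1 / real (Suc k)"
        using q \<rho> \<epsilon>(1)[of j] S(2)[OF q(3)] by (intro exI[of _ "q - \<epsilon> j"]) auto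
    qed (use \<epsilon>(1) Ib in auto)
    have "emeasure (P \<Otimes>\<^sub>M lborel) (bad k j) = (\<integral>\<^sup>+\<omega>. emeasure lborel (Pair \<omega> -` bad k j) \<partial>P)"
      by (rule lborel.emeasure_pair_measure_alt[OF bad_sets])
    also have "\<dots> \<le> (\<integral>\<^sup>+\<omega>. ennreal (5 * pi / real (Suc k)) * (\<integral>\<^sup>+E. h \<omega> E \<partial>lborel) \<partial>P)"
      by (rule nn_integral_mono) (rule sec)
    also have "\<dots> = ennreal (5 * pi / real (Suc k)) * (\<integral>\<^sup>+\<omega>. (\<integral>\<^sup>+E. h \<omega> E \<partial>lborel) \<partial>P)"
      by (rule nn_integral_cmult) (rule lborel.borel_measurable_nn_integral[OF hm])
    also have "(\<integral>\<^sup>+\<omega>. (\<integral>\<^sup>+E. h \<omega> E \<partial>lborel) \<partial>P) = (\<integral>\<^sup>+E. (\<integral>\<^sup>+\<omega>. h \<omega> E \<partial>P) \<partial>lborel)"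
      by (rule PL.Fubini'[OF hm, symmetric])
    also have "\<dots> \<le> (\<integral>\<^sup>+E. ennreal C * indicator I E \<partial>lborel)"
    proof (rule nn_integral_mono)
      fix E
      show "(\<integral>\<^sup>+\<omega>. h \<omega> E \<partial>P) \<le> ennreal C * indicator I E"
        using C[OF Z_memI[OF _ \<epsilon>(1,2)]] by (cases "E \<in> I") (auto simp: h_def)
    qed
    also have "\<dots> = D" using Ib by (simp add: D_def nn_integral_cmult_indicator)
    finally show ?thesis by (simp add: mult_left_mono)
  qed
  define N where "N = (\<Inter>k. \<Union>j. bad k j)"
  have U_sets: "(\<Union>j. bad k j) \<in> sets (P \<Otimes>\<^sub>M lborel)" for k using bad_sets by blast
  have N_sets: "N \<in> sets (P \<Otimes>\<^sub>M lborel)" unfolding N_def using U_sets by blast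
  have "emeasure (P \<Otimes>\<^sub>M lborel) N \<le> ennreal (5 * pi / real (Suc k)) * D" for k
  proof -
    have "emeasure (P \<Otimes>\<^sub>M lborel) N \<le> emeasure (P \<Otimes>\<^sub>M lborel) (\<Union>j. bad k j)"
      by (rule emeasure_mono[OF _ U_sets]) (auto simp: N_def)
    also have "\<dots> = (SUP j. emeasure (P \<Otimes>\<^sub>M lborel) (bad k j))"
      by (rule SUP_emeasure_incseq[symmetric]) (use bad_sets bad_mono in \<open>auto simp: incseq_def\<close>)
    also have "\<dots> \<le> ennreal (5 * pi / real (Suc k)) * D" by (rule SUP_least) (rule bad_le)
    finally show ?thesis .
  qed
  moreover have "(\<lambda>k. ennreal (5 * pi / real (Suc k)) * D) \<longlonglongrightarrow> 0"
  proof -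
    obtain d where d: "D = ennreal d" "d \<ge> 0" using D by (cases D) auto
    have "(\<lambda>k. (5 * pi * d) * (1 / real (Suc k))) \<longlonglongrightarrow> (5 * pi * d) * 0"
      by (intro tendsto_mult tendsto_const LIMSEQ_Suc[OF lim_1_over_n[where 'a = real]])
    then have "(\<lambda>k. ennreal ((5 * pi * d) * (1 / real (Suc k)))) \<longlonglongrightarrow> ennreal ((5 * pi * d) * 0)"
      by (rule tendsto_ennrealI)
    moreover have "ennreal ((5 * pi * d) * (1 / real (Suc k))) = ennreal (5 * pi / real (Suc k)) * D" for k
      unfolding d(1) using d(2) by (subst ennreal_mult[symmetric]) (auto simp: field_simps)
    ultimately show ?thesis by simp
  qed
  ultimately have "emeasure (P \<Otimes>\<^sub>M lborel) N \<le> 0" by (intro LIMSEQ_le_const) auto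
  then have N0: "N \<in> null_sets (P \<Otimes>\<^sub>M lborel)" using N_sets by (auto simp: null_sets_def)
  show ?thesis
  proof (rule AE_I'[OF N0], rule subsetI)
    fix y assume y: "y \<in> {y \<in> space (P \<Otimes>\<^sub>M lborel). \<not> (case y of (\<omega>, E) \<Rightarrow>
      E \<in> S \<longrightarrow> 0 < Liminf (at_right 0) (\<lambda>\<eta>. ereal (Im (Gr lam (Complex E \<eta>) \<omega> x))))}"
    obtain \<omega> E where yE: "y = (\<omega>, E)" by (cases y)
    have sp: "(\<omega>, E) \<in> space (P \<Otimes>\<^sub>M lborel)" and E: "E \<in> S"
      and fail: "\<not> Liminf (at_right 0) (\<lambda>\<eta>. ereal (Im (Gr lam (Complex E \<eta>) \<omega> x))) > 0"
      using y unfolding yE by auto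
    show "y \<in> N" unfolding yE
    proof (rule ccontr)
      assume "(\<omega>, E) \<notin> N"
      then obtain k where k: "\<And>j. (\<omega>, E) \<notin> bad k j" by (auto simp: N_def)
      define u where "u \<eta> = Im (Gr lam (Complex E \<eta>) \<omega> x)" for \<eta>
      have rat: "u q \<ge> 1 / real (Suc k)" if q: "q \<in> \<rat>" "0 < q" "q \<le> \<rho>" for q
      proof -
        obtain j where "1 / real (Suc j) < q" using nat_approx_posE[OF q(2)] by (auto simp: inverse_eq_divide)
        then have "\<epsilon> j < q" by (simp add: \<epsilon>_def) (smt (verit) frac_le of_nat_0_le_iff)
        then have "q \<in> \<rat> \<inter> {\<epsilon> j<..\<rho>}" using q by simp
        then have "(\<omega>, E) \<notin> slice k q" using k[of j] unfolding bad_def by blast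
        then show ?thesis using sp E by (simp add: slice_def u_def not_less)
      qed
      have uc: "continuous_on {0<..} u"
      proof -
        have "continuous_on {z. Im z > 0} (\<lambda>z. Gr lam z \<omega> x)"
          by (rule holomorphic_on_imp_continuous_on[OF Gr_holomorphic[OF lam x]])
        then have "continuous_on {0<..} (\<lambda>\<eta>. Gr lam (Complex E \<eta>) \<omega> x)"
          by (rule continuous_on_compose2) (auto simp: Complex_eq intro!: continuous_intros)
        then show ?thesis unfolding u_def by (intro continuous_intros)
      qed
      have all: "u \<eta> \<ge> 1 / real (Suc k)" if \<eta>: "0 < \<eta>" "\<eta> < \<rho>" for \<eta>
      proof (rule ccontr)
        assume "\<not> u \<eta> \<ge> 1 / real (Suc k)"
        then have lt: "u \<eta> < 1 / real (Suc k)" by simp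
        have "isCont u \<eta>" using uc \<eta>(1) by (simp add: continuous_on_eq_continuous_at)
        then have "\<forall>\<^sub>F y in at \<eta>. u y < 1 / real (Suc k)" using lt by (auto simp: isCont_def intro: order_tendstoD(2))
        then obtain d where d: "d > 0" "\<And>y. y \<noteq> \<eta> \<Longrightarrow> dist y \<eta> < d \<Longrightarrow> u y < 1 / real (Suc k)"
          unfolding eventually_at by auto
        obtain q where q: "q \<in> \<rat>" "\<eta> < q" "q < min \<rho> (\<eta> + d)"
          using Rats_dense_in_real[of \<eta> "min \<rho> (\<eta> + d)"] \<eta> d(1) by auto
        have "u q < 1 / real (Suc k)" using q by (intro d(2)) (auto simp: dist_real_def)
        then show False using rat[of q] q \<eta> by auto
      qed
      have "\<forall>\<^sub>F \<eta> in at_right 0. ereal (1 / real (Suc k)) \<le> ereal (Im (Gr lam (Complex E \<eta>) \<omega> x))"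
        by (rule eventually_at_rightI[of 0 \<rho>]) (use all \<rho>(1) in \<open>auto simp: u_def\<close>)
      then have "ereal (1 / real (Suc k)) \<le> Liminf (at_right 0) (\<lambda>\<eta>. ereal (Im (Gr lam (Complex E \<eta>) \<omega> x)))"
        by (rule Liminf_bounded)
      moreover have "0 < ereal (1 / real (Suc k))" by simp
      ultimately show False using fail by (metis less_le_trans)
    qed
  qed
qed

end

context substitution
begin

text \<open>
  If all children of a vertex have its label \<open>k\<close>, then the row \<open>k\<close> of every power of \<open>M\<close> vanishes off the
  diagonal. By (M2) there is then only one label, and (M0) applies. Otherwise (M1) gives a child of label \<open>k\<close> beside
  one of another label.
\<close>

lemma two_children_of_M:
  assumes "M0 M" "M1 M" "M2 M" and x: "x \<in> V"
  shows "2 \<le> card (ch x)"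
proof -
  have "card (ch x) = (\<Sum>u\<in>ch x. (\<lambda>_. 1) (a u))" by simp
  also have "\<dots> = (\<Sum>l\<in>UNIV. M $ a x $ l)" by (subst sum_ch_label[OF x]) simp
  finally have card: "card (ch x) = (\<Sum>l\<in>UNIV. M $ a x $ l)" .
  show ?thesis
  proof (cases "\<exists>l. l \<noteq> a x \<and> M $ a x $ l > 0")
    case True
    then obtain l where l: "l \<noteq> a x" "M $ a x $ l > 0" by blast
    have "(\<Sum>l\<in>{a x, l}. M $ a x $ l) \<le> (\<Sum>l\<in>UNIV. M $ a x $ l)" by (rule sum_mono2) auto
    moreover have "M $ a x $ a x \<ge> 1" using assms by (auto simp: M1_def)
    ultimately show ?thesis using l card by auto
  next
    case False
    then have row: "l \<noteq> a x \<Longrightarrow> M $ a x $ l = 0" for l by auto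
    have pow: "l \<noteq> a x \<Longrightarrow> (((**) M ^^ n) (mat 1)) $ a x $ l = 0" for l n
    proof (induction n)
      case 0
      then show ?case by (simp add: mat_def)
    next
      case (Suc n)
      have product: "(M ** X) $ k $ l = (\<Sum>i\<in>UNIV. M $ k $ i * X $ i $ l)" for X :: "nat^'a^'a" and k l
        by (simp add: matrix_matrix_mult_def)
      have "(\<Sum>i\<in>UNIV. M $ a x $ i * (((**) M ^^ n) (mat 1)) $ i $ l) = 0"
        using row Suc by (intro sum.neutral) (metis mult_is_0)
      then show ?case unfolding funpow.simps comp_apply product .
    qed
    have "UNIV = {a x}"
    proof -
      from \<open>M2 M\<close> obtain n where "\<And>k l. (((**) M ^^ n) (mat 1)) $ k $ l > 0" by (auto simp: M2_def)
      then have "l = a x" for l using pow by (metis less_irrefl)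
      then show ?thesis by auto
    qed
    then have "CARD('a) = 1" by (metis card_1_singleton_iff One_nat_def)
    then have "M $ a x $ a x > 1" using \<open>M0 M\<close> by (auto simp: M0_def)
    moreover have "M $ a x $ a x \<le> (\<Sum>l\<in>UNIV. M $ a x $ l)" by (rule member_le_sum) auto
    ultimately show ?thesis using card by linarith
  qed
qed

end

lemma random_tree_op_intro:
  assumes M: "M0 M" "M1 M" "M2 M" and st: "substitution_tree M j V adj rt a"
    and nu: "\<forall>y\<in>V. \<nu> y > 0" "\<forall>y\<in>V. \<forall>y'\<in>V. a y = a y' \<longrightarrow> \<nu> y = \<nu> y'"
    and T: "T0 V adj t" "T1 V \<nu> t" "T2 M V adj a t w"
    and P: "prob_space P" "random_potential P V adj rt a v"
  shows "random_tree_op V adj rt M a \<nu> t P w v"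
proof -
  interpret rooted_tree V adj rt using st by unfold_locales (auto simp: substitution_tree_def)
  interpret substitution V adj rt M a
  proof
    fix x l assume x: "x \<in> V"
    have "{y \<in> ch x. a y = l} = {y. adj x y \<and> graph_dist V adj rt y = graph_dist V adj rt x + 1 \<and> a y = l}"
      by (auto simp: ch_def dd_def)
    then show "finite {y \<in> ch x. a y = l} \<and> card {y \<in> ch x. a y = l} = M $ a x $ l"
      using st x by (simp add: substitution_tree_def)
  qed
  have Mpos: "M $ a x $ a y > 0" if "y \<in> ch x" for x y
  proof -
    have "y \<in> {u \<in> ch x. a u = a y}" using that by simp
    then have "card {u \<in> ch x. a u = a y} > 0" using subst[OF ch_V(1)[OF that]] by (metis card_gt_0_iff empty_iff)
    then show ?thesis using subst[OF ch_V(1)[OF that]] by simp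
  qed
  from T(3) obtain m d where md: "\<And>x y. x \<in> V \<Longrightarrow> y \<in> V \<Longrightarrow> adj x y \<Longrightarrow> (m :: real^'a^'a) $ a x $ a y = (cmod (t x y))\<^sup>2 * real (M $ a x $ a y)"
    "\<And>x. x \<in> V \<Longrightarrow> (d :: real^'a) $ a x = w x" unfolding T2_def by blast
  interpret prob_space P by (rule P(1))
  show ?thesis
  proof
    show "\<nu> y > 0" if "y \<in> V" for y using nu that by blast
    show "\<nu> y = \<nu> y'" if "y \<in> V" "y' \<in> V" "a y = a y'" for y y' using nu that by blast
    show "t x y \<noteq> 0" if "x \<in> V" "y \<in> ch x" for x y using T(1) that ch_V ch_adj by (auto simp: T0_def)
    show "t x y * of_real (\<nu> x) = cnj (t y x) * of_real (\<nu> y)" if "x \<in> V" "y \<in> V" for x y using T(2) that by (auto simp: T1_def)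
    show "2 \<le> card (ch x)" if "x \<in> V" for x by (rule two_children_of_M[OF M that])
    show "\<exists>y\<in>ch x. a y = a x" if "x \<in> V" for x
    proof -
      have "card {y \<in> ch x. a y = a x} \<ge> 1" using subst[OF that] M(2) by (simp add: M1_def)
      then have "{y \<in> ch x. a y = a x} \<noteq> {}" by (metis card.empty not_one_le_zero)
      then show ?thesis by blast
    qed
    show "w x = w y" if "x \<in> V" "y \<in> V" "a x = a y" for x y using md(2) that by metis
    show "random_potential P V adj rt a v" by (rule P(2))
    show "cmod (t x y) = cmod (t x' y')" if "x \<in> V" "x' \<in> V" "y \<in> ch x" "y' \<in> ch x'" "a x = a x'" "a y = a y'" for x x' y y'
    proof -
      have "(cmod (t x y))\<^sup>2 * real (M $ a x $ a y) = (cmod (t x' y'))\<^sup>2 * real (M $ a x $ a y)"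
        using md(1)[of x y] md(1)[of x' y'] that ch_V ch_adj by metis
      then have "(cmod (t x y))\<^sup>2 = (cmod (t x' y'))\<^sup>2" using Mpos[OF that(3)] by simp
      then show ?thesis by simp
    qed
  qed
qed

theorem theorem4p1:
  fixes M :: "nat ^'a ^('a::finite)" and j :: 'a
    and V :: "'v set" and adj :: "'v \<Rightarrow> 'v \<Rightarrow> bool" and rt :: 'v and a :: "'v \<Rightarrow> 'a"
    and \<nu> :: "'v \<Rightarrow> real" and t :: "'v \<Rightarrow> 'v \<Rightarrow> complex" and w :: "'v \<Rightarrow> real"
    and P :: "'w measure" and v :: "'w \<Rightarrow> 'v \<Rightarrow> real"
    and I :: "real set" and p :: real and x :: 'v
  defines "T \<equiv> tree_operator V adj t w"
  defines "\<Sigma> \<equiv> Sigma_set V adj rt \<nu> T"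
  defines "H \<equiv> (\<lambda>lam \<omega>. add_potential T lam (v \<omega>))"
  defines "G \<equiv> (\<lambda>E \<eta> K. green V \<nu> x (Complex E \<eta>) K)"
  assumes "M0 M" and "M1 M" and "M2 M"
    and "substitution_tree M j V adj rt a"
    and "\<forall>y\<in>V. \<nu> y > 0" and "\<forall>y\<in>V. \<forall>y'\<in>V. a y = a y' \<longrightarrow> \<nu> y = \<nu> y'"
    and "T0 V adj t" and "T1 V \<nu> t" and "T2 M V adj a t w"
    and "prob_space P" and "random_potential P V adj rt a v"
    and "I \<subseteq> \<Sigma>" and "compact I" and "p > 1" and "x \<in> V"
  shows "\<exists>lam0>0.
     (\<forall>lam\<in>{0..<lam0}.
        (SUP E\<in>I. SUP \<eta>\<in>{0<..1}.
           \<integral>\<^sup>+\<omega>. ennreal (cmod (G E \<eta> (H lam \<omega>)) powr p) \<partial>P) < \<infinity> \<and>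
        (AE \<omega> in P. Liminf (at_right 0)
           (\<lambda>\<eta>. \<integral>\<^sup>+E\<in>I. ennreal (cmod (G E \<eta> (H lam \<omega>)) powr p) \<partial>lborel) < \<infinity>) \<and>
        (AE (\<omega>, E) in P \<Otimes>\<^sub>M lborel. E \<in> I \<longrightarrow>
           Liminf (at_right 0) (\<lambda>\<eta>. ereal (Im (G E \<eta> (H lam \<omega>)))) > 0)) \<and>
     (\<forall>E\<in>\<Sigma>. ((\<lambda>lam. SUP \<eta>\<in>{0<..1}.
           \<integral>\<^sup>+\<omega>. ennreal (cmod (G E \<eta> (H lam \<omega>) - G E \<eta> T) powr p) \<partial>P) \<longlongrightarrow> 0) (at_right 0)) \<and>
     (\<forall>\<epsilon>>(0::ennreal). \<forall>\<^sub>F lam in at_right 0. \<forall>E\<in>I. (SUP \<eta>\<in>{0<..1}.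
           \<integral>\<^sup>+\<omega>. ennreal (cmod (G E \<eta> (H lam \<omega>) - G E \<eta> T) powr p) \<partial>P) < \<epsilon>)"
proof -
  interpret random_tree_op V adj rt M a \<nu> t P w v
    by (rule random_tree_op_intro[OF assms(5-15)])
  note x = \<open>x \<in> V\<close>
  have Geq: "G E \<eta> (H lam \<omega>) = Gr lam (Complex E \<eta>) \<omega> x" if "\<omega> \<in> space P" "0 \<le> lam" "lam \<le> 1" "0 < \<eta>" for E \<eta> lam \<omega>
    unfolding G_def H_def T_def using green_perturbed[OF that(1-3) _ x, of "Complex E \<eta>"] that(4) by simp
  have G0eq: "G E \<eta> T = G0 (Complex E \<eta>) x" if "0 < \<eta>" for E \<eta>
    unfolding G_def T_def using green_unperturbed[OF _ x, of "Complex E \<eta>"] that by simp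
  have small: "\<forall>\<^sub>F lam in at_right 0. \<forall>E\<in>J. (SUP \<eta>\<in>{0<..1}.
       \<integral>\<^sup>+\<omega>. ennreal (cmod (G E \<eta> (H lam \<omega>) - G E \<eta> T) powr p) \<partial>P) < \<epsilon>"
    if J: "J \<subseteq> \<Sigma>" "compact J" and \<epsilon>: "\<epsilon> > (0::ennreal)" for J \<epsilon>
  proof -
    obtain mJ MJ where "energy_window V adj rt M a \<nu> t P w v J mJ MJ"
      using compact_window[of J] J unfolding \<Sigma>_def T_def by blast
    then interpret W: energy_window V adj rt M a \<nu> t P w v J mJ MJ .
    obtain e where e: "e > 0" "ennreal e < \<epsilon>"
    proof -
      obtain e' where e': "0 < e'" "e' < \<epsilon>" using dense[OF \<epsilon>] by blast
      then obtain r where "e' = ennreal r" "r \<ge> 0" by (cases e') auto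
      then show ?thesis using that[of r] e' by (auto simp: ennreal_less_zero_iff)
    qed
    obtain l0 where l0: "l0 > 0" "\<And>lam z. 0 \<le> lam \<Longrightarrow> lam < l0 \<Longrightarrow> lam \<le> 1 \<Longrightarrow> z \<in> W.Z \<Longrightarrow>
      (\<integral>\<^sup>+\<omega>. ennreal (cmod (Gr lam z \<omega> x - G0 z x) powr p) \<partial>P) \<le> ennreal e"
      using W.difference_small[OF x _ e(1), of p] \<open>p > 1\<close> by auto
    show ?thesis
    proof (rule eventually_at_rightI[of 0 "min l0 1"], intro ballI)
      fix lam E assume l: "lam \<in> {0<..<min l0 1}" and E: "E \<in> J"
      have "(SUP \<eta>\<in>{0<..1}. \<integral>\<^sup>+\<omega>. ennreal (cmod (G E \<eta> (H lam \<omega>) - G E \<eta> T) powr p) \<partial>P) \<le> ennreal e"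
      proof (rule SUP_least)
        fix \<eta> :: real assume \<eta>: "\<eta> \<in> {0<..1}"
        have "(\<integral>\<^sup>+\<omega>. ennreal (cmod (G E \<eta> (H lam \<omega>) - G E \<eta> T) powr p) \<partial>P)
          = (\<integral>\<^sup>+\<omega>. ennreal (cmod (Gr lam (Complex E \<eta>) \<omega> x - G0 (Complex E \<eta>) x) powr p) \<partial>P)"
          using l \<eta> by (intro nn_integral_cong) (simp add: Geq G0eq)
        also have "\<dots> \<le> ennreal e" using l \<eta> W.Z_memI[OF E] by (intro l0(2)) auto
        finally show "(\<integral>\<^sup>+\<omega>. ennreal (cmod (G E \<eta> (H lam \<omega>) - G E \<eta> T) powr p) \<partial>P) \<le> ennreal e" .
      qed
      then show "(SUP \<eta>\<in>{0<..1}. \<integral>\<^sup>+\<omega>. ennreal (cmod (G E \<eta> (H lam \<omega>) - G E \<eta> T) powr p) \<partial>P) < \<epsilon>"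
        using e(2) by (rule le_less_trans)
    qed (use l0 in simp)
  qed
  have pointwise: "((\<lambda>lam. SUP \<eta>\<in>{0<..1}. \<integral>\<^sup>+\<omega>. ennreal (cmod (G E \<eta> (H lam \<omega>) - G E \<eta> T) powr p) \<partial>P) \<longlongrightarrow> 0) (at_right 0)"
    if "E \<in> \<Sigma>" for E
    by (rule order_tendstoI) (use small[of "{E}"] that in auto)
  have "open \<Sigma>" by (auto simp: \<Sigma>_def Sigma_set_def largest_extension_set_def common_extension_set_def)
  then obtain r where r: "r > 0" "(\<Union>E\<in>I. cball E r) \<subseteq> \<Sigma>"
    using compact_subset_open_imp_cball_epsilon_subset[OF \<open>compact I\<close> _ \<open>I \<subseteq> \<Sigma>\<close>] by blast
  \<comment> \<open>The average inequality behind \<open>Im_Gr_liminf_pos\<close> needs moment bounds in a neighbourhood of \<open>I\<close>.\<close>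
  define J where "J = (\<Union>E\<in>I. cball E r)"
  have Jc: "compact J" unfolding J_def by (rule compact_minkowski_sum_cball[OF \<open>compact I\<close>])
  have Jb: "J \<in> sets lborel" "I \<in> sets lborel" using Jc \<open>compact I\<close> by (auto intro: borel_compact)
  have IJ: "I \<subseteq> J" "E \<in> I \<Longrightarrow> cball E r \<subseteq> J" for E using r(1) by (force simp: J_def)+
  obtain mJ MJ where "energy_window V adj rt M a \<nu> t P w v J mJ MJ"
    using compact_window[OF _ Jc] r(2) unfolding \<Sigma>_def T_def J_def by blast
  then interpret W: energy_window V adj rt M a \<nu> t P w v J mJ MJ .
  obtain C l0 where C: "l0 > 0" "\<And>lam z. 0 \<le> lam \<Longrightarrow> lam < l0 \<Longrightarrow> lam \<le> 1 \<Longrightarrow> z \<in> W.Z \<Longrightarrow>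
    (\<integral>\<^sup>+\<omega>. ennreal (cmod (Gr lam z \<omega> x) powr p) \<partial>P) \<le> ennreal C"
    using W.moment_bound[OF x, of p] \<open>p > 1\<close> by auto
  obtain D l1 where D: "l1 > 0" "\<And>lam z. 0 \<le> lam \<Longrightarrow> lam < l1 \<Longrightarrow> lam \<le> 1 \<Longrightarrow> z \<in> W.Z \<Longrightarrow>
    (\<integral>\<^sup>+\<omega>. ennreal (1 / Im (Gr lam z \<omega> x)) \<partial>P) \<le> ennreal D"
    using W.goodD[OF W.Gr_families(3)[OF x], of 1, unfolded power_one_right] by blast
  define lam0 where "lam0 = min 1 (min l0 l1)"
  have lam0: "lam0 > 0" using C(1) D(1) by (simp add: lam0_def)
  have main: "(SUP E\<in>I. SUP \<eta>\<in>{0<..1}. \<integral>\<^sup>+\<omega>. ennreal (cmod (G E \<eta> (H lam \<omega>)) powr p) \<partial>P) < \<infinity>"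
    "AE \<omega> in P. Liminf (at_right 0) (\<lambda>\<eta>. \<integral>\<^sup>+E\<in>I. ennreal (cmod (G E \<eta> (H lam \<omega>)) powr p) \<partial>lborel) < \<infinity>"
    "AE (\<omega>, E) in P \<Otimes>\<^sub>M lborel. E \<in> I \<longrightarrow> Liminf (at_right 0) (\<lambda>\<eta>. ereal (Im (G E \<eta> (H lam \<omega>)))) > 0"
    if "lam \<in> {0..<lam0}" for lam
  proof -
    have l: "0 \<le> lam" "lam \<le> 1" "lam < l0" "lam < l1" using that by (auto simp: lam0_def)
    have "(SUP E\<in>I. SUP \<eta>\<in>{0<..1}. \<integral>\<^sup>+\<omega>. ennreal (cmod (G E \<eta> (H lam \<omega>)) powr p) \<partial>P) \<le> ennreal C"
    proof (intro SUP_least)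
      fix E and \<eta> :: real assume E: "E \<in> I" and \<eta>: "\<eta> \<in> {0<..1}"
      have "(\<integral>\<^sup>+\<omega>. ennreal (cmod (G E \<eta> (H lam \<omega>)) powr p) \<partial>P) = (\<integral>\<^sup>+\<omega>. ennreal (cmod (Gr lam (Complex E \<eta>) \<omega> x) powr p) \<partial>P)"
        using l \<eta> by (intro nn_integral_cong) (simp add: Geq)
      also have "\<dots> \<le> ennreal C" using l \<eta> W.Z_memI E IJ by (intro C(2)) auto
      finally show "(\<integral>\<^sup>+\<omega>. ennreal (cmod (G E \<eta> (H lam \<omega>)) powr p) \<partial>P) \<le> ennreal C" .
    qed
    then show "(SUP E\<in>I. SUP \<eta>\<in>{0<..1}. \<integral>\<^sup>+\<omega>. ennreal (cmod (G E \<eta> (H lam \<omega>)) powr p) \<partial>P) < \<infinity>"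
      by (rule le_less_trans) simp
    have "AE \<omega> in P. Liminf (at_right 0) (\<lambda>\<eta>. \<integral>\<^sup>+E\<in>I. ennreal (cmod (Gr lam (Complex E \<eta>) \<omega> x) powr p) \<partial>lborel) < \<infinity>"
      by (rule W.integrated_moment_liminf[OF x l(1,2) Jb(2) IJ(1) C(2)[OF l(1,3,2)]])
    then show "AE \<omega> in P. Liminf (at_right 0) (\<lambda>\<eta>. \<integral>\<^sup>+E\<in>I. ennreal (cmod (G E \<eta> (H lam \<omega>)) powr p) \<partial>lborel) < \<infinity>"
    proof (rule AE_mp, intro AE_I2 impI)
      fix \<omega> assume \<omega>: "\<omega> \<in> space P" and "Liminf (at_right 0) (\<lambda>\<eta>. \<integral>\<^sup>+E\<in>I. ennreal (cmod (Gr lam (Complex E \<eta>) \<omega> x) powr p) \<partial>lborel) < \<infinity>"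
      moreover have "Liminf (at_right 0) (\<lambda>\<eta>. \<integral>\<^sup>+E\<in>I. ennreal (cmod (G E \<eta> (H lam \<omega>)) powr p) \<partial>lborel)
        = Liminf (at_right 0) (\<lambda>\<eta>. \<integral>\<^sup>+E\<in>I. ennreal (cmod (Gr lam (Complex E \<eta>) \<omega> x) powr p) \<partial>lborel)"
        by (intro Liminf_eq eventually_at_rightI[of 0 1]) (simp_all add: Geq[OF \<omega> l(1,2)])
      ultimately show "Liminf (at_right 0) (\<lambda>\<eta>. \<integral>\<^sup>+E\<in>I. ennreal (cmod (G E \<eta> (H lam \<omega>)) powr p) \<partial>lborel) < \<infinity>" by simp
    qed
    have "AE (\<omega>, E) in P \<Otimes>\<^sub>M lborel. E \<in> I \<longrightarrow> Liminf (at_right 0) (\<lambda>\<eta>. ereal (Im (Gr lam (Complex E \<eta>) \<omega> x))) > 0"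
      by (rule W.Im_Gr_liminf_pos[OF x l(1,2) Jb IJ(2) r(1) D(2)[OF l(1,4,2)]])
    then show "AE (\<omega>, E) in P \<Otimes>\<^sub>M lborel. E \<in> I \<longrightarrow> Liminf (at_right 0) (\<lambda>\<eta>. ereal (Im (G E \<eta> (H lam \<omega>)))) > 0"
    proof (rule AE_mp, intro AE_I2 impI)
      fix y assume y: "y \<in> space (P \<Otimes>\<^sub>M lborel)"
        and *: "case y of (\<omega>, E) \<Rightarrow> E \<in> I \<longrightarrow> Liminf (at_right 0) (\<lambda>\<eta>. ereal (Im (Gr lam (Complex E \<eta>) \<omega> x))) > 0"
      obtain \<omega> E where yE: "y = (\<omega>, E)" by (cases y)
      have \<omega>: "\<omega> \<in> space P" using y by (simp add: yE space_pair_measure)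
      have "Liminf (at_right 0) (\<lambda>\<eta>. ereal (Im (G E \<eta> (H lam \<omega>)))) = Liminf (at_right 0) (\<lambda>\<eta>. ereal (Im (Gr lam (Complex E \<eta>) \<omega> x)))"
        by (intro Liminf_eq eventually_at_rightI[of 0 1]) (simp_all add: Geq[OF \<omega> l(1,2)])
      then show "case y of (\<omega>, E) \<Rightarrow> E \<in> I \<longrightarrow> Liminf (at_right 0) (\<lambda>\<eta>. ereal (Im (G E \<eta> (H lam \<omega>)))) > 0"
        using * by (simp add: yE)
    qed
  qed
  show ?thesis
    by (intro exI[of _ lam0] conjI ballI allI impI lam0 main pointwise small \<open>I \<subseteq> \<Sigma>\<close> \<open>compact I\<close>)
qed

end
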